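(* Let $d,v\in\mathbb N^n$, let $m\in\mathbb Z^n$ and let $\chi=\chi_m=\prod_{i\in I}\det_{GL(V_i)}^{m_i}$ be the corresponding character of $G_v=\prod_{i\in I}GL(V_i)$. Then the set of polynomials $f_\Delta$, with $\Delta$ running over all $\chi$-good data, generates $$\mathbb C[S]_{\chi,1}=\{f\in\mathbb C[S] : f(g s)=\chi(g)f(s)\ \text{for all } g\in G_v,\ s\in S\}$$ as a module over the ring of invariants $\mathbb C[S]^{G_v}$, where $S=S(d,v)$.
   Context: **Quiver.** $I=\{1,\dots,n\}$ is a finite set of vertices, $H$ a finite set of arrows, with source and target maps $h\mapsto h_0$, $h\mapsto h_1$ from $H$ to $I$ such that $h_0\ne h_1$ for all $h$; there is a fixed-point-free involution $h\mapsto\bar h$ of $H$ with $\bar h_0=h_1$ and $\bar h_1=h_0$, and a map $\varepsilon:H\to\{\pm1\}$ with $\varepsilon(\bar h)=-\varepsilon(h)$. **Space of matrices.** Fix complex vector spaces $D_i,V_i$ with $\dim D_i=d_i$, $\dim V_i=v_i$. Put $S=S(d,v)=\bigoplus_i \mathrm{Hom}(D_i,V_i)\oplus\bigoplus_i\mathrm{Hom}(V_i,D_i)\oplus\bigoplus_{h\in H}\mathrm{Hom}(V_{h_0},V_{h_1})$, with elements $s=(B,\gamma,\delta)$, $\gamma_i\in\mathrm{Hom}(D_i,V_i)$, $\delta_i\in\mathrm{Hom}(V_i,D_i)$, $B_h\in \mathrm{Hom}(V_{h_0},V_{h_1})$. $G_v$ acts by $g(B_h,\gamma_i,\delta_i)=(g_{h_1}B_hg_{h_0}^{-1},g_i\gamma_i,\delta_ig_i^{-1})$.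 **Path algebras.** A path $\alpha=h^{(r)}\cdots h^{(1)}$ is a sequence of arrows with $h^{(k)}_1=h^{(k+1)}_0$; its source is $\alpha_0=h^{(1)}_0$, its target $\alpha_1=h^{(r)}_1$, and its evaluation at $s$ is $\alpha(s)=B_{h^{(r)}}\circ\cdots\circ B_{h^{(1)}}$. There are also empty paths $\varnothing_i$ ($i\in I$) with source and target $i$ and $\varnothing_i(s)=\mathrm{Id}_{V_i}$. The path algebra is the vector space spanned by paths, with product given by concatenation. A $b$-path is a sequence $[i_{r+1}^{e_{r+1}}\alpha^{(r)}i_r^{e_r}\cdots\alpha^{(1)}i_1^{e_1}]$ with $\alpha^{(k)}$ a path from $i_k$ to $i_{k+1}$ and $e_k\in\mathbb N$ (or an empty $b$-path), evaluated as $(\gamma_{i_{r+1}}\delta_{i_{r+1}})^{e_{r+1}}\alpha^{(r)}(s)\cdots\alpha^{(1)}(s)(\gamma_{i_1}\delta_{i_1})^{e_1}\in\mathrm{Hom}(V_{i_1},V_{i_{r+1}})$; the $b$-path algebra is spanned by $b$-paths. Evaluation extends linearly. An element is of type $(i,j)$ if it is a linear combination of ($b$-)paths with source $i$ and target $j$; its evaluation at $s$ lies in $\mathrm{Hom}(V_i,V_j)$. **$\chi$-data.** A $\chi$-data $\Delta$ consists of: nonnegative integers $m_i^+,m_i^-$ ($i\in I$) with $m_i^+-m_i^-=m_i$; nonnegative integers $m^+,m^-$ with $\sum_i m_i^-v_i+m^-=\sum_i m_i^+v_i+m^+$; an ordered list $A=(a_1,\dots,a_{m^-})$ of elements of $\bigcup_i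 D_i$ and an ordered list $B=(b_1,\dots,b_{m^+})$ of elements of $\bigcup_iD_i^*$, with $a_l\in D_{I(a_l)}$ and $b_l\in D^*_{I(b_l)}$; and elements of the $b$-path algebra: $\alpha^{i,h}_{j,k}$ of type $(i,j)$, $\alpha^{i,h}_{l}$ of type $(i,I(b_l))$, $\alpha^{l}_{j,k}$ of type $(I(a_l),j)$, $\alpha^{l}_{l'}$ of type $(I(a_l),I(b_{l'}))$. Here $1\le h\le m_i^-$, $1\le k\le m_j^+$, lower indices of elements $b$ run over $1,\dots,m^+$ and upper indices $l$ of elements $a$ run over $1,\dots,m^-$. Let $Y=\bigoplus_i\bigoplus_{h=1}^{m_i^-}V_i^{(h)}\oplus\bigoplus_{l=1}^{m^-}\mathbb C_{a_l}$ and $Z=\bigoplus_i\bigoplus_{k=1}^{m_i^+}V_i^{[k]}\oplus\bigoplus_{l=1}^{m^+}\mathbb C_{b_l}$, where $V_i^{(h)},V_i^{[k]}$ are copies of $V_i$ and $\mathbb C_{a_l},\mathbb C_{b_l}$ are one-dimensional. Let $\Psi_\Delta(s):Y\to Z$ be the linear map with blocks: $V_i^{(h)}\to V_j^{[k]}$: $\alpha^{i,h}_{j,k}(s)$; $V_i^{(h)}\to\mathbb C_{b_l}$: $b_l\circ\delta_{I(b_l)}\circ\alpha^{i,h}_l(s)$; $\mathbb C_{a_l}\to V_j^{[k]}$: $\alpha^l_{j,k}(s)\circ\gamma_{I(a_l)}$ applied to $a_l$; $\mathbb C_{a_l}\to\mathbb C_{b_{l'}}$: $b_{l'}\circ\delta_{I(b_{l'})}\circ\alpha^l_{l'}(s)\circ\gamma_{I(a_l)}$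 applied to $a_l$. Then $f_\Delta(s)=\det\Psi_\Delta(s)$, where the determinant is defined (up to a nonzero constant) by fixing bases of $Y$ and $Z$. **Good data.** $\Delta$ is $\chi$-good if: 1. $m_i^++m_i^-=|m_i|$ for all $i$; 2. $\alpha^l_{l'}=0$ for all $l,l'$; 3. all the chosen elements $\alpha^*_*$ lie in the path algebra; 4. $\#\{(j,k):\alpha^{i,h}_{j,k}\ne0\}+\#\{l:\alpha^{i,h}_l\neq0\}\le v_i$ for all $i,h$; 5. $\#\{(i,h):\alpha^{i,h}_{j,k}\ne0\}+\#\{l:\alpha^{l}_{j,k}\neq0\}\le v_j$ for all $j,k$; 6. for every $l$ there is at most one pair $(i,h)$ with $\alpha^{i,h}_l\ne0$; 7. for every $l$ there is at most one pair $(j,k)$ with $\alpha^l_{j,k}\ne0$. *)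

theory Defs
  imports
    "Graph_Theory.Graph_Theory"
    "Jordan_Normal_Form.VS_Connect"
    "HOL-Algebra.Product_Groups"
    "HOL-Library.Poly_Mapping"
begin

locale double_quiver = fin_digraph G + loopfree_digraph G
  for G :: "(nat, 'h) pre_digraph" +
  fixes n :: nat
    and bar :: "'h \<Rightarrow> 'h"
    and eps :: "'h \<Rightarrow> int"
  assumes verts_eq: "verts G = {1..n}"
    and bar_arc: "h \<in> arcs G \<Longrightarrow> bar h \<in> arcs G"
    and bar_bar: "h \<in> arcs G \<Longrightarrow> bar (bar h) = h"
    and bar_neq: "h \<in> arcs G \<Longrightarrow> bar h \<noteq> h"
    and tail_bar: "h \<in> arcs G \<Longrightarrow> tail G (bar h) = head G h"
    and head_bar: "h \<in> arcs G \<Longrightarrow> head G (bar h) = tail G h"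
    and eps_sign: "h \<in> arcs G \<Longrightarrow> eps h \<in> {1, - 1}"
    and eps_bar: "h \<in> arcs G \<Longrightarrow> eps (bar h) = - eps h"

text \<open>Coordinates are chosen once and for all: \<open>D\<^sub>i\<close> and \<open>V\<^sub>i\<close> are the spaces of column vectors of
  length \<open>d i\<close> and \<open>v i\<close>, and elements of the dual of \<open>D\<^sub>i\<close> are vectors of length \<open>d i\<close> acting by the
  (bilinear) \<^const>\<open>scalar_prod\<close>.  A point is a triple \<open>(B, \<gamma>, \<delta>)\<close>.\<close>

type_synonym 'h point = "('h \<Rightarrow> complex mat) \<times> (nat \<Rightarrow> complex mat) \<times> (nat \<Rightarrow> complex mat)"

definition rep_space ::
  "(nat, 'h) pre_digraph \<Rightarrow> (nat \<Rightarrow> nat) \<Rightarrow> (nat \<Rightarrow> nat) \<Rightarrow> 'h point set" where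
  "rep_space G d v =
     (\<Pi>\<^sub>E h\<in>arcs G. carrier_mat (v (head G h)) (v (tail G h))) \<times>
     (\<Pi>\<^sub>E i\<in>verts G. carrier_mat (v i) (d i)) \<times>
     (\<Pi>\<^sub>E i\<in>verts G. carrier_mat (d i) (v i))"

definition GL :: "nat \<Rightarrow> complex mat monoid" where
  "GL k = units_of (ring_mat TYPE(complex) k ())"

definition gauge_group :: "(nat, 'h) pre_digraph \<Rightarrow> (nat \<Rightarrow> nat) \<Rightarrow> (nat \<Rightarrow> complex mat) monoid" where
  "gauge_group G v = product_group (verts G) (\<lambda>i. GL (v i))"

fun gauge_act ::
  "(nat, 'h) pre_digraph \<Rightarrow> (nat \<Rightarrow> nat) \<Rightarrow> (nat \<Rightarrow> complex mat) \<Rightarrow> 'h point \<Rightarrow> 'h point" where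
  "gauge_act G v g (B, \<gamma>, \<delta>) =
     ((\<lambda>h\<in>arcs G. g (head G h) * B h * inv\<^bsub>GL (v (tail G h))\<^esub> (g (tail G h))),
      (\<lambda>i\<in>verts G. g i * \<gamma> i),
      (\<lambda>i\<in>verts G. \<delta> i * inv\<^bsub>GL (v i)\<^esub> (g i)))"

definition det_character ::
  "(nat, 'h) pre_digraph \<Rightarrow> (nat \<Rightarrow> int) \<Rightarrow> (nat \<Rightarrow> complex mat) \<Rightarrow> complex" where
  "det_character G m g = (\<Prod>i\<in>verts G. det (g i) powi m i)"

text \<open>Since the complex numbers are infinite, polynomials on the space of matrices are identified
  with polynomial functions, represented as functions that are \<open>undefined\<close> outside that space.\<close>

inductive_set regular_functions ::
  "(nat, 'h) pre_digraph \<Rightarrow> (nat \<Rightarrow> nat) \<Rightarrow> (nat \<Rightarrow> nat) \<Rightarrow> ('h point \<Rightarrow> complex) set"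
  for G :: "(nat, 'h) pre_digraph" and d v :: "nat \<Rightarrow> nat" where
  const: "(\<lambda>s\<in>rep_space G d v. c) \<in> regular_functions G d v"
| coord_B: "\<lbrakk>h \<in> arcs G; p < v (head G h); q < v (tail G h)\<rbrakk> \<Longrightarrow>
    (\<lambda>(B, \<gamma>, \<delta>)\<in>rep_space G d v. B h $$ (p, q)) \<in> regular_functions G d v"
| coord_gamma: "\<lbrakk>i \<in> verts G; p < v i; q < d i\<rbrakk> \<Longrightarrow>
    (\<lambda>(B, \<gamma>, \<delta>)\<in>rep_space G d v. \<gamma> i $$ (p, q)) \<in> regular_functions G d v"
| coord_delta: "\<lbrakk>i \<in> verts G; p < d i; q < v i\<rbrakk> \<Longrightarrow>
    (\<lambda>(B, \<gamma>, \<delta>)\<in>rep_space G d v. \<delta> i $$ (p, q)) \<in> regular_functions G d v"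
| add: "\<lbrakk>f \<in> regular_functions G d v; f' \<in> regular_functions G d v\<rbrakk> \<Longrightarrow>
    (\<lambda>s\<in>rep_space G d v. f s + f' s) \<in> regular_functions G d v"
| mult: "\<lbrakk>f \<in> regular_functions G d v; f' \<in> regular_functions G d v\<rbrakk> \<Longrightarrow>
    (\<lambda>s\<in>rep_space G d v. f s * f' s) \<in> regular_functions G d v"

definition invariant_ring ::
  "(nat, 'h) pre_digraph \<Rightarrow> (nat \<Rightarrow> nat) \<Rightarrow> (nat \<Rightarrow> nat) \<Rightarrow> ('h point \<Rightarrow> complex) ring" where
  "invariant_ring G d v =
     \<lparr>carrier = {f \<in> regular_functions G d v.
        \<forall>g\<in>carrier (gauge_group G v). \<forall>s\<in>rep_space G d v. f (gauge_act G v g s) = f s},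
      mult = (\<lambda>f f'. \<lambda>s\<in>rep_space G d v. f s * f' s),
      one = (\<lambda>s\<in>rep_space G d v. 1),
      zero = (\<lambda>s\<in>rep_space G d v. 0),
      add = (\<lambda>f f'. \<lambda>s\<in>rep_space G d v. f s + f' s)\<rparr>"

text \<open>The fields \<open>mult\<close> and \<open>one\<close> are only there because module records extend ring records; modules
  do not use them.\<close>

definition semi_invariant_module ::
  "(nat, 'h) pre_digraph \<Rightarrow> (nat \<Rightarrow> nat) \<Rightarrow> (nat \<Rightarrow> nat) \<Rightarrow> (nat \<Rightarrow> int) \<Rightarrow>
     ('h point \<Rightarrow> complex, 'h point \<Rightarrow> complex) module" where
  "semi_invariant_module G d v m =
     \<lparr>carrier = {f \<in> regular_functions G d v.
        \<forall>g\<in>carrier (gauge_group G v). \<forall>s\<in>rep_space G d v.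
          f (gauge_act G v g s) = det_character G m g * f s},
      mult = undefined,
      one = undefined,
      zero = (\<lambda>s\<in>rep_space G d v. 0),
      add = (\<lambda>f f'. \<lambda>s\<in>rep_space G d v. f s + f' s),
      smult = (\<lambda>f f'. \<lambda>s\<in>rep_space G d v. f s * f' s)\<rparr>"

text \<open>A b-path is a walk in the quiver with one extra loop \<open>Inr i\<close> at every vertex \<open>i\<close>, which is
  evaluated as \<open>\<gamma>\<^sub>i \<delta>\<^sub>i\<close>.  A sequence of paths and of powers \<open>i\<^bsup>e\<^esup>\<close> of vertices becomes a walk by
  spelling out \<open>i\<^bsup>e\<^esup>\<close> as \<open>e\<close> copies of \<open>Inr i\<close>.  Sequences differing only by exponents 0 or empty
  paths in the middle become equal; this is needed for the path algebra to be a subalgebra of the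
  b-path algebra.  Walks list their steps in the order in which they are travelled, so the
  rightmost letter of the sequence comes first; the first component is the source, which is needed
  to distinguish the empty paths.\<close>

type_synonym 'h bpath = "nat \<times> ('h + nat) awalk"

text \<open>The underlying vector space of the b-path algebra is the free vector space on b-paths.\<close>

type_synonym 'h bpath_alg = "'h bpath \<Rightarrow>\<^sub>0 complex"

definition loop_quiver :: "(nat, 'h) pre_digraph \<Rightarrow> (nat, 'h + nat) pre_digraph" where
  "loop_quiver G = \<lparr>verts = verts G, arcs = arcs G <+> verts G,
     tail = case_sum (tail G) id, head = case_sum (head G) id\<rparr>"

definition has_type :: "(nat, 'h) pre_digraph \<Rightarrow> nat \<Rightarrow> nat \<Rightarrow> 'h bpath_alg \<Rightarrow> bool" where
  "has_type G i j x \<longleftrightarrow>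
     (\<forall>(k, w)\<in>Poly_Mapping.keys x. k = i \<and> pre_digraph.awalk (loop_quiver G) i w j)"

definition in_path_algebra :: "'h bpath_alg \<Rightarrow> bool" where
  "in_path_algebra x \<longleftrightarrow> (\<forall>(k, w)\<in>Poly_Mapping.keys x. set w \<subseteq> range Inl)"

fun walk_eval ::
  "(nat, 'h) pre_digraph \<Rightarrow> (nat \<Rightarrow> nat) \<Rightarrow> 'h point \<Rightarrow> nat \<Rightarrow> ('h + nat) awalk \<Rightarrow> complex mat" where
  "walk_eval G v (B, \<gamma>, \<delta>) i [] = 1\<^sub>m (v i)"
| "walk_eval G v (B, \<gamma>, \<delta>) i (Inl h # w) = walk_eval G v (B, \<gamma>, \<delta>) (head G h) w * B h"
| "walk_eval G v (B, \<gamma>, \<delta>) i (Inr k # w) = walk_eval G v (B, \<gamma>, \<delta>) k w * (\<gamma> k * \<delta> k)"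

text \<open>Linear extension, for elements of type \<open>(i, j)\<close>; it is written entrywise because matrices of
  unspecified size do not form a commutative monoid.\<close>

definition bpath_eval ::
  "(nat, 'h) pre_digraph \<Rightarrow> (nat \<Rightarrow> nat) \<Rightarrow> 'h point \<Rightarrow> nat \<Rightarrow> nat \<Rightarrow> 'h bpath_alg \<Rightarrow> complex mat" where
  "bpath_eval G v s i j x = mat (v j) (v i) (\<lambda>(p, q).
     \<Sum>(k, w)\<in>Poly_Mapping.keys x. Poly_Mapping.lookup x (k, w) * walk_eval G v s k w $$ (p, q))"

text \<open>All indices \<open>h\<close>, \<open>k\<close>, \<open>l\<close> count from 0.  The numbers \<open>m\<^sup>-\<close> and \<open>m\<^sup>+\<close> are the lengths of \<open>a_list\<close>
  and \<open>b_list\<close>, whose entries are tagged with the vertex they belong to.  The fields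
  \<open>alpha_VV i h j k\<close>, \<open>alpha_Vb i h l\<close>, \<open>alpha_aV l j k\<close>, \<open>alpha_ab l l'\<close> stand for
  \<open>\<alpha>\<^bsup>i,h\<^esup>\<^bsub>j,k\<^esub>\<close>, \<open>\<alpha>\<^bsup>i,h\<^esup>\<^bsub>l\<^esub>\<close>, \<open>\<alpha>\<^bsup>l\<^esup>\<^bsub>j,k\<^esub>\<close>, \<open>\<alpha>\<^bsup>l\<^esup>\<^bsub>l'\<^esub>\<close>.\<close>

record 'h chi_data =
  m_pos :: "nat \<Rightarrow> nat"
  m_neg :: "nat \<Rightarrow> nat"
  a_list :: "(nat \<times> complex vec) list"
  b_list :: "(nat \<times> complex vec) list"
  alpha_VV :: "nat \<Rightarrow> nat \<Rightarrow> nat \<Rightarrow> nat \<Rightarrow> 'h bpath_alg"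
  alpha_Vb :: "nat \<Rightarrow> nat \<Rightarrow> nat \<Rightarrow> 'h bpath_alg"
  alpha_aV :: "nat \<Rightarrow> nat \<Rightarrow> nat \<Rightarrow> 'h bpath_alg"
  alpha_ab :: "nat \<Rightarrow> nat \<Rightarrow> 'h bpath_alg"

definition Y_blocks :: "(nat, 'h) pre_digraph \<Rightarrow> 'h chi_data \<Rightarrow> (nat \<times> nat) set" where
  "Y_blocks G \<Delta> = (SIGMA i:verts G. {..<m_neg \<Delta> i})"

definition Z_blocks :: "(nat, 'h) pre_digraph \<Rightarrow> 'h chi_data \<Rightarrow> (nat \<times> nat) set" where
  "Z_blocks G \<Delta> = (SIGMA j:verts G. {..<m_pos \<Delta> j})"

definition is_chi_data ::
  "(nat, 'h) pre_digraph \<Rightarrow> (nat \<Rightarrow> nat) \<Rightarrow> (nat \<Rightarrow> nat) \<Rightarrow> (nat \<Rightarrow> int) \<Rightarrow> 'h chi_data \<Rightarrow> bool" where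
  "is_chi_data G d v m \<Delta> \<longleftrightarrow>
     (\<forall>i\<in>verts G. int (m_pos \<Delta> i) - int (m_neg \<Delta> i) = m i) \<and>
     (\<Sum>i\<in>verts G. m_neg \<Delta> i * v i) + length (a_list \<Delta>) =
       (\<Sum>i\<in>verts G. m_pos \<Delta> i * v i) + length (b_list \<Delta>) \<and>
     (\<forall>(i, a)\<in>set (a_list \<Delta>). i \<in> verts G \<and> a \<in> carrier_vec (d i)) \<and>
     (\<forall>(i, b)\<in>set (b_list \<Delta>). i \<in> verts G \<and> b \<in> carrier_vec (d i)) \<and>
     (\<forall>(i, h)\<in>Y_blocks G \<Delta>. \<forall>(j, k)\<in>Z_blocks G \<Delta>. has_type G i j (alpha_VV \<Delta> i h j k)) \<and>
     (\<forall>(i, h)\<in>Y_blocks G \<Delta>. \<forall>l<length (b_list \<Delta>).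
        has_type G i (fst (b_list \<Delta> ! l)) (alpha_Vb \<Delta> i h l)) \<and>
     (\<forall>l<length (a_list \<Delta>). \<forall>(j, k)\<in>Z_blocks G \<Delta>.
        has_type G (fst (a_list \<Delta> ! l)) j (alpha_aV \<Delta> l j k)) \<and>
     (\<forall>l<length (a_list \<Delta>). \<forall>l'<length (b_list \<Delta>).
        has_type G (fst (a_list \<Delta> ! l)) (fst (b_list \<Delta> ! l')) (alpha_ab \<Delta> l l'))"

definition chi_good ::
  "(nat, 'h) pre_digraph \<Rightarrow> (nat \<Rightarrow> nat) \<Rightarrow> (nat \<Rightarrow> int) \<Rightarrow> 'h chi_data \<Rightarrow> bool" where
  "chi_good G v m \<Delta> \<longleftrightarrow>
     (let Y = Y_blocks G \<Delta>; Z = Z_blocks G \<Delta>;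
          La = {..<length (a_list \<Delta>)}; Lb = {..<length (b_list \<Delta>)} in
      (\<forall>i\<in>verts G. int (m_pos \<Delta> i) + int (m_neg \<Delta> i) = \<bar>m i\<bar>) \<and>
      (\<forall>l\<in>La. \<forall>l'\<in>Lb. alpha_ab \<Delta> l l' = 0) \<and>
      (\<forall>(i, h)\<in>Y. \<forall>(j, k)\<in>Z. in_path_algebra (alpha_VV \<Delta> i h j k)) \<and>
      (\<forall>(i, h)\<in>Y. \<forall>l\<in>Lb. in_path_algebra (alpha_Vb \<Delta> i h l)) \<and>
      (\<forall>l\<in>La. \<forall>(j, k)\<in>Z. in_path_algebra (alpha_aV \<Delta> l j k)) \<and>
      (\<forall>l\<in>La. \<forall>l'\<in>Lb. in_path_algebra (alpha_ab \<Delta> l l')) \<and>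
      (\<forall>(i, h)\<in>Y. card {(j, k) \<in> Z. alpha_VV \<Delta> i h j k \<noteq> 0} +
                   card {l \<in> Lb. alpha_Vb \<Delta> i h l \<noteq> 0} \<le> v i) \<and>
      (\<forall>(j, k)\<in>Z. card {(i, h) \<in> Y. alpha_VV \<Delta> i h j k \<noteq> 0} +
                   card {l \<in> La. alpha_aV \<Delta> l j k \<noteq> 0} \<le> v j) \<and>
      (\<forall>l\<in>Lb. card {(i, h) \<in> Y. alpha_Vb \<Delta> i h l \<noteq> 0} \<le> 1) \<and>
      (\<forall>l\<in>La. card {(j, k) \<in> Z. alpha_aV \<Delta> l j k \<noteq> 0} \<le> 1))"

text \<open>Labels of the standard basis vectors of \<open>Y\<close> and of \<open>Z\<close>: \<open>Block i h p\<close> is the \<open>p\<close>-th unit vector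
  of the \<open>h\<close>-th copy of \<open>V\<^sub>i\<close>, and \<open>Line l\<close> spans the \<open>l\<close>-th one-dimensional summand.\<close>

datatype basis_label = Block nat nat nat | Line nat

definition basis_labels ::
  "(nat, 'h) pre_digraph \<Rightarrow> (nat \<Rightarrow> nat) \<Rightarrow> (nat \<Rightarrow> nat) \<Rightarrow> nat \<Rightarrow> basis_label list" where
  "basis_labels G v c r =
     [Block i h p. i \<leftarrow> sorted_list_of_set (verts G), h \<leftarrow> [0..<c i], p \<leftarrow> [0..<v i]] @
     [Line l. l \<leftarrow> [0..<r]]"

text \<open>The coefficient of \<open>\<Psi>\<^sub>\<Delta>(s)\<close> from the second label (in \<open>Y\<close>) to the first one (in \<open>Z\<close>).\<close>

fun Psi_entry ::
  "(nat, 'h) pre_digraph \<Rightarrow> (nat \<Rightarrow> nat) \<Rightarrow> 'h chi_data \<Rightarrow> 'h point \<Rightarrow>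
     basis_label \<Rightarrow> basis_label \<Rightarrow> complex" where
  "Psi_entry G v \<Delta> (B, \<gamma>, \<delta>) (Block j k q) (Block i h p) =
     bpath_eval G v (B, \<gamma>, \<delta>) i j (alpha_VV \<Delta> i h j k) $$ (q, p)"
| "Psi_entry G v \<Delta> (B, \<gamma>, \<delta>) (Line l) (Block i h p) =
     (let (j, b) = b_list \<Delta> ! l in
       scalar_prod b
         ((\<delta> j * bpath_eval G v (B, \<gamma>, \<delta>) i j (alpha_Vb \<Delta> i h l)) *\<^sub>v unit_vec (v i) p))"
| "Psi_entry G v \<Delta> (B, \<gamma>, \<delta>) (Block j k q) (Line l) =
     (let (i, a) = a_list \<Delta> ! l in
       ((bpath_eval G v (B, \<gamma>, \<delta>) i j (alpha_aV \<Delta> l j k) * \<gamma> i) *\<^sub>v a) $ q)"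
| "Psi_entry G v \<Delta> (B, \<gamma>, \<delta>) (Line l') (Line l) =
     (let (i, a) = a_list \<Delta> ! l; (j, b) = b_list \<Delta> ! l' in
       scalar_prod b
         ((\<delta> j * bpath_eval G v (B, \<gamma>, \<delta>) i j (alpha_ab \<Delta> l l') * \<gamma> i) *\<^sub>v a))"

definition Psi ::
  "(nat, 'h) pre_digraph \<Rightarrow> (nat \<Rightarrow> nat) \<Rightarrow> 'h chi_data \<Rightarrow> 'h point \<Rightarrow> complex mat" where
  "Psi G v \<Delta> s =
     (let ys = basis_labels G v (m_neg \<Delta>) (length (a_list \<Delta>));
          zs = basis_labels G v (m_pos \<Delta>) (length (b_list \<Delta>))
      in mat (length zs) (length ys) (\<lambda>(r, c). Psi_entry G v \<Delta> s (zs ! r) (ys ! c)))"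

definition f_Delta ::
  "(nat, 'h) pre_digraph \<Rightarrow> (nat \<Rightarrow> nat) \<Rightarrow> (nat \<Rightarrow> nat) \<Rightarrow> 'h chi_data \<Rightarrow> 'h point \<Rightarrow> complex" where
  "f_Delta G d v \<Delta> = (\<lambda>s\<in>rep_space G d v. det (Psi G v \<Delta> s))"

lemma GL_inv_closed:
  assumes "g \<in> carrier (GL k)"
  shows "g \<in> carrier_mat k k" "inv\<^bsub>GL k\<^esub> g \<in> carrier_mat k k"
proof -
  interpret R: ring "ring_mat TYPE(complex) k ()" by (rule ring_mat)
  interpret U: group "GL k" unfolding GL_def by (rule R.units_group)
  have sub: "carrier (GL k) \<subseteq> carrier_mat k k"
    by (auto simp: GL_def units_of_def Units_def ring_mat_simps)
  show "g \<in> carrier_mat k k" using assms sub by auto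
  show "inv\<^bsub>GL k\<^esub> g \<in> carrier_mat k k" using U.inv_closed[OF assms] sub by auto
qed

lemma gauge_act_closed:
  assumes "wf_digraph G" and "g \<in> carrier (gauge_group G v)" and "s \<in> rep_space G d v"
  shows "gauge_act G v g s \<in> rep_space G d v"
proof -
  interpret wf_digraph G by fact
  have g: "g i \<in> carrier (GL (v i))" if "i \<in> verts G" for i
    using assms(2) that by (auto simp: gauge_group_def PiE_def)
  obtain B \<gamma> \<delta> where s: "s = (B, \<gamma>, \<delta>)" by (cases s)
  show ?thesis
    using assms(3) GL_inv_closed[OF g]
    by (auto simp: s rep_space_def PiE_iff intro!: mult_carrier_mat)
qed

lemma regular_extensional:
  assumes "f \<in> regular_functions G d v"
  shows "f \<in> extensional (rep_space G d v)"
  using assms by (cases rule: regular_functions.cases) (auto simp: extensional_def)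

lemma regular_uminus:
  assumes "f \<in> regular_functions G d v"
  shows "(\<lambda>s\<in>rep_space G d v. - f s) \<in> regular_functions G d v"
proof -
  have "(\<lambda>s\<in>rep_space G d v. (\<lambda>s\<in>rep_space G d v. - 1) s * f s) \<in> regular_functions G d v"
    by (intro regular_functions.mult regular_functions.const assms)
  also have "(\<lambda>s\<in>rep_space G d v. (\<lambda>s\<in>rep_space G d v. - 1) s * f s) =
      (\<lambda>s\<in>rep_space G d v. - f s)"
    by (auto simp: restrict_def)
  finally show ?thesis .
qed

lemma invariant_ring_carrier:
  "f \<in> carrier (invariant_ring G d v) \<longleftrightarrow> f \<in> regular_functions G d v \<and>
    (\<forall>g\<in>carrier (gauge_group G v). \<forall>s\<in>rep_space G d v. f (gauge_act G v g s) = f s)"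
  by (simp add: invariant_ring_def)

lemma semi_invariant_module_carrier:
  "f \<in> carrier (semi_invariant_module G d v m) \<longleftrightarrow> f \<in> regular_functions G d v \<and>
    (\<forall>g\<in>carrier (gauge_group G v). \<forall>s\<in>rep_space G d v.
      f (gauge_act G v g s) = det_character G m g * f s)"
  by (simp add: semi_invariant_module_def)

lemma invariant_ring_ops:
  "mult (invariant_ring G d v) f f' = (\<lambda>s\<in>rep_space G d v. f s * f' s)"
  "one (invariant_ring G d v) = (\<lambda>s\<in>rep_space G d v. 1)"
  "zero (invariant_ring G d v) = (\<lambda>s\<in>rep_space G d v. 0)"
  "add (invariant_ring G d v) f f' = (\<lambda>s\<in>rep_space G d v. f s + f' s)"
  by (simp_all add: invariant_ring_def)

lemma semi_invariant_module_ops: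
  "zero (semi_invariant_module G d v m) = (\<lambda>s\<in>rep_space G d v. 0)"
  "add (semi_invariant_module G d v m) f f' = (\<lambda>s\<in>rep_space G d v. f s + f' s)"
  "smult (semi_invariant_module G d v m) f f' = (\<lambda>s\<in>rep_space G d v. f s * f' s)"
  by (simp_all add: semi_invariant_module_def)

lemmas regular_closed =
  regular_functions.const regular_functions.add regular_functions.mult regular_uminus

lemma invariant_ring_cring:
  assumes wf: "wf_digraph G"
  shows "cring (invariant_ring G d v)"
proof (intro cringI abelian_groupI comm_monoidI)
  let ?R = "invariant_ring G d v"
  show "\<zero>\<^bsub>?R\<^esub> \<in> carrier ?R" "\<one>\<^bsub>?R\<^esub> \<in> carrier ?R"
    unfolding invariant_ring_ops invariant_ring_carrier
    by (intro conjI ballI regular_closed; simp add: gauge_act_closed[OF wf])+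
  show "x \<oplus>\<^bsub>?R\<^esub> y \<in> carrier ?R" "x \<otimes>\<^bsub>?R\<^esub> y \<in> carrier ?R"
    if "x \<in> carrier ?R" "y \<in> carrier ?R" for x y
    using that unfolding invariant_ring_ops invariant_ring_carrier
    by (intro conjI ballI regular_closed; simp add: gauge_act_closed[OF wf])+
  fix x assume x: "x \<in> carrier ?R"
  then have ext: "x \<in> extensional (rep_space G d v)"
    by (simp add: invariant_ring_carrier regular_extensional)
  have "(\<lambda>s\<in>rep_space G d v. - x s) \<in> carrier ?R"
    using x unfolding invariant_ring_carrier
    by (intro conjI ballI regular_closed; simp add: gauge_act_closed[OF wf])
  then show "\<exists>y\<in>carrier ?R. y \<oplus>\<^bsub>?R\<^esub> x = \<zero>\<^bsub>?R\<^esub>"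
    by (rule bexI[rotated]) (simp add: invariant_ring_ops fun_eq_iff)
  show "\<zero>\<^bsub>?R\<^esub> \<oplus>\<^bsub>?R\<^esub> x = x" "\<one>\<^bsub>?R\<^esub> \<otimes>\<^bsub>?R\<^esub> x = x"
    using ext by (auto simp: invariant_ring_ops fun_eq_iff extensional_def)
qed (simp_all add: invariant_ring_ops fun_eq_iff algebra_simps)

lemma semi_invariant_module:
  assumes wf: "wf_digraph G"
  shows "module (invariant_ring G d v) (semi_invariant_module G d v m)"
proof (intro moduleI invariant_ring_cring wf abelian_groupI)
  let ?R = "invariant_ring G d v" and ?M = "semi_invariant_module G d v m"
  show "\<zero>\<^bsub>?M\<^esub> \<in> carrier ?M"
    unfolding semi_invariant_module_ops semi_invariant_module_carrier
    by (intro conjI ballI regular_closed; simp add: gauge_act_closed[OF wf])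
  show "x \<oplus>\<^bsub>?M\<^esub> y \<in> carrier ?M" if "x \<in> carrier ?M" "y \<in> carrier ?M" for x y
    using that unfolding semi_invariant_module_ops semi_invariant_module_carrier
    by (intro conjI ballI regular_closed; simp add: gauge_act_closed[OF wf] algebra_simps)
  show "a \<odot>\<^bsub>?M\<^esub> x \<in> carrier ?M" if "a \<in> carrier ?R" "x \<in> carrier ?M" for a x
    using that
    unfolding semi_invariant_module_ops semi_invariant_module_carrier invariant_ring_carrier
    by (intro conjI ballI regular_closed; simp add: gauge_act_closed[OF wf])
  fix x assume x: "x \<in> carrier ?M"
  then have ext: "x \<in> extensional (rep_space G d v)"
    by (simp add: semi_invariant_module_carrier regular_extensional)
  have "(\<lambda>s\<in>rep_space G d v. - x s) \<in> carrier ?M"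
    using x unfolding semi_invariant_module_carrier
    by (intro conjI ballI regular_closed; simp add: gauge_act_closed[OF wf])
  then show "\<exists>y\<in>carrier ?M. y \<oplus>\<^bsub>?M\<^esub> x = \<zero>\<^bsub>?M\<^esub>"
    by (rule bexI[rotated]) (simp add: semi_invariant_module_ops fun_eq_iff)
  show "\<zero>\<^bsub>?M\<^esub> \<oplus>\<^bsub>?M\<^esub> x = x" "\<one>\<^bsub>?R\<^esub> \<odot>\<^bsub>?M\<^esub> x = x"
    using ext
    by (auto simp: semi_invariant_module_ops invariant_ring_ops fun_eq_iff extensional_def)
qed (simp_all add: semi_invariant_module_ops invariant_ring_ops fun_eq_iff algebra_simps)

end

theory Submission
  imports Defs "HOL-Combinatorics.Permutations" "Jordan_Normal_Form.Char_Poly"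
begin

text \<open>Let \<open>f\<close> be a semi-invariant for the character \<open>\<chi>\<close> with exponents \<open>m\<^sub>i\<close>.  That the functions \<open>f\<^sub>\<Delta>\<close> of good data are
semi-invariant of this weight is the equivariance of \<open>\<Psi>\<^sub>\<Delta>\<close> (\<open>f_Delta_semi_invariant\<close>).  To write \<open>f\<close> in terms
of them, \<open>f\<close> is first polarized (\<open>semi_invariant_tensor_expansion\<close>): it is a combination of products of
coordinates whose coefficients form tensors, with a row and a column index for each factor, that are
semi-invariant of weight \<open>\<chi>\<close>.

Multiplying such a tensor by determinant tensors, \<open>\<bar>m\<^sub>i\<bar>\<close> of them at vertex \<open>i\<close>, cancels the character.
By the first fundamental theorem (\<open>first_fundamental_theorem\<close>) the product is a combination of complete
matchings between upper and lower slots at the same vertex.  Contracting the determinant tensors with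
themselves gives back a positive multiple of the tensor.  So \<open>f\<close> is a combination of functions of the
following kind: take a product of coordinate matrices of arrows and of framing maps, and contract it
along a matching with determinant tensors (\<open>tensor_slice_generated\<close>).

Such a matching is a wiring diagram.  Summing over the index at a joint between two matrices multiplies
them, so the diagram splits into closed paths, whose traces are invariant, paths between two framing
vectors, whose values are invariant as well, and paths with at least one end in a determinant tensor
(\<open>eliminate_wires\<close>, \<open>contraction_generated\<close>).  The sign of \<open>m\<^sub>i\<close> decides whether the determinant tensors
at \<open>i\<close> have upper or lower indices, so the paths of the last kind lead from a basis vector of \<open>Y\<close> to one of
\<open>Z\<close>, use each of these once, and carry an antisymmetrization over every copy of \<open>V\<^sub>i\<close> in \<open>Y\<close> and in \<open>Z\<close>.

The value of such a bracket graph is a mixed discriminant: it is the part of \<open>det (\<Sum>e. M e)\<close> that is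
linear in each of the matrices \<open>M e\<close> of its edges.  Inclusion-exclusion therefore writes it as an
alternating sum, over sets \<open>T\<close> of edges, of the determinants of \<open>\<Sum>e\<in>T. M e\<close>, and each of these is
\<open>f\<^sub>\<Delta>\<close> for the data \<open>\<Delta>\<close> whose elements are the sums of the paths in \<open>T\<close> between two summands.  These data
are good: a copy of \<open>V\<^sub>i\<close> has \<open>v\<^sub>i\<close> basis vectors and meets at most that many paths, a one-dimensional
summand meets at most one, and the paths between two framing vectors were split off before
(\<open>bracket_graph_generated\<close>).

The first fundamental theorem is derived from the double commutant theorem for finite permutation groups
(\<open>commutant_of_group_invariants\<close>): an invariant tensor is an endomorphism of a tensor power that commutes
with all invertible matrices, by density with all matrices, by polarization with everything that
commutes with the permutations of the slots, and hence is a combination of such permutations.\<close>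

section \<open>Permanents and commutants of finite permutation groups\<close>

text \<open>Ryser's formula for the permanent: expanding the product over \<open>A\<close> gives one term for every map
\<open>g\<close> from \<open>A\<close> to itself, and inclusion-exclusion over \<open>T\<close> keeps exactly those with image \<open>A\<close>.  It is the
common source of polarization (a multilinear form as a finite difference of a polynomial) and of the
expansion of a mixed discriminant.\<close>

lemma ryser:
  fixes f :: "'a \<Rightarrow> 'a \<Rightarrow> 'b :: comm_ring_1"
  assumes A: "finite A"
  shows "(\<Sum>T\<in>Pow A. (- 1) ^ (card A - card T) * (\<Prod>a\<in>A. \<Sum>b\<in>T. f a b))
       = (\<Sum>p | p permutes A. \<Prod>a\<in>A. f a (p a))"
proof -
  have fin: "finite (A \<rightarrow>\<^sub>E A)" using A by (intro finite_PiE) auto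
  have inner: "(\<Prod>a\<in>A. \<Sum>b\<in>T. f a b) = (\<Sum>g\<in>A \<rightarrow>\<^sub>E A. if g ` A \<subseteq> T then \<Prod>a\<in>A. f a (g a) else 0)"
    if T: "T \<in> Pow A" for T
  proof -
    have "(\<Prod>a\<in>A. \<Sum>b\<in>T. f a b) = (\<Sum>g\<in>A \<rightarrow>\<^sub>E T. \<Prod>a\<in>A. f a (g a))"
      using A T by (intro prod_sum_PiE) (auto intro: finite_subset)
    also have "\<dots> = (\<Sum>g\<in>{g\<in>A \<rightarrow>\<^sub>E A. g ` A \<subseteq> T}. \<Prod>a\<in>A. f a (g a))"
      using T by (intro sum.cong) (auto simp: PiE_def Pi_def)
    finally show ?thesis using fin by (simp add: sum.inter_filter)
  qed
  have alt: "(\<Sum>T\<in>Pow A. if S \<subseteq> T then (- 1) ^ (card A - card T) else 0) = (if S = A then 1 else 0 :: 'b)"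
    if S: "S \<subseteq> A" for S
  proof -
    have "(\<Sum>T\<in>Pow A. if S \<subseteq> T then (- 1 :: 'b) ^ (card A - card T) else 0)
        = (\<Sum>T\<in>{T\<in>Pow A. S \<subseteq> T}. (- 1) ^ (card A - card T))"
      using A by (intro sum.inter_filter[symmetric]) simp
    also have "\<dots> = (\<Sum>T\<in>Pow (A - S). (- 1) ^ card T)"
    proof (rule sum.reindex_bij_witness[of _ "\<lambda>T. A - T" "\<lambda>T. A - T"])
      fix T assume T: "T \<in> {T \<in> Pow A. S \<subseteq> T}"
      then have "finite T" using A finite_subset by auto
      then show "(- 1 :: 'b) ^ card (A - T) = (- 1) ^ (card A - card T)"
        using T by (simp add: card_Diff_subset)
    qed (use S in auto)
    also have "\<dots> = (\<Sum>T\<in>Pow (A - S). \<Prod>x\<in>T. - 1)"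
      by simp
    also have "\<dots> = (\<Prod>x\<in>A - S. (- 1) + 1)"
      using A by (subst prod_add) (auto intro!: sum.cong)
    also have "\<dots> = (if S = A then 1 else 0)"
      using A S by (auto simp: prod_constant power_0_left)
    finally show ?thesis .
  qed
  have fact_if: "x * (if P then y else 0) = (if P then x else 0) * y" for P and x y :: 'b by simp
  have "(\<Sum>T\<in>Pow A. (- 1) ^ (card A - card T) * (\<Prod>a\<in>A. \<Sum>b\<in>T. f a b))
      = (\<Sum>T\<in>Pow A. \<Sum>g\<in>A \<rightarrow>\<^sub>E A. (if g ` A \<subseteq> T then (- 1) ^ (card A - card T) else 0) * (\<Prod>a\<in>A. f a (g a)))"
    by (intro sum.cong refl, subst inner, assumption) (simp only: sum_distrib_left fact_if)
  also have "\<dots> = (\<Sum>g\<in>A \<rightarrow>\<^sub>E A. \<Sum>T\<in>Pow A. (if g ` A \<subseteq> T then (- 1) ^ (card A - card T) else 0) * (\<Prod>a\<in>A. f a (g a)))"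
    by (rule sum.swap)
  also have "\<dots> = (\<Sum>g\<in>A \<rightarrow>\<^sub>E A. (if g ` A = A then \<Prod>a\<in>A. f a (g a) else 0))"
  proof (rule sum.cong[OF refl])
    fix g assume "g \<in> A \<rightarrow>\<^sub>E A"
    then have "g ` A \<subseteq> A" by auto
    then show "(\<Sum>T\<in>Pow A. (if g ` A \<subseteq> T then (- 1) ^ (card A - card T) else 0) * (\<Prod>a\<in>A. f a (g a)))
        = (if g ` A = A then \<Prod>a\<in>A. f a (g a) else 0)"
      unfolding sum_distrib_right[symmetric] by (subst alt) simp_all
  qed
  also have "\<dots> = (\<Sum>g\<in>{g\<in>A \<rightarrow>\<^sub>E A. g ` A = A}. \<Prod>a\<in>A. f a (g a))"
    using fin by (simp only: sum.inter_filter)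
  also have "\<dots> = (\<Sum>p | p permutes A. \<Prod>a\<in>A. f a (p a))"
  proof (rule sum.reindex_bij_witness[of _ "\<lambda>p. restrict p A" "\<lambda>g x. if x \<in> A then g x else x"])
    fix g assume g: "g \<in> {g \<in> A \<rightarrow>\<^sub>E A. g ` A = A}"
    then have "bij_betw g A A"
      using A by (auto simp: bij_betw_def eq_card_imp_inj_on)
    then have "bij_betw (\<lambda>x. if x \<in> A then g x else x) A A"
      by (rule bij_betw_cong[THEN iffD1, rotated]) simp
    then show "(\<lambda>x. if x \<in> A then g x else x) \<in> {p. p permutes A}"
      by (auto intro: bij_imp_permutes)
    show "restrict (\<lambda>x. if x \<in> A then g x else x) A = g"
      using g by (auto simp: fun_eq_iff PiE_def extensional_def)
    show "(\<Prod>a\<in>A. f a (if a \<in> A then g a else a)) = (\<Prod>a\<in>A. f a (g a))"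
      by (rule prod.cong) auto
  next
    fix p assume "p \<in> {p. p permutes A}"
    then have p: "p permutes A" by simp
    show "(\<lambda>x. if x \<in> A then restrict p A x else x) = p"
      using p by (auto simp: fun_eq_iff permutes_not_in)
    show "restrict p A \<in> {g \<in> A \<rightarrow>\<^sub>E A. g ` A = A}"
      using permutes_image[OF p] by auto
  qed
  finally show ?thesis .
qed

text \<open>A projection onto the span of the functions \<open>\<psi> k\<close> is built by adding these functions one at a time: if
the new function is not fixed by the projection found so far, then its residue \<open>r\<close> is nonzero at some
point, and a rank one correction in the direction of \<open>r\<close> repairs this without changing the values on
the old functions.\<close>

lemma projection_onto_span:
  fixes \<psi> :: "'k \<Rightarrow> 'w \<Rightarrow> 'f :: field"
  assumes "finite K" and W: "finite W"
  shows "\<exists>\<theta>. \<forall>j\<in>K. \<forall>w\<in>W. (\<Sum>w'\<in>W. (\<Sum>k\<in>K. \<psi> k w * \<theta> k w') * \<psi> j w') = \<psi> j w"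
  using \<open>finite K\<close>
proof (induction rule: finite_induct)
  case (insert k0 K)
  then obtain \<theta> where \<theta>: "\<And>j w. j \<in> K \<Longrightarrow> w \<in> W \<Longrightarrow>
      (\<Sum>w'\<in>W. (\<Sum>k\<in>K. \<psi> k w * \<theta> k w') * \<psi> j w') = \<psi> j w" by blast
  define P where "P = (\<lambda>w w'. \<Sum>k\<in>K. \<psi> k w * \<theta> k w')"
  have P\<psi>: "(\<Sum>w'\<in>W. P w w' * \<psi> j w') = \<psi> j w" if "j \<in> K" "w \<in> W" for j w
    using \<theta>[OF that] by (simp add: P_def)
  define r where "r = (\<lambda>w. \<psi> k0 w - (\<Sum>w'\<in>W. P w w' * \<psi> k0 w'))"
  show ?case
  proof (cases "\<forall>w\<in>W. r w = 0")
    case True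
    show ?thesis
    proof (rule exI[of _ "\<theta>(k0 := \<lambda>_. 0)"], intro ballI)
      fix j w assume j: "j \<in> insert k0 K" and w: "w \<in> W"
      have *: "(\<Sum>k\<in>insert k0 K. \<psi> k w * (\<theta>(k0 := \<lambda>_. 0)) k w') = P w w'" for w'
      proof -
        have "(\<Sum>k\<in>K. \<psi> k w * (\<theta>(k0 := \<lambda>_. 0)) k w') = P w w'"
          unfolding P_def using insert.hyps by (intro sum.cong) auto
        then show ?thesis using insert.hyps by simp
      qed
      have r: "(\<Sum>w'\<in>W. P w w' * \<psi> k0 w') = \<psi> k0 w"
        using bspec[OF True w] unfolding r_def right_minus_eq by (rule sym)
      show "(\<Sum>w'\<in>W. (\<Sum>k\<in>insert k0 K. \<psi> k w * (\<theta>(k0 := \<lambda>_. 0)) k w') * \<psi> j w') = \<psi> j w"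
        unfolding * by (rule insertE[OF j]) (simp only: r, rule P\<psi>[OF _ w], assumption)
    qed
  next
    case False
    \<comment> \<open>The functional \<open>\<eta>\<close> is evaluation of the residue at \<open>w0\<close>, scaled to be 1 on the new function; it vanishes on the old ones.\<close>
    then obtain w0 where w0: "w0 \<in> W" "r w0 \<noteq> 0" by auto
    define \<eta> where "\<eta> = (\<lambda>w'. ((if w' = w0 then 1 else 0) - P w0 w') / r w0)"
    have \<eta>_apply: "(\<Sum>w'\<in>W. \<eta> w' * x w') = (x w0 - (\<Sum>w'\<in>W. P w0 w' * x w')) / r w0" for x
    proof -
      have "(\<Sum>w'\<in>W. \<eta> w' * x w') = (\<Sum>w'\<in>W. (if w' = w0 then x w' else 0) - P w0 w' * x w') / r w0"
        unfolding \<eta>_def sum_divide_distrib by (intro sum.cong refl) (simp add: left_diff_distrib diff_divide_distrib)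
      then show ?thesis using W w0 by (simp add: sum_subtractf)
    qed
    have \<eta>\<psi>: "(\<Sum>w'\<in>W. \<eta> w' * \<psi> j w') = 0" if "j \<in> K" for j
      using P\<psi>[OF that w0(1)] by (simp add: \<eta>_apply)
    have \<eta>k0: "(\<Sum>w'\<in>W. \<eta> w' * \<psi> k0 w') = 1"
      using w0 unfolding \<eta>_apply by (simp add: r_def)
    define \<theta>' where "\<theta>' = (\<lambda>k w'. if k = k0 then \<eta> w' else \<theta> k w' - \<eta> w' * (\<Sum>u\<in>W. \<theta> k u * \<psi> k0 u))"
    have Q: "(\<Sum>k\<in>insert k0 K. \<psi> k w * \<theta>' k w') = P w w' + r w * \<eta> w'" for w w'
    proof -
      have "(\<Sum>k\<in>K. \<psi> k w * \<theta>' k w') = (\<Sum>k\<in>K. \<psi> k w * \<theta> k w' - \<eta> w' * (\<psi> k w * (\<Sum>u\<in>W. \<theta> k u * \<psi> k0 u)))"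
        using insert.hyps by (intro sum.cong) (auto simp: \<theta>'_def algebra_simps)
      also have "\<dots> = P w w' - \<eta> w' * (\<Sum>k\<in>K. \<Sum>u\<in>W. \<psi> k w * \<theta> k u * \<psi> k0 u)"
        by (simp add: P_def sum_subtractf sum_distrib_left mult.assoc)
      also have "(\<Sum>k\<in>K. \<Sum>u\<in>W. \<psi> k w * \<theta> k u * \<psi> k0 u) = (\<Sum>u\<in>W. P w u * \<psi> k0 u)"
        by (subst sum.swap) (simp add: P_def sum_distrib_right)
      finally show ?thesis using insert.hyps by (simp add: \<theta>'_def r_def algebra_simps)
    qed
    show ?thesis
    proof (rule exI[of _ \<theta>'], intro ballI)
      fix j w assume j: "j \<in> insert k0 K" and w: "w \<in> W"
      have "(\<Sum>w'\<in>W. (\<Sum>k\<in>insert k0 K. \<psi> k w * \<theta>' k w') * \<psi> j w')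
          = (\<Sum>w'\<in>W. P w w' * \<psi> j w') + r w * (\<Sum>w'\<in>W. \<eta> w' * \<psi> j w')"
        unfolding Q by (simp add: ring_distribs sum.distrib sum_distrib_left mult.assoc)
      also have "\<dots> = \<psi> j w"
      proof (cases "j = k0")
        case True
        then show ?thesis by (simp only: \<eta>k0) (simp add: r_def)
      next
        case False
        then have "j \<in> K" using j by simp
        then show ?thesis by (simp only: P\<psi>[OF _ w] \<eta>\<psi>) simp
      qed
      finally show "(\<Sum>w'\<in>W. (\<Sum>k\<in>insert k0 K. \<psi> k w * \<theta>' k w') * \<psi> j w') = \<psi> j w" .
    qed
  qed
qed auto

text \<open>The double commutant theorem for the permutation representation of a finite group \<open>K\<close> on functions
on \<open>X\<close>: a matrix that commutes with all \<open>K\<close>-invariant matrices is a linear combination of the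
permutation matrices of the elements of \<open>K\<close>.  Averaging a projection onto the span of the permutation
matrices produces invariant matrices \<open>P y w\<close> for which \<open>\<Sum>w. P y w z w\<close> is \<open>card K\<close> times the identity
matrix.  Moving \<open>T\<close> past these matrices places it next to the permutation matrices occurring in the
kernel of the projection.  The group enters only through its action and its multiplication table,
so that no abstract group has to be set up for permutations preserving a colouring.\<close>

lemma commutant_of_group_invariants:
  fixes T :: "'x \<Rightarrow> 'x \<Rightarrow> 'f :: field_char_0" and act :: "'k \<Rightarrow> 'x \<Rightarrow> 'x"
  assumes X: "finite X" and K: "finite K" "K \<noteq> {}"
    and act: "\<And>k x. k \<in> K \<Longrightarrow> x \<in> X \<Longrightarrow> act k x \<in> X"
    and inj: "\<And>k x y. k \<in> K \<Longrightarrow> x \<in> X \<Longrightarrow> y \<in> X \<Longrightarrow> act k x = act k y \<Longrightarrow> x = y"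
    and act_mul: "\<And>k k' x. k \<in> K \<Longrightarrow> k' \<in> K \<Longrightarrow> x \<in> X \<Longrightarrow> act (mul k k') x = act k (act k' x)"
    and mul: "\<And>k. k \<in> K \<Longrightarrow> bij_betw (mul k) K K" "\<And>k. k \<in> K \<Longrightarrow> bij_betw (\<lambda>k'. mul k' k) K K"
    and comm: "\<And>P x y. (\<And>k x y. k \<in> K \<Longrightarrow> x \<in> X \<Longrightarrow> y \<in> X \<Longrightarrow> P (act k x) (act k y) = P x y) \<Longrightarrow>
      x \<in> X \<Longrightarrow> y \<in> X \<Longrightarrow> (\<Sum>z\<in>X. T x z * P z y) = (\<Sum>z\<in>X. P x z * T z y)"
  shows "\<exists>c. \<forall>x\<in>X. \<forall>y\<in>X. T x y = (\<Sum>k\<in>K. c k * of_bool (x = act k y))"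
proof -
  define \<psi> where "\<psi> = (\<lambda>k (x, y). of_bool (x = act k y) :: 'f)"
  obtain \<theta> where \<theta>: "\<And>j w. j \<in> K \<Longrightarrow> w \<in> X \<times> X \<Longrightarrow>
      (\<Sum>w'\<in>X \<times> X. (\<Sum>k\<in>K. \<psi> k w * \<theta> k w') * \<psi> j w') = \<psi> j w"
    using projection_onto_span[of K "X \<times> X" \<psi>] K X by blast
  define p0 where "p0 = (\<lambda>w w'. \<Sum>k\<in>K. \<psi> k w * \<theta> k w')"
  have p0: "(\<Sum>b\<in>X. p0 (x, y) (act k b, b)) = of_bool (x = act k y)"
    if k: "k \<in> K" and xy: "x \<in> X" "y \<in> X" for k x y
  proof -
    have "(\<Sum>b\<in>X. p0 (x, y) (act k b, b)) = (\<Sum>b\<in>X. \<Sum>a\<in>X. if a = act k b then p0 (x, y) (a, b) else 0)"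
      using X act[OF k] by (intro sum.cong refl) simp
    also have "\<dots> = (\<Sum>a\<in>X. \<Sum>b\<in>X. if a = act k b then p0 (x, y) (a, b) else 0)"
      by (rule sum.swap)
    also have "\<dots> = (\<Sum>w'\<in>X \<times> X. p0 (x, y) w' * \<psi> k w')"
      unfolding sum.cartesian_product by (intro sum.cong refl) (auto simp: \<psi>_def)
    also have "\<dots> = \<psi> k (x, y)" unfolding p0_def using k xy by (intro \<theta>) auto
    finally show ?thesis by (simp add: \<psi>_def)
  qed
  define P where "P = (\<lambda>y w x z. \<Sum>k\<in>K. p0 (act k x, y) (act k z, w))"
  have P_inv: "P y w (act k x) (act k z) = P y w x z" if "k \<in> K" "x \<in> X" "z \<in> X" for k x y z w
  proof -
    have "P y w (act k x) (act k z) = (\<Sum>k'\<in>K. p0 (act (mul k' k) x, y) (act (mul k' k) z, w))"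
      unfolding P_def using that by (intro sum.cong refl) (simp add: act_mul)
    also have "\<dots> = P y w x z"
      unfolding P_def by (rule sum.reindex_bij_betw[OF mul(2)[OF that(1)]])
    finally show ?thesis .
  qed
  define c' where "c' = (\<lambda>k k'. \<Sum>w\<in>X. \<Sum>z\<in>X. \<theta> k' (act k z, w) * T z w)"
  \<comment> \<open>The coefficient of \<open>k''\<close> is the average over \<open>k\<close> of the coefficient of the pair \<open>(k, k * k'')\<close>.\<close>
  define c where "c = (\<lambda>k''. (\<Sum>k\<in>K. c' k (mul k k'')) / of_nat (card K))"
  show ?thesis
  proof (intro exI[of _ c] ballI)
    fix x y assume xy: "x \<in> X" "y \<in> X"
    have "of_nat (card K) * T x y = (\<Sum>z\<in>X. T x z * (\<Sum>w\<in>X. P y w z w))"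
    proof -
      have "(\<Sum>w\<in>X. P y w z w) = of_nat (card K) * of_bool (z = y)" if z: "z \<in> X" for z
      proof -
        have "(\<Sum>w\<in>X. P y w z w) = (\<Sum>k\<in>K. \<Sum>w\<in>X. p0 (act k z, y) (act k w, w))"
          unfolding P_def by (rule sum.swap)
        also have "\<dots> = (\<Sum>k\<in>K. of_bool (z = y))"
          using z xy act inj by (intro sum.cong refl) (auto simp: p0)
        finally show ?thesis by simp
      qed
      then have "(\<Sum>z\<in>X. T x z * (\<Sum>w\<in>X. P y w z w)) = (\<Sum>z\<in>X. if z = y then of_nat (card K) * T x z else 0)"
        by (intro sum.cong refl) simp
      then show ?thesis using X xy by simp
    qed
    also have "\<dots> = (\<Sum>w\<in>X. \<Sum>z\<in>X. T x z * P y w z w)"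
      unfolding sum_distrib_left by (rule sum.swap)
    also have "\<dots> = (\<Sum>w\<in>X. \<Sum>z\<in>X. P y w x z * T z w)"
      using xy by (intro sum.cong refl comm P_inv)
    also have "\<dots> = (\<Sum>w\<in>X. \<Sum>z\<in>X. \<Sum>k\<in>K. \<Sum>k'\<in>K. of_bool (act k x = act k' y) * (\<theta> k' (act k z, w) * T z w))"
      unfolding P_def p0_def sum_distrib_right by (intro sum.cong refl) (simp add: \<psi>_def)
    also have "\<dots> = (\<Sum>k\<in>K. \<Sum>k'\<in>K. of_bool (act k x = act k' y) * c' k k')"
      unfolding c'_def sum_distrib_left
      by (simp only: sum.swap[of _ K X])
    also have "\<dots> = (\<Sum>k\<in>K. \<Sum>k''\<in>K. of_bool (act k x = act (mul k k'') y) * c' k (mul k k''))"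
      by (intro sum.cong refl sum.reindex_bij_betw[symmetric] mul)
    also have "\<dots> = (\<Sum>k\<in>K. \<Sum>k''\<in>K. of_bool (x = act k'' y) * c' k (mul k k''))"
    proof (intro sum.cong refl)
      fix k k'' assume k: "k \<in> K" "k'' \<in> K"
      then have "act k x = act (mul k k'') y \<longleftrightarrow> x = act k'' y"
        using xy inj[OF k(1) xy(1) act[OF k(2) xy(2)]] by (auto simp: act_mul)
      then show "of_bool (act k x = act (mul k k'') y) * c' k (mul k k'')
          = of_bool (x = act k'' y) * c' k (mul k k'')" by simp
    qed
    also have "\<dots> = (\<Sum>k''\<in>K. of_nat (card K) * (c k'' * of_bool (x = act k'' y)))"
      using K by (subst sum.swap) (intro sum.cong refl, simp add: c_def sum_distrib_left)
    also have "\<dots> = of_nat (card K) * (\<Sum>k''\<in>K. c k'' * of_bool (x = act k'' y))"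
      by (simp add: sum_distrib_left)
    finally show "T x y = (\<Sum>k\<in>K. c k * of_bool (x = act k y))"
      using K by simp
  qed
qed

section \<open>Invariant tensors of products of general linear groups\<close>

text \<open>Tensors are stored in coordinates.  A finite set \<open>U\<close> of slots carries colours \<open>c\<close>, the slots of
colour \<open>i\<close> hold vectors of length \<open>v i\<close>, and an assignment is a multi-index, that is, a choice of one
coordinate for each slot.\<close>

definition assignments :: "('i \<Rightarrow> nat) \<Rightarrow> ('u \<Rightarrow> 'i) \<Rightarrow> 'u set \<Rightarrow> ('u \<Rightarrow> nat) set" where
  "assignments v c U = (\<Pi>\<^sub>E u\<in>U. {..<v (c u)})"

lemma finite_assignments [simp]: "finite U \<Longrightarrow> finite (assignments v c U)"
  unfolding assignments_def by (intro finite_PiE) auto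

text \<open>Pairs consisting of an element of the product of the groups \<open>GL (v i)\<close> and its inverse.  Carrying the
inverse along keeps matrix inversion out of the invariance conditions.\<close>

definition inverse_families :: "('i \<Rightarrow> nat) \<Rightarrow> (('i \<Rightarrow> complex mat) \<times> ('i \<Rightarrow> complex mat)) set" where
  "inverse_families v = {(A, A'). \<forall>i. A i \<in> carrier_mat (v i) (v i) \<and> A' i \<in> carrier_mat (v i) (v i) \<and>
     A i * A' i = 1\<^sub>m (v i) \<and> A' i * A i = 1\<^sub>m (v i)}"

definition tensor_power :: "('u \<Rightarrow> 'i) \<Rightarrow> 'u set \<Rightarrow> ('i \<Rightarrow> complex mat) \<Rightarrow> ('u \<Rightarrow> nat) \<Rightarrow> ('u \<Rightarrow> nat) \<Rightarrow> complex" where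
  "tensor_power c U A x y = (\<Prod>u\<in>U. A (c u) $$ (x u, y u))"

lemma prod_of_bool:
  "finite A \<Longrightarrow> (\<Prod>a\<in>A. of_bool (P a) :: 'b :: comm_semiring_1) = of_bool (\<forall>a\<in>A. P a)"
  by (induction rule: finite_induct) auto

lemma assignments_eq_iff:
  assumes "x \<in> assignments v c U" "y \<in> assignments v c U"
  shows "x = y \<longleftrightarrow> (\<forall>u\<in>U. x u = y u)"
  using assms unfolding assignments_def by (auto intro: PiE_ext)

lemma tensor_power_one:
  assumes "finite U" "x \<in> assignments v c U" "y \<in> assignments v c U"
  shows "tensor_power c U (\<lambda>i. 1\<^sub>m (v i)) x y = of_bool (x = y)"
proof -
  have "tensor_power c U (\<lambda>i. 1\<^sub>m (v i)) x y = (\<Prod>u\<in>U. of_bool (x u = y u))"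
    unfolding tensor_power_def using assms by (intro prod.cong) (auto simp: assignments_def PiE_iff)
  then show ?thesis using assms by (simp add: prod_of_bool assignments_eq_iff[OF assms(2,3)])
qed

lemma tensor_power_mult:
  assumes U: "finite U" and x: "x \<in> assignments v c U" and z: "z \<in> assignments v c U"
    and A: "\<And>i. A i \<in> carrier_mat (v i) (v i)" "\<And>i. B i \<in> carrier_mat (v i) (v i)"
  shows "(\<Sum>y\<in>assignments v c U. tensor_power c U A x y * tensor_power c U B y z)
    = tensor_power c U (\<lambda>i. A i * B i) x z"
proof -
  have "(\<Sum>y\<in>assignments v c U. tensor_power c U A x y * tensor_power c U B y z)
     = (\<Sum>y\<in>assignments v c U. \<Prod>u\<in>U. A (c u) $$ (x u, y u) * B (c u) $$ (y u, z u))"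
    by (simp add: tensor_power_def prod.distrib)
  also have "\<dots> = (\<Prod>u\<in>U. \<Sum>r<v (c u). A (c u) $$ (x u, r) * B (c u) $$ (r, z u))"
    unfolding assignments_def using U by (intro prod_sum_PiE[symmetric]) auto
  also have "\<dots> = tensor_power c U (\<lambda>i. A i * B i) x z"
    unfolding tensor_power_def
  proof (intro prod.cong refl)
    fix u assume u: "u \<in> U"
    have "x u < v (c u)" "z u < v (c u)" using x z u by (auto simp: assignments_def PiE_iff)
    then show "(\<Sum>r<v (c u). A (c u) $$ (x u, r) * B (c u) $$ (r, z u)) = (A (c u) * B (c u)) $$ (x u, z u)"
      using A[of "c u"] by (simp add: scalar_prod_def lessThan_atLeast0)
  qed
  finally show ?thesis .
qed

text \<open>Invertible matrices are dense: the determinant of \<open>A + t\<close> is, as a function of \<open>t\<close>, the characteristic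
polynomial of \<open>- A\<close>, and it has finitely many roots.\<close>

lemma shifted_det_eventually_nonzero:
  fixes A :: "complex mat"
  assumes A: "A \<in> carrier_mat n n"
  shows "eventually (\<lambda>t. det (A + t \<cdot>\<^sub>m 1\<^sub>m n) \<noteq> 0) (at 0)"
proof -
  let ?p = "char_poly (- A)"
  have mA: "- A \<in> carrier_mat n n" using A by simp
  have "?p \<noteq> 0" using degree_monic_char_poly[OF mA] by auto
  then have fin: "finite {t. poly ?p t = 0}" by (rule poly_roots_finite)
  have "A + t \<cdot>\<^sub>m 1\<^sub>m n = - char_matrix (- A) t" for t
    using A by (intro eq_matI) (auto simp: char_matrix_def)
  then have "poly ?p t = det (A + t \<cdot>\<^sub>m 1\<^sub>m n)" for t
    by (simp add: char_poly_matrix[OF mA])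
  then have "{t. det (A + t \<cdot>\<^sub>m 1\<^sub>m n) = 0} - {0} \<subseteq> {t. poly ?p t = 0}" by auto
  then have "finite ({t. det (A + t \<cdot>\<^sub>m 1\<^sub>m n) = 0} - {0})" using fin finite_subset by blast
  then have "open (- ({t. det (A + t \<cdot>\<^sub>m 1\<^sub>m n) = 0} - {0}))"
    by (intro open_Compl finite_imp_closed)
  then show ?thesis
    unfolding eventually_at_topological by (intro exI conjI) (assumption, auto)
qed

text \<open>For invertible \<open>A\<close> this is a restatement of invariance.  Both sides are polynomial in the entries of
\<open>A\<close>, so the identity extends to all matrices by density.\<close>

lemma tensor_power_commutes:
  assumes U: "finite U"
    and inv: "\<And>A A' y a. (A, A') \<in> inverse_families v \<Longrightarrow> y \<in> assignments v c U \<Longrightarrow> a \<in> assignments v c U \<Longrightarrow>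
      (\<Sum>x'\<in>assignments v c U. \<Sum>y'\<in>assignments v c U.
         S y' x' * tensor_power c U A x' a * tensor_power c U A' y y') = S y a"
    and A: "\<And>i. A i \<in> carrier_mat (v i) (v i)"
    and xy: "x \<in> assignments v c U" "a \<in> assignments v c U"
  shows "(\<Sum>z\<in>assignments v c U. S x z * tensor_power c U A z a)
       = (\<Sum>z\<in>assignments v c U. tensor_power c U A x z * S z a)"
proof -
  let ?X = "assignments v c U" and ?\<rho> = "tensor_power c U"
  have invertible: "(\<Sum>z\<in>?X. S x z * ?\<rho> A z a) = (\<Sum>z\<in>?X. ?\<rho> A x z * S z a)"
    if AA: "(A, A') \<in> inverse_families v" for A A'
  proof -
    have carr: "\<And>i. A i \<in> carrier_mat (v i) (v i)" "\<And>i. A' i \<in> carrier_mat (v i) (v i)"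
      and AA1: "\<And>i. A i * A' i = 1\<^sub>m (v i)"
      using AA by (auto simp: inverse_families_def)
    have Sza: "S z a = (\<Sum>y'\<in>?X. \<Sum>x'\<in>?X. S y' x' * ?\<rho> A x' a * ?\<rho> A' z y')" if "z \<in> ?X" for z
      using inv[OF AA that xy(2)] by (subst sum.swap) simp
    have "(\<Sum>z\<in>?X. ?\<rho> A x z * S z a)
        = (\<Sum>z\<in>?X. ?\<rho> A x z * (\<Sum>y'\<in>?X. \<Sum>x'\<in>?X. S y' x' * ?\<rho> A x' a * ?\<rho> A' z y'))"
      by (intro sum.cong refl arg_cong2[where f = "(*)"] Sza)
    also have "\<dots> = (\<Sum>z\<in>?X. \<Sum>y'\<in>?X. \<Sum>x'\<in>?X. S y' x' * ?\<rho> A x' a * (?\<rho> A x z * ?\<rho> A' z y'))"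
      unfolding sum_distrib_left by (intro sum.cong refl) (simp only: mult_ac)
    also have "\<dots> = (\<Sum>y'\<in>?X. \<Sum>x'\<in>?X. S y' x' * ?\<rho> A x' a * (\<Sum>z\<in>?X. ?\<rho> A x z * ?\<rho> A' z y'))"
      unfolding sum_distrib_left
      by (subst sum.swap, rule sum.cong[OF refl], rule sum.swap)
    also have "\<dots> = (\<Sum>y'\<in>?X. \<Sum>x'\<in>?X. S y' x' * ?\<rho> A x' a * of_bool (x = y'))"
      by (intro sum.cong refl, subst tensor_power_mult[OF U xy(1) _ carr], assumption)
        (simp add: AA1 tensor_power_one[OF U xy(1)])
    also have "\<dots> = (\<Sum>y'\<in>?X. if x = y' then \<Sum>x'\<in>?X. S y' x' * ?\<rho> A x' a else 0)"
      by (intro sum.cong refl) auto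
    also have "\<dots> = (\<Sum>x'\<in>?X. S x x' * ?\<rho> A x' a)"
      using U xy by simp
    finally show ?thesis by simp
  qed
  \<comment> \<open>The defect \<open>h t\<close> for the shifted matrices is continuous and vanishes for small \<open>t \<noteq> 0\<close>.\<close>
  define At where "At = (\<lambda>t i. A i + t \<cdot>\<^sub>m 1\<^sub>m (v i))"
  define h where "h = (\<lambda>t. (\<Sum>z\<in>?X. S x z * ?\<rho> (At t) z a) - (\<Sum>z\<in>?X. ?\<rho> (At t) x z * S z a))"
  have \<rho>At: "?\<rho> (At t) y z = (\<Prod>u\<in>U. A (c u) $$ (y u, z u) + t * of_bool (y u = z u))"
    if "y \<in> ?X" "z \<in> ?X" for t y z
    unfolding tensor_power_def
  proof (intro prod.cong refl)
    fix u assume "u \<in> U"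
    then have "y u < v (c u)" "z u < v (c u)" using that by (auto simp: assignments_def PiE_iff)
    then show "At t (c u) $$ (y u, z u) = A (c u) $$ (y u, z u) + t * of_bool (y u = z u)"
      using A[of "c u"] by (simp add: At_def)
  qed
  have h_eq: "h = (\<lambda>t. (\<Sum>z\<in>?X. S x z * (\<Prod>u\<in>U. A (c u) $$ (z u, a u) + t * of_bool (z u = a u)))
      - (\<Sum>z\<in>?X. (\<Prod>u\<in>U. A (c u) $$ (x u, z u) + t * of_bool (x u = z u)) * S z a))"
    unfolding h_def using xy by (simp add: \<rho>At)
  have lim: "(h \<longlongrightarrow> h 0) (at 0)"
    unfolding h_eq by (intro tendsto_intros)
  have "eventually (\<lambda>t. \<forall>i\<in>c ` U. det (At t i) \<noteq> 0) (at 0)"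
    using U A by (intro eventually_ball_finite ballI) (auto simp: At_def intro: shifted_det_eventually_nonzero)
  then have "eventually (\<lambda>t. h t = 0) (at 0)"
  proof (rule eventually_mono)
    fix t assume t: "\<forall>i\<in>c ` U. det (At t i) \<noteq> 0"
    have carr: "At t i \<in> carrier_mat (v i) (v i)" for i using A by (simp add: At_def)
    have "\<forall>i. \<exists>B B'. B \<in> carrier_mat (v i) (v i) \<and> B' \<in> carrier_mat (v i) (v i) \<and>
        B * B' = 1\<^sub>m (v i) \<and> B' * B = 1\<^sub>m (v i) \<and> (i \<in> c ` U \<longrightarrow> B = At t i)"
    proof
      fix i
      show "\<exists>B B'. B \<in> carrier_mat (v i) (v i) \<and> B' \<in> carrier_mat (v i) (v i) \<and>
        B * B' = 1\<^sub>m (v i) \<and> B' * B = 1\<^sub>m (v i) \<and> (i \<in> c ` U \<longrightarrow> B = At t i)"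
      proof (cases "i \<in> c ` U")
        case True
        then have "At t i \<in> Units (ring_mat TYPE(complex) (v i) ())"
          by (intro det_non_zero_imp_unit[OF carr] bspec[OF t])
        then obtain B' where "B' \<in> carrier_mat (v i) (v i)" "At t i * B' = 1\<^sub>m (v i)" "B' * At t i = 1\<^sub>m (v i)"
          unfolding Units_def ring_mat_def by auto
        then show ?thesis using carr by blast
      next
        case False
        then show ?thesis by (intro exI[of _ "1\<^sub>m (v i)"]) auto
      qed
    qed
    then obtain B B' where B: "\<And>i. B i \<in> carrier_mat (v i) (v i)" "\<And>i. B' i \<in> carrier_mat (v i) (v i)"
        "\<And>i. B i * B' i = 1\<^sub>m (v i)" "\<And>i. B' i * B i = 1\<^sub>m (v i)" "\<And>i. i \<in> c ` U \<Longrightarrow> B i = At t i"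
      by metis
    then have "(B, B') \<in> inverse_families v" by (simp add: inverse_families_def)
    from invertible[OF this] have "(\<Sum>z\<in>?X. S x z * ?\<rho> B z a) = (\<Sum>z\<in>?X. ?\<rho> B x z * S z a)" .
    moreover have "?\<rho> B = ?\<rho> (At t)" unfolding tensor_power_def by (intro ext prod.cong refl) (simp add: B(5))
    ultimately show "h t = 0" by (simp add: h_def)
  qed
  then have "(h \<longlongrightarrow> 0) (at 0)" by (rule tendsto_eventually)
  with lim have "h 0 = 0" by (intro LIM_unique)
  moreover have "At 0 i = A i" for i unfolding At_def using A[of i] by (intro eq_matI) auto
  then have "At 0 = A" by (rule ext)
  ultimately show ?thesis by (simp add: h_def)
qed

definition color_permutations :: "('u \<Rightarrow> 'i) \<Rightarrow> 'u set \<Rightarrow> ('u \<Rightarrow> 'u) set" where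
  "color_permutations c U = {p. p permutes U \<and> (\<forall>u\<in>U. c (p u) = c u)}"

lemma color_permutations_finite [simp]:
  assumes "finite U"
  shows "finite (color_permutations c U)"
  using finite_permutations[OF assms] unfolding color_permutations_def by (rule rev_finite_subset) blast

lemma color_permutations_id: "id \<in> color_permutations c U"
  by (simp add: color_permutations_def permutes_id)

lemma color_permutations_inv:
  assumes "p \<in> color_permutations c U"
  shows "inv_into UNIV p \<in> color_permutations c U"
proof -
  have p: "p permutes U" and c: "\<And>u. u \<in> U \<Longrightarrow> c (p u) = c u"
    using assms by (auto simp: color_permutations_def)
  have "c (inv_into UNIV p u) = c u" if "u \<in> U" for u
    using c[of "inv_into UNIV p u"] permutes_in_image[OF permutes_inv[OF p], of u]
      permutes_inverses(1)[OF p, of u] that by simp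
  then show ?thesis using permutes_inv[OF p] by (simp add: color_permutations_def)
qed

lemma color_permutations_comp:
  assumes p: "p \<in> color_permutations c U" and q: "q \<in> color_permutations c U"
  shows "q \<circ> p \<in> color_permutations c U"
proof -
  have perm: "p permutes U" "q permutes U" using p q by (simp_all add: color_permutations_def)
  have "c ((q \<circ> p) u) = c u" if "u \<in> U" for u
  proof -
    have "p u \<in> U" using permutes_in_image[OF perm(1)] that by blast
    then show ?thesis using p q that unfolding color_permutations_def by simp
  qed
  then show ?thesis using permutes_compose[OF perm] unfolding color_permutations_def by blast
qed

lemma assignments_comp:
  assumes p: "p \<in> color_permutations c U" and x: "x \<in> assignments v c U"
  shows "x \<circ> p \<in> assignments v c U"
  unfolding assignments_def
proof (rule PiE_I)
  have perm: "p permutes U" using p by (simp add: color_permutations_def)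
  show "(x \<circ> p) u \<in> {..<v (c u)}" if "u \<in> U" for u
    using PiE_mem[OF x[unfolded assignments_def], of "p u"] permutes_in_image[OF perm, of u] p that
    by (simp add: color_permutations_def)
  show "(x \<circ> p) u = undefined" if "u \<notin> U" for u
    using PiE_arb[OF x[unfolded assignments_def] that] permutes_not_in[OF perm that] by simp
qed

lemma comp_eq_iff_inv:
  assumes "p \<in> color_permutations c U"
  shows "z = x \<circ> p \<longleftrightarrow> x = z \<circ> inv_into UNIV p"
proof -
  have "p \<circ> inv_into UNIV p = id" "inv_into UNIV p \<circ> p = id"
    using assms permutes_inv_o[of p U] by (auto simp: color_permutations_def)
  then show ?thesis by (metis comp_assoc comp_id)
qed

text \<open>A product of matrix units, one for each slot, becomes after symmetrization over the permutations that
preserve colours a linear combination of tensor powers; this is polarization in the form of Ryser's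
formula.\<close>

lemma symmetrized_unit_polarization:
  assumes U: "finite U" and x0: "x0 \<in> assignments v c U" and y0: "y0 \<in> assignments v c U"
    and z: "z \<in> assignments v c U" and y: "y \<in> assignments v c U"
  shows "(\<Sum>T\<in>Pow U. (- 1) ^ (card U - card T) *
      tensor_power c U (\<lambda>i. mat (v i) (v i) (\<lambda>(r, s). \<Sum>u\<in>T. of_bool (c u = i \<and> x0 u = r \<and> y0 u = s))) z y)
    = (\<Sum>p\<in>color_permutations c U. of_bool (z = x0 \<circ> p \<and> y = y0 \<circ> p))"
proof -
  let ?f = "\<lambda>u' u. of_bool (c u = c u' \<and> x0 u = z u' \<and> y0 u = y u') :: complex"
  have "tensor_power c U (\<lambda>i. mat (v i) (v i) (\<lambda>(r, s). \<Sum>u\<in>T. of_bool (c u = i \<and> x0 u = r \<and> y0 u = s))) z y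
      = (\<Prod>u'\<in>U. \<Sum>u\<in>T. ?f u' u)" for T
    unfolding tensor_power_def
  proof (intro prod.cong refl)
    fix u assume "u \<in> U"
    then have "z u < v (c u)" "y u < v (c u)" using z y by (auto simp: assignments_def PiE_iff)
    then show "mat (v (c u)) (v (c u)) (\<lambda>(r, s). \<Sum>u'\<in>T. of_bool (c u' = c u \<and> x0 u' = r \<and> y0 u' = s)) $$ (z u, y u)
      = (\<Sum>u'\<in>T. ?f u u')" by simp
  qed
  then have "(\<Sum>T\<in>Pow U. (- 1) ^ (card U - card T) *
      tensor_power c U (\<lambda>i. mat (v i) (v i) (\<lambda>(r, s). \<Sum>u\<in>T. of_bool (c u = i \<and> x0 u = r \<and> y0 u = s))) z y)
      = (\<Sum>p | p permutes U. \<Prod>u\<in>U. ?f u (p u))"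
    by (simp only: ryser[OF U])
  also have "\<dots> = (\<Sum>p | p permutes U. if \<forall>u\<in>U. c (p u) = c u then of_bool (z = x0 \<circ> p \<and> y = y0 \<circ> p) else 0)"
  proof (intro sum.cong refl)
    fix p assume "p \<in> {p. p permutes U}"
    then have p: "p permutes U" by simp
    show "(\<Prod>u\<in>U. ?f u (p u)) = (if \<forall>u\<in>U. c (p u) = c u then of_bool (z = x0 \<circ> p \<and> y = y0 \<circ> p) else 0)"
    proof (cases "\<forall>u\<in>U. c (p u) = c u")
      case True
      then have "p \<in> color_permutations c U" using p by (simp add: color_permutations_def)
      then have "x0 \<circ> p = z \<longleftrightarrow> (\<forall>u\<in>U. x0 (p u) = z u)" "y0 \<circ> p = y \<longleftrightarrow> (\<forall>u\<in>U. y0 (p u) = y u)"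
        using assignments_eq_iff[OF assignments_comp[OF _ x0] z] assignments_eq_iff[OF assignments_comp[OF _ y0] y]
        by simp_all
      then have "(\<forall>u\<in>U. c (p u) = c u \<and> x0 (p u) = z u \<and> y0 (p u) = y u) \<longleftrightarrow> x0 \<circ> p = z \<and> y0 \<circ> p = y"
        using True by blast
      then show ?thesis
        unfolding prod_of_bool[OF U] using True by (simp add: eq_commute[of z] eq_commute[of y])
    next
      case False
      then show ?thesis unfolding prod_of_bool[OF U] by auto
    qed
  qed
  also have "\<dots> = (\<Sum>p\<in>{p \<in> {p. p permutes U}. \<forall>u\<in>U. c (p u) = c u}. of_bool (z = x0 \<circ> p \<and> y = y0 \<circ> p))"
    using U by (intro sum.inter_filter[symmetric]) (simp add: finite_permutations)
  finally show ?thesis by (simp add: color_permutations_def)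
qed

text \<open>By \<open>symmetrized_unit_polarization\<close> the tensor powers span all matrices that are invariant under
permutations preserving colours, so whatever commutes with the tensor powers commutes with them.\<close>

lemma commutes_with_color_invariants:
  fixes U :: "'u set" and c :: "'u \<Rightarrow> 'i"
  assumes U: "finite U"
    and S: "\<And>A x y. (\<And>i. A i \<in> carrier_mat (v i) (v i)) \<Longrightarrow> x \<in> assignments v c U \<Longrightarrow> y \<in> assignments v c U \<Longrightarrow>
      (\<Sum>z\<in>assignments v c U. S x z * tensor_power c U A z y) = (\<Sum>z\<in>assignments v c U. tensor_power c U A x z * S z y)"
    and P: "\<And>p x y. p \<in> color_permutations c U \<Longrightarrow> x \<in> assignments v c U \<Longrightarrow> y \<in> assignments v c U \<Longrightarrow>
      P (x \<circ> p) (y \<circ> p) = P x y"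
    and xy: "x \<in> assignments v c U" "y \<in> assignments v c U"
  shows "(\<Sum>z\<in>assignments v c U. S x z * P z y) = (\<Sum>z\<in>assignments v c U. P x z * S z y)"
proof -
  let ?X = "assignments v c U" and ?K = "color_permutations c U"
  define A where "A = (\<lambda>x0 y0 (T :: 'u set) i. mat (v i) (v i) (\<lambda>(r, s). \<Sum>u\<in>T. of_bool (c u = i \<and> x0 u = r \<and> y0 u = s)) :: complex mat)"
  define e where "e = (\<lambda>T :: 'u set. (- 1) ^ (card U - card T) :: complex)"
  have card: "of_nat (card ?K) \<noteq> (0 :: complex)"
    using color_permutations_id[of c U] card_gt_0_iff[of ?K] color_permutations_finite[OF U, of c] by auto
  have expand: "of_nat (card ?K) * P z y = (\<Sum>x0\<in>?X. \<Sum>y0\<in>?X. \<Sum>T\<in>Pow U. P x0 y0 * e T * tensor_power c U (A x0 y0 T) z y)"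
    if z: "z \<in> ?X" and y: "y \<in> ?X" for z y
  proof -
    have "(\<Sum>x0\<in>?X. \<Sum>y0\<in>?X. \<Sum>T\<in>Pow U. P x0 y0 * e T * tensor_power c U (A x0 y0 T) z y)
        = (\<Sum>x0\<in>?X. \<Sum>y0\<in>?X. P x0 y0 * (\<Sum>p\<in>?K. of_bool (z = x0 \<circ> p \<and> y = y0 \<circ> p)))"
      by (intro sum.cong refl, subst symmetrized_unit_polarization[OF U _ _ z y, symmetric])
        (simp_all add: A_def e_def sum_distrib_left mult.assoc)
    also have "\<dots> = (\<Sum>p\<in>?K. \<Sum>x0\<in>?X. \<Sum>y0\<in>?X. P x0 y0 * of_bool (z = x0 \<circ> p \<and> y = y0 \<circ> p))"
      unfolding sum_distrib_left by (simp only: sum.swap[of _ ?K ?X])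
    also have "\<dots> = (\<Sum>p\<in>?K. P z y)"
    proof (intro sum.cong refl)
      fix p assume p: "p \<in> ?K"
      note ip = color_permutations_inv[OF p]
      have "(\<Sum>x0\<in>?X. \<Sum>y0\<in>?X. P x0 y0 * of_bool (z = x0 \<circ> p \<and> y = y0 \<circ> p))
          = (\<Sum>x0\<in>?X. if x0 = z \<circ> inv_into UNIV p then \<Sum>y0\<in>?X. if y0 = y \<circ> inv_into UNIV p then P x0 y0 else 0 else 0)"
        by (intro sum.cong refl) (auto simp: comp_eq_iff_inv[OF p] intro!: sum.cong sum.neutral)
      also have "\<dots> = P z y"
        using U assignments_comp[OF ip] z y P[OF ip z y] by simp
      finally show "(\<Sum>x0\<in>?X. \<Sum>y0\<in>?X. P x0 y0 * of_bool (z = x0 \<circ> p \<and> y = y0 \<circ> p)) = P z y" .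
    qed
    finally show ?thesis by simp
  qed
  have "of_nat (card ?K) * (\<Sum>z\<in>?X. S x z * P z y)
      = (\<Sum>z\<in>?X. \<Sum>x0\<in>?X. \<Sum>y0\<in>?X. \<Sum>T\<in>Pow U. P x0 y0 * e T * (S x z * tensor_power c U (A x0 y0 T) z y))"
    unfolding sum_distrib_left
  proof (intro sum.cong refl)
    fix z assume "z \<in> ?X"
    have "of_nat (card ?K) * (S x z * P z y) = S x z * (of_nat (card ?K) * P z y)" by simp
    also have "\<dots> = (\<Sum>x0\<in>?X. \<Sum>y0\<in>?X. \<Sum>T\<in>Pow U. P x0 y0 * e T * (S x z * tensor_power c U (A x0 y0 T) z y))"
      unfolding expand[OF \<open>z \<in> ?X\<close> xy(2)] sum_distrib_left by (intro sum.cong refl) (simp only: mult_ac)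
    finally show "of_nat (card ?K) * (S x z * P z y)
      = (\<Sum>x0\<in>?X. \<Sum>y0\<in>?X. \<Sum>T\<in>Pow U. P x0 y0 * e T * (S x z * tensor_power c U (A x0 y0 T) z y))" .
  qed
  also have "\<dots> = (\<Sum>x0\<in>?X. \<Sum>y0\<in>?X. \<Sum>T\<in>Pow U. P x0 y0 * e T * (\<Sum>z\<in>?X. S x z * tensor_power c U (A x0 y0 T) z y))"
    unfolding sum_distrib_left
    by (subst sum.swap, rule sum.cong[OF refl], subst sum.swap, rule sum.cong[OF refl], rule sum.swap)
  also have "\<dots> = (\<Sum>x0\<in>?X. \<Sum>y0\<in>?X. \<Sum>T\<in>Pow U. P x0 y0 * e T * (\<Sum>z\<in>?X. tensor_power c U (A x0 y0 T) x z * S z y))"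
    using xy by (intro sum.cong refl arg_cong2[where f = "(*)"] S) (simp_all add: A_def)
  also have "\<dots> = (\<Sum>z\<in>?X. \<Sum>x0\<in>?X. \<Sum>y0\<in>?X. \<Sum>T\<in>Pow U. P x0 y0 * e T * (tensor_power c U (A x0 y0 T) x z * S z y))"
    unfolding sum_distrib_left
    by (rule sym, subst sum.swap, rule sum.cong[OF refl], subst sum.swap, rule sum.cong[OF refl], rule sum.swap)
  also have "\<dots> = of_nat (card ?K) * (\<Sum>z\<in>?X. P x z * S z y)"
    unfolding sum_distrib_left
  proof (intro sum.cong refl)
    fix z assume "z \<in> ?X"
    have "of_nat (card ?K) * (P x z * S z y) = of_nat (card ?K) * P x z * S z y" by simp
    also have "\<dots> = (\<Sum>x0\<in>?X. \<Sum>y0\<in>?X. \<Sum>T\<in>Pow U. P x0 y0 * e T * (tensor_power c U (A x0 y0 T) x z * S z y))"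
      unfolding expand[OF xy(1) \<open>z \<in> ?X\<close>] sum_distrib_right by (intro sum.cong refl) (simp only: mult_ac)
    finally show "(\<Sum>x0\<in>?X. \<Sum>y0\<in>?X. \<Sum>T\<in>Pow U. P x0 y0 * e T * (tensor_power c U (A x0 y0 T) x z * S z y))
       = of_nat (card ?K) * (P x z * S z y)" by simp
  qed
  finally show ?thesis using card by simp
qed

lemma invariant_endomorphism_spanned_by_permutations:
  assumes U: "finite U"
    and inv: "\<And>A A' y a. (A, A') \<in> inverse_families v \<Longrightarrow> y \<in> assignments v c U \<Longrightarrow> a \<in> assignments v c U \<Longrightarrow>
      (\<Sum>x'\<in>assignments v c U. \<Sum>y'\<in>assignments v c U.
         S y' x' * tensor_power c U A x' a * tensor_power c U A' y y') = S y a"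
  shows "\<exists>coef. \<forall>x\<in>assignments v c U. \<forall>y\<in>assignments v c U.
    S x y = (\<Sum>p\<in>color_permutations c U. coef p * of_bool (x = y \<circ> p))"
proof (rule commutant_of_group_invariants[where act = "\<lambda>p x. x \<circ> p" and mul = "\<lambda>p q. q \<circ> p"])
  let ?K = "color_permutations c U"
  show "?K \<noteq> {}" using color_permutations_id[of c U] by blast
  show "x = y" if "p \<in> ?K" "x \<circ> p = y \<circ> p" for p and x y :: "'a \<Rightarrow> nat"
    using that comp_eq_iff_inv[OF that(1), of "x \<circ> p" x] comp_eq_iff_inv[OF that(1), of "x \<circ> p" y] by simp
  have inverse: "p \<circ> inv_into UNIV p = id" "inv_into UNIV p \<circ> p = id" if "p \<in> ?K" for p
    using that permutes_inv_o[of p U] by (auto simp: color_permutations_def)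
  show "bij_betw (\<lambda>q. q \<circ> p) ?K ?K" if p: "p \<in> ?K" for p
  proof (rule bij_betw_byWitness[where f' = "\<lambda>q. q \<circ> inv_into UNIV p"])
    show "(\<lambda>q. q \<circ> p) ` ?K \<subseteq> ?K" "(\<lambda>q. q \<circ> inv_into UNIV p) ` ?K \<subseteq> ?K"
      by (intro image_subsetI color_permutations_comp p color_permutations_inv; assumption)+
  qed (simp_all add: comp_assoc inverse[OF p])
  show "bij_betw (\<lambda>q. p \<circ> q) ?K ?K" if p: "p \<in> ?K" for p
  proof (rule bij_betw_byWitness[where f' = "\<lambda>q. inv_into UNIV p \<circ> q"])
    show "(\<lambda>q. p \<circ> q) ` ?K \<subseteq> ?K" "(\<lambda>q. inv_into UNIV p \<circ> q) ` ?K \<subseteq> ?K"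
      by (intro image_subsetI color_permutations_comp p color_permutations_inv; assumption)+
  qed (simp_all add: comp_assoc[symmetric] inverse[OF p])
  show "(\<Sum>z\<in>assignments v c U. S x z * P z y) = (\<Sum>z\<in>assignments v c U. P x z * S z y)"
    if "\<And>p x y. p \<in> ?K \<Longrightarrow> x \<in> assignments v c U \<Longrightarrow> y \<in> assignments v c U \<Longrightarrow> P (x \<circ> p) (y \<circ> p) = P x y"
      and "x \<in> assignments v c U" "y \<in> assignments v c U" for P x y
  proof (rule commutes_with_color_invariants[OF U _ _ that(2,3)])
    fix A :: "'b \<Rightarrow> complex mat" and x' y'
    assume A: "\<And>i. A i \<in> carrier_mat (v i) (v i)" and xy: "x' \<in> assignments v c U" "y' \<in> assignments v c U"
    show "(\<Sum>z\<in>assignments v c U. S x' z * tensor_power c U A z y')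
        = (\<Sum>z\<in>assignments v c U. tensor_power c U A x' z * S z y')"
      by (rule tensor_power_commutes[OF U _ A xy]) (rule inv)
  next
    show "P (x \<circ> p) (y \<circ> p) = P x y"
      if "p \<in> ?K" "x \<in> assignments v c U" "y \<in> assignments v c U" for p x y
      by (rule \<open>\<And>p x y. p \<in> ?K \<Longrightarrow> x \<in> assignments v c U \<Longrightarrow> y \<in> assignments v c U \<Longrightarrow> P (x \<circ> p) (y \<circ> p) = P x y\<close>[OF that])
  qed
qed (use U in \<open>simp_all add: assignments_comp comp_assoc\<close>)

lemma color_preserving_bijection:
  assumes U: "finite U" and L: "finite L"
    and card: "\<And>i. card {u \<in> U. cu u = i} = card {l \<in> L. cl l = i}"
  obtains \<pi> where "bij_betw \<pi> U L" "\<And>u. u \<in> U \<Longrightarrow> cl (\<pi> u) = cu u"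
proof -
  have "\<exists>f. bij_betw f {u \<in> U. cu u = i} {l \<in> L. cl l = i}" for i
    using U L card by (intro finite_same_card_bij) auto
  then obtain f where f: "\<And>i. bij_betw (f i) {u \<in> U. cu u = i} {l \<in> L. cl l = i}" by metis
  define \<pi> where "\<pi> = (\<lambda>u. f (cu u) u)"
  have \<pi>: "\<pi> u \<in> L \<and> cl (\<pi> u) = cu u" if "u \<in> U" for u
    using bij_betwE[OF f[of "cu u"]] that by (auto simp: \<pi>_def)
  have "inj_on \<pi> U"
  proof (rule inj_onI)
    fix x y assume xy: "x \<in> U" "y \<in> U" "\<pi> x = \<pi> y"
    then have "cu x = cu y" using \<pi> by metis
    then show "x = y"
      using bij_betw_imp_inj_on[OF f[of "cu y"]] xy by (auto simp: \<pi>_def inj_on_def)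
  qed
  moreover have "\<pi> ` U = L"
  proof
    show "L \<subseteq> \<pi> ` U"
    proof
      fix l assume "l \<in> L"
      then have "l \<in> f (cl l) ` {u \<in> U. cu u = cl l}" using f[of "cl l"] by (simp add: bij_betw_def)
      then obtain x where "x \<in> U" "cu x = cl l" "l = f (cl l) x" by blast
      then show "l \<in> \<pi> ` U" by (intro image_eqI[of _ _ x]) (simp_all add: \<pi>_def)
    qed
  qed (use \<pi> in auto)
  ultimately show thesis using \<pi> by (intro that[of \<pi>]) (auto simp: bij_betw_def)
qed

text \<open>The scalar \<open>t\<close> at colour \<open>i\<close> acts with weight the number of slots of that colour; comparing weights
shows that nonzero invariant tensors need equally many upper and lower slots of each colour.\<close>

lemma tensor_power_scalar:
  assumes U: "finite U" and xy: "x \<in> assignments v c U" "y \<in> assignments v c U"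
  shows "tensor_power c U (\<lambda>j. if j = i then t \<cdot>\<^sub>m 1\<^sub>m (v j) else 1\<^sub>m (v j)) x y = t ^ card {u \<in> U. c u = i} * of_bool (x = y)"
proof -
  have "tensor_power c U (\<lambda>j. if j = i then t \<cdot>\<^sub>m 1\<^sub>m (v j) else 1\<^sub>m (v j)) x y
      = (\<Prod>u\<in>U. (if c u = i then t else 1) * of_bool (x u = y u))"
    unfolding tensor_power_def using xy by (intro prod.cong) (auto simp: assignments_def PiE_iff)
  also have "\<dots> = (\<Prod>u\<in>{u \<in> U. c u = i}. t) * of_bool (x = y)"
    unfolding prod.distrib prod.inter_filter[OF U] using U by (simp add: prod_of_bool assignments_eq_iff[OF xy])
  finally show ?thesis by simp
qed

text \<open>The first fundamental theorem for a product of general linear groups, in tensor form: the group acts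
on the slots \<open>U\<close> of \<open>F\<close> directly and on the slots \<open>L\<close> contragrediently, and the invariant tensors are spanned by the complete
contractions, which match every slot in \<open>U\<close> with a slot in \<open>L\<close> of the same colour.  If the numbers of
slots disagree at some colour, scalars force \<open>F\<close> to vanish.  Otherwise a fixed matching turns \<open>F\<close> into
an endomorphism of a tensor power that commutes with the group, to which
\<open>invariant_endomorphism_spanned_by_permutations\<close> applies.\<close>

theorem first_fundamental_theorem:
  fixes F :: "('u \<Rightarrow> nat) \<Rightarrow> ('l \<Rightarrow> nat) \<Rightarrow> complex" and cu :: "'u \<Rightarrow> 'i" and cl :: "'l \<Rightarrow> 'i"
  assumes U: "finite U" and L: "finite L"
    and inv: "\<And>A A' a b. (A, A') \<in> inverse_families v \<Longrightarrow> a \<in> assignments v cu U \<Longrightarrow> b \<in> assignments v cl L \<Longrightarrow>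
      (\<Sum>a'\<in>assignments v cu U. \<Sum>b'\<in>assignments v cl L.
         F a' b' * tensor_power cu U A a' a * tensor_power cl L A' b b') = F a b"
  shows "\<exists>(I :: ('u \<Rightarrow> 'u) set) coef \<pi>. finite I \<and>
    (\<forall>p\<in>I. bij_betw (\<pi> p) U L \<and> (\<forall>u\<in>U. cl (\<pi> p u) = cu u)) \<and>
    (\<forall>a\<in>assignments v cu U. \<forall>b\<in>assignments v cl L.
       F a b = (\<Sum>p\<in>I. coef p * of_bool (\<forall>u\<in>U. a u = b (\<pi> p u))))"
proof (cases "\<forall>i. card {u \<in> U. cu u = i} = card {l \<in> L. cl l = i}")
  case False
  then obtain i where i: "card {u \<in> U. cu u = i} \<noteq> card {l \<in> L. cl l = i}" by blast
  \<comment> \<open>The scalar 2 at a colour where the numbers differ multiplies \<open>F\<close> by a power of 2 other than 1.\<close>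
  let ?A = "\<lambda>t j. if j = i then t \<cdot>\<^sub>m 1\<^sub>m (v j) else 1\<^sub>m (v j) :: complex mat"
  have fam: "(?A 2, ?A (1/2)) \<in> inverse_families v"
    by (auto simp: inverse_families_def intro!: eq_matI)
  have "F a b = 0" if ab: "a \<in> assignments v cu U" "b \<in> assignments v cl L" for a b
  proof -
    let ?x = "2 ^ card {u \<in> U. cu u = i} * (1/2) ^ card {l \<in> L. cl l = i} :: complex"
    have "F a b = (\<Sum>a'\<in>assignments v cu U. \<Sum>b'\<in>assignments v cl L.
         F a' b' * tensor_power cu U (?A 2) a' a * tensor_power cl L (?A (1/2)) b b')"
      by (rule inv[OF fam ab, symmetric])
    also have "\<dots> = (\<Sum>a'\<in>assignments v cu U. \<Sum>b'\<in>assignments v cl L.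
         if b = b' then if a' = a then F a b * ?x else 0 else 0)"
      using ab by (intro sum.cong refl) (simp add: tensor_power_scalar U L)
    also have "\<dots> = F a b * ?x" using ab U L by simp
    finally have *: "F a b = F a b * ?x" .
    have "?x \<noteq> 1"
    proof
      assume "?x = 1"
      then have "(2 :: complex) ^ card {u \<in> U. cu u = i} = 2 ^ card {l \<in> L. cl l = i}"
        by (simp add: power_divide field_simps)
      then have "of_nat (2 ^ card {u \<in> U. cu u = i}) = (of_nat (2 ^ card {l \<in> L. cl l = i}) :: complex)"
        by simp
      then have "(2 :: nat) ^ card {u \<in> U. cu u = i} = 2 ^ card {l \<in> L. cl l = i}"
        unfolding of_nat_eq_iff .
      then show False using i by (simp add: power_inject_exp)
    qed
    with * show ?thesis by simp
  qed
  then show ?thesis by (intro exI[of _ "{}"]) simp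
next
  case True
  then obtain \<pi>0 where \<pi>0: "bij_betw \<pi>0 U L" and col: "\<And>u. u \<in> U \<Longrightarrow> cl (\<pi>0 u) = cu u"
    using color_preserving_bijection[OF U L, of cu cl] by auto
  let ?XU = "assignments v cu U" and ?XL = "assignments v cl L" and ?K = "color_permutations cu U"
  define \<iota> where "\<iota> = (\<lambda>y :: 'u \<Rightarrow> nat. restrict (y \<circ> inv_into U \<pi>0) L)"
  define \<kappa> where "\<kappa> = (\<lambda>b :: 'l \<Rightarrow> nat. restrict (b \<circ> \<pi>0) U)"
  have inv0: "inv_into U \<pi>0 l \<in> U" "\<pi>0 (inv_into U \<pi>0 l) = l" if "l \<in> L" for l
    using \<pi>0 that by (auto simp: bij_betw_def inv_into_into f_inv_into_f)
  have inv1: "\<pi>0 u \<in> L" "inv_into U \<pi>0 (\<pi>0 u) = u" if "u \<in> U" for u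
    using \<pi>0 that by (auto simp: bij_betw_def)
  have \<kappa>: "\<kappa> b \<in> ?XU" if "b \<in> ?XL" for b
    unfolding assignments_def \<kappa>_def
  proof (rule restrict_PiE_iff[THEN iffD2], intro ballI)
    fix u assume "u \<in> U"
    then show "(b \<circ> \<pi>0) u \<in> {..<v (cu u)}"
      using PiE_mem[OF that[unfolded assignments_def] inv1(1)] col by simp
  qed
  have \<iota>: "\<iota> y \<in> ?XL" if "y \<in> ?XU" for y
    unfolding assignments_def \<iota>_def
  proof (rule restrict_PiE_iff[THEN iffD2], intro ballI)
    fix l assume "l \<in> L"
    then show "(y \<circ> inv_into U \<pi>0) l \<in> {..<v (cl l)}"
      using PiE_mem[OF that[unfolded assignments_def] inv0(1)] col[of "inv_into U \<pi>0 l"] inv0 by simp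
  qed
  have \<iota>\<kappa>: "\<iota> (\<kappa> b) = b" if "b \<in> ?XL" for b
    using assignments_eq_iff[OF \<iota>[OF \<kappa>[OF that]] that] inv0 by (simp add: \<iota>_def \<kappa>_def)
  have \<kappa>\<iota>: "\<kappa> (\<iota> y) = y" if "y \<in> ?XU" for y
    using assignments_eq_iff[OF \<kappa>[OF \<iota>[OF that]] that] inv1 by (simp add: \<iota>_def \<kappa>_def)
  have bij: "bij_betw \<iota> ?XU ?XL"
    using \<iota> \<kappa> \<iota>\<kappa> \<kappa>\<iota> by (intro bij_betw_byWitness[where f' = \<kappa>]) auto
  have \<iota>_at: "\<iota> y (\<pi>0 u) = y u" if "u \<in> U" for u y
    using inv1[OF that] by (simp add: \<iota>_def)
  have pow: "tensor_power cl L A' (\<iota> y) (\<iota> y') = tensor_power cu U A' y y'" for A' y y'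
    unfolding tensor_power_def
    by (subst prod.reindex_bij_betw[OF \<pi>0, symmetric], intro prod.cong refl) (simp add: \<iota>_at col)
  define S where "S = (\<lambda>y a. F a (\<iota> y))"
  have "\<exists>coef. \<forall>x\<in>?XU. \<forall>y\<in>?XU. S x y = (\<Sum>p\<in>?K. coef p * of_bool (x = y \<circ> p))"
  proof (rule invariant_endomorphism_spanned_by_permutations[OF U])
    fix A A' y a assume AA: "(A, A') \<in> inverse_families v" and ya: "y \<in> ?XU" "a \<in> ?XU"
    have "(\<Sum>x'\<in>?XU. \<Sum>y'\<in>?XU. S y' x' * tensor_power cu U A x' a * tensor_power cu U A' y y')
        = (\<Sum>x'\<in>?XU. \<Sum>y'\<in>?XU. F x' (\<iota> y') * tensor_power cu U A x' a * tensor_power cl L A' (\<iota> y) (\<iota> y'))"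
      by (simp add: S_def pow)
    also have "\<dots> = (\<Sum>x'\<in>?XU. \<Sum>b'\<in>?XL. F x' b' * tensor_power cu U A x' a * tensor_power cl L A' (\<iota> y) b')"
      by (intro sum.cong refl sum.reindex_bij_betw[OF bij])
    also have "\<dots> = S y a" unfolding S_def by (rule inv[OF AA ya(2) \<iota>[OF ya(1)]])
    finally show "(\<Sum>x'\<in>?XU. \<Sum>y'\<in>?XU. S y' x' * tensor_power cu U A x' a * tensor_power cu U A' y y') = S y a" .
  qed
  then obtain coef where coef: "\<And>x y. x \<in> ?XU \<Longrightarrow> y \<in> ?XU \<Longrightarrow> S x y = (\<Sum>p\<in>?K. coef p * of_bool (x = y \<circ> p))"
    by blast
  show ?thesis
  proof (intro exI[of _ ?K] exI[of _ coef] exI[of _ "\<lambda>p. \<pi>0 \<circ> inv_into UNIV p"] conjI ballI)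
    show "finite ?K" using U by simp
    fix p assume p: "p \<in> ?K"
    have ip: "inv_into UNIV p permutes U" and ipc: "\<And>u. u \<in> U \<Longrightarrow> cu (inv_into UNIV p u) = cu u"
      using color_permutations_inv[OF p] by (auto simp: color_permutations_def)
    show "bij_betw (\<pi>0 \<circ> inv_into UNIV p) U L"
      by (rule bij_betw_trans[OF permutes_imp_bij[OF ip] \<pi>0])
    show "cl ((\<pi>0 \<circ> inv_into UNIV p) u) = cu u" if "u \<in> U" for u
      using that permutes_in_image[OF ip] by (simp add: col ipc)
  next
    fix a b assume a: "a \<in> ?XU" and b: "b \<in> ?XL"
    have "F a b = S (\<kappa> b) a" by (simp add: S_def \<iota>\<kappa>[OF b])
    also have "\<dots> = (\<Sum>p\<in>?K. coef p * of_bool (\<kappa> b = a \<circ> p))" by (rule coef[OF \<kappa>[OF b] a])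
    also have "\<dots> = (\<Sum>p\<in>?K. coef p * of_bool (\<forall>u\<in>U. a u = b ((\<pi>0 \<circ> inv_into UNIV p) u)))"
    proof (intro sum.cong refl)
      fix p assume p: "p \<in> ?K"
      note ip = color_permutations_inv[OF p]
      have ipU: "inv_into UNIV p u \<in> U \<longleftrightarrow> u \<in> U" for u
        using ip permutes_in_image by (fastforce simp: color_permutations_def)
      have "\<kappa> b = a \<circ> p \<longleftrightarrow> a = \<kappa> b \<circ> inv_into UNIV p" by (rule comp_eq_iff_inv[OF p])
      also have "\<dots> \<longleftrightarrow> (\<forall>u\<in>U. a u = b ((\<pi>0 \<circ> inv_into UNIV p) u))"
        using assignments_eq_iff[OF a assignments_comp[OF ip \<kappa>[OF b]]] by (simp add: \<kappa>_def ipU)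
      finally show "coef p * of_bool (\<kappa> b = a \<circ> p)
        = coef p * of_bool (\<forall>u\<in>U. a u = b ((\<pi>0 \<circ> inv_into UNIV p) u))" by simp
    qed
    finally show "F a b = (\<Sum>p\<in>?K. coef p * of_bool (\<forall>u\<in>U. a u = b ((\<pi>0 \<circ> inv_into UNIV p) u)))" .
  qed
qed

section \<open>Mixed discriminants and determinants of block sums\<close>

lemma det_as_sum:
  "det (mat R R f) = (\<Sum>p | p permutes {..<R}. signof p * (\<Prod>i<R. f (i, p i)))" for f :: "nat \<times> nat \<Rightarrow> 'a :: comm_ring_1"
proof -
  have "det (mat R R f) = (\<Sum>p | p permutes {..<R}. signof p * (\<Prod>i<R. mat R R f $$ (i, p i)))"
    by (subst det_def'[of _ R]) (simp_all add: lessThan_atLeast0)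
  also have "\<dots> = (\<Sum>p | p permutes {..<R}. signof p * (\<Prod>i<R. f (i, p i)))"
  proof (intro sum.cong refl arg_cong2[where f = "(*)"] prod.cong)
    fix p i assume "p \<in> {p. p permutes {..<R}}" "i \<in> {..<R}"
    then have "i < R" "p i < R" using permutes_in_image[of p "{..<R}" i] by auto
    then show "mat R R f $$ (i, p i) = f (i, p i)" by simp
  qed
  finally show ?thesis .
qed

text \<open>Inclusion-exclusion over the set \<open>T\<close> of edges present extracts from the determinant of a sum the part
that is linear in each of the matrices \<open>M k\<close>.  Each term of this part uses every edge once; \<open>\<rho> k\<close> and
\<open>\<sigma> (s k)\<close> are the row and the column used by edge \<open>k\<close>.  Since edge \<open>k\<close> only has entries in the row
block of \<open>k\<close> and in the column block of \<open>s k\<close>, both \<open>\<rho>\<close> and \<open>\<sigma>\<close> preserve blocks.\<close>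

lemma mixed_discriminant:
  fixes M :: "nat \<Rightarrow> nat \<Rightarrow> nat \<Rightarrow> complex"
  assumes s: "s permutes {..<R}"
  shows "(\<Sum>T\<in>Pow {..<R}. (- 1) ^ (R - card T) * det (mat R R (\<lambda>(i, j).
      \<Sum>k\<in>T. if blZ i = blZ k \<and> blY j = blY (s k) then M k i j else 0)))
    = signof s * (\<Sum>\<rho>\<in>color_permutations blZ {..<R}. \<Sum>\<sigma>\<in>color_permutations blY {..<R}.
        signof \<rho> * signof \<sigma> * (\<Prod>k<R. M k (\<rho> k) (\<sigma> (s k))))"
proof -
  let ?P = "{p. p permutes {..<R}}"
  define E where "E = (\<lambda>k i j. if blZ i = blZ k \<and> blY j = blY (s k) then M k i j else 0)"
  have "(\<Sum>T\<in>Pow {..<R}. (- 1) ^ (R - card T) * det (mat R R (\<lambda>(i, j). \<Sum>k\<in>T. E k i j)))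
      = (\<Sum>\<tau>\<in>?P. signof \<tau> * (\<Sum>T\<in>Pow {..<R}. (- 1) ^ (card {..<R} - card T) * (\<Prod>i<R. \<Sum>k\<in>T. E k i (\<tau> i))))"
    unfolding det_as_sum sum_distrib_left
    by (subst sum.swap) (intro sum.cong refl, simp)
  also have "\<dots> = (\<Sum>\<tau>\<in>?P. signof \<tau> * (\<Sum>p\<in>?P. \<Prod>i<R. E (p i) i (\<tau> i)))"
    by (subst ryser) simp_all
  also have "\<dots> = (\<Sum>\<tau>\<in>?P. signof \<tau> * (\<Sum>p\<in>?P. \<Prod>k<R. E k (p k) (\<tau> (p k))))"
  proof (rule sum.cong[OF refl], rule arg_cong2[where f = "(*)", OF refl])
    fix \<tau>
    have "(\<Sum>p\<in>?P. \<Prod>i<R. E (p i) i (\<tau> i)) = (\<Sum>p\<in>?P. \<Prod>i<R. E (inv_into UNIV p i) i (\<tau> i))"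
      by (rule sum.reindex_bij_witness[of _ "inv_into UNIV" "inv_into UNIV"])
        (auto intro: permutes_inv simp: permutes_inv_inv)
    also have "\<dots> = (\<Sum>p\<in>?P. \<Prod>k<R. E k (p k) (\<tau> (p k)))"
    proof (intro sum.cong refl)
      fix p assume "p \<in> ?P"
      then have p: "p permutes {..<R}" by simp
      have "(\<Prod>i<R. E (inv_into UNIV p i) i (\<tau> i)) = (\<Prod>k<R. E (inv_into UNIV p (p k)) (p k) (\<tau> (p k)))"
        by (rule prod.reindex_bij_betw[OF permutes_imp_bij[OF p], symmetric])
      then show "(\<Prod>i<R. E (inv_into UNIV p i) i (\<tau> i)) = (\<Prod>k<R. E k (p k) (\<tau> (p k)))"
        by (simp add: permutes_inverses[OF p])
    qed
    finally show "(\<Sum>p\<in>?P. \<Prod>i<R. E (p i) i (\<tau> i)) = (\<Sum>p\<in>?P. \<Prod>k<R. E k (p k) (\<tau> (p k)))" .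
  qed
  also have "\<dots> = (\<Sum>\<rho>\<in>?P. \<Sum>\<tau>\<in>?P. signof \<tau> * (\<Prod>k<R. E k (\<rho> k) (\<tau> (\<rho> k))))"
    unfolding sum_distrib_left by (rule sum.swap)
  also have "\<dots> = (\<Sum>\<rho>\<in>?P. \<Sum>\<sigma>\<in>?P. signof s * (signof \<rho> * signof \<sigma> * (\<Prod>k<R. E k (\<rho> k) (\<sigma> (s k)))))"
  proof (rule sum.cong[OF refl])
    fix \<rho> assume "\<rho> \<in> ?P"
    then have \<rho>: "\<rho> permutes {..<R}" by simp
    let ?i = "inv_into UNIV"
    show "(\<Sum>\<tau>\<in>?P. signof \<tau> * (\<Prod>k<R. E k (\<rho> k) (\<tau> (\<rho> k))))
        = (\<Sum>\<sigma>\<in>?P. signof s * (signof \<rho> * signof \<sigma> * (\<Prod>k<R. E k (\<rho> k) (\<sigma> (s k)))))"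
    proof (rule sum.reindex_bij_witness[of _ "\<lambda>\<sigma>. (\<sigma> \<circ> s) \<circ> ?i \<rho>" "\<lambda>\<tau>. (\<tau> \<circ> \<rho>) \<circ> ?i s"])
      fix \<tau> assume "\<tau> \<in> ?P"
      then have \<tau>: "\<tau> permutes {..<R}" by simp
      note perms = permutes_compose[OF permutes_inv[OF s] permutes_compose[OF \<rho> \<tau>]]
      show "(\<tau> \<circ> \<rho>) \<circ> ?i s \<in> ?P" using perms by simp
      show "((\<tau> \<circ> \<rho>) \<circ> ?i s) \<circ> s \<circ> ?i \<rho> = \<tau>"
        by (simp add: comp_assoc permutes_inv_o[OF s] permutes_inv_o[OF \<rho>])
      have "permutation s" "permutation \<rho>" "permutation \<tau>"
        using s \<rho> \<tau> by (auto intro: permutes_imp_permutation)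
      then have "sign ((\<tau> \<circ> \<rho>) \<circ> ?i s) = sign \<tau> * sign \<rho> * sign s"
        by (simp add: sign_compose sign_inverse permutation_compose permutation_inverse)
      then have "signof s * (signof \<rho> * signof ((\<tau> \<circ> \<rho>) \<circ> ?i s)) = (signof \<tau> :: complex)"
        by (simp add: sign_def split: if_splits)
      then show "signof s * (signof \<rho> * signof ((\<tau> \<circ> \<rho>) \<circ> ?i s) * (\<Prod>k<R. E k (\<rho> k) (((\<tau> \<circ> \<rho>) \<circ> ?i s) (s k))))
         = signof \<tau> * (\<Prod>k<R. E k (\<rho> k) (\<tau> (\<rho> k)))"
        by (simp add: permutes_inverses[OF s] mult.assoc[symmetric])
    next
      fix \<sigma> assume "\<sigma> \<in> ?P"
      then have \<sigma>: "\<sigma> permutes {..<R}" by simp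
      show "(\<sigma> \<circ> s) \<circ> ?i \<rho> \<in> ?P" using permutes_compose[OF permutes_inv[OF \<rho>] permutes_compose[OF s \<sigma>]] by simp
      show "((\<sigma> \<circ> s) \<circ> ?i \<rho>) \<circ> \<rho> \<circ> ?i s = \<sigma>"
        by (simp add: comp_assoc permutes_inv_o[OF s] permutes_inv_o[OF \<rho>])
    qed
  qed
  also have "\<dots> = signof s * (\<Sum>\<rho>\<in>?P. \<Sum>\<sigma>\<in>?P. signof \<rho> * signof \<sigma> * (\<Prod>k<R. E k (\<rho> k) (\<sigma> (s k))))"
    by (simp add: sum_distrib_left)
  also have "(\<Sum>\<rho>\<in>?P. \<Sum>\<sigma>\<in>?P. signof \<rho> * signof \<sigma> * (\<Prod>k<R. E k (\<rho> k) (\<sigma> (s k))))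
     = (\<Sum>\<rho>\<in>color_permutations blZ {..<R}. \<Sum>\<sigma>\<in>color_permutations blY {..<R}.
        signof \<rho> * signof \<sigma> * (\<Prod>k<R. M k (\<rho> k) (\<sigma> (s k))))"
  proof -
    have zeroZ: "(\<Prod>k<R. E k (\<rho> k) (\<sigma> (s k))) = 0" if "\<rho> \<in> ?P - color_permutations blZ {..<R}" for \<rho> \<sigma>
    proof -
      from that obtain k where "k < R" "blZ (\<rho> k) \<noteq> blZ k" by (auto simp: color_permutations_def)
      then have "E k (\<rho> k) (\<sigma> (s k)) = 0" by (simp add: E_def)
      then show ?thesis using \<open>k < R\<close> by (intro prod_zero) auto
    qed
    have zeroY: "(\<Prod>k<R. E k (\<rho> k) (\<sigma> (s k))) = 0" if "\<sigma> \<in> ?P - color_permutations blY {..<R}" for \<rho> \<sigma>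
    proof -
      from that obtain j where j: "j < R" "blY (\<sigma> j) \<noteq> blY j" by (auto simp: color_permutations_def)
      then obtain k where k: "k < R" "s k = j"
        using permutes_image[OF s] by (metis imageE lessThan_iff)
      then have "E k (\<rho> k) (\<sigma> (s k)) = 0" using j by (simp add: E_def)
      then show ?thesis using \<open>k < R\<close> by (intro prod_zero) auto
    qed
    have E: "E k (\<rho> k) (\<sigma> (s k)) = M k (\<rho> k) (\<sigma> (s k))"
      if "\<rho> \<in> color_permutations blZ {..<R}" "\<sigma> \<in> color_permutations blY {..<R}" "k < R" for k \<rho> \<sigma>
    proof -
      have "s k < R" using permutes_in_image[OF s, of k] that by simp
      then show ?thesis using that by (simp add: E_def color_permutations_def)
    qed
    have fin: "finite ?P" by (simp add: finite_permutations)
    have sub: "color_permutations c {..<R} \<subseteq> ?P" for c :: "nat \<Rightarrow> 'x" by (auto simp: color_permutations_def)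
    have "(\<Sum>\<rho>\<in>?P. \<Sum>\<sigma>\<in>?P. signof \<rho> * signof \<sigma> * (\<Prod>k<R. E k (\<rho> k) (\<sigma> (s k))))
        = (\<Sum>\<rho>\<in>color_permutations blZ {..<R}. \<Sum>\<sigma>\<in>?P. signof \<rho> * signof \<sigma> * (\<Prod>k<R. E k (\<rho> k) (\<sigma> (s k))))"
      by (rule sum.mono_neutral_right[OF fin sub]) (simp add: zeroZ)
    also have "\<dots> = (\<Sum>\<rho>\<in>color_permutations blZ {..<R}. \<Sum>\<sigma>\<in>color_permutations blY {..<R}.
        signof \<rho> * signof \<sigma> * (\<Prod>k<R. E k (\<rho> k) (\<sigma> (s k))))"
      by (intro sum.cong refl sum.mono_neutral_right[OF fin sub]) (simp add: zeroY)
    also have "\<dots> = (\<Sum>\<rho>\<in>color_permutations blZ {..<R}. \<Sum>\<sigma>\<in>color_permutations blY {..<R}.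
        signof \<rho> * signof \<sigma> * (\<Prod>k<R. M k (\<rho> k) (\<sigma> (s k))))"
      by (intro sum.cong refl arg_cong2[where f = "(*)"] prod.cong E) auto
    finally show ?thesis .
  qed
  finally show ?thesis by (simp only: E_def)
qed

lemma det_append:
  fixes E :: "'x \<Rightarrow> 'x \<Rightarrow> 'a :: idom"
  assumes "\<And>x y. x \<in> set xs \<Longrightarrow> y \<in> set ys \<Longrightarrow> E x y = 0"
  shows "det (mat (length (xs @ ys)) (length (xs @ ys)) (\<lambda>(r, c). E ((xs @ ys) ! r) ((xs @ ys) ! c)))
    = det (mat (length xs) (length xs) (\<lambda>(r, c). E (xs ! r) (xs ! c)))
      * det (mat (length ys) (length ys) (\<lambda>(r, c). E (ys ! r) (ys ! c)))"
proof -
  let ?n = "length xs" and ?m = "length ys"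
  have *: "mat (length (xs @ ys)) (length (xs @ ys)) (\<lambda>(r, c). E ((xs @ ys) ! r) ((xs @ ys) ! c))
      = four_block_mat (mat ?n ?n (\<lambda>(r, c). E (xs ! r) (xs ! c))) (0\<^sub>m ?n ?m)
          (mat ?m ?n (\<lambda>(r, c). E (ys ! r) (xs ! c))) (mat ?m ?m (\<lambda>(r, c). E (ys ! r) (ys ! c)))"
    by (rule eq_matI) (auto simp: nth_append assms)
  show ?thesis
    unfolding * by (rule det_four_block_mat_upper_right_zero[OF mat_carrier refl mat_carrier mat_carrier])
qed

lemma det_concat:
  fixes E :: "'x \<Rightarrow> 'x \<Rightarrow> 'a :: idom"
  assumes "distinct is" and "\<And>i j x y. i \<in> set is \<Longrightarrow> j \<in> set is \<Longrightarrow> i \<noteq> j \<Longrightarrow> x \<in> set (f i) \<Longrightarrow> y \<in> set (f j) \<Longrightarrow> E x y = 0"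
  shows "det (mat (length (concat (map f is))) (length (concat (map f is)))
      (\<lambda>(r, c). E (concat (map f is) ! r) (concat (map f is) ! c)))
    = (\<Prod>i\<in>set is. det (mat (length (f i)) (length (f i)) (\<lambda>(r, c). E (f i ! r) (f i ! c))))"
  using assms
proof (induction "is")
  case (Cons i "is")
  have "det (mat (length (concat (map f is))) (length (concat (map f is)))
      (\<lambda>(r, c). E (concat (map f is) ! r) (concat (map f is) ! c)))
    = (\<Prod>i\<in>set is. det (mat (length (f i)) (length (f i)) (\<lambda>(r, c). E (f i ! r) (f i ! c))))"
    using Cons.prems by (intro Cons.IH) auto
  moreover have "E x y = 0" if "x \<in> set (f i)" "y \<in> set (concat (map f is))" for x y
    using that Cons.prems by auto
  ultimately show ?case
    using Cons.prems(1) det_append[of "f i" "concat (map f is)" E] by simp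
qed simp

fun label_block :: "basis_label \<Rightarrow> (nat \<times> nat) + nat" where
  "label_block (Block i h p) = Inl (i, h)"
| "label_block (Line l) = Inr l"

fun label_pos :: "basis_label \<Rightarrow> nat" where
  "label_pos (Block i h p) = p"
| "label_pos (Line l) = 0"

text \<open>One-dimensional summands are assigned the vertex 0, which is not a vertex of the quiver and stands for
the trivial representation.\<close>

fun label_vertex :: "basis_label \<Rightarrow> nat" where
  "label_vertex (Block i h p) = i"
| "label_vertex (Line l) = 0"

lemma label_eqI: "label_block x = label_block y \<Longrightarrow> label_pos x = label_pos y \<Longrightarrow> x = y"
  by (cases x; cases y) auto

lemma label_vertex_cong: "label_block x = label_block y \<Longrightarrow> label_vertex x = label_vertex y"
  by (cases x; cases y) auto

text \<open>The action of a family \<open>A\<close> on the direct sum with the basis \<open>xs\<close>.\<close>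

definition block_matrix :: "basis_label list \<Rightarrow> (nat \<Rightarrow> complex mat) \<Rightarrow> complex mat" where
  "block_matrix xs A = mat (length xs) (length xs) (\<lambda>(r, c).
     if label_block (xs ! r) = label_block (xs ! c)
     then A (label_vertex (xs ! r)) $$ (label_pos (xs ! r), label_pos (xs ! c)) else 0)"

lemma block_matrix_carrier [simp]: "block_matrix xs A \<in> carrier_mat (length xs) (length xs)"
  by (simp add: block_matrix_def)

definition full_blocks :: "(nat \<Rightarrow> nat) \<Rightarrow> basis_label list \<Rightarrow> bool" where
  "full_blocks v xs \<longleftrightarrow> distinct xs \<and> (\<forall>x\<in>set xs. label_pos x < v (label_vertex x) \<and>
     (\<forall>q<v (label_vertex x). \<exists>y\<in>set xs. label_block y = label_block x \<and> label_pos y = q))"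

lemma set_basis_labels:
  assumes "finite (verts G)"
  shows "set (basis_labels G v c k) = {Block i h p | i h p. i \<in> verts G \<and> h < c i \<and> p < v i} \<union> Line ` {..<k}"
proof -
  have "set (basis_labels G v c k)
      = (\<Union>i\<in>verts G. \<Union>h\<in>{0..<c i}. Block i h ` {0..<v i}) \<union> Line ` {0..<k}"
    using assms by (simp add: basis_labels_def)
  also have "(\<Union>i\<in>verts G. \<Union>h\<in>{0..<c i}. Block i h ` {0..<v i})
      = {Block i h p | i h p. i \<in> verts G \<and> h < c i \<and> p < v i}"
  proof (intro subset_antisym subsetI)
    fix x assume "x \<in> {Block i h p | i h p. i \<in> verts G \<and> h < c i \<and> p < v i}"
    then obtain i h p where "x = Block i h p" "i \<in> verts G" "h < c i" "p < v i" by blast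
    then show "x \<in> (\<Union>i\<in>verts G. \<Union>h\<in>{0..<c i}. Block i h ` {0..<v i})"
      by (intro UN_I[of i] UN_I[of h] image_eqI[of _ _ p]) auto
  qed auto
  finally show ?thesis by (simp add: lessThan_atLeast0)
qed

lemma distinct_basis_labels: "distinct (basis_labels G v c k)"
proof -
  have "distinct (concat (map (\<lambda>h. map (Block i h) [0..<q]) [0..<m]))" for i q m
    by (induction m) (auto simp: distinct_map inj_on_def)
  moreover have "distinct (concat (map (\<lambda>i. concat (map (\<lambda>h. map (Block i h) [0..<v i]) [0..<c i])) is))"
    if "distinct is" for "is"
    using that calculation by (induction "is") auto
  ultimately show ?thesis
    by (auto simp: basis_labels_def distinct_map inj_on_def)
qed

lemma full_blocks_basis_labels:
  assumes "finite (verts G)" "0 \<notin> verts G" "\<And>i. i \<in> verts G \<Longrightarrow> w i = v i" "w 0 = 1"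
  shows "full_blocks w (basis_labels G v c k)"
  unfolding full_blocks_def
proof (intro conjI ballI allI impI distinct_basis_labels)
  let ?xs = "basis_labels G v c k"
  fix x assume x: "x \<in> set ?xs"
  show "label_pos x < w (label_vertex x)"
    using x assms by (auto simp: set_basis_labels)
  fix q assume q: "q < w (label_vertex x)"
  show "\<exists>y\<in>set ?xs. label_block y = label_block x \<and> label_pos y = q"
  proof (cases x)
    case (Block i h p)
    then show ?thesis
      using x q assms by (intro bexI[of _ "Block i h q"]) (auto simp: set_basis_labels)
  next
    case (Line l)
    then show ?thesis
      using x q assms by (intro bexI[of _ x]) auto
  qed
qed

lemma full_blocks_pos: "full_blocks v xs \<Longrightarrow> r < length xs \<Longrightarrow> label_pos (xs ! r) < v (label_vertex (xs ! r))"
  by (simp add: full_blocks_def)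

lemma full_blocks_index:
  assumes "full_blocks v xs" "r < length xs" "q < v (label_vertex (xs ! r))"
  obtains k where "k < length xs" "label_block (xs ! k) = label_block (xs ! r)" "label_pos (xs ! k) = q"
proof -
  have "\<exists>y\<in>set xs. label_block y = label_block (xs ! r) \<and> label_pos y = q"
    using assms unfolding full_blocks_def by simp
  then show thesis using that by (auto simp: in_set_conv_nth)
qed

text \<open>The condition on \<open>A 0\<close> makes the one-dimensional summands contribute the factor 1.\<close>

lemma det_block_matrix:
  assumes fin: "finite (verts G)" and A: "\<And>i. i \<in> verts G \<Longrightarrow> A i \<in> carrier_mat (v i) (v i)" and A0: "A 0 $$ (0, 0) = 1"
  shows "det (block_matrix (basis_labels G v c k) A) = (\<Prod>i\<in>verts G. det (A i) ^ c i)"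
proof -
  define E where "E = (\<lambda>x y. if label_block x = label_block y
     then A (label_vertex x) $$ (label_pos x, label_pos y) else 0)"
  define D where "D = (\<lambda>xs. det (mat (length xs) (length xs) (\<lambda>(r, c). E (xs ! r) (xs ! c))))"
  have D_append: "D (xs @ ys) = D xs * D ys" if "\<And>x y. x \<in> set xs \<Longrightarrow> y \<in> set ys \<Longrightarrow> E x y = 0" for xs ys
    unfolding D_def by (rule det_append[OF that])
  have D_concat: "D (concat (map f is)) = (\<Prod>i\<in>set is. D (f i))"
    if "distinct is" "\<And>i j x y. i \<in> set is \<Longrightarrow> j \<in> set is \<Longrightarrow> i \<noteq> j \<Longrightarrow> x \<in> set (f i) \<Longrightarrow> y \<in> set (f j) \<Longrightarrow> E x y = 0"
    for f and "is" :: "nat list"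
    unfolding D_def by (rule det_concat[OF that])
  have D_block: "D (map (Block i h) [0..<v i]) = det (A i)" if "i \<in> verts G" for i h
    unfolding D_def using A[OF that] by (intro arg_cong[where f = det] eq_matI) (auto simp: E_def)
  have D_line: "D [Line l] = 1" for l
    unfolding D_def by (subst det_as_sum) (simp add: E_def A0 permutes_sing lessThan_Suc)
  have "block_matrix (basis_labels G v c k) A = mat (length (basis_labels G v c k)) (length (basis_labels G v c k))
      (\<lambda>(r, s). E (basis_labels G v c k ! r) (basis_labels G v c k ! s))"
    by (simp add: block_matrix_def E_def)
  then have "det (block_matrix (basis_labels G v c k) A) = D (basis_labels G v c k)"
    by (simp add: D_def)
  also have "basis_labels G v c k = concat (map (\<lambda>i. concat (map (\<lambda>h. map (Block i h) [0..<v i]) [0..<c i]))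
      (sorted_list_of_set (verts G))) @ concat (map (\<lambda>l. [Line l]) [0..<k])"
    by (simp add: basis_labels_def)
  also have "D \<dots> = D (concat (map (\<lambda>i. concat (map (\<lambda>h. map (Block i h) [0..<v i]) [0..<c i]))
      (sorted_list_of_set (verts G)))) * D (concat (map (\<lambda>l. [Line l]) [0..<k]))"
    by (rule D_append) (auto simp: E_def)
  also have "D (concat (map (\<lambda>l. [Line l]) [0..<k])) = 1"
    by (subst D_concat) (auto simp: E_def D_line)
  also have "D (concat (map (\<lambda>i. concat (map (\<lambda>h. map (Block i h) [0..<v i]) [0..<c i])) (sorted_list_of_set (verts G))))
      = (\<Prod>i\<in>verts G. D (concat (map (\<lambda>h. map (Block i h) [0..<v i]) [0..<c i])))"
    using fin by (subst D_concat) (auto simp: E_def)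
  also have "\<dots> = (\<Prod>i\<in>verts G. det (A i) ^ c i)"
    by (intro prod.cong refl, subst D_concat) (auto simp: E_def D_block)
  finally show ?thesis by (simp add: basis_labels_def)
qed

abbreviation block_permutations :: "basis_label list \<Rightarrow> (nat \<Rightarrow> nat) set" where
  "block_permutations xs \<equiv> color_permutations (\<lambda>r. label_block (xs ! r)) {..<length xs}"

text \<open>The product of the determinant tensors of all blocks in \<open>xs\<close>: for distinct labels it is nonzero exactly at the
multi-indices that permute the coordinates inside every block, where it is the sign of that
permutation.\<close>

definition block_sign :: "basis_label list \<Rightarrow> (nat \<Rightarrow> nat) \<Rightarrow> complex" where
  "block_sign xs e = (\<Sum>\<rho>\<in>block_permutations xs. signof \<rho> * of_bool (\<forall>r<length xs. e r = label_pos (xs ! \<rho> r)))"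

lemma block_permutation_lt: "\<rho> \<in> block_permutations xs \<Longrightarrow> r < length xs \<Longrightarrow> \<rho> r < length xs"
  using permutes_in_image[of \<rho> "{..<length xs}" r] by (simp add: color_permutations_def)

text \<open>Terms of the Leibniz formula that leave the diagonal blocks vanish.\<close>

lemma sum_block_permutations:
  "(\<Sum>\<rho>\<in>block_permutations xs. signof \<rho> * (\<Prod>r<length xs. M r (\<rho> r)))
   = det (mat (length xs) (length xs) (\<lambda>(r, c). if label_block (xs ! r) = label_block (xs ! c) then M r c else 0 :: complex))"
proof -
  let ?P = "{p. p permutes {..<length xs}}"
  have "det (mat (length xs) (length xs) (\<lambda>(r, c). if label_block (xs ! r) = label_block (xs ! c) then M r c else 0))
      = (\<Sum>p\<in>?P. signof p * (\<Prod>r<length xs. if label_block (xs ! r) = label_block (xs ! p r) then M r (p r) else 0))"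
    by (simp add: det_as_sum)
  also have "\<dots> = (\<Sum>\<rho>\<in>block_permutations xs. signof \<rho> * (\<Prod>r<length xs. if label_block (xs ! r) = label_block (xs ! \<rho> r) then M r (\<rho> r) else 0))"
  proof (rule sum.mono_neutral_right)
    show "\<forall>p\<in>?P - block_permutations xs.
      signof p * (\<Prod>r<length xs. if label_block (xs ! r) = label_block (xs ! p r) then M r (p r) else 0) = 0"
    proof
      fix p assume "p \<in> ?P - block_permutations xs"
      then obtain r where "r < length xs" "label_block (xs ! p r) \<noteq> label_block (xs ! r)"
        by (auto simp: color_permutations_def)
      then have "(\<Prod>r<length xs. if label_block (xs ! r) = label_block (xs ! p r) then M r (p r) else 0) = 0"
        by (intro prod_zero) (auto intro!: bexI[of _ r])
      then show "signof p * (\<Prod>r<length xs. if label_block (xs ! r) = label_block (xs ! p r) then M r (p r) else 0) = 0"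
        by simp
    qed
  qed (auto simp: finite_permutations color_permutations_def)
  also have "\<dots> = (\<Sum>\<rho>\<in>block_permutations xs. signof \<rho> * (\<Prod>r<length xs. M r (\<rho> r)))"
    by (intro sum.cong refl arg_cong2[where f = "(*)"] prod.cong) (auto simp: color_permutations_def)
  finally show ?thesis by simp
qed

lemma block_sign_of_block_permutation:
  assumes "distinct xs" and \<rho>: "\<rho> \<in> block_permutations xs" and e: "\<And>r. r < length xs \<Longrightarrow> e r = label_pos (xs ! \<rho> r)"
  shows "block_sign xs e = signof \<rho>"
proof -
  have "(\<forall>r<length xs. e r = label_pos (xs ! \<rho>' r)) \<longleftrightarrow> \<rho>' = \<rho>" if \<rho>': "\<rho>' \<in> block_permutations xs" for \<rho>'
  proof
    assume *: "\<forall>r<length xs. e r = label_pos (xs ! \<rho>' r)"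
    show "\<rho>' = \<rho>"
    proof
      fix r
      show "\<rho>' r = \<rho> r"
      proof (cases "r < length xs")
        case True
        then have "xs ! \<rho>' r = xs ! \<rho> r"
          using * e[OF True] \<rho> \<rho>' by (intro label_eqI) (auto simp: color_permutations_def)
        then show ?thesis
          using nth_eq_iff_index_eq[OF assms(1)] block_permutation_lt \<rho> \<rho>' True by blast
      next
        case False
        then have "r \<notin> {..<length xs}" by simp
        then show ?thesis
          using permutes_not_in[of \<rho> "{..<length xs}" r] permutes_not_in[of \<rho>' "{..<length xs}" r] \<rho> \<rho>'
          unfolding color_permutations_def by simp
      qed
    qed
  qed (simp add: e)
  then have "block_sign xs e = (\<Sum>\<rho>'\<in>block_permutations xs. if \<rho>' = \<rho> then signof \<rho> else 0)"
    unfolding block_sign_def by (intro sum.cong refl) auto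
  then show ?thesis using \<rho> by simp
qed

text \<open>The determinant tensor transforms by the determinant.  In the Leibniz expansion of the left hand side
the coefficient matrix is the product of the incidence matrix of \<open>b\<close>, whose determinant is
\<open>block_sign xs b\<close>, with \<open>block_matrix xs A\<close>.\<close>

lemma block_sign_transform:
  assumes full: "full_blocks v xs"
    and A: "\<And>i. A i \<in> carrier_mat (v i) (v i)"
    and b: "b \<in> assignments v (\<lambda>r. label_vertex (xs ! r)) {..<length xs}"
  shows "(\<Sum>b'\<in>assignments v (\<lambda>r. label_vertex (xs ! r)) {..<length xs}.
      block_sign xs b' * tensor_power (\<lambda>r. label_vertex (xs ! r)) {..<length xs} A b b')
    = det (block_matrix xs A) * block_sign xs b"
proof -
  let ?R = "length xs" and ?col = "\<lambda>r. label_vertex (xs ! r)"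
  let ?X = "assignments v ?col {..<?R}" and ?K = "block_permutations xs"
  have "(\<Sum>b'\<in>?X. block_sign xs b' * tensor_power ?col {..<?R} A b b')
      = (\<Sum>\<rho>\<in>?K. signof \<rho> * (\<Sum>b'\<in>?X. of_bool (\<forall>r<?R. b' r = label_pos (xs ! \<rho> r)) * tensor_power ?col {..<?R} A b b'))"
    unfolding block_sign_def sum_distrib_left sum_distrib_right
    by (subst sum.swap) (simp only: mult.assoc)
  also have "\<dots> = (\<Sum>\<rho>\<in>?K. signof \<rho> * (\<Prod>r<?R. A (?col r) $$ (b r, label_pos (xs ! \<rho> r))))"
  proof (rule sum.cong[OF refl], rule arg_cong2[where f = "(*)", OF refl])
    fix \<rho> assume \<rho>: "\<rho> \<in> ?K"
    define e where "e = (\<lambda>r\<in>{..<?R}. label_pos (xs ! \<rho> r))"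
    have "label_pos (xs ! \<rho> r) < v (?col r)" if "r < ?R" for r
    proof -
      have "label_vertex (xs ! \<rho> r) = ?col r"
        using \<rho> that by (intro label_vertex_cong) (simp add: color_permutations_def)
      then show ?thesis
        using full_blocks_pos[OF full block_permutation_lt[OF \<rho> that]] by simp
    qed
    then have e: "e \<in> ?X" by (auto simp: e_def assignments_def)
    have "(\<forall>r<?R. b' r = label_pos (xs ! \<rho> r)) \<longleftrightarrow> b' = e" if "b' \<in> ?X" for b'
      using assignments_eq_iff[OF that e] by (auto simp: e_def)
    then have "(\<Sum>b'\<in>?X. of_bool (\<forall>r<?R. b' r = label_pos (xs ! \<rho> r)) * tensor_power ?col {..<?R} A b b')
        = (\<Sum>b'\<in>?X. if b' = e then tensor_power ?col {..<?R} A b e else 0)"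
      by (intro sum.cong refl) auto
    also have "\<dots> = tensor_power ?col {..<?R} A b e" using e by simp
    also have "\<dots> = (\<Prod>r<?R. A (?col r) $$ (b r, label_pos (xs ! \<rho> r)))"
      unfolding tensor_power_def by (intro prod.cong refl) (simp add: e_def)
    finally show "(\<Sum>b'\<in>?X. of_bool (\<forall>r<?R. b' r = label_pos (xs ! \<rho> r)) * tensor_power ?col {..<?R} A b b')
        = (\<Prod>r<?R. A (?col r) $$ (b r, label_pos (xs ! \<rho> r)))" .
  qed
  also have "\<dots> = det (mat ?R ?R (\<lambda>(r, c). if label_block (xs ! r) = label_block (xs ! c)
      then A (?col r) $$ (b r, label_pos (xs ! c)) else 0))"
    by (rule sum_block_permutations)
  also have "mat ?R ?R (\<lambda>(r, c). if label_block (xs ! r) = label_block (xs ! c) then A (?col r) $$ (b r, label_pos (xs ! c)) else 0)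
      = mat ?R ?R (\<lambda>(r, c). if label_block (xs ! r) = label_block (xs ! c) then of_bool (b r = label_pos (xs ! c)) else 0)
        * block_matrix xs A" (is "?N = ?D * _")
  proof (rule eq_matI)
    fix r c assume "r < dim_row (?D * block_matrix xs A)" "c < dim_col (?D * block_matrix xs A)"
    then have rc: "r < ?R" "c < ?R" by (simp_all add: block_matrix_def)
    have "b r < v (?col r)" using b rc by (auto simp: assignments_def PiE_iff)
    then obtain k0 where k0: "k0 < ?R" "label_block (xs ! k0) = label_block (xs ! r)" "label_pos (xs ! k0) = b r"
      by (rule full_blocks_index[OF full rc(1)])
    have uniq: "k = k0" if "k < ?R" "label_block (xs ! r) = label_block (xs ! k)" "b r = label_pos (xs ! k)" for k
    proof -
      have "xs ! k = xs ! k0" using that k0 by (intro label_eqI) auto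
      then show ?thesis using full that(1) k0(1) by (simp add: full_blocks_def nth_eq_iff_index_eq)
    qed
    have "(?D * block_matrix xs A) $$ (r, c) = (\<Sum>k<?R. (if label_block (xs ! r) = label_block (xs ! k) then of_bool (b r = label_pos (xs ! k)) else 0)
        * block_matrix xs A $$ (k, c))"
      using rc by (simp add: scalar_prod_def block_matrix_def lessThan_atLeast0)
    also have "\<dots> = (\<Sum>k<?R. if k = k0 then block_matrix xs A $$ (k0, c) else 0)"
    proof (rule sum.cong[OF refl])
      fix k assume "k \<in> {..<?R}"
      then show "(if label_block (xs ! r) = label_block (xs ! k) then of_bool (b r = label_pos (xs ! k)) else 0)
          * block_matrix xs A $$ (k, c) = (if k = k0 then block_matrix xs A $$ (k0, c) else 0)"
        using uniq[of k] k0(2,3) by (cases "k = k0") auto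
    qed
    also have "\<dots> = block_matrix xs A $$ (k0, c)" using k0 by simp
    also have "\<dots> = ?N $$ (r, c)"
      using rc k0 label_vertex_cong[OF k0(2)] by (simp add: block_matrix_def)
    finally show "?N $$ (r, c) = (?D * block_matrix xs A) $$ (r, c)" by simp
  qed (simp_all add: block_matrix_def)
  also have "det (?D * block_matrix xs A) = det ?D * det (block_matrix xs A)"
    by (rule det_mult[of _ ?R]) simp_all
  also have "det ?D = block_sign xs b"
    unfolding sum_block_permutations[symmetric] block_sign_def
    by (simp add: prod_of_bool Ball_def)
  finally show ?thesis by (simp add: mult.commute)
qed

lemma block_sign_transform_transposed:
  assumes full: "full_blocks v xs"
    and A: "\<And>i. A i \<in> carrier_mat (v i) (v i)"
    and a: "a \<in> assignments v (\<lambda>r. label_vertex (xs ! r)) {..<length xs}"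
  shows "(\<Sum>a'\<in>assignments v (\<lambda>r. label_vertex (xs ! r)) {..<length xs}.
      block_sign xs a' * tensor_power (\<lambda>r. label_vertex (xs ! r)) {..<length xs} A a' a)
    = det (block_matrix xs A) * block_sign xs a"
proof -
  let ?R = "length xs" and ?col = "\<lambda>r. label_vertex (xs ! r)"
  let ?X = "assignments v ?col {..<?R}"
  let ?At = "\<lambda>i. transpose_mat (A i)"
  have "tensor_power ?col {..<?R} A a' a = tensor_power ?col {..<?R} ?At a a'" if "a' \<in> ?X" for a'
    unfolding tensor_power_def
  proof (intro prod.cong refl)
    fix r assume "r \<in> {..<?R}"
    then have "a r < v (?col r)" "a' r < v (?col r)" using a that by (auto simp: assignments_def PiE_iff)
    then show "A (?col r) $$ (a' r, a r) = ?At (?col r) $$ (a r, a' r)" using A[of "?col r"] by simp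
  qed
  then have "(\<Sum>a'\<in>?X. block_sign xs a' * tensor_power ?col {..<?R} A a' a)
      = (\<Sum>a'\<in>?X. block_sign xs a' * tensor_power ?col {..<?R} ?At a a')" by simp
  also have "\<dots> = det (block_matrix xs ?At) * block_sign xs a"
    using A by (intro block_sign_transform[OF full _ a]) simp
  also have "block_matrix xs ?At = transpose_mat (block_matrix xs A)"
  proof (rule eq_matI)
    fix r c assume "r < dim_row (transpose_mat (block_matrix xs A))" "c < dim_col (transpose_mat (block_matrix xs A))"
    then have rc: "r < ?R" "c < ?R" by (simp_all add: block_matrix_def)
    have "label_pos (xs ! r) < v (?col r)" "label_pos (xs ! c) < v (?col c)"
      using full rc by (auto simp: full_blocks_def)
    then show "block_matrix xs ?At $$ (r, c) = transpose_mat (block_matrix xs A) $$ (r, c)"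
      using rc A[of "?col c"] label_vertex_cong[of "xs ! r" "xs ! c"] by (auto simp: block_matrix_def)
  qed (simp_all add: block_matrix_def)
  also have "det \<dots> = det (block_matrix xs A)" by (rule det_transpose[of _ ?R]) simp
  finally show ?thesis .
qed

section \<open>Polarization of semi-invariants\<close>

text \<open>The coordinates of a point, grouped into matrices: \<open>Arr h\<close> is the matrix of an arrow, \<open>Gam i r\<close> the
\<open>r\<close>-th column of \<open>\<gamma>\<^sub>i\<close>, and \<open>Del i r\<close> the \<open>r\<close>-th row of \<open>\<delta>\<^sub>i\<close>.  The framing spaces \<open>D\<^sub>i\<close> are not
acted upon, so splitting \<open>\<gamma>\<^sub>i\<close> and \<open>\<delta>\<^sub>i\<close> in this way leaves generators with at most one row index and one
column index on which the group acts.\<close>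

datatype 'h generator = Arr 'h | Gam nat nat | Del nat nat

type_synonym 'h coordinate = "'h generator \<times> nat \<times> nat"

fun coord :: "'h point \<Rightarrow> 'h coordinate \<Rightarrow> complex" where
  "coord (B, \<gamma>, \<delta>) (Arr h, p, q) = B h $$ (p, q)"
| "coord (B, \<gamma>, \<delta>) (Gam i r, p, q) = \<gamma> i $$ (p, r)"
| "coord (B, \<gamma>, \<delta>) (Del i r, p, q) = \<delta> i $$ (r, q)"

text \<open>Polynomials are lists of terms, a coefficient followed by a word in the variables.  Keeping words
rather than monomials makes homogeneous parts and polarization immediate.\<close>

definition poly_eval :: "(complex \<times> 'x list) list \<Rightarrow> ('x \<Rightarrow> complex) \<Rightarrow> complex" where
  "poly_eval ws z = (\<Sum>(c, w)\<leftarrow>ws. c * (\<Prod>k<length w. z (w ! k)))"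

lemma poly_eval_Nil [simp]: "poly_eval [] z = 0"
  and poly_eval_Cons: "poly_eval ((c, w) # ws) z = c * (\<Prod>k<length w. z (w ! k)) + poly_eval ws z"
  and poly_eval_append: "poly_eval (ws @ ws') z = poly_eval ws z + poly_eval ws' z"
  by (simp_all add: poly_eval_def)

lemma prod_nth_append:
  fixes z :: "'x \<Rightarrow> complex"
  shows "(\<Prod>k<length (w @ w'). z ((w @ w') ! k)) = (\<Prod>k<length w. z (w ! k)) * (\<Prod>k<length w'. z (w' ! k))"
proof -
  have *: "(\<Prod>k<length u. z (u ! k)) = prod_list (map z u)" for u
    by (simp add: prod.list_conv_set_nth lessThan_atLeast0)
  show ?thesis unfolding * by simp
qed

lemma poly_eval_mult:
  "poly_eval (concat (map (\<lambda>(c, w). map (\<lambda>(c', w'). (c * c', w @ w')) ws') ws)) z = poly_eval ws z * poly_eval ws' z"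
proof (induction ws)
  case (Cons cw ws)
  obtain c w where cw: "cw = (c, w)" by (cases cw)
  have "poly_eval (map (\<lambda>(c', w'). (c * c', w @ w')) ws') z = c * (\<Prod>k<length w. z (w ! k)) * poly_eval ws' z" for ws'
  proof (induction ws')
    case (Cons cw' ws')
    then show ?case by (cases cw') (simp only: list.map prod.case poly_eval_Cons prod_nth_append, simp add: algebra_simps)
  qed simp
  then show ?case using Cons by (simp add: cw poly_eval_append poly_eval_Cons algebra_simps)
qed simp

locale framed_quiver = fin_digraph G for G :: "(nat, 'h) pre_digraph" +
  fixes d v :: "nat \<Rightarrow> nat"
  assumes zero_notin_verts: "0 \<notin> verts G"
begin

text \<open>The missing index of a column of \<open>\<gamma>\<^sub>i\<close> or of a row of \<open>\<delta>\<^sub>i\<close> is treated as an index of the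
one-dimensional space at the extra vertex 0, so that every generator has a row vertex \<open>rv\<close> and a
column vertex \<open>cv\<close>.\<close>

definition w :: "nat \<Rightarrow> nat" where "w = v(0 := 1)"

lemma w_verts [simp]: "i \<in> verts G \<Longrightarrow> w i = v i" and w_0 [simp]: "w 0 = 1"
  using zero_notin_verts by (auto simp: w_def)

fun rv :: "'h generator \<Rightarrow> nat" where
  "rv (Arr h) = head G h" | "rv (Gam i r) = i" | "rv (Del i r) = 0"

fun cv :: "'h generator \<Rightarrow> nat" where
  "cv (Arr h) = tail G h" | "cv (Gam i r) = 0" | "cv (Del i r) = i"

definition gens :: "'h generator set" where
  "gens = Arr ` arcs G \<union> (\<Union>i\<in>verts G. Gam i ` {..<d i}) \<union> (\<Union>i\<in>verts G. Del i ` {..<d i})"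

lemma finite_gens [simp]: "finite gens"
  by (simp add: gens_def)

definition coords :: "'h coordinate set" where
  "coords = (SIGMA g:gens. {..<w (rv g)} \<times> {..<w (cv g)})"

lemma finite_coords [simp]: "finite coords"
  by (simp add: coords_def)

lemma mem_coords:
  "(Arr h, p, q) \<in> coords \<longleftrightarrow> h \<in> arcs G \<and> p < v (head G h) \<and> q < v (tail G h)"
  "(Gam i r, p, q) \<in> coords \<longleftrightarrow> i \<in> verts G \<and> r < d i \<and> p < v i \<and> q = 0"
  "(Del i r, p, q) \<in> coords \<longleftrightarrow> i \<in> verts G \<and> r < d i \<and> p = 0 \<and> q < v i"
  by (auto simp: coords_def gens_def)

definition point_of :: "('h coordinate \<Rightarrow> complex) \<Rightarrow> 'h point" where
  "point_of z = ((\<lambda>h\<in>arcs G. mat (v (head G h)) (v (tail G h)) (\<lambda>(p, q). z (Arr h, p, q))),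
     (\<lambda>i\<in>verts G. mat (v i) (d i) (\<lambda>(p, r). z (Gam i r, p, 0))),
     (\<lambda>i\<in>verts G. mat (d i) (v i) (\<lambda>(r, q). z (Del i r, 0, q))))"

lemma point_of_rep_space: "point_of z \<in> rep_space G d v"
  by (auto simp: point_of_def rep_space_def)

lemma coord_point_of: "x \<in> coords \<Longrightarrow> coord (point_of z) x = z x"
  by (cases "(point_of z, x)" rule: coord.cases) (auto simp: point_of_def mem_coords)

lemma regular_is_polynomial:
  assumes "f \<in> regular_functions G d v"
  shows "\<exists>ws. (\<forall>(c, u)\<in>set ws. set u \<subseteq> coords) \<and> (\<forall>s\<in>rep_space G d v. f s = poly_eval ws (coord s))"
  using assms
proof induction
  case (const c)
  then show ?case by (intro exI[of _ "[(c, [])]"]) (simp add: poly_eval_Cons)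
next
  case (coord_B h p q)
  then show ?case by (intro exI[of _ "[(1, [(Arr h, p, q)])]"]) (auto simp: poly_eval_Cons mem_coords lessThan_Suc)
next
  case (coord_gamma i p q)
  then show ?case by (intro exI[of _ "[(1, [(Gam i q, p, 0)])]"]) (auto simp: poly_eval_Cons mem_coords lessThan_Suc)
next
  case (coord_delta i p q)
  then show ?case by (intro exI[of _ "[(1, [(Del i p, 0, q)])]"]) (auto simp: poly_eval_Cons mem_coords lessThan_Suc)
next
  case (add f f')
  then obtain ws ws' where "\<forall>(c, u)\<in>set ws. set u \<subseteq> coords" "\<forall>s\<in>rep_space G d v. f s = poly_eval ws (coord s)"
    "\<forall>(c, u)\<in>set ws'. set u \<subseteq> coords" "\<forall>s\<in>rep_space G d v. f' s = poly_eval ws' (coord s)" by blast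
  then show ?case by (intro exI[of _ "ws @ ws'"]) (auto simp: poly_eval_append)
next
  case (mult f f')
  then obtain ws ws' where "\<forall>(c, u)\<in>set ws. set u \<subseteq> coords" "\<forall>s\<in>rep_space G d v. f s = poly_eval ws (coord s)"
    "\<forall>(c, u)\<in>set ws'. set u \<subseteq> coords" "\<forall>s\<in>rep_space G d v. f' s = poly_eval ws' (coord s)" by blast
  then show ?case
    by (intro exI[of _ "concat (map (\<lambda>(c, w). map (\<lambda>(c', w'). (c * c', w @ w')) ws') ws)"])
      (fastforce simp: poly_eval_mult)
qed

text \<open>The gauge action on coordinates, for a family \<open>A\<close> with inverse \<open>A'\<close>.\<close>

definition act :: "(nat \<Rightarrow> complex mat) \<Rightarrow> (nat \<Rightarrow> complex mat) \<Rightarrow> ('h coordinate \<Rightarrow> complex) \<Rightarrow> 'h coordinate \<Rightarrow> complex" where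
  "act A A' z = (\<lambda>(g, p, q). \<Sum>p'<w (rv g). \<Sum>q'<w (cv g). A (rv g) $$ (p, p') * z (g, p', q') * A' (cv g) $$ (q', q))"

lemma GL_inverse:
  assumes "A \<in> carrier_mat k k" "A' \<in> carrier_mat k k" "A * A' = 1\<^sub>m k" "A' * A = 1\<^sub>m k"
  shows "A \<in> carrier (GL k)" "inv\<^bsub>GL k\<^esub> A = A'"
proof -
  interpret R: ring "ring_mat TYPE(complex) k ()" by (rule ring_mat)
  interpret U: group "GL k" unfolding GL_def by (rule R.units_group)
  have A: "A \<in> carrier (GL k)" "A' \<in> carrier (GL k)"
    using assms by (auto simp: GL_def units_of_def Units_def ring_mat_simps)
  then show "A \<in> carrier (GL k)" by simp
  show "inv\<^bsub>GL k\<^esub> A = A'"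
    using assms by (intro U.inv_equality A) (simp add: GL_def units_of_def ring_mat_simps)
qed

lemma gauge_act_point_of:
  assumes AA: "(A, A') \<in> inverse_families w" and A0: "A 0 = 1\<^sub>m 1" "A' 0 = 1\<^sub>m 1"
  shows "restrict A (verts G) \<in> carrier (gauge_group G v)"
    and "gauge_act G v (restrict A (verts G)) (point_of z) = point_of (act A A' z)"
proof -
  have A: "A i \<in> carrier_mat (v i) (v i)" "A' i \<in> carrier_mat (v i) (v i)" "A i * A' i = 1\<^sub>m (v i)" "A' i * A i = 1\<^sub>m (v i)"
    if "i \<in> verts G" for i
    using AA w_verts[OF that] unfolding inverse_families_def by (auto simp del: w_verts) metis+
  note GL = GL_inverse[OF A]
  show "restrict A (verts G) \<in> carrier (gauge_group G v)"
    by (simp add: gauge_group_def GL)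
  have B: "A (head G h) * mat (v (head G h)) (v (tail G h)) (\<lambda>(p, q). z (Arr h, p, q)) * A' (tail G h)
      = mat (v (head G h)) (v (tail G h)) (\<lambda>(p, q). act A A' z (Arr h, p, q))" if h: "h \<in> arcs G" for h
  proof (rule eq_matI)
    note Ah = A[OF head_in_verts[OF h]] and At = A[OF tail_in_verts[OF h]]
    fix p q assume "p < dim_row (mat (v (head G h)) (v (tail G h)) (\<lambda>(p, q). act A A' z (Arr h, p, q)))"
      "q < dim_col (mat (v (head G h)) (v (tail G h)) (\<lambda>(p, q). act A A' z (Arr h, p, q)))"
    then have pq: "p < v (head G h)" "q < v (tail G h)" by simp_all
    have "(A (head G h) * mat (v (head G h)) (v (tail G h)) (\<lambda>(p, q). z (Arr h, p, q)) * A' (tail G h)) $$ (p, q)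
       = (\<Sum>q'<v (tail G h). (\<Sum>p'<v (head G h). A (head G h) $$ (p, p') * z (Arr h, p', q')) * A' (tail G h) $$ (q', q))"
      using pq Ah(1) At(2) by (simp add: scalar_prod_def lessThan_atLeast0)
    also have "\<dots> = act A A' z (Arr h, p, q)"
      using h unfolding act_def by (simp add: sum_distrib_right) (rule sum.swap)
    finally show "(A (head G h) * mat (v (head G h)) (v (tail G h)) (\<lambda>(p, q). z (Arr h, p, q)) * A' (tail G h)) $$ (p, q)
       = mat (v (head G h)) (v (tail G h)) (\<lambda>(p, q). act A A' z (Arr h, p, q)) $$ (p, q)"
      using pq by simp
  qed (use A[OF head_in_verts[OF h]] A[OF tail_in_verts[OF h]] in auto)
  have \<gamma>: "A i * mat (v i) (d i) (\<lambda>(p, r). z (Gam i r, p, 0)) = mat (v i) (d i) (\<lambda>(p, r). act A A' z (Gam i r, p, 0))"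
    if i: "i \<in> verts G" for i
    using A(1)[OF i] i by (intro eq_matI) (auto simp: act_def A0 scalar_prod_def lessThan_atLeast0)
  have \<delta>: "mat (d i) (v i) (\<lambda>(r, q). z (Del i r, 0, q)) * A' i = mat (d i) (v i) (\<lambda>(r, q). act A A' z (Del i r, 0, q))"
    if i: "i \<in> verts G" for i
    using A(2)[OF i] i by (intro eq_matI) (auto simp: act_def A0 scalar_prod_def lessThan_atLeast0)
  show "gauge_act G v (restrict A (verts G)) (point_of z) = point_of (act A A' z)"
    unfolding point_of_def gauge_act.simps
    by (intro arg_cong2[where f = Pair] restrict_ext) (simp_all add: GL B \<gamma> \<delta>)
qed

lemma act_sum: "act A A' (\<lambda>x. \<Sum>k\<in>T. Z k x) y = (\<Sum>k\<in>T. act A A' (Z k) y)"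
proof -
  obtain g p q where y: "y = (g, p, q)" by (cases y)
  show ?thesis unfolding y act_def prod.case sum_distrib_left sum_distrib_right
    by (simp only: sum.swap[of _ T])
qed

lemma act_scale: "act A A' (\<lambda>x. t * z x) y = t * act A A' z y"
  by (cases y) (simp add: act_def sum_distrib_left mult_ac)

lemma act_unit:
  assumes "(g, p, q) \<in> coords" "(g', p', q') \<in> coords"
  shows "act A A' (\<lambda>x. of_bool (x = (g, p, q))) (g', p', q')
    = of_bool (g' = g) * (A (rv g') $$ (p', p) * A' (cv g') $$ (q, q'))"
proof (cases "g' = g")
  case True
  have "act A A' (\<lambda>x. of_bool (x = (g, p, q))) (g', p', q') = (\<Sum>r<w (rv g). if r = p then \<Sum>s<w (cv g).
      if s = q then A (rv g) $$ (p', p) * A' (cv g) $$ (q, q') else 0 else 0)"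
    unfolding act_def prod.case True
  proof (rule sum.cong[OF refl])
    fix r
    have "(\<Sum>s<w (cv g). A (rv g) $$ (p', r) * of_bool ((g, r, s) = (g, p, q)) * A' (cv g) $$ (s, q'))
      = (\<Sum>s<w (cv g). if s = q then if r = p then A (rv g) $$ (p', p) * A' (cv g) $$ (q, q') else 0 else 0)"
      by (rule sum.cong) auto
    then show "(\<Sum>s<w (cv g). A (rv g) $$ (p', r) * of_bool ((g, r, s) = (g, p, q)) * A' (cv g) $$ (s, q'))
      = (if r = p then \<Sum>s<w (cv g). if s = q then A (rv g) $$ (p', p) * A' (cv g) $$ (q, q') else 0 else 0)"
      by simp
  qed
  also have "\<dots> = A (rv g) $$ (p', p) * A' (cv g) $$ (q, q')"
    using assms by (simp add: coords_def)
  finally show ?thesis by (simp add: True)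
qed (simp add: act_def)

lemma sum_over_coordinate_words:
  fixes F :: "(nat \<Rightarrow> 'h coordinate) \<Rightarrow> complex"
  shows "(\<Sum>x\<in>{..<N} \<rightarrow>\<^sub>E coords. F x) = (\<Sum>e\<in>{..<N} \<rightarrow>\<^sub>E gens. \<Sum>p\<in>assignments w (rv \<circ> e) {..<N}.
     \<Sum>q\<in>assignments w (cv \<circ> e) {..<N}. F (\<lambda>k\<in>{..<N}. (e k, p k, q k)))"
proof -
  let ?S = "SIGMA e:{..<N} \<rightarrow>\<^sub>E gens. assignments w (rv \<circ> e) {..<N} \<times> assignments w (cv \<circ> e) {..<N}"
  have fin: "finite ({..<N} \<rightarrow>\<^sub>E gens)" by (intro finite_PiE) auto
  have "(\<Sum>e\<in>{..<N} \<rightarrow>\<^sub>E gens. \<Sum>p\<in>assignments w (rv \<circ> e) {..<N}.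
     \<Sum>q\<in>assignments w (cv \<circ> e) {..<N}. F (\<lambda>k\<in>{..<N}. (e k, p k, q k)))
    = (\<Sum>e\<in>{..<N} \<rightarrow>\<^sub>E gens. \<Sum>(p, q)\<in>assignments w (rv \<circ> e) {..<N} \<times> assignments w (cv \<circ> e) {..<N}.
       F (\<lambda>k\<in>{..<N}. (e k, p k, q k)))"
    by (simp add: sum.cartesian_product)
  also have "\<dots> = (\<Sum>(e, p, q)\<in>?S. F (\<lambda>k\<in>{..<N}. (e k, p k, q k)))"
    using fin by (subst sum.Sigma) (auto simp: case_prod_unfold)
  also have "\<dots> = (\<Sum>x\<in>{..<N} \<rightarrow>\<^sub>E coords. F x)"
  proof (rule sum.reindex_bij_witness[of _
        "\<lambda>x. (\<lambda>k\<in>{..<N}. fst (x k), \<lambda>k\<in>{..<N}. fst (snd (x k)), \<lambda>k\<in>{..<N}. snd (snd (x k)))"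
        "\<lambda>(e, p, q). \<lambda>k\<in>{..<N}. (e k, p k, q k)"])
    fix a assume "a \<in> ?S"
    then obtain e p q where a: "a = (e, p, q)" "e \<in> {..<N} \<rightarrow>\<^sub>E gens"
        "p \<in> assignments w (rv \<circ> e) {..<N}" "q \<in> assignments w (cv \<circ> e) {..<N}" by blast
    have "(e k, p k, q k) \<in> coords" if "k < N" for k
      using PiE_mem[OF a(2), of k] PiE_mem[OF a(3)[unfolded assignments_def], of k]
        PiE_mem[OF a(4)[unfolded assignments_def], of k] that by (simp add: coords_def)
    then show "(case a of (e, p, q) \<Rightarrow> \<lambda>k\<in>{..<N}. (e k, p k, q k)) \<in> {..<N} \<rightarrow>\<^sub>E coords"
      by (simp add: a(1))
    have "(\<lambda>k\<in>{..<N}. fst ((\<lambda>k\<in>{..<N}. (e k, p k, q k)) k)) = restrict e {..<N}"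
      "(\<lambda>k\<in>{..<N}. fst (snd ((\<lambda>k\<in>{..<N}. (e k, p k, q k)) k))) = restrict p {..<N}"
      "(\<lambda>k\<in>{..<N}. snd (snd ((\<lambda>k\<in>{..<N}. (e k, p k, q k)) k))) = restrict q {..<N}"
      by (rule restrict_ext, simp)+
    then show "(\<lambda>k\<in>{..<N}. fst ((case a of (e, p, q) \<Rightarrow> \<lambda>k\<in>{..<N}. (e k, p k, q k)) k),
        \<lambda>k\<in>{..<N}. fst (snd ((case a of (e, p, q) \<Rightarrow> \<lambda>k\<in>{..<N}. (e k, p k, q k)) k)),
        \<lambda>k\<in>{..<N}. snd (snd ((case a of (e, p, q) \<Rightarrow> \<lambda>k\<in>{..<N}. (e k, p k, q k)) k))) = a"
      using PiE_restrict[OF a(2)] PiE_restrict[OF a(3)[unfolded assignments_def]]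
        PiE_restrict[OF a(4)[unfolded assignments_def]] by (simp only: a(1) prod.case)
    show "F (case a of (e, p, q) \<Rightarrow> \<lambda>k\<in>{..<N}. (e k, p k, q k)) = (case a of (e, p, q) \<Rightarrow> F (\<lambda>k\<in>{..<N}. (e k, p k, q k)))"
      by (simp only: a(1) prod.case)
  next
    fix x assume x: "x \<in> {..<N} \<rightarrow>\<^sub>E coords"
    have mem: "fst (x k) \<in> gens" "fst (snd (x k)) < w (rv (fst (x k)))" "snd (snd (x k)) < w (cv (fst (x k)))"
      if "k < N" for k
      using PiE_mem[OF x, of k] that by (auto simp: coords_def)
    show "(\<lambda>k\<in>{..<N}. fst (x k), \<lambda>k\<in>{..<N}. fst (snd (x k)), \<lambda>k\<in>{..<N}. snd (snd (x k))) \<in> ?S"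
      using mem by (simp add: assignments_def PiE_iff)
    have "(case (\<lambda>k\<in>{..<N}. fst (x k), \<lambda>k\<in>{..<N}. fst (snd (x k)), \<lambda>k\<in>{..<N}. snd (snd (x k))) of
        (e, p, q) \<Rightarrow> \<lambda>k\<in>{..<N}. (e k, p k, q k)) = restrict x {..<N}"
      unfolding prod.case by (rule restrict_ext) simp
    then show "(case (\<lambda>k\<in>{..<N}. fst (x k), \<lambda>k\<in>{..<N}. fst (snd (x k)), \<lambda>k\<in>{..<N}. snd (snd (x k))) of
        (e, p, q) \<Rightarrow> \<lambda>k\<in>{..<N}. (e k, p k, q k)) = x"
      using PiE_restrict[OF x] by simp
  qed
  finally show ?thesis by simp
qed

definition homogeneous :: "nat \<Rightarrow> (complex \<times> 'h coordinate list) list \<Rightarrow> bool" where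
  "homogeneous N ws \<longleftrightarrow> (\<forall>(c, u)\<in>set ws. set u \<subseteq> coords \<and> length u = N)"

text \<open>\<open>fact N\<close> times the complete polarization of a polynomial that is homogeneous of degree \<open>N\<close>: the
variables in a word are taken from the \<open>N\<close> different points \<open>Z k\<close>, in all possible orders.\<close>

definition polarization :: "nat \<Rightarrow> (complex \<times> 'h coordinate list) list \<Rightarrow> (nat \<Rightarrow> 'h coordinate \<Rightarrow> complex) \<Rightarrow> complex" where
  "polarization N ws Z = (\<Sum>(c, u)\<leftarrow>ws. c * (\<Sum>\<sigma> | \<sigma> permutes {..<N}. \<Prod>k<N. Z (\<sigma> k) (u ! k)))"

lemma polarization_Cons:
  "polarization N ((c, u) # ws) Z = c * (\<Sum>\<sigma> | \<sigma> permutes {..<N}. \<Prod>k<N. Z (\<sigma> k) (u ! k)) + polarization N ws Z"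
  by (simp add: polarization_def)

lemma polarization_as_finite_difference:
  assumes "homogeneous N ws"
  shows "polarization N ws Z = (\<Sum>T\<in>Pow {..<N}. (- 1) ^ (N - card T) * poly_eval ws (\<lambda>x. \<Sum>k\<in>T. Z k x))"
  using assms
proof (induction ws)
  case (Cons cu ws)
  obtain c u where cu: "cu = (c, u)" by (cases cu)
  have "length u = N" "homogeneous N ws" using Cons.prems by (auto simp: homogeneous_def cu)
  define P where "P = (\<lambda>T. \<Prod>k<N. \<Sum>j\<in>T. Z j (u ! k))"
  have "(\<Sum>\<sigma> | \<sigma> permutes {..<N}. \<Prod>k<N. Z (\<sigma> k) (u ! k)) = (\<Sum>T\<in>Pow {..<N}. (- 1) ^ (N - card T) * P T)"
    using ryser[of "{..<N}" "\<lambda>k j. Z j (u ! k)"] by (simp add: P_def)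
  moreover have "poly_eval (cu # ws) (\<lambda>x. \<Sum>k\<in>T. Z k x) = c * P T + poly_eval ws (\<lambda>x. \<Sum>k\<in>T. Z k x)" for T
    by (simp add: cu poly_eval_Cons P_def \<open>length u = N\<close>)
  ultimately show ?case
    using Cons.IH[OF \<open>homogeneous N ws\<close>]
    by (simp only: cu polarization_Cons distrib_left sum.distrib sum_distrib_left mult.left_commute)
qed (simp add: polarization_def)

lemma polarization_diagonal:
  assumes "homogeneous N ws"
  shows "polarization N ws (\<lambda>_. z) = of_nat (fact N) * poly_eval ws z"
  using assms
proof (induction ws)
  case (Cons cu ws)
  obtain c u where cu: "cu = (c, u)" by (cases cu)
  have "length u = N" "homogeneous N ws" using Cons.prems by (auto simp: homogeneous_def cu)
  then show ?case
    using Cons.IH card_permutations[of "{..<N}" N]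
    by (simp add: cu polarization_Cons poly_eval_Cons algebra_simps)
qed (simp add: polarization_def)

lemma polarization_multilinear:
  assumes "homogeneous N ws"
  shows "polarization N ws Z = (\<Sum>x\<in>{..<N} \<rightarrow>\<^sub>E coords.
     polarization N ws (\<lambda>k y. of_bool (y = x k)) * (\<Prod>k<N. Z k (x k)))"
  using assms
proof (induction ws)
  case (Cons cu ws)
  obtain c u where cu: "cu = (c, u)" by (cases cu)
  have u: "length u = N" "set u \<subseteq> coords" "homogeneous N ws" using Cons.prems by (auto simp: homogeneous_def cu)
  let ?X = "{..<N} \<rightarrow>\<^sub>E coords"
  have fin: "finite ?X" by (intro finite_PiE) auto
  have "(\<Sum>x\<in>?X. (\<Prod>k<N. of_bool (u ! k = x (\<sigma> k))) * (\<Prod>k<N. Z k (x k))) = (\<Prod>k<N. Z (\<sigma> k) (u ! k))"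
    if \<sigma>: "\<sigma> permutes {..<N}" for \<sigma>
  proof -
    define x0 where "x0 = (\<lambda>k\<in>{..<N}. u ! inv_into UNIV \<sigma> k)"
    have inv_lt: "inv_into UNIV \<sigma> k < N" if "k < N" for k
      using permutes_in_image[OF permutes_inv[OF \<sigma>], of k] that by simp
    have lt: "\<sigma> k < N" if "k < N" for k using permutes_in_image[OF \<sigma>, of k] that by simp
    have x0: "x0 \<in> ?X" using u inv_lt nth_mem[of _ u] by (auto simp: x0_def)
    have "(\<forall>k<N. u ! k = x (\<sigma> k)) \<longleftrightarrow> x = x0" if x: "x \<in> ?X" for x
    proof
      assume *: "\<forall>k<N. u ! k = x (\<sigma> k)"
      show "x = x0"
      proof (rule PiE_ext[OF x x0])
        fix k assume "k \<in> {..<N}"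
        then show "x k = x0 k" using *[rule_format, of "inv_into UNIV \<sigma> k"] inv_lt[of k]
          by (simp add: x0_def permutes_inverses[OF \<sigma>])
      qed
    next
      assume "x = x0"
      then show "\<forall>k<N. u ! k = x (\<sigma> k)" using lt by (simp add: x0_def permutes_inverses[OF \<sigma>])
    qed
    then have "(\<Sum>x\<in>?X. (\<Prod>k<N. of_bool (u ! k = x (\<sigma> k))) * (\<Prod>k<N. Z k (x k)))
        = (\<Sum>x\<in>?X. if x = x0 then \<Prod>k<N. Z k (x0 k) else 0)"
      by (intro sum.cong refl) (auto simp: prod_of_bool Ball_def)
    also have "\<dots> = (\<Prod>k<N. Z k (x0 k))" using x0 fin by simp
    also have "\<dots> = (\<Prod>k<N. Z (\<sigma> k) (x0 (\<sigma> k)))"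
      by (rule prod.reindex_bij_betw[OF permutes_imp_bij[OF \<sigma>], symmetric])
    also have "\<dots> = (\<Prod>k<N. Z (\<sigma> k) (u ! k))"
      using lt by (intro prod.cong refl) (simp add: x0_def permutes_inverses[OF \<sigma>])
    finally show ?thesis .
  qed
  then have "(\<Sum>\<sigma> | \<sigma> permutes {..<N}. \<Prod>k<N. Z (\<sigma> k) (u ! k))
     = (\<Sum>\<sigma> | \<sigma> permutes {..<N}. \<Sum>x\<in>?X. (\<Prod>k<N. of_bool (u ! k = x (\<sigma> k))) * (\<Prod>k<N. Z k (x k)))"
    by (intro sum.cong refl) simp
  also have "\<dots> = (\<Sum>x\<in>?X. (\<Sum>\<sigma> | \<sigma> permutes {..<N}. \<Prod>k<N. of_bool (u ! k = x (\<sigma> k))) * (\<Prod>k<N. Z k (x k)))"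
    unfolding sum_distrib_right by (rule sum.swap)
  finally have *: "(\<Sum>\<sigma> | \<sigma> permutes {..<N}. \<Prod>k<N. Z (\<sigma> k) (u ! k))
    = (\<Sum>x\<in>?X. (\<Sum>\<sigma> | \<sigma> permutes {..<N}. \<Prod>k<N. of_bool (u ! k = x (\<sigma> k))) * (\<Prod>k<N. Z k (x k)))" .
  show ?case
    unfolding cu polarization_Cons * Cons.IH[OF u(3)] distrib_right sum.distrib
    by (simp only: sum_distrib_left[of c _ ?X] mult.assoc)
qed (simp add: polarization_def)

text \<open>As a finite difference, the polarization only involves values of the polynomial at sums of the points,
and the action is linear.\<close>

lemma polarization_act:
  assumes hom: "homogeneous N ws" and inv: "\<And>z. poly_eval ws (act A A' z) = \<chi> * poly_eval ws z"
  shows "polarization N ws (\<lambda>k. act A A' (Z k)) = \<chi> * polarization N ws Z"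
  unfolding polarization_as_finite_difference[OF hom] sum_distrib_left
proof (intro sum.cong refl)
  fix T
  have "(\<lambda>x. \<Sum>k\<in>T. act A A' (Z k) x) = act A A' (\<lambda>x. \<Sum>k\<in>T. Z k x)"
    by (rule ext) (rule act_sum[symmetric])
  then show "(- 1) ^ (N - card T) * poly_eval ws (\<lambda>x. \<Sum>k\<in>T. act A A' (Z k) x)
      = \<chi> * ((- 1) ^ (N - card T) * poly_eval ws (\<lambda>x. \<Sum>k\<in>T. Z k x))"
    by (simp add: inv)
qed

definition tensor :: "nat \<Rightarrow> (complex \<times> 'h coordinate list) list \<Rightarrow> (nat \<Rightarrow> 'h generator) \<Rightarrow> (nat \<Rightarrow> nat) \<Rightarrow> (nat \<Rightarrow> nat) \<Rightarrow> complex" where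
  "tensor N ws e p q = polarization N ws (\<lambda>k y. of_bool (y = (e k, p k, q k)))"

lemma polarization_cong:
  assumes "homogeneous N ws" "\<And>k y. k < N \<Longrightarrow> y \<in> coords \<Longrightarrow> Z k y = Z' k y"
  shows "polarization N ws Z = polarization N ws Z'"
  using assms(1)
proof (induction ws)
  case (Cons cu ws)
  obtain c u where cu: "cu = (c, u)" by (cases cu)
  have u: "length u = N" "set u \<subseteq> coords" "homogeneous N ws" using Cons.prems by (auto simp: homogeneous_def cu)
  have "(\<Sum>\<sigma> | \<sigma> permutes {..<N}. \<Prod>k<N. Z (\<sigma> k) (u ! k)) = (\<Sum>\<sigma> | \<sigma> permutes {..<N}. \<Prod>k<N. Z' (\<sigma> k) (u ! k))"
  proof (intro sum.cong prod.cong refl assms(2))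
    fix \<sigma> k assume "\<sigma> \<in> {\<sigma>. \<sigma> permutes {..<N}}" "k \<in> {..<N}"
    then show "\<sigma> k < N" "u ! k \<in> coords" using permutes_in_image[of \<sigma> "{..<N}" k] u nth_mem[of k u] by auto
  qed
  then show ?case using Cons.IH[OF u(3)] by (simp add: cu polarization_Cons)
qed (simp add: polarization_def)

lemma poly_eval_tensor:
  assumes hom: "homogeneous N ws"
  shows "of_nat (fact N) * poly_eval ws z = (\<Sum>e\<in>{..<N} \<rightarrow>\<^sub>E gens. \<Sum>p\<in>assignments w (rv \<circ> e) {..<N}.
     \<Sum>q\<in>assignments w (cv \<circ> e) {..<N}. tensor N ws e p q * (\<Prod>k<N. z (e k, p k, q k)))"
proof -
  have *: "polarization N ws (\<lambda>k y. of_bool (y = (\<lambda>k\<in>{..<N}. (e k, p k, q k)) k)) = tensor N ws e p q" for e p q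
    unfolding tensor_def by (intro polarization_cong[OF hom]) simp
  have **: "(\<Prod>k<N. z ((\<lambda>k\<in>{..<N}. (e k, p k, q k)) k)) = (\<Prod>k<N. z (e k, p k, q k))" for e :: "nat \<Rightarrow> 'h generator" and p q
    by (intro prod.cong refl) simp
  show ?thesis
    unfolding polarization_diagonal[OF hom, symmetric] polarization_multilinear[OF hom, of "\<lambda>_. z"]
      sum_over_coordinate_words * ** ..
qed

lemma tensor_transform:
  assumes hom: "homogeneous N ws" and inv: "\<And>z. poly_eval ws (act A A' z) = \<chi> * poly_eval ws z"
    and e: "e \<in> {..<N} \<rightarrow>\<^sub>E gens" and p: "p \<in> assignments w (rv \<circ> e) {..<N}" and q: "q \<in> assignments w (cv \<circ> e) {..<N}"
  shows "(\<Sum>p'\<in>assignments w (rv \<circ> e) {..<N}. \<Sum>q'\<in>assignments w (cv \<circ> e) {..<N}.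
      tensor N ws e p' q' * tensor_power (rv \<circ> e) {..<N} A p' p * tensor_power (cv \<circ> e) {..<N} A' q q')
    = \<chi> * tensor N ws e p q"
proof -
  have mem: "(e k, p k, q k) \<in> coords" if "k < N" for k
    using e p q that by (auto simp: coords_def assignments_def PiE_iff)
  have *: "polarization N ws (\<lambda>k y. of_bool (y = (\<lambda>k\<in>{..<N}. (e k, p k, q k)) k)) = tensor N ws e p q" for e p q
    unfolding tensor_def by (intro polarization_cong[OF hom]) simp
  have fin: "finite ({..<N} \<rightarrow>\<^sub>E gens)" by (intro finite_PiE) auto
  let ?Z = "\<lambda>k. act A A' (\<lambda>x. of_bool (x = (e k, p k, q k)))"
  have prodZ: "(\<Prod>k<N. ?Z k (e' k, p' k, q' k)) = (if e' = e then
      tensor_power (rv \<circ> e) {..<N} A p' p * tensor_power (cv \<circ> e) {..<N} A' q q' else 0)"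
    if e': "e' \<in> {..<N} \<rightarrow>\<^sub>E gens" and p': "p' \<in> assignments w (rv \<circ> e') {..<N}" and q': "q' \<in> assignments w (cv \<circ> e') {..<N}"
    for e' p' q'
  proof -
    have mem': "(e' k, p' k, q' k) \<in> coords" if "k < N" for k
      using e' p' q' that by (auto simp: coords_def assignments_def PiE_iff)
    have "(\<Prod>k<N. ?Z k (e' k, p' k, q' k))
        = (\<Prod>k<N. of_bool (e' k = e k) * (A (rv (e' k)) $$ (p' k, p k) * A' (cv (e' k)) $$ (q k, q' k)))"
      using mem mem' by (intro prod.cong refl act_unit) auto
    also have "\<dots> = of_bool (\<forall>k<N. e' k = e k) * (tensor_power (rv \<circ> e') {..<N} A p' p * tensor_power (cv \<circ> e') {..<N} A' q q')"
      by (simp add: prod.distrib tensor_power_def prod_of_bool Ball_def)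
    also have "(\<forall>k<N. e' k = e k) \<longleftrightarrow> e' = e" using e e' by (auto intro: PiE_ext)
    finally show ?thesis by (cases "e' = e") (simp_all only: of_bool_eq simp_thms if_True if_False mult_1_left mult_zero_left)
  qed
  have "\<chi> * tensor N ws e p q = polarization N ws ?Z"
    unfolding tensor_def by (rule polarization_act[OF hom inv, symmetric])
  also have "\<dots> = (\<Sum>e'\<in>{..<N} \<rightarrow>\<^sub>E gens. \<Sum>p'\<in>assignments w (rv \<circ> e') {..<N}.
     \<Sum>q'\<in>assignments w (cv \<circ> e') {..<N}. tensor N ws e' p' q' * (\<Prod>k<N. ?Z k ((\<lambda>k\<in>{..<N}. (e' k, p' k, q' k)) k)))"
    unfolding polarization_multilinear[OF hom, of ?Z] sum_over_coordinate_words * ..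
  also have "\<dots> = (\<Sum>e'\<in>{..<N} \<rightarrow>\<^sub>E gens. \<Sum>p'\<in>assignments w (rv \<circ> e') {..<N}.
     \<Sum>q'\<in>assignments w (cv \<circ> e') {..<N}. tensor N ws e' p' q' * (\<Prod>k<N. ?Z k (e' k, p' k, q' k)))"
    by (intro sum.cong refl arg_cong2[where f = "(*)"] prod.cong) simp
  also have "\<dots> = (\<Sum>e'\<in>{..<N} \<rightarrow>\<^sub>E gens. if e' = e then \<Sum>p'\<in>assignments w (rv \<circ> e) {..<N}.
     \<Sum>q'\<in>assignments w (cv \<circ> e) {..<N}. tensor N ws e p' q' *
       (tensor_power (rv \<circ> e) {..<N} A p' p * tensor_power (cv \<circ> e) {..<N} A' q q') else 0)"
    by (rule sum.cong[OF refl]) (simp add: prodZ)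
  also have "\<dots> = (\<Sum>p'\<in>assignments w (rv \<circ> e) {..<N}. \<Sum>q'\<in>assignments w (cv \<circ> e) {..<N}.
      tensor N ws e p' q' * tensor_power (rv \<circ> e) {..<N} A p' p * tensor_power (cv \<circ> e) {..<N} A' q q')"
    using e fin by (simp add: mult.assoc)
  finally show ?thesis by simp
qed

definition homogeneous_part :: "nat \<Rightarrow> (complex \<times> 'h coordinate list) list \<Rightarrow> (complex \<times> 'h coordinate list) list" where
  "homogeneous_part N ws = filter (\<lambda>(c, u). length u = N) ws"

lemma poly_eval_scale:
  assumes "\<forall>(c, u)\<in>set ws. length u \<le> M"
  shows "poly_eval ws (\<lambda>x. t * z x) = (\<Sum>N\<le>M. poly_eval (homogeneous_part N ws) z * t ^ N)"
  using assms
proof (induction ws)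
  case (Cons cu ws)
  obtain c u where cu: "cu = (c, u)" by (cases cu)
  have "(\<Sum>N\<le>M. poly_eval (homogeneous_part N (cu # ws)) z * t ^ N)
     = (\<Sum>N\<le>M. (if N = length u then c * (\<Prod>k<length u. z (u ! k)) * t ^ N else 0)
         + poly_eval (homogeneous_part N ws) z * t ^ N)"
    by (intro sum.cong refl) (auto simp: cu homogeneous_part_def poly_eval_Cons algebra_simps)
  also have "\<dots> = poly_eval ((c, u) # ws) (\<lambda>x. t * z x)"
    using Cons by (simp add: cu sum.distrib poly_eval_Cons prod.distrib)
  finally show ?case by (simp add: cu)
qed (simp add: homogeneous_part_def)

text \<open>A semi-invariant is a combination of monomials in the coordinates whose coefficients, for fixed degree
and fixed generators \<open>e\<close>, form a tensor with the same transformation law.  The homogeneous parts are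
semi-invariant because the action commutes with scalars; each of them is recovered from its
polarization on the diagonal, and the coefficients of the polarization are its values on unit vectors.\<close>

theorem semi_invariant_tensor_expansion:
  assumes f: "f \<in> carrier (semi_invariant_module G d v m)"
  shows "\<exists>(M :: nat) C.
    (\<forall>s\<in>rep_space G d v. f s = (\<Sum>N\<le>M. \<Sum>e\<in>{..<N} \<rightarrow>\<^sub>E gens. \<Sum>p\<in>assignments w (rv \<circ> e) {..<N}.
       \<Sum>q\<in>assignments w (cv \<circ> e) {..<N}. C N e p q * (\<Prod>k<N. coord s (e k, p k, q k)))) \<and>
    (\<forall>N :: nat. \<forall>e\<in>{..<N} \<rightarrow>\<^sub>E gens. \<forall>(A, A')\<in>inverse_families w. A 0 = 1\<^sub>m 1 \<longrightarrow> A' 0 = 1\<^sub>m 1 \<longrightarrow>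
       (\<forall>p\<in>assignments w (rv \<circ> e) {..<N}. \<forall>q\<in>assignments w (cv \<circ> e) {..<N}.
       (\<Sum>p'\<in>assignments w (rv \<circ> e) {..<N}. \<Sum>q'\<in>assignments w (cv \<circ> e) {..<N}.
          C N e p' q' * tensor_power (rv \<circ> e) {..<N} A p' p * tensor_power (cv \<circ> e) {..<N} A' q q')
       = (\<Prod>i\<in>verts G. det (A i) powi m i) * C N e p q))"
proof -
  from f have reg: "f \<in> regular_functions G d v"
    and semi: "\<And>g s. g \<in> carrier (gauge_group G v) \<Longrightarrow> s \<in> rep_space G d v \<Longrightarrow> f (gauge_act G v g s) = det_character G m g * f s"
    by (auto simp: semi_invariant_module_carrier)
  from regular_is_polynomial[OF reg] obtain ws where ws: "\<forall>(c, u)\<in>set ws. set u \<subseteq> coords"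
    and fws: "\<And>s. s \<in> rep_space G d v \<Longrightarrow> f s = poly_eval ws (coord s)" by blast
  have poly_coord: "poly_eval ws' (coord (point_of z)) = poly_eval ws' z" if "\<forall>(c, u)\<in>set ws'. set u \<subseteq> coords" for ws' z
    using that
  proof (induction ws')
    case (Cons cu ws')
    obtain c u where cu: "cu = (c, u)" by (cases cu)
    have "(\<Prod>k<length u. coord (point_of z) (u ! k)) = (\<Prod>k<length u. z (u ! k))"
      using Cons.prems nth_mem[of _ u] by (intro prod.cong refl coord_point_of) (auto simp: cu)
    then show ?case using Cons by (simp add: cu poly_eval_Cons)
  qed simp
  define M where "M = Max (insert 0 (length ` snd ` set ws))"
  have M: "\<forall>(c, u)\<in>set ws. length u \<le> M" unfolding M_def by (force intro: Max_ge)
  let ?wsN = "\<lambda>N. homogeneous_part N ws"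
  have hom: "homogeneous N (?wsN N)" for N using ws by (auto simp: homogeneous_def homogeneous_part_def)
  define \<chi> where "\<chi> = (\<lambda>A :: nat \<Rightarrow> complex mat. \<Prod>i\<in>verts G. det (A i) powi m i)"
  have inv: "poly_eval ws (act A A' z) = \<chi> A * poly_eval ws z"
    if "(A, A') \<in> inverse_families w" "A 0 = 1\<^sub>m 1" "A' 0 = 1\<^sub>m 1" for A A' z
  proof -
    note g = gauge_act_point_of[OF that]
    have "poly_eval ws (act A A' z) = f (point_of (act A A' z))"
      by (simp add: fws[OF point_of_rep_space] poly_coord[OF ws])
    also have "\<dots> = det_character G m (restrict A (verts G)) * f (point_of z)"
      unfolding g(2)[symmetric] by (rule semi[OF g(1) point_of_rep_space])
    also have "det_character G m (restrict A (verts G)) = \<chi> A"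
      unfolding det_character_def \<chi>_def by (intro prod.cong refl) simp
    finally show ?thesis by (simp add: fws[OF point_of_rep_space] poly_coord[OF ws])
  qed
  \<comment> \<open>Comparison of the coefficients of \<open>t\<close> in the law at the points \<open>t * z\<close>.\<close>
  have inv_hom: "poly_eval (?wsN N) (act A A' z) = \<chi> A * poly_eval (?wsN N) z"
    if AA: "(A, A') \<in> inverse_families w" "A 0 = 1\<^sub>m 1" "A' 0 = 1\<^sub>m 1" for A A' z N
  proof (cases "N \<le> M")
    case True
    have "(\<Sum>N\<le>M. poly_eval (?wsN N) (act A A' z) * t ^ N) = (\<Sum>N\<le>M. (\<chi> A * poly_eval (?wsN N) z) * t ^ N)" for t
    proof -
      have "(\<Sum>N\<le>M. poly_eval (?wsN N) (act A A' z) * t ^ N) = poly_eval ws (\<lambda>x. t * act A A' z x)"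
        by (rule poly_eval_scale[OF M, symmetric])
      also have "(\<lambda>x. t * act A A' z x) = act A A' (\<lambda>x. t * z x)" by (rule ext) (simp add: act_scale)
      also have "poly_eval ws \<dots> = \<chi> A * poly_eval ws (\<lambda>x. t * z x)" by (rule inv[OF AA])
      finally show ?thesis by (simp add: poly_eval_scale[OF M] sum_distrib_left mult.assoc)
    qed
    then show ?thesis using True polyfun_eq_coeffs[where n = M and c = "\<lambda>N. poly_eval (?wsN N) (act A A' z)" and d = "\<lambda>N. \<chi> A * poly_eval (?wsN N) z"] by blast
  next
    case False
    then have "?wsN N = []" using M by (force simp: homogeneous_part_def filter_empty_conv)
    then show ?thesis by simp
  qed
  show ?thesis
  proof (intro exI[of _ M] exI[of _ "\<lambda>N e p q. tensor N (?wsN N) e p q / of_nat (fact N)"] conjI ballI allI)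
    fix s assume s: "s \<in> rep_space G d v"
    have "f s = poly_eval ws (\<lambda>x. 1 * coord s x)" by (simp add: fws[OF s])
    also have "\<dots> = (\<Sum>N\<le>M. poly_eval (?wsN N) (coord s))" by (subst poly_eval_scale[OF M]) simp
    also have "\<dots> = (\<Sum>N\<le>M. \<Sum>e\<in>{..<N} \<rightarrow>\<^sub>E gens. \<Sum>p\<in>assignments w (rv \<circ> e) {..<N}.
       \<Sum>q\<in>assignments w (cv \<circ> e) {..<N}. tensor N (?wsN N) e p q / of_nat (fact N) * (\<Prod>k<N. coord s (e k, p k, q k)))"
    proof (rule sum.cong[OF refl])
      fix N
      have "poly_eval (?wsN N) (coord s) = (of_nat (fact N) * poly_eval (?wsN N) (coord s)) / of_nat (fact N)"
        by simp
      then show "poly_eval (?wsN N) (coord s) = (\<Sum>e\<in>{..<N} \<rightarrow>\<^sub>E gens. \<Sum>p\<in>assignments w (rv \<circ> e) {..<N}.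
       \<Sum>q\<in>assignments w (cv \<circ> e) {..<N}. tensor N (?wsN N) e p q / of_nat (fact N) * (\<Prod>k<N. coord s (e k, p k, q k)))"
        unfolding poly_eval_tensor[OF hom] sum_divide_distrib by simp
    qed
    finally show "f s = (\<Sum>N\<le>M. \<Sum>e\<in>{..<N} \<rightarrow>\<^sub>E gens. \<Sum>p\<in>assignments w (rv \<circ> e) {..<N}.
       \<Sum>q\<in>assignments w (cv \<circ> e) {..<N}. tensor N (?wsN N) e p q / of_nat (fact N) * (\<Prod>k<N. coord s (e k, p k, q k)))" .
  next
    fix N :: nat and e AA'
    assume e: "e \<in> {..<N} \<rightarrow>\<^sub>E gens" and AA': "AA' \<in> inverse_families w"
    obtain A A' where AA'_eq: "AA' = (A, A')" by (cases AA')
    show "case AA' of (A, A') \<Rightarrow> A 0 = 1\<^sub>m 1 \<longrightarrow> A' 0 = 1\<^sub>m 1 \<longrightarrow>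
       (\<forall>p\<in>assignments w (rv \<circ> e) {..<N}. \<forall>q\<in>assignments w (cv \<circ> e) {..<N}.
       (\<Sum>p'\<in>assignments w (rv \<circ> e) {..<N}. \<Sum>q'\<in>assignments w (cv \<circ> e) {..<N}.
          tensor N (?wsN N) e p' q' / of_nat (fact N) * tensor_power (rv \<circ> e) {..<N} A p' p * tensor_power (cv \<circ> e) {..<N} A' q q')
       = (\<Prod>i\<in>verts G. det (A i) powi m i) * (tensor N (?wsN N) e p q / of_nat (fact N)))"
      unfolding AA'_eq prod.case
    proof (intro impI ballI)
    fix p q assume A0: "A 0 = 1\<^sub>m 1" "A' 0 = 1\<^sub>m 1"
      and p: "p \<in> assignments w (rv \<circ> e) {..<N}" and q: "q \<in> assignments w (cv \<circ> e) {..<N}"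
    note AA = AA'[unfolded AA'_eq] A0
    have "(\<Sum>p'\<in>assignments w (rv \<circ> e) {..<N}. \<Sum>q'\<in>assignments w (cv \<circ> e) {..<N}.
          tensor N (?wsN N) e p' q' * tensor_power (rv \<circ> e) {..<N} A p' p * tensor_power (cv \<circ> e) {..<N} A' q q') / of_nat (fact N)
       = \<chi> A * tensor N (?wsN N) e p q / of_nat (fact N)"
      by (simp only: tensor_transform[OF hom inv_hom[OF AA] e p q])
    then show "(\<Sum>p'\<in>assignments w (rv \<circ> e) {..<N}. \<Sum>q'\<in>assignments w (cv \<circ> e) {..<N}.
          tensor N (?wsN N) e p' q' / of_nat (fact N) * tensor_power (rv \<circ> e) {..<N} A p' p * tensor_power (cv \<circ> e) {..<N} A' q q')
       = (\<Prod>i\<in>verts G. det (A i) powi m i) * (tensor N (?wsN N) e p q / of_nat (fact N))"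
      by (simp add: sum_divide_distrib \<chi>_def)
    qed
  qed
qed

end

section \<open>Paths with framed ends and contraction of wires\<close>

lemma GL_inv_cancel:
  assumes "g \<in> carrier (GL k)"
  shows "g * inv\<^bsub>GL k\<^esub> g = 1\<^sub>m k" "inv\<^bsub>GL k\<^esub> g * g = 1\<^sub>m k"
proof -
  interpret R: ring "ring_mat TYPE(complex) k ()" by (rule ring_mat)
  interpret U: group "GL k" unfolding GL_def by (rule R.units_group)
  show "g * inv\<^bsub>GL k\<^esub> g = 1\<^sub>m k" "inv\<^bsub>GL k\<^esub> g * g = 1\<^sub>m k"
    using U.r_inv[OF assms] U.l_inv[OF assms] by (simp_all add: GL_def units_of_def ring_mat_simps)
qed

lemma mult_mat_cancel_middle:
  fixes A B :: "'a :: semiring_1 mat"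
  assumes "A \<in> carrier_mat m k" "P \<in> carrier_mat k k" "Q \<in> carrier_mat k k" "P * Q = 1\<^sub>m k" "B \<in> carrier_mat k l"
  shows "(A * P) * (Q * B) = A * B"
proof -
  have "(A * P) * (Q * B) = A * (P * (Q * B))"
    using assms by (intro assoc_mult_mat[of _ m k _ k _ l]) auto
  also have "P * (Q * B) = (P * Q) * B"
    using assms by (intro assoc_mult_mat[symmetric, of _ k k _ k _ l]) auto
  finally show ?thesis using assms by simp
qed

text \<open>A path in the framed quiver starts and ends at a vertex or at a basis vector of a framing space.\<close>

datatype endpoint = Vtx nat | Frm nat nat

context framed_quiver
begin

text \<open>Formulas in \<open>s\<close> are kept free of the restriction to the space of matrices.\<close>

definition regular :: "('h point \<Rightarrow> complex) \<Rightarrow> bool" where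
  "regular f \<longleftrightarrow> restrict f (rep_space G d v) \<in> regular_functions G d v"

lemma regular_cong: "(\<And>s. s \<in> rep_space G d v \<Longrightarrow> f s = f' s) \<Longrightarrow> regular f \<longleftrightarrow> regular f'"
  unfolding regular_def by (auto cong: restrict_cong)

lemma regular_const [simp]: "regular (\<lambda>s. c)"
  unfolding regular_def by (rule regular_functions.const)

lemma regular_add: "regular f \<Longrightarrow> regular f' \<Longrightarrow> regular (\<lambda>s. f s + f' s)"
  using regular_functions.add[of "restrict f (rep_space G d v)" G d v "restrict f' (rep_space G d v)"]
  unfolding regular_def by (simp cong: restrict_cong)

lemma regular_mult: "regular f \<Longrightarrow> regular f' \<Longrightarrow> regular (\<lambda>s. f s * f' s)"
  using regular_functions.mult[of "restrict f (rep_space G d v)" G d v "restrict f' (rep_space G d v)"]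
  unfolding regular_def by (simp cong: restrict_cong)

lemma regular_sum: "(\<And>i. i \<in> I \<Longrightarrow> regular (f i)) \<Longrightarrow> regular (\<lambda>s. \<Sum>i\<in>I. f i s)"
  by (induction I rule: infinite_finite_induct) (auto intro: regular_add)

lemma regular_prod: "(\<And>i. i \<in> I \<Longrightarrow> regular (f i)) \<Longrightarrow> regular (\<lambda>s. \<Prod>i\<in>I. f i s)"
  by (induction I rule: infinite_finite_induct) (auto intro: regular_mult)

lemma regular_coord:
  assumes "x \<in> coords"
  shows "regular (\<lambda>s. coord s x)"
proof -
  obtain g p q where x: "x = (g, p, q)" by (cases x)
  show ?thesis
  proof (cases g)
    case (Arr h)
    have "(\<lambda>s\<in>rep_space G d v. coord s x) = (\<lambda>(B, \<gamma>, \<delta>)\<in>rep_space G d v. B h $$ (p, q))"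
      by (rule restrict_ext) (auto simp: x Arr)
    then show ?thesis
      using assms unfolding regular_def by (simp only:) (rule regular_functions.coord_B; simp add: x Arr mem_coords)
  next
    case (Gam i r)
    have "(\<lambda>s\<in>rep_space G d v. coord s x) = (\<lambda>(B, \<gamma>, \<delta>)\<in>rep_space G d v. \<gamma> i $$ (p, r))"
      by (rule restrict_ext) (auto simp: x Gam)
    then show ?thesis
      using assms unfolding regular_def by (simp only:) (rule regular_functions.coord_gamma; simp add: x Gam mem_coords)
  next
    case (Del i r)
    have "(\<lambda>s\<in>rep_space G d v. coord s x) = (\<lambda>(B, \<gamma>, \<delta>)\<in>rep_space G d v. \<delta> i $$ (r, q))"
      by (rule restrict_ext) (auto simp: x Del)
    then show ?thesis
      using assms unfolding regular_def by (simp only:) (rule regular_functions.coord_delta; simp add: x Del mem_coords)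
  qed
qed

lemma regular_det:
  assumes "\<And>i j. i < k \<Longrightarrow> j < k \<Longrightarrow> regular (\<lambda>s. M s i j)"
  shows "regular (\<lambda>s. det (mat k k (\<lambda>(i, j). M s i j)))"
  unfolding det_as_sum prod.case
proof (intro regular_sum regular_mult regular_const regular_prod)
  fix p i assume "p \<in> {p. p permutes {..<k}}" "i \<in> {..<k}"
  then show "regular (\<lambda>s. M s i (p i))"
    using assms permutes_in_image[of p "{..<k}" i] by auto
qed

definition invariant :: "('h point \<Rightarrow> complex) \<Rightarrow> bool" where
  "invariant f \<longleftrightarrow> regular f \<and> (\<forall>g\<in>carrier (gauge_group G v). \<forall>s\<in>rep_space G d v. f (gauge_act G v g s) = f s)"

lemma invariant_const [simp]: "invariant (\<lambda>s. c)"
  by (simp add: invariant_def)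

lemma invariant_mult: "invariant f \<Longrightarrow> invariant f' \<Longrightarrow> invariant (\<lambda>s. f s * f' s)"
  by (simp add: invariant_def regular_mult)

lemma invariant_prod: "(\<And>i. i \<in> I \<Longrightarrow> invariant (f i)) \<Longrightarrow> invariant (\<lambda>s. \<Prod>i\<in>I. f i s)"
  by (induction I rule: infinite_finite_induct) (auto intro: invariant_mult)

lemma invariant_in_ring: "invariant f \<Longrightarrow> restrict f (rep_space G d v) \<in> carrier (invariant_ring G d v)"
  by (auto simp: invariant_def regular_def invariant_ring_carrier gauge_act_closed[OF wf_digraph])

fun path :: "nat \<Rightarrow> 'h list \<Rightarrow> nat \<Rightarrow> bool" where
  "path i [] j \<longleftrightarrow> i \<in> verts G \<and> i = j"
| "path i (h # hs) j \<longleftrightarrow> h \<in> arcs G \<and> tail G h = i \<and> path (head G h) hs j"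

lemma path_verts: "path i hs j \<Longrightarrow> i \<in> verts G \<and> j \<in> verts G"
  by (induction hs arbitrary: i) auto

lemma path_append: "path i hs k \<Longrightarrow> path k hs' j \<Longrightarrow> path i (hs @ hs') j"
  by (induction hs arbitrary: i) auto

definition W :: "'h point \<Rightarrow> nat \<Rightarrow> 'h list \<Rightarrow> complex mat" where
  "W s i hs = walk_eval G v s i (map Inl hs)"

lemma W_Nil [simp]: "W s i [] = 1\<^sub>m (v i)"
  and W_Cons: "W s i (h # hs) = W s (head G h) hs * fst s h"
  by (cases s; simp add: W_def)+

lemma rep_space_carrier:
  assumes "s \<in> rep_space G d v"
  shows "h \<in> arcs G \<Longrightarrow> fst s h \<in> carrier_mat (v (head G h)) (v (tail G h))"
    and "i \<in> verts G \<Longrightarrow> fst (snd s) i \<in> carrier_mat (v i) (d i)"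
    and "i \<in> verts G \<Longrightarrow> snd (snd s) i \<in> carrier_mat (d i) (v i)"
  using assms by (auto simp: rep_space_def)

lemma W_carrier: "s \<in> rep_space G d v \<Longrightarrow> path i hs j \<Longrightarrow> W s i hs \<in> carrier_mat (v j) (v i)"
proof (induction hs arbitrary: i)
  case (Cons h hs)
  then show ?case
    using rep_space_carrier(1)[OF Cons.prems(1), of h] by (auto simp: W_Cons intro!: mult_carrier_mat)
qed auto

lemma W_append:
  assumes s: "s \<in> rep_space G d v"
  shows "path i hs k \<Longrightarrow> path k hs' j \<Longrightarrow> W s i (hs @ hs') = W s k hs' * W s i hs"
proof (induction hs arbitrary: i)
  case Nil
  then show ?case using W_carrier[OF s, of k hs' j] by simp
next
  case (Cons h hs)
  then have p: "path (head G h) hs k" "h \<in> arcs G" "tail G h = i" by auto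
  have "W s i ((h # hs) @ hs') = W s k hs' * W s (head G h) hs * fst s h"
    using Cons.IH[OF p(1) Cons.prems(2)] by (simp add: W_Cons)
  also have "\<dots> = W s k hs' * (W s (head G h) hs * fst s h)"
    by (rule assoc_mult_mat[OF W_carrier[OF s Cons.prems(2)] W_carrier[OF s p(1)] rep_space_carrier(1)[OF s p(2)]])
  finally show ?case by (simp add: W_Cons)
qed

lemma gauge_component: "g \<in> carrier (gauge_group G v) \<Longrightarrow> i \<in> verts G \<Longrightarrow> g i \<in> carrier (GL (v i))"
  by (auto simp: gauge_group_def)

lemma gauge_act_components:
  "h \<in> arcs G \<Longrightarrow> fst (gauge_act G v g s) h = g (head G h) * fst s h * inv\<^bsub>GL (v (tail G h))\<^esub> (g (tail G h))"
  "i \<in> verts G \<Longrightarrow> fst (snd (gauge_act G v g s)) i = g i * fst (snd s) i"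
  "i \<in> verts G \<Longrightarrow> snd (snd (gauge_act G v g s)) i = snd (snd s) i * inv\<^bsub>GL (v i)\<^esub> (g i)"
  by (cases s; simp)+

lemma W_gauge:
  assumes s: "s \<in> rep_space G d v" and g: "g \<in> carrier (gauge_group G v)"
  shows "path i hs j \<Longrightarrow> W (gauge_act G v g s) i hs = g j * W s i hs * inv\<^bsub>GL (v i)\<^esub> (g i)"
proof (induction hs arbitrary: i)
  case Nil
  then have gi: "g i \<in> carrier (GL (v i))" "i = j" using gauge_component[OF g] by auto
  then show ?case using GL_inv_closed[OF gi(1)] GL_inv_cancel[OF gi(1)] by simp
next
  case (Cons h hs)
  then have p: "path (head G h) hs j" "h \<in> arcs G" "tail G h = i" by auto
  let ?a = "g (head G h)" and ?ai = "inv\<^bsub>GL (v (head G h))\<^esub> (g (head G h))" and ?ti = "inv\<^bsub>GL (v i)\<^esub> (g i)"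
  have gh: "?a \<in> carrier (GL (v (head G h)))" using gauge_component[OF g] p by simp
  have gi: "g i \<in> carrier (GL (v i))" "g j \<in> carrier (GL (v j))" using gauge_component[OF g] p path_verts[OF p(1)] by auto
  note carr [simp] = GL_inv_closed[OF gh] GL_inv_closed[OF gi(1)] GL_inv_closed[OF gi(2)]
  have Wc [simp]: "W s (head G h) hs \<in> carrier_mat (v j) (v (head G h))" by (rule W_carrier[OF s p(1)])
  have Bc [simp]: "fst s h \<in> carrier_mat (v (head G h)) (v i)" using rep_space_carrier(1)[OF s p(2)] p(3) by simp
  have "W (gauge_act G v g s) i (h # hs) = (g j * W s (head G h) hs * ?ai) * (?a * fst s h * ?ti)"
    using p by (simp add: W_Cons Cons.IH[OF p(1)] gauge_act_components)
  also have "?a * fst s h * ?ti = ?a * (fst s h * ?ti)"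
    by (rule assoc_mult_mat[OF carr(1) Bc carr(4)])
  also have "(g j * W s (head G h) hs * ?ai) * (?a * (fst s h * ?ti)) = (g j * W s (head G h) hs) * (fst s h * ?ti)"
    by (rule mult_mat_cancel_middle[OF mult_carrier_mat[OF carr(5) Wc] carr(2,1) GL_inv_cancel(2)[OF gh] mult_carrier_mat[OF Bc carr(4)]])
  also have "\<dots> = g j * W s (head G h) hs * fst s h * ?ti"
    by (rule assoc_mult_mat[symmetric, OF mult_carrier_mat[OF carr(5) Wc] Bc carr(4)])
  also have "g j * W s (head G h) hs * fst s h = g j * (W s (head G h) hs * fst s h)"
    by (rule assoc_mult_mat[OF carr(5) Wc Bc])
  finally show ?case by (simp add: W_Cons)
qed

lemma sum_mult_mat:
  assumes "A \<in> carrier_mat m k" "B \<in> carrier_mat k l" "p < m" "q < l"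
  shows "(A * B) $$ (p, q) = (\<Sum>t<k. A $$ (p, t) * B $$ (t, q))"
  using assms by (simp add: scalar_prod_def lessThan_atLeast0)

lemma regular_mult_mat:
  assumes "\<And>s. s \<in> rep_space G d v \<Longrightarrow> A s \<in> carrier_mat m k" "\<And>s. s \<in> rep_space G d v \<Longrightarrow> B s \<in> carrier_mat k l" "p < m" "q < l"
    and "\<And>t. t < k \<Longrightarrow> regular (\<lambda>s. A s $$ (p, t))" "\<And>t. t < k \<Longrightarrow> regular (\<lambda>s. B s $$ (t, q))"
  shows "regular (\<lambda>s. (A s * B s) $$ (p, q))"
proof -
  have "regular (\<lambda>s. \<Sum>t<k. A s $$ (p, t) * B s $$ (t, q))"
    using assms(5,6) by (intro regular_sum regular_mult) auto
  then show ?thesis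
    using regular_cong[of "\<lambda>s. (A s * B s) $$ (p, q)"] sum_mult_mat[OF assms(1,2) assms(3,4)] by simp
qed

lemma regular_components:
  "h \<in> arcs G \<Longrightarrow> p < v (head G h) \<Longrightarrow> q < v (tail G h) \<Longrightarrow> regular (\<lambda>s. fst s h $$ (p, q))"
  "i \<in> verts G \<Longrightarrow> p < v i \<Longrightarrow> r < d i \<Longrightarrow> regular (\<lambda>s. fst (snd s) i $$ (p, r))"
  "i \<in> verts G \<Longrightarrow> r < d i \<Longrightarrow> q < v i \<Longrightarrow> regular (\<lambda>s. snd (snd s) i $$ (r, q))"
proof -
  have eq: "coord s (Arr h, p, q) = fst s h $$ (p, q)" "coord s (Gam i r, p, 0) = fst (snd s) i $$ (p, r)"
    "coord s (Del i r, 0, q) = snd (snd s) i $$ (r, q)" for s :: "'h point"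
    by (cases s; simp)+
  show "h \<in> arcs G \<Longrightarrow> p < v (head G h) \<Longrightarrow> q < v (tail G h) \<Longrightarrow> regular (\<lambda>s. fst s h $$ (p, q))"
    "i \<in> verts G \<Longrightarrow> p < v i \<Longrightarrow> r < d i \<Longrightarrow> regular (\<lambda>s. fst (snd s) i $$ (p, r))"
    "i \<in> verts G \<Longrightarrow> r < d i \<Longrightarrow> q < v i \<Longrightarrow> regular (\<lambda>s. snd (snd s) i $$ (r, q))"
    unfolding eq[symmetric] by (rule regular_coord, simp add: mem_coords)+
qed

lemma regular_W:
  "path i hs j \<Longrightarrow> p < v j \<Longrightarrow> q < v i \<Longrightarrow> regular (\<lambda>s. W s i hs $$ (p, q))"
proof (induction hs arbitrary: i q)
  case (Cons h hs)
  then have p: "path (head G h) hs j" "h \<in> arcs G" "tail G h = i" by auto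
  show ?case unfolding W_Cons
  proof (rule regular_mult_mat[where m = "v j" and k = "v (head G h)" and l = "v i"])
    fix s assume s: "s \<in> rep_space G d v"
    show "W s (head G h) hs \<in> carrier_mat (v j) (v (head G h))" by (rule W_carrier[OF s p(1)])
    show "fst s h \<in> carrier_mat (v (head G h)) (v i)" using rep_space_carrier(1)[OF s p(2)] p(3) by simp
  next
    fix t assume t: "t < v (head G h)"
    show "regular (\<lambda>s. W s (head G h) hs $$ (p, t))" using Cons.IH[OF p(1)] Cons.prems t by simp
    show "regular (\<lambda>s. fst s h $$ (t, q))" using Cons.prems t p by (intro regular_components(1)) auto
  qed (use Cons.prems in auto)
qed auto

text \<open>A framed end carries no free index; its dimension is 1 and its only index value is 0.\<close>

fun evert :: "endpoint \<Rightarrow> nat" where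
  "evert (Vtx i) = i" | "evert (Frm i r) = i"

fun edim :: "endpoint \<Rightarrow> nat" where
  "edim (Vtx i) = v i" | "edim (Frm i r) = 1"

fun evalid :: "endpoint \<Rightarrow> bool" where
  "evalid (Vtx i) \<longleftrightarrow> True" | "evalid (Frm i r) \<longleftrightarrow> r < d i"

text \<open>The underlying path in the quiver; the framing maps at the ends are implied by the endpoints.\<close>

definition epath :: "endpoint \<Rightarrow> 'h list \<Rightarrow> endpoint \<Rightarrow> bool" where
  "epath x hs y \<longleftrightarrow> evalid x \<and> evalid y \<and> path (evert x) hs (evert y)"

fun edge :: "'h point \<Rightarrow> endpoint \<Rightarrow> 'h list \<Rightarrow> endpoint \<Rightarrow> nat \<Rightarrow> nat \<Rightarrow> complex" where
  "edge s (Vtx i) hs (Vtx j) p q = W s i hs $$ (p, q)"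
| "edge s (Frm i r) hs (Vtx j) p q = (W s i hs * fst (snd s) i) $$ (p, r)"
| "edge s (Vtx i) hs (Frm j r') p q = (snd (snd s) j * W s i hs) $$ (r', q)"
| "edge s (Frm i r) hs (Frm j r') p q = (snd (snd s) j * W s i hs * fst (snd s) i) $$ (r', r)"

text \<open>Summation over the index at an intermediate vertex is matrix multiplication.\<close>

lemma edge_compose:
  assumes s: "s \<in> rep_space G d v" and x: "epath x hs (Vtx k)" and y: "epath (Vtx k) hs' y"
    and p: "p < edim y" and q: "q < edim x"
  shows "(\<Sum>t<v k. edge s (Vtx k) hs' y p t * edge s x hs (Vtx k) t q) = edge s x (hs @ hs') y p q"
proof -
  have path: "path (evert x) hs k" "path k hs' (evert y)" using x y by (auto simp: epath_def)
  note W = W_append[OF s path] W_carrier[OF s path(1)] W_carrier[OF s path(2)]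
  have verts: "evert x \<in> verts G" "evert y \<in> verts G" using path_verts path by blast+
  note carr = rep_space_carrier(2)[OF s verts(1)] rep_space_carrier(3)[OF s verts(2)]
  have valid: "evalid x" "evalid y" using x y by (auto simp: epath_def)
  show ?thesis
  proof (cases x)
    case (Vtx i)
    then have Wx: "W s i hs \<in> carrier_mat (v k) (v i)" and qi: "q < v i" using W q by simp_all
    show ?thesis
    proof (cases y)
      case (Vtx j)
      then have Wy: "W s k hs' \<in> carrier_mat (v j) (v k)" and pj: "p < v j" using W p by simp_all
      show ?thesis
        using W(1) sum_mult_mat[OF Wy Wx pj qi] unfolding \<open>x = Vtx i\<close> Vtx by simp
    next
      case (Frm j r)
      then have Wy: "W s k hs' \<in> carrier_mat (v j) (v k)" and rj: "r < d j"
        and \<delta>: "snd (snd s) j \<in> carrier_mat (d j) (v j)" using W valid carr by simp_all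
      show ?thesis
        using W(1) sum_mult_mat[OF mult_carrier_mat[OF \<delta> Wy] Wx rj qi] assoc_mult_mat[OF \<delta> Wy Wx]
        unfolding \<open>x = Vtx i\<close> Frm by (simp del: assoc_mult_mat)
    qed
  next
    case (Frm i r)
    then have Wx: "W s i hs \<in> carrier_mat (v k) (v i)" and ri: "r < d i"
      and \<gamma>: "fst (snd s) i \<in> carrier_mat (v i) (d i)" using W valid carr by simp_all
    show ?thesis
    proof (cases y)
      case (Vtx j)
      then have Wy: "W s k hs' \<in> carrier_mat (v j) (v k)" and pj: "p < v j" using W p by simp_all
      show ?thesis
        using W(1) sum_mult_mat[OF Wy mult_carrier_mat[OF Wx \<gamma>] pj ri] assoc_mult_mat[OF Wy Wx \<gamma>]
        unfolding \<open>x = Frm i r\<close> Vtx by (simp del: assoc_mult_mat)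
    next
      case (Frm j r')
      then have Wy: "W s k hs' \<in> carrier_mat (v j) (v k)" and rj: "r' < d j"
        and \<delta>: "snd (snd s) j \<in> carrier_mat (d j) (v j)" using W valid carr by simp_all
      have "snd (snd s) j * (W s k hs' * W s i hs) * fst (snd s) i
          = snd (snd s) j * W s k hs' * (W s i hs * fst (snd s) i)"
        unfolding assoc_mult_mat[OF \<delta> Wy Wx, symmetric]
        by (rule assoc_mult_mat[OF mult_carrier_mat[OF \<delta> Wy] Wx \<gamma>])
      then show ?thesis
        using W(1) sum_mult_mat[OF mult_carrier_mat[OF \<delta> Wy] mult_carrier_mat[OF Wx \<gamma>] rj ri]
        unfolding \<open>x = Frm i r\<close> Frm by (simp del: assoc_mult_mat)
    qed
  qed
qed

lemma invariant_trace:
  assumes "path i hs i"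
  shows "invariant (\<lambda>s. \<Sum>t<v i. edge s (Vtx i) hs (Vtx i) t t)"
  unfolding invariant_def
proof (intro conjI ballI)
  show "regular (\<lambda>s. \<Sum>t<v i. edge s (Vtx i) hs (Vtx i) t t)"
    using assms by (auto intro!: regular_sum regular_W)
  fix g s assume g: "g \<in> carrier (gauge_group G v)" and s: "s \<in> rep_space G d v"
  let ?gi = "inv\<^bsub>GL (v i)\<^esub> (g i)"
  have gi: "g i \<in> carrier (GL (v i))" using gauge_component[OF g] path_verts[OF assms] by auto
  note carr = GL_inv_closed[OF gi] and Wc = W_carrier[OF s assms]
  have "(\<Sum>t<v i. edge (gauge_act G v g s) (Vtx i) hs (Vtx i) t t) = (\<Sum>t<v i. \<Sum>r<v i. (g i * W s i hs) $$ (t, r) * ?gi $$ (r, t))"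
    unfolding edge.simps W_gauge[OF s g assms]
    by (intro sum.cong refl sum_mult_mat[OF mult_carrier_mat[OF carr(1) Wc] carr(2)]) auto
  also have "\<dots> = (\<Sum>r<v i. \<Sum>t<v i. ?gi $$ (r, t) * (g i * W s i hs) $$ (t, r))"
    by (subst sum.swap) (simp add: mult.commute)
  also have "\<dots> = (\<Sum>r<v i. (?gi * (g i * W s i hs)) $$ (r, r))"
    using carr Wc by (intro sum.cong refl sum_mult_mat[symmetric, of _ "v i"]) auto
  also have "?gi * (g i * W s i hs) = W s i hs"
    using carr Wc by (simp add: assoc_mult_mat[symmetric, of _ "v i" "v i" _ "v i" _ "v i"] GL_inv_cancel[OF gi])
  finally show "(\<Sum>t<v i. edge (gauge_act G v g s) (Vtx i) hs (Vtx i) t t) = (\<Sum>t<v i. edge s (Vtx i) hs (Vtx i) t t)"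
    by simp
qed

lemma invariant_framed_edge:
  assumes "epath (Frm i r) hs (Frm j r')"
  shows "invariant (\<lambda>s. edge s (Frm i r) hs (Frm j r') p q)"
  unfolding invariant_def
proof (intro conjI ballI)
  have path: "path i hs j" and r: "r < d i" "r' < d j" using assms by (auto simp: epath_def)
  have verts: "i \<in> verts G" "j \<in> verts G" using path_verts[OF path] by auto
  show "regular (\<lambda>s. edge s (Frm i r) hs (Frm j r') p q)"
    unfolding edge.simps
    using r verts path
    by (intro regular_mult_mat[where m = "d j" and k = "v i" and l = "d i"] regular_mult_mat[where m = "d j" and k = "v j" and l = "v i"]
        regular_components regular_W mult_carrier_mat[of _ "d j" "v j"] W_carrier rep_space_carrier) auto
  fix g s assume g: "g \<in> carrier (gauge_group G v)" and s: "s \<in> rep_space G d v"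
  let ?gi = "inv\<^bsub>GL (v i)\<^esub> (g i)" and ?gj = "inv\<^bsub>GL (v j)\<^esub> (g j)" and ?W = "W s i hs"
    and ?\<gamma> = "fst (snd s) i" and ?\<delta> = "snd (snd s) j"
  have gi: "g i \<in> carrier (GL (v i))" and gj: "g j \<in> carrier (GL (v j))" using gauge_component[OF g] verts by auto
  note carr = GL_inv_closed[OF gi] GL_inv_closed[OF gj] W_carrier[OF s path] rep_space_carrier(2)[OF s verts(1)] rep_space_carrier(3)[OF s verts(2)]
  have 1: "g j * ?W * ?gi * (g i * ?\<gamma>) = g j * ?W * ?\<gamma>"
  proof -
    have "g j * ?W * ?gi * (g i * ?\<gamma>) = g j * ?W * (?gi * (g i * ?\<gamma>))"
      using carr by (intro assoc_mult_mat[of _ "v j" "v i" _ "v i" _ "d i"]) auto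
    also have "?gi * (g i * ?\<gamma>) = ?\<gamma>"
      using carr by (simp add: assoc_mult_mat[symmetric, of _ "v i" "v i" _ "v i" _ "d i"] GL_inv_cancel[OF gi])
    finally show ?thesis .
  qed
  have "?\<delta> * ?gj * (g j * ?W * ?gi) * (g i * ?\<gamma>) = ?\<delta> * ?gj * (g j * ?W * ?gi * (g i * ?\<gamma>))"
    using carr by (intro assoc_mult_mat[of _ "d j" "v j" _ "v i" _ "d i"]) auto
  also have "\<dots> = ?\<delta> * (?gj * (g j * ?W * ?\<gamma>))"
    unfolding 1 using carr by (intro assoc_mult_mat[of _ "d j" "v j" _ "v j" _ "d i"]) auto
  also have "g j * ?W * ?\<gamma> = g j * (?W * ?\<gamma>)"
    using carr by (intro assoc_mult_mat[of _ "v j" "v j" _ "v i" _ "d i"]) auto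
  also have "?gj * (g j * (?W * ?\<gamma>)) = ?gj * g j * (?W * ?\<gamma>)"
    using carr by (intro assoc_mult_mat[symmetric, of _ "v j" "v j" _ "v j" _ "d i"]) auto
  also have "\<dots> = ?W * ?\<gamma>"
    using carr by (simp add: GL_inv_cancel[OF gj] left_mult_one_mat[of _ "v j" "d i"])
  also have "?\<delta> * (?W * ?\<gamma>) = ?\<delta> * ?W * ?\<gamma>"
    using carr by (intro assoc_mult_mat[symmetric, of _ "d j" "v j" _ "v i" _ "d i"]) auto
  finally show "edge (gauge_act G v g s) (Frm i r) hs (Frm j r') p q = edge s (Frm i r) hs (Frm j r') p q"
    by (simp add: W_gauge[OF s g path] gauge_act_components verts)
qed

text \<open>Values at the joints in \<open>S\<close> are summed over and those elsewhere are prescribed by \<open>\<beta>\<close>.\<close>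

definition override :: "'n set \<Rightarrow> ('n \<Rightarrow> nat) \<Rightarrow> ('n \<Rightarrow> nat) \<Rightarrow> 'n \<Rightarrow> nat" where
  "override S \<beta> x n = (if n \<in> S then x n else \<beta> n)"

text \<open>The elements of \<open>K\<close> are wires; wire \<open>k\<close> carries a path, it starts at the joint \<open>k\<close> and ends at the joint
\<open>out k\<close>, and joints carry an index.  Suppose that one wire ends and another begins at the joint \<open>a\<close>.
If these are the same wire, then summing over the index at \<open>a\<close> produces the trace of a closed path,
which is an invariant function.  Otherwise the sum is a matrix product, and the wires become one.\<close>

lemma eliminate_wire:
  fixes col :: "'n \<Rightarrow> endpoint"
  assumes K: "finite K" and inj: "inj_on out K" and ep: "\<And>k. k \<in> K \<Longrightarrow> epath (col k) (hs k) (col (out k))"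
    and a: "a \<in> K" "a \<in> out ` K" "col a = Vtx i"
  obtains J hs' out' where "invariant J" "inj_on out' (K - {a})" "out' ` (K - {a}) = out ` K - {a}"
    "\<And>k. k \<in> K - {a} \<Longrightarrow> epath (col k) (hs' k) (col (out' k))"
    "\<forall>s\<in>rep_space G d v. \<forall>\<beta>. (\<forall>n\<in>K \<union> out ` K - {a}. \<beta> n < edim (col n)) \<longrightarrow>
      (\<Sum>y<v i. \<Prod>k\<in>K. edge s (col k) (hs k) (col (out k)) ((\<beta>(a := y)) (out k)) ((\<beta>(a := y)) k))
      = J s * (\<Prod>k\<in>K - {a}. edge s (col k) (hs' k) (col (out' k)) (\<beta> (out' k)) (\<beta> k))"
proof -
  obtain k' where k': "k' \<in> K" "out k' = a" using a(2) by blast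
  have out_neq: "out k \<noteq> a" if "k \<in> K" "k \<noteq> k'" for k
    using inj k' that by (auto simp: inj_on_def)
  show thesis
  proof (cases "k' = a")
    case True
    define J where "J = (\<lambda>s. \<Sum>t<v i. edge s (Vtx i) (hs a) (Vtx i) t t)"
    have "path i (hs a) i" using ep[OF a(1)] k'(2) True a(3) by (simp add: epath_def)
    then have "invariant J" unfolding J_def by (rule invariant_trace)
    then show thesis
    proof (rule that)
      show "inj_on out (K - {a})" using inj by (rule inj_on_subset) auto
      show "out ` (K - {a}) = out ` K - {a}" using inj k' True a by (auto simp: inj_on_def)
      show "epath (col k) (hs k) (col (out k))" if "k \<in> K - {a}" for k using ep that by simp
      show "\<forall>s\<in>rep_space G d v. \<forall>\<beta>. (\<forall>n\<in>K \<union> out ` K - {a}. \<beta> n < edim (col n)) \<longrightarrow>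
        (\<Sum>y<v i. \<Prod>k\<in>K. edge s (col k) (hs k) (col (out k)) ((\<beta>(a := y)) (out k)) ((\<beta>(a := y)) k))
        = J s * (\<Prod>k\<in>K - {a}. edge s (col k) (hs k) (col (out k)) (\<beta> (out k)) (\<beta> k))"
      proof (intro ballI allI impI)
      fix s and \<beta> :: "'n \<Rightarrow> nat"
      have "(\<Prod>k\<in>K. edge s (col k) (hs k) (col (out k)) ((\<beta>(a := y)) (out k)) ((\<beta>(a := y)) k))
          = edge s (Vtx i) (hs a) (Vtx i) y y * (\<Prod>k\<in>K - {a}. edge s (col k) (hs k) (col (out k)) (\<beta> (out k)) (\<beta> k))" for y
      proof -
        have "(\<Prod>k\<in>K. edge s (col k) (hs k) (col (out k)) ((\<beta>(a := y)) (out k)) ((\<beta>(a := y)) k))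
            = edge s (col a) (hs a) (col (out a)) ((\<beta>(a := y)) (out a)) ((\<beta>(a := y)) a) *
              (\<Prod>k\<in>K - {a}. edge s (col k) (hs k) (col (out k)) ((\<beta>(a := y)) (out k)) ((\<beta>(a := y)) k))"
          by (rule prod.remove[OF K a(1)])
        also have "edge s (col a) (hs a) (col (out a)) ((\<beta>(a := y)) (out a)) ((\<beta>(a := y)) a) = edge s (Vtx i) (hs a) (Vtx i) y y"
          using k'(2) True a(3) by simp
        also have "(\<Prod>k\<in>K - {a}. edge s (col k) (hs k) (col (out k)) ((\<beta>(a := y)) (out k)) ((\<beta>(a := y)) k))
          = (\<Prod>k\<in>K - {a}. edge s (col k) (hs k) (col (out k)) (\<beta> (out k)) (\<beta> k))"
          using out_neq True by (intro prod.cong refl) auto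
        finally show ?thesis .
      qed
      then show "(\<Sum>y<v i. \<Prod>k\<in>K. edge s (col k) (hs k) (col (out k)) ((\<beta>(a := y)) (out k)) ((\<beta>(a := y)) k))
        = J s * (\<Prod>k\<in>K - {a}. edge s (col k) (hs k) (col (out k)) (\<beta> (out k)) (\<beta> k))"
        by (simp add: J_def sum_distrib_right)
      qed
    qed
  next
    case False
    \<comment> \<open>The wire \<open>k'\<close> that ends at \<open>a\<close> absorbs the wire that starts there.\<close>
    define hs' where "hs' = hs(k' := hs k' @ hs a)"
    define out' where "out' = out(k' := out a)"
    have ep_a: "epath (Vtx i) (hs a) (col (out a))" and ep_k': "epath (col k') (hs k') (Vtx i)"
      using ep[OF a(1)] ep[OF k'(1)] k'(2) a(3) by auto
    have out_a: "out a \<noteq> a" using out_neq a(1) False by auto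
    show thesis
    proof (rule that[of "\<lambda>s. 1" out' hs'])
      show "inj_on out' (K - {a})"
        using inj a(1) by (auto simp: inj_on_def out'_def)
      show "out' ` (K - {a}) = out ` K - {a}"
      proof
        show "out' ` (K - {a}) \<subseteq> out ` K - {a}"
          using out_neq out_a a(1) by (auto simp: out'_def)
        show "out ` K - {a} \<subseteq> out' ` (K - {a})"
        proof
          fix n assume n: "n \<in> out ` K - {a}"
          then obtain k where k: "k \<in> K" "n = out k" by blast
          with n k' have "k \<noteq> k'" by auto
          show "n \<in> out' ` (K - {a})"
          proof (cases "k = a")
            case True
            then have "n = out' k'" using k by (simp add: out'_def)
            then show ?thesis using k' False by blast
          next
            case False
            then have "n = out' k" using k \<open>k \<noteq> k'\<close> by (simp add: out'_def)
            then show ?thesis using k False by blast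
          qed
        qed
      qed
      show "epath (col k) (hs' k) (col (out' k))" if "k \<in> K - {a}" for k
      proof (cases "k = k'")
        case True
        then show ?thesis using ep_a ep_k' path_append by (auto simp: hs'_def out'_def epath_def)
      next
        case False
        then show ?thesis using ep that by (simp add: hs'_def out'_def)
      qed
      show "\<forall>s\<in>rep_space G d v. \<forall>\<beta>. (\<forall>n\<in>K \<union> out ` K - {a}. \<beta> n < edim (col n)) \<longrightarrow>
        (\<Sum>y<v i. \<Prod>k\<in>K. edge s (col k) (hs k) (col (out k)) ((\<beta>(a := y)) (out k)) ((\<beta>(a := y)) k))
        = 1 * (\<Prod>k\<in>K - {a}. edge s (col k) (hs' k) (col (out' k)) (\<beta> (out' k)) (\<beta> k))"
      proof (intro ballI allI impI)
      fix s and \<beta> :: "'n \<Rightarrow> nat"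
      assume s: "s \<in> rep_space G d v" and \<beta>: "\<forall>n\<in>K \<union> out ` K - {a}. \<beta> n < edim (col n)"
      let ?R = "K - {a} - {k'}"
      let ?P = "\<Prod>k\<in>?R. edge s (col k) (hs k) (col (out k)) (\<beta> (out k)) (\<beta> k)"
      have "(\<Prod>k\<in>K. edge s (col k) (hs k) (col (out k)) ((\<beta>(a := y)) (out k)) ((\<beta>(a := y)) k))
          = edge s (Vtx i) (hs a) (col (out a)) (\<beta> (out a)) y * edge s (col k') (hs k') (Vtx i) y (\<beta> k') * ?P" for y
      proof -
        let ?f = "\<lambda>k. edge s (col k) (hs k) (col (out k)) ((\<beta>(a := y)) (out k)) ((\<beta>(a := y)) k)"
        have "prod ?f K = ?f a * prod ?f (K - {a})" by (rule prod.remove[OF K a(1)])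
        also have "prod ?f (K - {a}) = ?f k' * prod ?f ?R"
          using K k'(1) False by (intro prod.remove) auto
        also have "prod ?f ?R = ?P" using out_neq by (intro prod.cong refl) auto
        also have "?f a = edge s (Vtx i) (hs a) (col (out a)) (\<beta> (out a)) y" using out_a a(3) by simp
        also have "?f k' = edge s (col k') (hs k') (Vtx i) y (\<beta> k')" using k'(2) a(3) False by simp
        finally show ?thesis by simp
      qed
      then have "(\<Sum>y<v i. \<Prod>k\<in>K. edge s (col k) (hs k) (col (out k)) ((\<beta>(a := y)) (out k)) ((\<beta>(a := y)) k))
          = (\<Sum>y<v i. edge s (Vtx i) (hs a) (col (out a)) (\<beta> (out a)) y * edge s (col k') (hs k') (Vtx i) y (\<beta> k')) * ?P"
        by (simp add: sum_distrib_right)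
      also have "(\<Sum>y<v i. edge s (Vtx i) (hs a) (col (out a)) (\<beta> (out a)) y * edge s (col k') (hs k') (Vtx i) y (\<beta> k'))
          = edge s (col k') (hs' k') (col (out' k')) (\<beta> (out' k')) (\<beta> k')"
        using edge_compose[OF s ep_k' ep_a, of "\<beta> (out a)" "\<beta> k'"] \<beta> a(1) k'(1) out_a False by (simp add: hs'_def out'_def)
      also have "?P = (\<Prod>k\<in>?R. edge s (col k) (hs' k) (col (out' k)) (\<beta> (out' k)) (\<beta> k))"
        by (intro prod.cong refl) (simp add: hs'_def out'_def)
      also have "edge s (col k') (hs' k') (col (out' k')) (\<beta> (out' k')) (\<beta> k') * \<dots>
          = (\<Prod>k\<in>K - {a}. edge s (col k) (hs' k) (col (out' k)) (\<beta> (out' k)) (\<beta> k))"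
        using K k'(1) False by (intro prod.remove[symmetric]) auto
      finally show "(\<Sum>y<v i. \<Prod>k\<in>K. edge s (col k) (hs k) (col (out k)) ((\<beta>(a := y)) (out k)) ((\<beta>(a := y)) k))
        = 1 * (\<Prod>k\<in>K - {a}. edge s (col k) (hs' k) (col (out' k)) (\<beta> (out' k)) (\<beta> k))" by simp
      qed
    qed simp
  qed
qed

text \<open>Eliminating all inner joints leaves an invariant factor, the product of the traces of the closed
circuits, times a product over the open chains of wires.\<close>

lemma eliminate_wires:
  fixes col :: "'n \<Rightarrow> endpoint"
  assumes "finite S" "finite K" "inj_on out K" "\<And>k. k \<in> K \<Longrightarrow> epath (col k) (hs k) (col (out k))"
    and "S \<subseteq> K \<inter> out ` K" "\<And>a. a \<in> S \<Longrightarrow> \<exists>i. col a = Vtx i"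
  shows "\<exists>J hs' out'. invariant J \<and> inj_on out' (K - S) \<and> out' ` (K - S) = out ` K - S \<and>
    (\<forall>k\<in>K - S. epath (col k) (hs' k) (col (out' k))) \<and>
    (\<forall>s\<in>rep_space G d v. \<forall>\<beta>. (\<forall>n\<in>K \<union> out ` K - S. \<beta> n < edim (col n)) \<longrightarrow>
      (\<Sum>x\<in>Pi\<^sub>E S (\<lambda>n. {..<edim (col n)}). \<Prod>k\<in>K. edge s (col k) (hs k) (col (out k)) (override S \<beta> x (out k)) (override S \<beta> x k))
      = J s * (\<Prod>k\<in>K - S. edge s (col k) (hs' k) (col (out' k)) (\<beta> (out' k)) (\<beta> k)))"
  using assms
proof (induction S arbitrary: K hs out rule: finite_induct)
  case empty
  show ?case
    using empty.prems by (intro exI[of _ "\<lambda>s. 1"] exI[of _ hs] exI[of _ out]) (auto simp: override_def)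
next
  case (insert a S)
  obtain i where i: "col a = Vtx i" using insert.prems(5) by blast
  have aK: "a \<in> K" "a \<in> out ` K" using insert.prems(4) by auto
  obtain J1 hs1 out1 where 1: "invariant J1" "inj_on out1 (K - {a})" "out1 ` (K - {a}) = out ` K - {a}"
    "\<And>k. k \<in> K - {a} \<Longrightarrow> epath (col k) (hs1 k) (col (out1 k))"
    "\<forall>s\<in>rep_space G d v. \<forall>\<beta>. (\<forall>n\<in>K \<union> out ` K - {a}. \<beta> n < edim (col n)) \<longrightarrow>
      (\<Sum>y<v i. \<Prod>k\<in>K. edge s (col k) (hs k) (col (out k)) ((\<beta>(a := y)) (out k)) ((\<beta>(a := y)) k))
      = J1 s * (\<Prod>k\<in>K - {a}. edge s (col k) (hs1 k) (col (out1 k)) (\<beta> (out1 k)) (\<beta> k))"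
    by (rule eliminate_wire[where hs = hs and out = out and K = K and a = a and col = col and i = i, OF insert.prems(1,2) _ aK i])
      (rule insert.prems(3), assumption, rule that)
  have "\<exists>J hs' out'. invariant J \<and> inj_on out' (K - {a} - S) \<and> out' ` (K - {a} - S) = out1 ` (K - {a}) - S \<and>
    (\<forall>k\<in>K - {a} - S. epath (col k) (hs' k) (col (out' k))) \<and>
    (\<forall>s\<in>rep_space G d v. \<forall>\<beta>. (\<forall>n\<in>K - {a} \<union> out1 ` (K - {a}) - S. \<beta> n < edim (col n)) \<longrightarrow>
      (\<Sum>x\<in>Pi\<^sub>E S (\<lambda>n. {..<edim (col n)}). \<Prod>k\<in>K - {a}. edge s (col k) (hs1 k) (col (out1 k)) (override S \<beta> x (out1 k)) (override S \<beta> x k))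
      = J s * (\<Prod>k\<in>K - {a} - S. edge s (col k) (hs' k) (col (out' k)) (\<beta> (out' k)) (\<beta> k)))"
  proof (rule insert.IH)
    show "finite (K - {a})" using insert.prems(1) by simp
    show "S \<subseteq> (K - {a}) \<inter> out1 ` (K - {a})" using insert.prems(4) insert.hyps(2) unfolding 1(3) by auto
    show "\<exists>i. col a = Vtx i" if "a \<in> S" for a using insert.prems(5) that by simp
    show "inj_on out1 (K - {a})" by (rule 1(2))
    show "epath (col k) (hs1 k) (col (out1 k))" if "k \<in> K - {a}" for k by (rule 1(4)[OF that])
  qed
  then obtain J hs' out' where 2: "invariant J" "inj_on out' (K - {a} - S)" "out' ` (K - {a} - S) = out1 ` (K - {a}) - S"
    "\<forall>k\<in>K - {a} - S. epath (col k) (hs' k) (col (out' k))"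
    "\<forall>s\<in>rep_space G d v. \<forall>\<beta>. (\<forall>n\<in>K - {a} \<union> out1 ` (K - {a}) - S. \<beta> n < edim (col n)) \<longrightarrow>
      (\<Sum>x\<in>Pi\<^sub>E S (\<lambda>n. {..<edim (col n)}). \<Prod>k\<in>K - {a}. edge s (col k) (hs1 k) (col (out1 k)) (override S \<beta> x (out1 k)) (override S \<beta> x k))
      = J s * (\<Prod>k\<in>K - {a} - S. edge s (col k) (hs' k) (col (out' k)) (\<beta> (out' k)) (\<beta> k))"
    by (elim exE conjE) (rule that)
  have diff: "K - insert a S = K - {a} - S" by auto
  show ?case
  proof (intro exI[of _ "\<lambda>s. J1 s * J s"] exI[of _ hs'] exI[of _ out'] conjI ballI allI impI)
    show "invariant (\<lambda>s. J1 s * J s)" by (rule invariant_mult[OF 1(1) 2(1)])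
    show "inj_on out' (K - insert a S)" "out' ` (K - insert a S) = out ` K - insert a S"
      unfolding diff using 2(2,3) 1(3) by auto
    show "epath (col k) (hs' k) (col (out' k))" if "k \<in> K - insert a S" for k
      using 2(4) that unfolding diff by blast
    fix s \<beta> assume s: "s \<in> rep_space G d v" and \<beta>: "\<forall>n\<in>K \<union> out ` K - insert a S. \<beta> n < edim (col n)"
    let ?T = "\<lambda>n. {..<edim (col n)}"
    let ?F = "\<lambda>x. \<Prod>k\<in>K. edge s (col k) (hs k) (col (out k)) (override (insert a S) \<beta> x (out k)) (override (insert a S) \<beta> x k)"
    have "(\<Sum>x\<in>Pi\<^sub>E (insert a S) ?T. ?F x) = (\<Sum>(y, x)\<in>?T a \<times> Pi\<^sub>E S ?T. ?F (x(a := y)))"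
      unfolding PiE_insert_eq
      by (subst sum.reindex[OF inj_combinator[OF insert.hyps(2)]]) (simp add: case_prod_unfold comp_def)
    also have "\<dots> = (\<Sum>x\<in>Pi\<^sub>E S ?T. \<Sum>y<v i. ?F (x(a := y)))"
      unfolding sum.cartesian_product[symmetric] i edim.simps by (rule sum.swap)
    also have "\<dots> = (\<Sum>x\<in>Pi\<^sub>E S ?T. \<Sum>y<v i. \<Prod>k\<in>K. edge s (col k) (hs k) (col (out k))
        (((override S \<beta> x)(a := y)) (out k)) (((override S \<beta> x)(a := y)) k))"
    proof (intro sum.cong refl prod.cong)
      fix x y k
      have "override (insert a S) \<beta> (x(a := y)) = (override S \<beta> x)(a := y)"
        by (auto simp: override_def fun_eq_iff)
      then show "edge s (col k) (hs k) (col (out k)) (override (insert a S) \<beta> (x(a := y)) (out k)) (override (insert a S) \<beta> (x(a := y)) k)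
        = edge s (col k) (hs k) (col (out k)) (((override S \<beta> x)(a := y)) (out k)) (((override S \<beta> x)(a := y)) k)"
        by simp
    qed
    also have "\<dots> = (\<Sum>x\<in>Pi\<^sub>E S ?T. J1 s * (\<Prod>k\<in>K - {a}. edge s (col k) (hs1 k) (col (out1 k)) (override S \<beta> x (out1 k)) (override S \<beta> x k)))"
    proof (rule sum.cong[OF refl], rule 1(5)[rule_format, OF s])
      fix x n assume "x \<in> Pi\<^sub>E S ?T" "n \<in> K \<union> out ` K - {a}"
      then show "override S \<beta> x n < edim (col n)" using \<beta> by (auto simp: override_def PiE_iff)
    qed
    also have "\<dots> = J1 s * (J s * (\<Prod>k\<in>K - {a} - S. edge s (col k) (hs' k) (col (out' k)) (\<beta> (out' k)) (\<beta> k)))"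
      unfolding sum_distrib_left[symmetric]
      by (subst 2(5)[rule_format, OF s]) (use \<beta> 1(3) in auto)
    finally show "(\<Sum>x\<in>Pi\<^sub>E (insert a S) ?T. ?F x)
      = J1 s * J s * (\<Prod>k\<in>K - insert a S. edge s (col k) (hs' k) (col (out' k)) (\<beta> (out' k)) (\<beta> k))"
      by (simp add: diff mult.assoc)
  qed
qed

end

section \<open>Blocks of basis vectors\<close>

fun with_pos :: "basis_label \<Rightarrow> nat \<Rightarrow> basis_label" where
  "with_pos (Block i h p) q = Block i h q"
| "with_pos (Line l) q = Line l"

lemma with_pos_same: "label_block y = label_block x \<Longrightarrow> with_pos x (label_pos y) = y"
  by (cases x; cases y) auto

lemma sum_over_block:
  fixes F :: "basis_label \<Rightarrow> complex"
  assumes full: "full_blocks v xs" and r: "r < length xs"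
  shows "(\<Sum>k<length xs. if label_block (xs ! r) = label_block (xs ! k) then F (xs ! k) else 0)
    = (\<Sum>q<v (label_vertex (xs ! r)). F (with_pos (xs ! r) q))"
proof -
  let ?S = "{k. k < length xs \<and> label_block (xs ! k) = label_block (xs ! r)}"
  have "(\<Sum>k<length xs. if label_block (xs ! r) = label_block (xs ! k) then F (xs ! k) else 0) = (\<Sum>k\<in>?S. F (xs ! k))"
    by (rule sum.mono_neutral_cong_right) auto
  also have "\<dots> = (\<Sum>q<v (label_vertex (xs ! r)). F (with_pos (xs ! r) q))"
  proof -
    have bij: "bij_betw (\<lambda>k. label_pos (xs ! k)) ?S {..<v (label_vertex (xs ! r))}"
      unfolding bij_betw_def
    proof (intro conjI inj_onI subset_antisym subsetI)
      fix k l assume kl: "k \<in> ?S" "l \<in> ?S" "label_pos (xs ! k) = label_pos (xs ! l)"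
      then have "xs ! k = xs ! l" by (intro label_eqI) auto
      moreover have "distinct xs" using full by (simp add: full_blocks_def)
      ultimately show "k = l" using nth_eq_iff_index_eq kl(1,2) by blast
    next
      fix q assume "q \<in> (\<lambda>k. label_pos (xs ! k)) ` ?S"
      then obtain k where k: "k < length xs" "label_block (xs ! k) = label_block (xs ! r)" "q = label_pos (xs ! k)" by blast
      then show "q \<in> {..<v (label_vertex (xs ! r))}"
        using full_blocks_pos[OF full k(1)] label_vertex_cong[OF k(2)] by simp
    next
      fix q assume "q \<in> {..<v (label_vertex (xs ! r))}"
      then have "q < v (label_vertex (xs ! r))" by simp
      then obtain k where "k < length xs" "label_block (xs ! k) = label_block (xs ! r)" "label_pos (xs ! k) = q"
        by (rule full_blocks_index[OF full r])
      then show "q \<in> (\<lambda>k. label_pos (xs ! k)) ` ?S" by (intro image_eqI[of _ _ k]) auto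
    qed
    show ?thesis
      unfolding sum.reindex_bij_betw[OF bij, symmetric] by (intro sum.cong refl) (simp add: with_pos_same)
  qed
  finally show ?thesis .
qed

lemma length_basis_labels:
  assumes "finite (verts G)"
  shows "length (basis_labels G v c k) = (\<Sum>i\<in>verts G. c i * v i) + k"
proof -
  have "length (concat (map (\<lambda>h. map (Block i h) [0..<q]) [0..<n])) = n * q" for i q n
    by (induction n) auto
  then have "length (concat (map (\<lambda>i. concat (map (\<lambda>h. map (Block i h) [0..<v i]) [0..<c i])) is)) = sum_list (map (\<lambda>i. c i * v i) is)" for "is"
    by (induction "is") auto
  then show ?thesis
    using assms by (simp add: basis_labels_def sum_list_distinct_conv_sum_set)
qed

lemma basis_labels_nth:
  shows "r < length (basis_labels G v c 0) \<Longrightarrow> basis_labels G v c k ! r = basis_labels G v c 0 ! r"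
    and "l < k \<Longrightarrow> basis_labels G v c k ! (length (basis_labels G v c 0) + l) = Line l"
    and "length (basis_labels G v c k) = length (basis_labels G v c 0) + k"
  by (simp_all add: basis_labels_def nth_append)

lemma basis_labels_blocks:
  assumes "finite (verts G)" "r < length (basis_labels G v c 0)"
  shows "\<exists>i h p. basis_labels G v c 0 ! r = Block i h p \<and> i \<in> verts G \<and> h < c i \<and> p < v i"
  using nth_mem[OF assms(2)] by (auto simp: set_basis_labels[OF assms(1)])

lemma card_block_le:
  assumes fin: "finite (verts G)"
  shows "card {r. r < length (basis_labels G v c k) \<and> label_block (basis_labels G v c k ! r) = \<beta>}
    \<le> (case \<beta> of Inl (i, h) \<Rightarrow> v i | Inr l \<Rightarrow> 1)" (is "card ?S \<le> ?n")
proof -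
  let ?xs = "basis_labels G v c k"
  have "label_pos (?xs ! r) < ?n" if "r \<in> ?S" for r
  proof -
    have "?xs ! r \<in> set ?xs" using that by simp
    then show ?thesis using that by (auto simp: set_basis_labels[OF fin])
  qed
  moreover have "inj_on (\<lambda>r. label_pos (?xs ! r)) ?S"
  proof (rule inj_onI)
    fix r r' assume rr: "r \<in> ?S" "r' \<in> ?S" "label_pos (?xs ! r) = label_pos (?xs ! r')"
    then have "?xs ! r = ?xs ! r'" by (intro label_eqI) auto
    then show "r = r'" using rr(1,2) nth_eq_iff_index_eq[OF distinct_basis_labels[of G v c k], of r r'] by blast
  qed
  ultimately have "card ?S \<le> card {..<?n}" by (intro card_inj_on_le[of "\<lambda>r. label_pos (?xs ! r)"]) auto
  then show ?thesis by simp
qed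

text \<open>One-dimensional summands can only be permuted trivially.\<close>

lemma block_permutations_lines:
  "block_permutations (basis_labels G v c k) = block_permutations (basis_labels G v c 0)"
proof (intro subset_antisym subsetI)
  let ?xs = "basis_labels G v c k" and ?ys = "basis_labels G v c 0"
  let ?Q = "length ?ys" and ?R = "length ?xs"
  have R: "?Q \<le> ?R" using basis_labels_nth(3)[of G v c k] by linarith
  fix \<rho> assume \<rho>: "\<rho> \<in> block_permutations ?xs"
  then have perm: "\<rho> permutes {..<?R}" and blk: "\<And>r. r < ?R \<Longrightarrow> label_block (?xs ! \<rho> r) = label_block (?xs ! r)"
    by (auto simp: color_permutations_def)
  have lt: "\<rho> r < ?R" if "r < ?R" for r by (rule block_permutation_lt[OF \<rho> that])
  have fix_line: "\<rho> r = r" if "\<not> r < ?Q" for r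
  proof (cases "r < ?R")
    case True
    define l where "l = r - ?Q"
    have l: "r = ?Q + l" "l < k" using True that basis_labels_nth(3)[of G v c k] unfolding l_def by linarith+
    have "?xs ! r = Line l" unfolding l(1) by (rule basis_labels_nth(2)[OF l(2)])
    then have "?xs ! \<rho> r = ?xs ! r" using blk[OF True] by (cases "?xs ! \<rho> r") auto
    then show ?thesis using nth_eq_iff_index_eq[OF distinct_basis_labels lt[OF True] True] by blast
  next
    case False
    then show ?thesis using perm by (simp add: permutes_not_in)
  qed
  have perm0: "\<rho> permutes {..<?Q}"
    using perm fix_line by (intro permutes_superset[OF perm]) auto
  have "label_block (?ys ! \<rho> r) = label_block (?ys ! r)" if "r < ?Q" for r
  proof -
    have "\<rho> r < ?Q" using permutes_in_image[OF perm0, of r] that by simp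
    then show ?thesis using blk[of r] that R basis_labels_nth(1)[of _ G v c k] by simp
  qed
  then show "\<rho> \<in> block_permutations ?ys" using perm0 by (simp add: color_permutations_def)
next
  let ?xs = "basis_labels G v c k" and ?ys = "basis_labels G v c 0"
  let ?Q = "length ?ys" and ?R = "length ?xs"
  have R: "?Q \<le> ?R" using basis_labels_nth(3)[of G v c k] by linarith
  fix \<rho> assume \<rho>: "\<rho> \<in> block_permutations ?ys"
  then have perm: "\<rho> permutes {..<?Q}" and blk: "\<And>r. r < ?Q \<Longrightarrow> label_block (?ys ! \<rho> r) = label_block (?ys ! r)"
    by (auto simp: color_permutations_def)
  have "label_block (?xs ! \<rho> r) = label_block (?xs ! r)" for r
  proof (cases "r < ?Q")
    case True
    then show ?thesis using blk[OF True] block_permutation_lt[OF \<rho> True] basis_labels_nth(1)[of _ G v c k] by simp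
  next
    case False
    then show ?thesis using perm by (simp add: permutes_not_in)
  qed
  then show "\<rho> \<in> block_permutations ?xs"
    using permutes_subset[OF perm] R by (simp add: color_permutations_def)
qed

section \<open>Evaluation of elements of the path algebra\<close>

context framed_quiver
begin

lemma awalk_map_Inl: "pre_digraph.awalk (loop_quiver G) i (map Inl hs) j \<longleftrightarrow> path i hs j"
proof -
  have cas: "pre_digraph.cas (loop_quiver G) i (map Inl hs) j \<and> i \<in> verts G \<and> set hs \<subseteq> arcs G \<longleftrightarrow> path i hs j"
  proof (induction hs arbitrary: i)
    case (Cons h hs)
    show ?case
      unfolding path.simps Cons.IH[symmetric]
      by (auto simp: pre_digraph.cas.simps loop_quiver_def)
  qed (simp add: pre_digraph.cas.simps conj_commute)
  have "set (map Inl hs) \<subseteq> arcs (loop_quiver G) \<longleftrightarrow> set hs \<subseteq> arcs G"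
    by (auto simp: loop_quiver_def)
  then show ?thesis unfolding pre_digraph.awalk_def cas[symmetric] by (auto simp: loop_quiver_def)
qed

definition path_element :: "nat \<Rightarrow> nat \<Rightarrow> 'h bpath_alg \<Rightarrow> bool" where
  "path_element i j x \<longleftrightarrow> has_type G i j x \<and> in_path_algebra x"

lemma path_element_keys:
  assumes "path_element i j x" "\<kappa> \<in> Poly_Mapping.keys x"
  obtains hs where "\<kappa> = (i, map Inl hs)" "path i hs j"
proof -
  obtain k u where \<kappa>: "\<kappa> = (k, u)" by (cases \<kappa>)
  then have "k = i" "pre_digraph.awalk (loop_quiver G) i u j" "set u \<subseteq> range Inl"
    using assms by (auto simp: path_element_def has_type_def in_path_algebra_def)
  moreover from this(3) have "u = map Inl (map projl u)"
    by (auto simp: comp_def intro!: map_idI[symmetric])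
  then obtain hs where "u = map Inl hs" ..
  ultimately show thesis using that \<kappa> by (simp add: awalk_map_Inl)
qed

definition linear_extension :: "'h bpath_alg \<Rightarrow> ('h bpath \<Rightarrow> complex) \<Rightarrow> complex" where
  "linear_extension x f = (\<Sum>\<kappa>\<in>Poly_Mapping.keys x. Poly_Mapping.lookup x \<kappa> * f \<kappa>)"

lemma bpath_eval_carrier: "bpath_eval G v s i j x \<in> carrier_mat (v j) (v i)"
  by (simp add: bpath_eval_def)

lemma bpath_eval_entry:
  "p < v j \<Longrightarrow> q < v i \<Longrightarrow> bpath_eval G v s i j x $$ (p, q) = linear_extension x (\<lambda>(k, u). walk_eval G v s k u $$ (p, q))"
  by (simp add: bpath_eval_def linear_extension_def case_prod_unfold)

lemma regular_bpath_eval: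
  assumes x: "path_element i j x" and pq: "p < v j" "q < v i"
  shows "regular (\<lambda>s. bpath_eval G v s i j x $$ (p, q))"
  unfolding bpath_eval_entry[OF pq] linear_extension_def
proof (intro regular_sum regular_mult regular_const)
  fix \<kappa> assume "\<kappa> \<in> Poly_Mapping.keys x"
  then obtain hs where "\<kappa> = (i, map Inl hs)" "path i hs j" using path_element_keys[OF x] by blast
  then show "regular (\<lambda>s. case \<kappa> of (k, u) \<Rightarrow> walk_eval G v s k u $$ (p, q))"
    using regular_W[of i hs j p q] pq by (simp add: W_def)
qed

lemma bpath_eval_gauge:
  assumes x: "path_element i j x" and ij: "i \<in> verts G" "j \<in> verts G"
    and s: "s \<in> rep_space G d v" and g: "g \<in> carrier (gauge_group G v)"
  shows "bpath_eval G v (gauge_act G v g s) i j x = g j * bpath_eval G v s i j x * inv\<^bsub>GL (v i)\<^esub> (g i)"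
proof (rule eq_matI)
  let ?gi = "inv\<^bsub>GL (v i)\<^esub> (g i)" and ?E = "bpath_eval G v s i j x"
  note gi = gauge_component[OF g ij(1)] and gj = gauge_component[OF g ij(2)]
  note carr = GL_inv_closed[OF gi] GL_inv_closed[OF gj]
  have Ec: "?E \<in> carrier_mat (v j) (v i)" by (rule bpath_eval_carrier)
  fix p q assume "p < dim_row (g j * ?E * ?gi)" "q < dim_col (g j * ?E * ?gi)"
  then have pq: "p < v j" "q < v i" using carr by auto
  have expand: "(g j * M * ?gi) $$ (p, q) = (\<Sum>r<v i. \<Sum>t<v j. g j $$ (p, t) * M $$ (t, r) * ?gi $$ (r, q))"
    if M: "M \<in> carrier_mat (v j) (v i)" for M
    unfolding sum_mult_mat[OF mult_carrier_mat[OF carr(3) M] carr(2) pq]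
    by (intro sum.cong refl) (simp add: sum_mult_mat[OF carr(3) M pq(1)] sum_distrib_right)
  have "bpath_eval G v (gauge_act G v g s) i j x $$ (p, q)
      = (\<Sum>\<kappa>\<in>Poly_Mapping.keys x. Poly_Mapping.lookup x \<kappa> * (\<Sum>r<v i. \<Sum>t<v j. g j $$ (p, t) *
          (case \<kappa> of (k, u) \<Rightarrow> walk_eval G v s k u $$ (t, r)) * ?gi $$ (r, q)))"
    unfolding bpath_eval_entry[OF pq] linear_extension_def
  proof (intro sum.cong refl arg_cong2[where f = "(*)"])
    fix \<kappa> assume "\<kappa> \<in> Poly_Mapping.keys x"
    then obtain hs where \<kappa>: "\<kappa> = (i, map Inl hs)" and path: "path i hs j" using path_element_keys[OF x] by blast
    show "(case \<kappa> of (k, u) \<Rightarrow> walk_eval G v (gauge_act G v g s) k u $$ (p, q))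
      = (\<Sum>r<v i. \<Sum>t<v j. g j $$ (p, t) * (case \<kappa> of (k, u) \<Rightarrow> walk_eval G v s k u $$ (t, r)) * ?gi $$ (r, q))"
      using W_gauge[OF s g path] expand[OF W_carrier[OF s path]] by (simp add: \<kappa> W_def)
  qed
  also have "\<dots> = (\<Sum>r<v i. \<Sum>t<v j. g j $$ (p, t) * linear_extension x (\<lambda>(k, u). walk_eval G v s k u $$ (t, r)) * ?gi $$ (r, q))"
    unfolding linear_extension_def sum_distrib_left sum_distrib_right
    by (subst sum.swap, rule sum.cong[OF refl], subst sum.swap) (simp add: mult_ac)
  also have "\<dots> = (g j * ?E * ?gi) $$ (p, q)"
    unfolding expand[OF Ec] by (intro sum.cong refl) (simp add: bpath_eval_entry)
  finally show "bpath_eval G v (gauge_act G v g s) i j x $$ (p, q) = (g j * ?E * ?gi) $$ (p, q)" .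
qed (use GL_inv_closed[OF gauge_component[OF g ij(1)]] GL_inv_closed[OF gauge_component[OF g ij(2)]] in \<open>auto simp: bpath_eval_def\<close>)

end

section \<open>Determinants of good data are semi-invariant\<close>

context framed_quiver
begin

lemma Psi_entry_cases:
  shows "Psi_entry G v \<Delta> s (Block j k q) (Block i h p) = bpath_eval G v s i j (alpha_VV \<Delta> i h j k) $$ (q, p)"
    and "b_list \<Delta> ! l = (j, b) \<Longrightarrow> Psi_entry G v \<Delta> s (Line l) (Block i h p) =
      scalar_prod b ((snd (snd s) j * bpath_eval G v s i j (alpha_Vb \<Delta> i h l)) *\<^sub>v unit_vec (v i) p)"
    and "a_list \<Delta> ! l' = (i, a) \<Longrightarrow> Psi_entry G v \<Delta> s (Block j k q) (Line l') =
      ((bpath_eval G v s i j (alpha_aV \<Delta> l' j k) * fst (snd s) i) *\<^sub>v a) $ q"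
    and "a_list \<Delta> ! l' = (i, a) \<Longrightarrow> b_list \<Delta> ! l = (j, b) \<Longrightarrow> Psi_entry G v \<Delta> s (Line l) (Line l') =
      scalar_prod b ((snd (snd s) j * bpath_eval G v s i j (alpha_ab \<Delta> l' l) * fst (snd s) i) *\<^sub>v a)"
  by (cases s; simp)+

lemma scalar_prod_mult_unit_vec:
  fixes M :: "complex mat"
  assumes "M \<in> carrier_mat m n" "p < n"
  shows "scalar_prod b (M *\<^sub>v unit_vec n p) = (\<Sum>r<m. b $ r * M $$ (r, p))"
proof -
  have "(M *\<^sub>v unit_vec n p) $ r = M $$ (r, p)" if "r < m" for r
    using assms that by simp
  then show ?thesis
    using assms by (simp add: scalar_prod_def lessThan_atLeast0)
qed

lemma scalar_prod_zero_mat: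
  fixes a :: "complex vec"
  assumes "a \<in> carrier_vec l"
  shows "scalar_prod b (0\<^sub>m k l *\<^sub>v a) = 0"
  using assms by (simp add: scalar_prod_def)

lemma mult_mat_vec_index:
  fixes M :: "complex mat"
  assumes "M \<in> carrier_mat m n" "a \<in> carrier_vec n" "q < m"
  shows "(M *\<^sub>v a) $ q = (\<Sum>r<n. M $$ (q, r) * a $ r)"
  using assms by (simp add: scalar_prod_def lessThan_atLeast0)

lemma bpath_eval_0: "bpath_eval G v s i j 0 = 0\<^sub>m (v j) (v i)"
  by (rule eq_matI) (auto simp: bpath_eval_def)

context
  fixes \<Delta> :: "'h chi_data" and m :: "nat \<Rightarrow> int"
  assumes data: "is_chi_data G d v m \<Delta>" and good: "chi_good G v m \<Delta>"
begin

lemma alpha_path_elements: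
  "i \<in> verts G \<Longrightarrow> h < m_neg \<Delta> i \<Longrightarrow> j \<in> verts G \<Longrightarrow> k < m_pos \<Delta> j \<Longrightarrow> path_element i j (alpha_VV \<Delta> i h j k)"
  "i \<in> verts G \<Longrightarrow> h < m_neg \<Delta> i \<Longrightarrow> l < length (b_list \<Delta>) \<Longrightarrow> path_element i (fst (b_list \<Delta> ! l)) (alpha_Vb \<Delta> i h l)"
  "l' < length (a_list \<Delta>) \<Longrightarrow> j \<in> verts G \<Longrightarrow> k < m_pos \<Delta> j \<Longrightarrow> path_element (fst (a_list \<Delta> ! l')) j (alpha_aV \<Delta> l' j k)"
  "l' < length (a_list \<Delta>) \<Longrightarrow> l < length (b_list \<Delta>) \<Longrightarrow> alpha_ab \<Delta> l' l = 0"
  using data good unfolding is_chi_data_def chi_good_def Let_def path_element_def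
  by (auto simp: Y_blocks_def Z_blocks_def)

lemma framing_vectors:
  "l' < length (a_list \<Delta>) \<Longrightarrow> a_list \<Delta> ! l' = (i, a) \<Longrightarrow> i \<in> verts G \<and> a \<in> carrier_vec (d i)"
  "l < length (b_list \<Delta>) \<Longrightarrow> b_list \<Delta> ! l = (j, b) \<Longrightarrow> j \<in> verts G \<and> b \<in> carrier_vec (d j)"
  using data nth_mem[of l' "a_list \<Delta>"] nth_mem[of l "b_list \<Delta>"] unfolding is_chi_data_def by fastforce+

abbreviation "zs \<equiv> basis_labels G v (m_pos \<Delta>) (length (b_list \<Delta>))"
abbreviation "ys \<equiv> basis_labels G v (m_neg \<Delta>) (length (a_list \<Delta>))"

lemma length_labels: "length zs = length ys"
  using data by (simp add: length_basis_labels is_chi_data_def)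

lemma regular_Psi_entry:
  assumes x: "x \<in> set zs" and y: "y \<in> set ys"
  shows "regular (\<lambda>s. Psi_entry G v \<Delta> s x y)"
proof (cases x)
  case X: (Block j k q)
  then have j: "j \<in> verts G" "k < m_pos \<Delta> j" "q < v j" using x by (auto simp: set_basis_labels)
  show ?thesis
  proof (cases y)
    case (Block i h p)
    then have "i \<in> verts G" "h < m_neg \<Delta> i" "p < v i" using y by (auto simp: set_basis_labels)
    then show ?thesis unfolding X Block Psi_entry_cases(1)
      using j by (intro regular_bpath_eval alpha_path_elements)
  next
    case (Line l')
    then have l': "l' < length (a_list \<Delta>)" using y by (auto simp: set_basis_labels)
    obtain i a where ia: "a_list \<Delta> ! l' = (i, a)" by (cases "a_list \<Delta> ! l'")
    note fr = framing_vectors(1)[OF l' ia] and pe = alpha_path_elements(3)[OF l' j(1,2), unfolded ia fst_conv]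
    let ?E = "\<lambda>s. bpath_eval G v s i j (alpha_aV \<Delta> l' j k)"
    have "regular (\<lambda>s. \<Sum>r<d i. (?E s * fst (snd s) i) $$ (q, r) * a $ r)"
      using fr j pe
      by (intro regular_sum regular_mult regular_const regular_mult_mat[where m = "v j" and k = "v i" and l = "d i"]
          regular_bpath_eval regular_components rep_space_carrier bpath_eval_carrier) auto
    moreover have "Psi_entry G v \<Delta> s x y = (\<Sum>r<d i. (?E s * fst (snd s) i) $$ (q, r) * a $ r)" if s: "s \<in> rep_space G d v" for s
      unfolding X Line Psi_entry_cases(3)[OF ia]
      using fr j by (intro mult_mat_vec_index[of _ "v j"] mult_carrier_mat[OF bpath_eval_carrier rep_space_carrier(2)[OF s]]) auto
    ultimately show ?thesis using regular_cong[of "\<lambda>s. Psi_entry G v \<Delta> s x y"] by simp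
  qed
next
  case X: (Line l)
  then have l: "l < length (b_list \<Delta>)" using x by (auto simp: set_basis_labels)
  obtain j b where jb: "b_list \<Delta> ! l = (j, b)" by (cases "b_list \<Delta> ! l")
  note frb = framing_vectors(2)[OF l jb]
  show ?thesis
  proof (cases y)
    case (Block i h p)
    then have i: "i \<in> verts G" "h < m_neg \<Delta> i" "p < v i" using y by (auto simp: set_basis_labels)
    note pe = alpha_path_elements(2)[OF i(1,2) l, unfolded jb fst_conv]
    let ?E = "\<lambda>s. bpath_eval G v s i j (alpha_Vb \<Delta> i h l)"
    have "regular (\<lambda>s. \<Sum>r<d j. b $ r * (snd (snd s) j * ?E s) $$ (r, p))"
      using frb i pe
      by (intro regular_sum regular_mult regular_const regular_mult_mat[where m = "d j" and k = "v j" and l = "v i"]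
          regular_bpath_eval regular_components rep_space_carrier bpath_eval_carrier) auto
    moreover have "Psi_entry G v \<Delta> s x y = (\<Sum>r<d j. b $ r * (snd (snd s) j * ?E s) $$ (r, p))" if s: "s \<in> rep_space G d v" for s
      unfolding X Block Psi_entry_cases(2)[OF jb]
      using frb i by (intro scalar_prod_mult_unit_vec mult_carrier_mat[OF rep_space_carrier(3)[OF s] bpath_eval_carrier]) auto
    ultimately show ?thesis using regular_cong[of "\<lambda>s. Psi_entry G v \<Delta> s x y"] by simp
  next
    case (Line l')
    then have l': "l' < length (a_list \<Delta>)" using y by (auto simp: set_basis_labels)
    obtain i a where ia: "a_list \<Delta> ! l' = (i, a)" by (cases "a_list \<Delta> ! l'")
    note fr = framing_vectors(1)[OF l' ia]
    have "Psi_entry G v \<Delta> s x y = 0" if s: "s \<in> rep_space G d v" for s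
      using fr frb rep_space_carrier(2)[OF s, of i] rep_space_carrier(3)[OF s, of j]
      unfolding X Line Psi_entry_cases(4)[OF ia jb] alpha_path_elements(4)[OF l' l] bpath_eval_0
      by (simp add: right_mult_zero_mat[of _ "d j" "v j" "v i"] left_mult_zero_mat[of _ "v i" "d i" "d j"] scalar_prod_zero_mat)
    then show ?thesis using regular_cong[of "\<lambda>s. Psi_entry G v \<Delta> s x y" "\<lambda>s. 0"] by simp
  qed
qed

text \<open>The linear map \<open>\<Psi>\<^sub>\<Delta>\<close> is equivariant, since along a path the group elements cancel at all intermediate
vertices.  The fixed framing vectors give the trivial action on the one-dimensional summands.\<close>

lemma Psi_entry_gauge:
  assumes x: "x \<in> set zs" and y: "y \<in> set ys" and s: "s \<in> rep_space G d v" and g: "g \<in> carrier (gauge_group G v)"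
  defines "A \<equiv> g(0 := 1\<^sub>m 1)" and "A' \<equiv> (\<lambda>i. inv\<^bsub>GL (v i)\<^esub> (g i))(0 := 1\<^sub>m 1)"
  shows "Psi_entry G v \<Delta> (gauge_act G v g s) x y = (\<Sum>q<w (label_vertex x). \<Sum>p<w (label_vertex y).
    A (label_vertex x) $$ (label_pos x, q) * Psi_entry G v \<Delta> s (with_pos x q) (with_pos y p) * A' (label_vertex y) $$ (p, label_pos y))"
proof -
  have vert: "i \<noteq> 0" if "i \<in> verts G" for i using that zero_notin_verts by metis
  let ?inv = "\<lambda>i. inv\<^bsub>GL (v i)\<^esub> (g i)"
  note carr = GL_inv_closed[OF gauge_component[OF g]]
  have AV [simp]: "A i = g i" "A' i = ?inv i" if "i \<in> verts G" for i
    using vert[OF that] by (simp_all add: A_def A'_def)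
  have A0 [simp]: "A 0 = 1\<^sub>m 1" "A' 0 = 1\<^sub>m 1" by (simp_all add: A_def A'_def)
  let ?gs = "gauge_act G v g s"
  show ?thesis
  proof (cases x)
    case X: (Block j k q0)
    then have j: "j \<in> verts G" "k < m_pos \<Delta> j" "q0 < v j" using x by (auto simp: set_basis_labels)
    show ?thesis
    proof (cases y)
      case (Block i h p0)
      then have i: "i \<in> verts G" "h < m_neg \<Delta> i" "p0 < v i" using y by (auto simp: set_basis_labels)
      let ?E = "bpath_eval G v s i j (alpha_VV \<Delta> i h j k)"
      have Ec: "?E \<in> carrier_mat (v j) (v i)" by (rule bpath_eval_carrier)
      have "Psi_entry G v \<Delta> ?gs x y = (g j * ?E * ?inv i) $$ (q0, p0)"
        unfolding X Block Psi_entry_cases(1) bpath_eval_gauge[OF alpha_path_elements(1)[OF i(1,2) j(1,2)] i(1) j(1) s g] ..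
      also have "\<dots> = (\<Sum>p<v i. \<Sum>q<v j. g j $$ (q0, q) * ?E $$ (q, p) * ?inv i $$ (p, p0))"
        unfolding sum_mult_mat[OF mult_carrier_mat[OF carr(1)[OF j(1)] Ec] carr(2)[OF i(1)] j(3) i(3)]
        by (intro sum.cong refl) (simp add: sum_mult_mat[OF carr(1)[OF j(1)] Ec j(3)] sum_distrib_right)
      also have "\<dots> = (\<Sum>q<v j. \<Sum>p<v i. g j $$ (q0, q) * ?E $$ (q, p) * ?inv i $$ (p, p0))"
        by (rule sum.swap)
      finally show ?thesis
        using i j by (simp add: X Block Psi_entry_cases(1))
    next
      case (Line l')
      then have l': "l' < length (a_list \<Delta>)" using y by (auto simp: set_basis_labels)
      obtain i a where ia: "a_list \<Delta> ! l' = (i, a)" by (cases "a_list \<Delta> ! l'")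
      have fr: "i \<in> verts G" "a \<in> carrier_vec (d i)" using framing_vectors(1)[OF l' ia] by auto
      note pe = alpha_path_elements(3)[OF l' j(1,2), unfolded ia fst_conv]
      let ?E = "bpath_eval G v s i j (alpha_aV \<Delta> l' j k)" and ?\<gamma> = "fst (snd s) i"
      have Ec: "?E \<in> carrier_mat (v j) (v i)" by (rule bpath_eval_carrier)
      have \<gamma>c: "?\<gamma> \<in> carrier_mat (v i) (d i)" by (rule rep_space_carrier(2)[OF s fr(1)])
      have gauge: "bpath_eval G v ?gs i j (alpha_aV \<Delta> l' j k) * fst (snd ?gs) i = g j * (?E * ?\<gamma>)"
        unfolding bpath_eval_gauge[OF pe fr(1) j(1) s g] gauge_act_components(2)[OF fr(1)]
          mult_mat_cancel_middle[OF mult_carrier_mat[OF carr(1)[OF j(1)] Ec] carr(2,1)[OF fr(1)] GL_inv_cancel(2)[OF gauge_component[OF g fr(1)]] \<gamma>c]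
        by (rule assoc_mult_mat[OF carr(1)[OF j(1)] Ec \<gamma>c])
      have psi: "Psi_entry G v \<Delta> s (Block j k q) (Line l') = (\<Sum>r<d i. (?E * ?\<gamma>) $$ (q, r) * a $ r)" if "q < v j" for q
        unfolding Psi_entry_cases(3)[OF ia] by (rule mult_mat_vec_index[OF mult_carrier_mat[OF Ec \<gamma>c] fr(2) that])
      have "Psi_entry G v \<Delta> ?gs x y = (\<Sum>r<d i. (g j * (?E * ?\<gamma>)) $$ (q0, r) * a $ r)"
        unfolding X Line Psi_entry_cases(3)[OF ia] gauge
        by (rule mult_mat_vec_index[OF mult_carrier_mat[OF carr(1)[OF j(1)] mult_carrier_mat[OF Ec \<gamma>c]] fr(2) j(3)])
      also have "\<dots> = (\<Sum>r<d i. \<Sum>q<v j. g j $$ (q0, q) * ((?E * ?\<gamma>) $$ (q, r) * a $ r))"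
        by (intro sum.cong refl) (simp add: sum_mult_mat[OF carr(1)[OF j(1)] mult_carrier_mat[OF Ec \<gamma>c] j(3)] sum_distrib_right mult.assoc)
      also have "\<dots> = (\<Sum>q<v j. g j $$ (q0, q) * Psi_entry G v \<Delta> s (Block j k q) (Line l'))"
        by (subst sum.swap) (intro sum.cong refl, simp only: lessThan_iff psi sum_distrib_left)
      finally show ?thesis
        using j by (simp add: X Line)
    qed
  next
    case X: (Line l)
    then have l: "l < length (b_list \<Delta>)" using x by (auto simp: set_basis_labels)
    obtain j b where jb: "b_list \<Delta> ! l = (j, b)" by (cases "b_list \<Delta> ! l")
    have frb: "j \<in> verts G" "b \<in> carrier_vec (d j)" using framing_vectors(2)[OF l jb] by auto
    show ?thesis
    proof (cases y)
      case (Block i h p0)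
      then have i: "i \<in> verts G" "h < m_neg \<Delta> i" "p0 < v i" using y by (auto simp: set_basis_labels)
      note pe = alpha_path_elements(2)[OF i(1,2) l, unfolded jb fst_conv]
      let ?E = "bpath_eval G v s i j (alpha_Vb \<Delta> i h l)" and ?\<delta> = "snd (snd s) j"
      have Ec: "?E \<in> carrier_mat (v j) (v i)" by (rule bpath_eval_carrier)
      have \<delta>c: "?\<delta> \<in> carrier_mat (d j) (v j)" by (rule rep_space_carrier(3)[OF s frb(1)])
      have gauge: "snd (snd ?gs) j * bpath_eval G v ?gs i j (alpha_Vb \<Delta> i h l) = ?\<delta> * ?E * ?inv i"
        unfolding bpath_eval_gauge[OF pe i(1) frb(1) s g] gauge_act_components(3)[OF frb(1)]
          assoc_mult_mat[OF carr(1)[OF frb(1)] Ec carr(2)[OF i(1)]]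
          mult_mat_cancel_middle[OF \<delta>c carr(2,1)[OF frb(1)] GL_inv_cancel(2)[OF gauge_component[OF g frb(1)]] mult_carrier_mat[OF Ec carr(2)[OF i(1)]]]
        by (rule assoc_mult_mat[symmetric, OF \<delta>c Ec carr(2)[OF i(1)]])
      have psi: "Psi_entry G v \<Delta> s (Line l) (Block i h p) = (\<Sum>r<d j. b $ r * (?\<delta> * ?E) $$ (r, p))" if "p < v i" for p
        unfolding Psi_entry_cases(2)[OF jb] by (rule scalar_prod_mult_unit_vec[OF mult_carrier_mat[OF \<delta>c Ec] that])
      have "Psi_entry G v \<Delta> ?gs x y = (\<Sum>r<d j. b $ r * (?\<delta> * ?E * ?inv i) $$ (r, p0))"
        unfolding X Block Psi_entry_cases(2)[OF jb] gauge
        by (rule scalar_prod_mult_unit_vec[OF mult_carrier_mat[OF mult_carrier_mat[OF \<delta>c Ec] carr(2)[OF i(1)]] i(3)])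
      also have "\<dots> = (\<Sum>r<d j. \<Sum>p<v i. b $ r * (?\<delta> * ?E) $$ (r, p) * ?inv i $$ (p, p0))"
        by (intro sum.cong refl) (simp add: sum_mult_mat[OF mult_carrier_mat[OF \<delta>c Ec] carr(2)[OF i(1)] _ i(3)] sum_distrib_left mult.assoc)
      also have "\<dots> = (\<Sum>p<v i. Psi_entry G v \<Delta> s (Line l) (Block i h p) * ?inv i $$ (p, p0))"
        by (subst sum.swap) (intro sum.cong refl, simp only: lessThan_iff psi sum_distrib_right)
      finally show ?thesis
        using i by (simp add: X Block)
    next
      case (Line l')
      then have l': "l' < length (a_list \<Delta>)" using y by (auto simp: set_basis_labels)
      obtain i a where ia: "a_list \<Delta> ! l' = (i, a)" by (cases "a_list \<Delta> ! l'")
      have fr: "i \<in> verts G" "a \<in> carrier_vec (d i)" using framing_vectors(1)[OF l' ia] by auto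
      have zero: "Psi_entry G v \<Delta> s' (Line l) (Line l') = 0" if s': "s' \<in> rep_space G d v" for s'
        using fr frb rep_space_carrier(2)[OF s', of i] rep_space_carrier(3)[OF s', of j]
        unfolding Psi_entry_cases(4)[OF ia jb] alpha_path_elements(4)[OF l' l] bpath_eval_0
        by (simp add: right_mult_zero_mat[of _ "d j" "v j" "v i"] left_mult_zero_mat[of _ "v i" "d i" "d j"] scalar_prod_zero_mat)
      show ?thesis
        by (simp add: X Line zero[OF s] zero[OF gauge_act_closed[OF wf_digraph g s]])
    qed
  qed
qed

text \<open>Equivariance reads \<open>\<Psi>(g s) = g\<^sub>Z \<Psi>(s) g\<^sub>Y\<^sup>-\<^sup>1\<close> with block diagonal matrices, so the determinant changes
by the product of \<open>det(g\<^sub>i)\<close> to the power \<open>m\<^sub>i\<^sup>+ - m\<^sub>i\<^sup>- = m\<^sub>i\<close>.\<close>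

lemma f_Delta_semi_invariant: "f_Delta G d v \<Delta> \<in> carrier (semi_invariant_module G d v m)"
proof -
  let ?R = "length zs"
  have Psi: "Psi G v \<Delta> s = mat ?R ?R (\<lambda>(r, c). Psi_entry G v \<Delta> s (zs ! r) (ys ! c))" for s
    unfolding Psi_def Let_def length_labels ..
  have "regular (\<lambda>s. det (Psi G v \<Delta> s))"
    unfolding Psi by (rule regular_det) (simp add: regular_Psi_entry length_labels)
  then have reg: "f_Delta G d v \<Delta> \<in> regular_functions G d v"
    by (simp add: regular_def f_Delta_def)
  have full: "full_blocks w zs" "full_blocks w ys"
    using zero_notin_verts by (auto intro: full_blocks_basis_labels)
  have "f_Delta G d v \<Delta> (gauge_act G v g s) = det_character G m g * f_Delta G d v \<Delta> s"
    if g: "g \<in> carrier (gauge_group G v)" and s: "s \<in> rep_space G d v" for g s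
  proof -
    define A where "A = g(0 := 1\<^sub>m 1)"
    define A' where "A' = (\<lambda>i. inv\<^bsub>GL (v i)\<^esub> (g i))(0 := 1\<^sub>m 1)"
    have ne0: "i \<noteq> 0" if "i \<in> verts G" for i using that zero_notin_verts by metis
    have AA: "A i = g i" "A' i = inv\<^bsub>GL (v i)\<^esub> (g i)" if "i \<in> verts G" for i
      using ne0[OF that] by (simp_all add: A_def A'_def)
    note carr = GL_inv_closed[OF gauge_component[OF g]]
    have "Psi G v \<Delta> (gauge_act G v g s) = block_matrix zs A * Psi G v \<Delta> s * block_matrix ys A'"
    proof (rule eq_matI)
      fix r c assume "r < dim_row (block_matrix zs A * Psi G v \<Delta> s * block_matrix ys A')"
        "c < dim_col (block_matrix zs A * Psi G v \<Delta> s * block_matrix ys A')"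
      then have rc: "r < ?R" "c < ?R" by (simp_all add: block_matrix_def length_labels)
      then have rcs: "zs ! r \<in> set zs" "ys ! c \<in> set ys" by (simp_all add: length_labels)
      let ?P = "Psi_entry G v \<Delta> s" and ?vx = "label_vertex (zs ! r)" and ?vy = "label_vertex (ys ! c)"
      have Pc: "Psi G v \<Delta> s \<in> carrier_mat ?R ?R" by (simp add: Psi)
      have Yc: "block_matrix ys A' \<in> carrier_mat ?R ?R" unfolding length_labels by simp
      have "(block_matrix zs A * Psi G v \<Delta> s * block_matrix ys A') $$ (r, c)
          = (\<Sum>k<?R. (\<Sum>l<?R. block_matrix zs A $$ (r, l) * Psi G v \<Delta> s $$ (l, k)) * block_matrix ys A' $$ (k, c))"
        unfolding sum_mult_mat[OF mult_carrier_mat[OF block_matrix_carrier Pc] Yc rc]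
        by (intro sum.cong refl) (simp add: sum_mult_mat[OF block_matrix_carrier Pc rc(1)])
      also have "\<dots> = (\<Sum>k<?R. (\<Sum>l<?R. if label_block (zs ! r) = label_block (zs ! l)
          then A ?vx $$ (label_pos (zs ! r), label_pos (zs ! l)) * ?P (zs ! l) (ys ! k) else 0) * block_matrix ys A' $$ (k, c))"
        using rc by (intro sum.cong refl arg_cong2[where f = "(*)"]) (auto simp: Psi block_matrix_def)
      also have "\<dots> = (\<Sum>k<?R. (\<Sum>q<w ?vx. A ?vx $$ (label_pos (zs ! r), label_pos (with_pos (zs ! r) q)) * ?P (with_pos (zs ! r) q) (ys ! k))
          * block_matrix ys A' $$ (k, c))"
        unfolding sum_over_block[OF full(1) rc(1), of "\<lambda>x. A ?vx $$ (label_pos (zs ! r), label_pos x) * ?P x (ys ! _)"] ..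
      also have "\<dots> = (\<Sum>k<length ys. if label_block (ys ! c) = label_block (ys ! k)
          then (\<Sum>q<w ?vx. A ?vx $$ (label_pos (zs ! r), label_pos (with_pos (zs ! r) q)) * ?P (with_pos (zs ! r) q) (ys ! k))
             * A' ?vy $$ (label_pos (ys ! k), label_pos (ys ! c)) else 0)"
      proof (rule sum.cong)
        fix k assume "k \<in> {..<length ys}"
        then have k: "k < length ys" "c < length ys" using rc length_labels by simp_all
        have "block_matrix ys A' $$ (k, c) = (if label_block (ys ! c) = label_block (ys ! k)
            then A' ?vy $$ (label_pos (ys ! k), label_pos (ys ! c)) else 0)"
          using k label_vertex_cong[of "ys ! k" "ys ! c"] by (simp add: block_matrix_def)
        then show "(\<Sum>q<w ?vx. A ?vx $$ (label_pos (zs ! r), label_pos (with_pos (zs ! r) q)) * ?P (with_pos (zs ! r) q) (ys ! k))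
          * block_matrix ys A' $$ (k, c)
          = (if label_block (ys ! c) = label_block (ys ! k)
          then (\<Sum>q<w ?vx. A ?vx $$ (label_pos (zs ! r), label_pos (with_pos (zs ! r) q)) * ?P (with_pos (zs ! r) q) (ys ! k))
             * A' ?vy $$ (label_pos (ys ! k), label_pos (ys ! c)) else 0)"
          by (simp only: if_distrib[of "\<lambda>x. _ * x"] mult_zero_right)
      qed (simp add: length_labels)
      also have "\<dots> = (\<Sum>p<w ?vy. (\<Sum>q<w ?vx. A ?vx $$ (label_pos (zs ! r), label_pos (with_pos (zs ! r) q)) * ?P (with_pos (zs ! r) q) (with_pos (ys ! c) p))
             * A' ?vy $$ (label_pos (with_pos (ys ! c) p), label_pos (ys ! c)))"
        by (rule sum_over_block[OF full(2)]) (use rc length_labels in simp)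
      also have "\<dots> = (\<Sum>q<w ?vx. \<Sum>p<w ?vy. A ?vx $$ (label_pos (zs ! r), label_pos (with_pos (zs ! r) q)) *
          ?P (with_pos (zs ! r) q) (with_pos (ys ! c) p) * A' ?vy $$ (label_pos (with_pos (ys ! c) p), label_pos (ys ! c)))"
        unfolding sum_distrib_right by (rule sum.swap)
      also have "\<dots> = (\<Sum>q<w ?vx. \<Sum>p<w ?vy. A ?vx $$ (label_pos (zs ! r), q) *
          ?P (with_pos (zs ! r) q) (with_pos (ys ! c) p) * A' ?vy $$ (p, label_pos (ys ! c)))"
      proof (intro sum.cong refl)
        fix q p assume "q \<in> {..<w ?vx}" "p \<in> {..<w ?vy}"
        then have "label_pos (with_pos (zs ! r) q) = q" "label_pos (with_pos (ys ! c) p) = p"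
          by (cases "zs ! r"; simp) (use \<open>p \<in> {..<w ?vy}\<close> in \<open>cases "ys ! c"; simp\<close>)
        then show "A ?vx $$ (label_pos (zs ! r), label_pos (with_pos (zs ! r) q)) *
          ?P (with_pos (zs ! r) q) (with_pos (ys ! c) p) * A' ?vy $$ (label_pos (with_pos (ys ! c) p), label_pos (ys ! c))
          = A ?vx $$ (label_pos (zs ! r), q) * ?P (with_pos (zs ! r) q) (with_pos (ys ! c) p) * A' ?vy $$ (p, label_pos (ys ! c))"
          by simp
      qed
      also have "\<dots> = Psi_entry G v \<Delta> (gauge_act G v g s) (zs ! r) (ys ! c)"
        unfolding A_def A'_def by (rule Psi_entry_gauge[OF rcs s g, symmetric])
      also have "\<dots> = Psi G v \<Delta> (gauge_act G v g s) $$ (r, c)" using rc by (simp add: Psi)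
      finally show "Psi G v \<Delta> (gauge_act G v g s) $$ (r, c) = (block_matrix zs A * Psi G v \<Delta> s * block_matrix ys A') $$ (r, c)" ..
    qed (simp_all add: Psi block_matrix_def length_labels)
    also have "det \<dots> = det (block_matrix zs A) * det (Psi G v \<Delta> s) * det (block_matrix ys A')"
    proof -
      have c: "block_matrix zs A \<in> carrier_mat ?R ?R" "Psi G v \<Delta> s \<in> carrier_mat ?R ?R" "block_matrix ys A' \<in> carrier_mat ?R ?R"
        using length_labels by (simp_all add: Psi block_matrix_def)
      show ?thesis unfolding det_mult[OF mult_carrier_mat[OF c(1,2)] c(3)] det_mult[OF c(1,2)] ..
    qed
    also have "det (block_matrix zs A) = (\<Prod>i\<in>verts G. det (A i) ^ m_pos \<Delta> i)"
      using AA carr by (intro det_block_matrix) (auto simp: A_def)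
    also have "det (block_matrix ys A') = (\<Prod>i\<in>verts G. det (A' i) ^ m_neg \<Delta> i)"
      using AA carr by (intro det_block_matrix) (auto simp: A'_def)
    also have "(\<Prod>i\<in>verts G. det (A i) ^ m_pos \<Delta> i) * det (Psi G v \<Delta> s) * (\<Prod>i\<in>verts G. det (A' i) ^ m_neg \<Delta> i)
        = (\<Prod>i\<in>verts G. det (A i) ^ m_pos \<Delta> i * det (A' i) ^ m_neg \<Delta> i) * det (Psi G v \<Delta> s)"
      by (simp add: prod.distrib)
    also have "(\<Prod>i\<in>verts G. det (A i) ^ m_pos \<Delta> i * det (A' i) ^ m_neg \<Delta> i) = det_character G m g"
      unfolding det_character_def
    proof (intro prod.cong refl)
      fix i assume i: "i \<in> verts G"
      note gi = gauge_component[OF g i]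
      have inv: "det (g i) * det (A' i) = 1"
        using det_mult[OF carr[OF i]] GL_inv_cancel(1)[OF gi] AA[OF i] by simp
      then have nz: "det (g i) \<noteq> 0" by auto
      have A': "det (A' i) = inverse (det (g i))" using inv nz by (metis inverse_unique)
      have mi: "m i = int (m_pos \<Delta> i) - int (m_neg \<Delta> i)" using data i by (simp add: is_chi_data_def)
      show "det (A i) ^ m_pos \<Delta> i * det (A' i) ^ m_neg \<Delta> i = det (g i) powi m i"
        unfolding A' AA(1)[OF i] mi power_int_diff[OF disjI1[OF nz]] by (simp add: power_inverse divide_inverse)
    qed
    finally show ?thesis using s gauge_act_closed[OF wf_digraph g s] by (simp add: f_Delta_def)
  qed
  then show ?thesis using reg by (simp add: semi_invariant_module_carrier)
qed

end

end

section \<open>Bracket graphs as sums of determinants of good data\<close>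

context framed_quiver
begin

definition good_functions :: "(nat \<Rightarrow> int) \<Rightarrow> ('h point \<Rightarrow> complex) set" where
  "good_functions m = {f_Delta G d v \<Delta> | \<Delta>. is_chi_data G d v m \<Delta> \<and> chi_good G v m \<Delta>}"

lemma good_functions_semi_invariant: "good_functions m \<subseteq> carrier (semi_invariant_module G d v m)"
  by (auto simp: good_functions_def f_Delta_semi_invariant)

text \<open>Membership of a formula in the span of the good functions.  Elements of the module are undefined
outside the space of matrices, whence the restriction.\<close>

definition generated :: "(nat \<Rightarrow> int) \<Rightarrow> ('h point \<Rightarrow> complex) \<Rightarrow> bool" where
  "generated m f \<longleftrightarrow> restrict f (rep_space G d v) \<in>
     LinearCombinations.module.span (invariant_ring G d v) (semi_invariant_module G d v m) (good_functions m)"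

lemma span_submodule:
  "LinearCombinations.submodule (invariant_ring G d v)
     (LinearCombinations.module.span (invariant_ring G d v) (semi_invariant_module G d v m) (good_functions m))
     (semi_invariant_module G d v m)"
  by (rule LinearCombinations.module.span_is_submodule[OF semi_invariant_module[OF wf_digraph] good_functions_semi_invariant])

lemma generated_cong: "(\<And>s. s \<in> rep_space G d v \<Longrightarrow> f s = f' s) \<Longrightarrow> generated m f \<longleftrightarrow> generated m f'"
  unfolding generated_def by (auto cong: restrict_cong)

lemma generated_zero: "generated m (\<lambda>s. 0)"
  using span_submodule[of m] unfolding LinearCombinations.submodule_def generated_def
  by (simp add: semi_invariant_module_ops)

lemma generated_add:
  assumes "generated m f" "generated m f'"
  shows "generated m (\<lambda>s. f s + f' s)"
proof -
  have "(\<lambda>s\<in>rep_space G d v. f s + f' s)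
      = restrict f (rep_space G d v) \<oplus>\<^bsub>semi_invariant_module G d v m\<^esub> restrict f' (rep_space G d v)"
    by (simp add: semi_invariant_module_ops cong: restrict_cong)
  then show ?thesis
    using LinearCombinations.submodule.m_closed[OF span_submodule] assms unfolding generated_def by simp
qed

lemma generated_mult:
  assumes "invariant J" "generated m f"
  shows "generated m (\<lambda>s. J s * f s)"
proof -
  have "(\<lambda>s\<in>rep_space G d v. J s * f s)
      = restrict J (rep_space G d v) \<odot>\<^bsub>semi_invariant_module G d v m\<^esub> restrict f (rep_space G d v)"
    by (simp add: semi_invariant_module_ops cong: restrict_cong)
  then show ?thesis
    using LinearCombinations.submodule.smult_closed[OF span_submodule invariant_in_ring[OF assms(1)]] assms(2)
    unfolding generated_def by simp
qed

lemma generated_scale: "generated m f \<Longrightarrow> generated m (\<lambda>s. c * f s)"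
  using generated_mult[of "\<lambda>s. c"] by simp

lemma generated_sum: "(\<And>i. i \<in> I \<Longrightarrow> generated m (f i)) \<Longrightarrow> generated m (\<lambda>s. \<Sum>i\<in>I. f i s)"
  by (induction I rule: infinite_finite_induct) (auto intro: generated_zero generated_add)

lemma generated_good:
  assumes "is_chi_data G d v m \<Delta>" "chi_good G v m \<Delta>"
  shows "generated m (\<lambda>s. det (Psi G v \<Delta> s))"
proof -
  have "f_Delta G d v \<Delta> \<in> good_functions m" using assms by (auto simp: good_functions_def)
  then show ?thesis
    using LinearCombinations.module.in_own_span[OF semi_invariant_module[OF wf_digraph] good_functions_semi_invariant]
    unfolding generated_def f_Delta_def by blast
qed

fun label_end :: "(nat \<times> nat) list \<Rightarrow> basis_label \<Rightarrow> endpoint" where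
  "label_end fr (Block i h p) = Vtx i"
| "label_end fr (Line l) = Frm (fst (fr ! l)) (snd (fr ! l))"

lemma label_end_cong: "label_block x = label_block y \<Longrightarrow> label_end fr x = label_end fr y"
  by (cases x; cases y) auto

lemma linear_extension_single_sum:
  assumes "finite F"
  shows "linear_extension (\<Sum>e\<in>F. Poly_Mapping.single (\<kappa> e) 1) f = (\<Sum>e\<in>F. f (\<kappa> e))"
proof -
  let ?x = "\<Sum>e\<in>F. Poly_Mapping.single (\<kappa> e) (1 :: complex)"
  have look: "Poly_Mapping.lookup ?x k = (\<Sum>e\<in>F. of_bool (\<kappa> e = k))" for k
    by (simp add: lookup_sum lookup_single when_def of_bool_def)
  have keys: "Poly_Mapping.keys ?x \<subseteq> \<kappa> ` F"
  proof
    fix k assume k: "k \<in> Poly_Mapping.keys ?x"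
    show "k \<in> \<kappa> ` F"
    proof (rule ccontr)
      assume "k \<notin> \<kappa> ` F"
      then have "Poly_Mapping.lookup ?x k = 0" unfolding look by (intro sum.neutral) auto
      then show False using k by (simp add: in_keys_iff)
    qed
  qed
  have "linear_extension ?x f = (\<Sum>k\<in>\<kappa> ` F. Poly_Mapping.lookup ?x k * f k)"
    unfolding linear_extension_def using assms keys by (intro sum.mono_neutral_left) (auto simp: in_keys_iff)
  also have "\<dots> = (\<Sum>e\<in>F. \<Sum>k\<in>\<kappa> ` F. if k = \<kappa> e then f k else 0)"
    unfolding look sum_distrib_right by (subst sum.swap) (intro sum.cong refl, auto)
  also have "\<dots> = (\<Sum>e\<in>F. f (\<kappa> e))"
    using assms by (intro sum.cong refl) simp
  finally show ?thesis .
qed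

text \<open>A bracket graph of weight \<open>m\<close>: its edges \<open>e < R\<close> carry paths \<open>hs e\<close>, edge \<open>e\<close> starts at the basis vector
\<open>ys ! \<tau> e\<close> of \<open>Y\<close> and ends at the basis vector \<open>zs ! e\<close> of \<open>Z\<close>, every basis vector is used once, and no
edge joins two framing vectors.  The lists \<open>la\<close> and \<open>lb\<close> name the framing vectors of the
one-dimensional summands.  Its value is the product of the matrix entries along the edges,
antisymmetrized over the coordinates inside every block of \<open>Y\<close> and of \<open>Z\<close>.\<close>

context
  fixes m :: "nat \<Rightarrow> int" and la lb :: "(nat \<times> nat) list" and \<tau> :: "nat \<Rightarrow> nat" and hs :: "nat \<Rightarrow> 'h list" and R :: nat
  fixes ys zs :: "basis_label list"
  defines "ys \<equiv> basis_labels G v (\<lambda>i. nat (- m i)) (length la)"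
    and "zs \<equiv> basis_labels G v (\<lambda>i. nat (m i)) (length lb)"
  assumes R: "length ys = R" "length zs = R" and \<tau>: "\<tau> permutes {..<R}"
    and edges: "\<And>e. e < R \<Longrightarrow> epath (label_end la (ys ! \<tau> e)) (hs e) (label_end lb (zs ! e))"
    and no_lines: "\<And>e l l'. e < R \<Longrightarrow> ys ! \<tau> e = Line l \<Longrightarrow> zs ! e \<noteq> Line l'"
    and la: "\<And>i r. (i, r) \<in> set la \<Longrightarrow> i \<in> verts G \<and> r < d i"
    and lb: "\<And>i r. (i, r) \<in> set lb \<Longrightarrow> i \<in> verts G \<and> r < d i"
begin

definition blocks_edges :: "nat set \<Rightarrow> (nat \<times> nat) + nat \<Rightarrow> (nat \<times> nat) + nat \<Rightarrow> nat set" where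
  "blocks_edges T y z = {e \<in> T. e < R \<and> label_block (ys ! \<tau> e) = y \<and> label_block (zs ! e) = z}"

definition edge_sum :: "nat set \<Rightarrow> nat \<Rightarrow> (nat \<times> nat) + nat \<Rightarrow> (nat \<times> nat) + nat \<Rightarrow> 'h bpath_alg" where
  "edge_sum T i y z = (\<Sum>e\<in>blocks_edges T y z. Poly_Mapping.single (i, map Inl (hs e)) 1)"

text \<open>Every edge contributes its path to the element between the two summands that it joins, and parallel
edges are added up.  Letting \<open>T\<close> vary over the sets of edges gives the terms of an inclusion-exclusion.\<close>

definition graph_data :: "nat set \<Rightarrow> 'h chi_data" where
  "graph_data T = \<lparr>m_pos = (\<lambda>i. nat (m i)), m_neg = (\<lambda>i. nat (- m i)),
     a_list = map (\<lambda>(i, r). (i, unit_vec (d i) r)) la, b_list = map (\<lambda>(i, r). (i, unit_vec (d i) r)) lb,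
     alpha_VV = (\<lambda>i h j k. edge_sum T i (Inl (i, h)) (Inl (j, k))),
     alpha_Vb = (\<lambda>i h l. edge_sum T i (Inl (i, h)) (Inr l)),
     alpha_aV = (\<lambda>l j k. edge_sum T (fst (la ! l)) (Inr l) (Inl (j, k))),
     alpha_ab = (\<lambda>l l'. edge_sum T (fst (la ! l)) (Inr l) (Inr l'))\<rparr>"

lemma graph_data_simps [simp]:
  "m_pos (graph_data T) = (\<lambda>i. nat (m i))" "m_neg (graph_data T) = (\<lambda>i. nat (- m i))"
  "a_list (graph_data T) = map (\<lambda>(i, r). (i, unit_vec (d i) r)) la"
  "b_list (graph_data T) = map (\<lambda>(i, r). (i, unit_vec (d i) r)) lb"
  "alpha_VV (graph_data T) i h j k = edge_sum T i (Inl (i, h)) (Inl (j, k))"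
  "alpha_Vb (graph_data T) i h l = edge_sum T i (Inl (i, h)) (Inr l)"
  "alpha_aV (graph_data T) l j k = edge_sum T (fst (la ! l)) (Inr l) (Inl (j, k))"
  "alpha_ab (graph_data T) l l' = edge_sum T (fst (la ! l)) (Inr l) (Inr l')"
  by (simp_all add: graph_data_def)

lemma finite_blocks_edges [simp]: "finite (blocks_edges T y z)"
  by (rule finite_subset[of _ "{..<R}"]) (auto simp: blocks_edges_def)

lemma blocks_edges_path:
  assumes "e \<in> blocks_edges T (label_block y) (label_block z)"
  shows "epath (label_end la y) (hs e) (label_end lb z)"
proof -
  have "e < R" "label_block (ys ! \<tau> e) = label_block y" "label_block (zs ! e) = label_block z"
    using assms by (auto simp: blocks_edges_def)
  then show ?thesis using edges[of e] label_end_cong[of "ys ! \<tau> e" y la] label_end_cong[of "zs ! e" z lb] by simp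
qed

lemma edge_sum_keys:
  assumes "\<kappa> \<in> Poly_Mapping.keys (edge_sum T i y z)"
  obtains e where "e \<in> blocks_edges T y z" "\<kappa> = (i, map Inl (hs e))"
proof -
  have "\<kappa> \<in> (\<Union>e\<in>blocks_edges T y z. Poly_Mapping.keys (Poly_Mapping.single (i, map Inl (hs e)) (1 :: complex)))"
    by (rule subsetD[OF keys_sum assms[unfolded edge_sum_def]])
  then obtain e where "e \<in> blocks_edges T y z"
      "\<kappa> \<in> Poly_Mapping.keys (Poly_Mapping.single (i, map Inl (hs e)) (1 :: complex))" by (rule UN_E)
  then show thesis using that by simp
qed

lemma edge_sum_path_element:
  "path_element (evert (label_end la y)) (evert (label_end lb z)) (edge_sum T (evert (label_end la y)) (label_block y) (label_block z))"
  (is "path_element ?i ?j ?x")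
proof -
  have ex: "\<exists>hs. \<kappa> = (?i, map Inl hs) \<and> path ?i hs ?j" if "\<kappa> \<in> Poly_Mapping.keys ?x" for \<kappa>
  proof -
    from edge_sum_keys[OF that] obtain e where e: "e \<in> blocks_edges T (label_block y) (label_block z)" "\<kappa> = (?i, map Inl (hs e))" .
    show ?thesis using blocks_edges_path[OF e(1)] e(2) unfolding epath_def by blast
  qed
  have "case \<kappa> of (k, u) \<Rightarrow> (k = ?i \<and> pre_digraph.awalk (loop_quiver G) ?i u ?j) \<and> set u \<subseteq> range Inl"
    if \<kappa>: "\<kappa> \<in> Poly_Mapping.keys ?x" for \<kappa>
  proof -
    from ex[OF \<kappa>] obtain hs where "\<kappa> = (?i, map Inl hs)" "path ?i hs ?j" by blast
    then show ?thesis by (simp add: awalk_map_Inl image_subset_iff)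
  qed
  then show ?thesis
    unfolding path_element_def has_type_def in_path_algebra_def by fast
qed

lemma bpath_eval_edge_sum:
  assumes "p < v j" "q < v i"
  shows "bpath_eval G v s i j (edge_sum T i y z) $$ (p, q) = (\<Sum>e\<in>blocks_edges T y z. W s i (hs e) $$ (p, q))"
  unfolding bpath_eval_entry[OF assms] edge_sum_def linear_extension_single_sum[OF finite_blocks_edges] by (simp add: W_def)

lemma edge_sum_nonzero: "edge_sum T i y z \<noteq> 0 \<Longrightarrow> blocks_edges T y z \<noteq> {}"
  by (auto simp: edge_sum_def)

lemma Psi_entry_graph_data:
  assumes x: "z \<in> set zs" and y: "y \<in> set ys" and s: "s \<in> rep_space G d v"
  shows "Psi_entry G v (graph_data T) s z y = (\<Sum>e\<in>blocks_edges T (label_block y) (label_block z).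
    edge s (label_end la y) (hs e) (label_end lb z) (label_pos z) (label_pos y))"
proof -
  have bp: "epath (label_end la y) (hs e) (label_end lb z)"
    if "e \<in> blocks_edges T (label_block y) (label_block z)" for e
    by (rule blocks_edges_path[OF that])
  show ?thesis
  proof (cases z)
    case Z: (Block j k q)
    then have j: "j \<in> verts G" "q < v j" using x by (auto simp: zs_def set_basis_labels)
    show ?thesis
    proof (cases y)
      case (Block i h p)
      then have i: "i \<in> verts G" "p < v i" using y by (auto simp: ys_def set_basis_labels)
      show ?thesis using i j by (simp add: Z Block Psi_entry_cases(1) bpath_eval_edge_sum)
    next
      case (Line l)
      then have l: "l < length la" using y by (auto simp: ys_def set_basis_labels)
      obtain i r where ir: "la ! l = (i, r)" by (cases "la ! l")
      have i: "i \<in> verts G" "r < d i" using la[of i r] nth_mem[OF l] ir by auto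
      let ?B = "blocks_edges T (Inr l) (Inl (j, k))" and ?E = "bpath_eval G v s i j (edge_sum T i (Inr l) (Inl (j, k)))"
      have al: "a_list (graph_data T) ! l = (i, unit_vec (d i) r)" using l ir by simp
      have \<gamma>: "fst (snd s) i \<in> carrier_mat (v i) (d i)" by (rule rep_space_carrier(2)[OF s i(1)])
      have Wc: "W s i (hs e) \<in> carrier_mat (v j) (v i)" if "e \<in> ?B" for e
        using bp[of e] that ir by (intro W_carrier[OF s]) (simp add: Z Line epath_def)
      have "Psi_entry G v (graph_data T) s z y = (\<Sum>t<d i. (?E * fst (snd s) i) $$ (q, t) * unit_vec (d i) r $ t)"
        unfolding Z Line Psi_entry_cases(3)[OF al] using ir j
        by (simp add: mult_mat_vec_index[OF mult_carrier_mat[OF bpath_eval_carrier \<gamma>] unit_vec_carrier])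
      also have "\<dots> = (\<Sum>t<d i. if t = r then (?E * fst (snd s) i) $$ (q, r) else 0)"
        using i by (intro sum.cong refl) auto
      also have "\<dots> = (?E * fst (snd s) i) $$ (q, r)" using i by simp
      also have "\<dots> = (\<Sum>t<v i. (\<Sum>e\<in>?B. W s i (hs e) $$ (q, t)) * fst (snd s) i $$ (t, r))"
        unfolding sum_mult_mat[OF bpath_eval_carrier \<gamma> j(2) i(2)]
        by (intro sum.cong refl) (simp add: bpath_eval_edge_sum[OF j(2)])
      also have "\<dots> = (\<Sum>e\<in>?B. \<Sum>t<v i. W s i (hs e) $$ (q, t) * fst (snd s) i $$ (t, r))"
        unfolding sum_distrib_right by (rule sum.swap)
      also have "\<dots> = (\<Sum>e\<in>?B. (W s i (hs e) * fst (snd s) i) $$ (q, r))"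
        by (intro sum.cong refl) (simp add: sum_mult_mat[OF Wc \<gamma> j(2) i(2)])
      finally show ?thesis by (simp add: Z Line ir)
    qed
  next
    case Z: (Line l)
    then have l: "l < length lb" using x by (auto simp: zs_def set_basis_labels)
    obtain j r where jr: "lb ! l = (j, r)" by (cases "lb ! l")
    have j: "j \<in> verts G" "r < d j" using lb[of j r] nth_mem[OF l] jr by auto
    have bl: "b_list (graph_data T) ! l = (j, unit_vec (d j) r)" using l jr by simp
    show ?thesis
    proof (cases y)
      case (Block i h p)
      then have i: "i \<in> verts G" "p < v i" using y by (auto simp: ys_def set_basis_labels)
      let ?B = "blocks_edges T (Inl (i, h)) (Inr l)" and ?E = "bpath_eval G v s i j (edge_sum T i (Inl (i, h)) (Inr l))"
      have \<delta>: "snd (snd s) j \<in> carrier_mat (d j) (v j)" by (rule rep_space_carrier(3)[OF s j(1)])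
      have Wc: "W s i (hs e) \<in> carrier_mat (v j) (v i)" if "e \<in> ?B" for e
        using bp[of e] that jr by (intro W_carrier[OF s]) (simp add: Z Block epath_def)
      have "Psi_entry G v (graph_data T) s z y = (\<Sum>t<d j. unit_vec (d j) r $ t * (snd (snd s) j * ?E) $$ (t, p))"
        unfolding Z Block Psi_entry_cases(2)[OF bl]
        by (simp add: scalar_prod_mult_unit_vec[OF mult_carrier_mat[OF \<delta> bpath_eval_carrier] i(2)])
      also have "\<dots> = (\<Sum>t<d j. if t = r then (snd (snd s) j * ?E) $$ (r, p) else 0)"
        using j by (intro sum.cong refl) auto
      also have "\<dots> = (snd (snd s) j * ?E) $$ (r, p)" using j by simp
      also have "\<dots> = (\<Sum>t<v j. snd (snd s) j $$ (r, t) * (\<Sum>e\<in>?B. W s i (hs e) $$ (t, p)))"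
        unfolding sum_mult_mat[OF \<delta> bpath_eval_carrier j(2) i(2)]
        by (intro sum.cong refl) (simp add: bpath_eval_edge_sum[OF _ i(2)])
      also have "\<dots> = (\<Sum>e\<in>?B. \<Sum>t<v j. snd (snd s) j $$ (r, t) * W s i (hs e) $$ (t, p))"
        unfolding sum_distrib_left by (rule sum.swap)
      also have "\<dots> = (\<Sum>e\<in>?B. (snd (snd s) j * W s i (hs e)) $$ (r, p))"
        by (intro sum.cong refl) (simp add: sum_mult_mat[OF \<delta> Wc j(2) i(2)])
      finally show ?thesis by (simp add: Z Block jr)
    next
      case (Line l')
      then have l': "l' < length la" using y by (auto simp: ys_def set_basis_labels)
      obtain i r' where ir: "la ! l' = (i, r')" by (cases "la ! l'")
      have i: "i \<in> verts G" "r' < d i" using la[of i r'] nth_mem[OF l'] ir by auto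
      have al: "a_list (graph_data T) ! l' = (i, unit_vec (d i) r')" using l' ir by simp
      have empty: "blocks_edges T (Inr l') (Inr l) = {}"
      proof -
        have "False" if "e \<in> blocks_edges T (Inr l') (Inr l)" for e
        proof -
          have "e < R" "ys ! \<tau> e = Line l'" "zs ! e = Line l"
            using that by (auto simp: blocks_edges_def intro: label_eqI elim!: label_block.elims)
          then show False using no_lines by blast
        qed
        then show ?thesis by blast
      qed
      have "Psi_entry G v (graph_data T) s z y = 0"
        using rep_space_carrier(2)[OF s i(1)] rep_space_carrier(3)[OF s j(1)]
        unfolding Z Line Psi_entry_cases(4)[OF al bl]
        by (simp add: edge_sum_def empty bpath_eval_0 right_mult_zero_mat[of _ "d j" "v j" "v i"]
            left_mult_zero_mat[of _ "v i" "d i" "d j"] scalar_prod_zero_mat)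
      then show ?thesis by (simp add: Z Line empty)
    qed
  qed
qed

lemma card_edges_at_block:
  shows "card {e. e < R \<and> label_block (ys ! \<tau> e) = \<beta>} \<le> (case \<beta> of Inl (i, h) \<Rightarrow> v i | Inr l \<Rightarrow> 1)"
    and "card {e. e < R \<and> label_block (zs ! e) = \<beta>} \<le> (case \<beta> of Inl (i, h) \<Rightarrow> v i | Inr l \<Rightarrow> 1)"
proof -
  have "\<tau> e < R" if "e < R" for e using permutes_in_image[OF \<tau>, of e] that by simp
  then have "card {e. e < R \<and> label_block (ys ! \<tau> e) = \<beta>} \<le> card {r. r < R \<and> label_block (ys ! r) = \<beta>}"
    using permutes_inj[OF \<tau>] by (intro card_inj_on_le[of \<tau>]) (auto simp: inj_on_def)
  also have "\<dots> \<le> (case \<beta> of Inl (i, h) \<Rightarrow> v i | Inr l \<Rightarrow> 1)"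
    using card_block_le[OF finite_verts, where v = v] unfolding R(1)[symmetric] ys_def .
  finally show "card {e. e < R \<and> label_block (ys ! \<tau> e) = \<beta>} \<le> (case \<beta> of Inl (i, h) \<Rightarrow> v i | Inr l \<Rightarrow> 1)" .
  show "card {e. e < R \<and> label_block (zs ! e) = \<beta>} \<le> (case \<beta> of Inl (i, h) \<Rightarrow> v i | Inr l \<Rightarrow> 1)"
    using card_block_le[OF finite_verts, where v = v] unfolding R(2)[symmetric] zs_def .
qed

lemma card_sum_type_le:
  fixes f :: "'e \<Rightarrow> 'x + 'y"
  assumes "finite E" "Inl ` X \<subseteq> f ` E" "Inr ` Y \<subseteq> f ` E"
  shows "card X + card Y \<le> card E"
proof -
  have fin: "finite (Inl ` X :: ('x + 'y) set)" "finite (Inr ` Y :: ('x + 'y) set)"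
    using finite_subset[OF assms(2)] finite_subset[OF assms(3)] assms(1) by blast+
  have "card X + card Y = card (Inl ` X \<union> Inr ` Y)"
    using fin by (subst card_Un_disjoint) (auto simp: card_image)
  also have "\<dots> \<le> card (f ` E)" using assms by (intro card_mono) auto
  also have "\<dots> \<le> card E" using assms(1) by (rule card_image_le)
  finally show ?thesis .
qed

lemma graph_data_chi_data: "is_chi_data G d v m (graph_data T)"
proof -
  have sizes: "(\<Sum>i\<in>verts G. nat (- m i) * v i) + length la = (\<Sum>i\<in>verts G. nat (m i) * v i) + length lb"
    using R unfolding ys_def zs_def by (simp add: length_basis_labels)
  note pe = edge_sum_path_element[unfolded path_element_def]
  have VV: "has_type G i j (edge_sum T i (Inl (i, h)) (Inl (j, k)))" for i h j k
    using pe[of "Block i h 0" "Block j k 0" T] by simp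
  have Vb: "has_type G i (fst (lb ! l)) (edge_sum T i (Inl (i, h)) (Inr l))" for i h l
    using pe[of "Block i h 0" "Line l" T] by simp
  have aV: "has_type G (fst (la ! l)) j (edge_sum T (fst (la ! l)) (Inr l) (Inl (j, k)))" for l j k
    using pe[of "Line l" "Block j k 0" T] by simp
  have ab: "has_type G (fst (la ! l)) (fst (lb ! l')) (edge_sum T (fst (la ! l)) (Inr l) (Inr l'))" for l l'
    using pe[of "Line l" "Line l'" T] by simp
  have fsts: "fst (case x of (i, r) \<Rightarrow> (i, unit_vec (d i) r)) = fst x" for x :: "nat \<times> nat"
    by (cases x) simp
  show ?thesis
    unfolding is_chi_data_def graph_data_simps
    using sizes la lb VV Vb aV ab by (auto simp: fsts)
qed

text \<open>A block at vertex \<open>i\<close> contains \<open>v i\<close> basis vectors and so meets at most \<open>v i\<close> edges, and a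
one-dimensional summand meets at most one; this bounds the numbers of nonzero elements.  The elements
between two one-dimensional summands vanish because no edge joins two framing vectors, and only one
of \<open>m\<^sub>i\<^sup>+\<close> and \<open>m\<^sub>i\<^sup>-\<close> is nonzero.\<close>

lemma graph_data_good: "chi_good G v m (graph_data T)"
proof -
  note pe = edge_sum_path_element[unfolded path_element_def]
  have VV: "in_path_algebra (edge_sum T i (Inl (i, h)) (Inl (j, k)))" for i h j k
    using pe[of "Block i h 0" "Block j k 0" T] by simp
  have Vb: "in_path_algebra (edge_sum T i (Inl (i, h)) (Inr l))" for i h l
    using pe[of "Block i h 0" "Line l" T] by simp
  have aV: "in_path_algebra (edge_sum T (fst (la ! l)) (Inr l) (Inl (j, k)))" for l j k
    using pe[of "Line l" "Block j k 0" T] by simp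
  have "blocks_edges T (Inr l) (Inr l') = {}" for l l'
  proof -
    have False if "e \<in> blocks_edges T (Inr l) (Inr l')" for e
    proof -
      have "e < R" "ys ! \<tau> e = Line l" "zs ! e = Line l'"
        using that by (auto simp: blocks_edges_def elim!: label_block.elims)
      then show False using no_lines by blast
    qed
    then show ?thesis by blast
  qed
  then have ab: "edge_sum T (fst (la ! l)) (Inr l) (Inr l') = 0" for l l'
    by (simp add: edge_sum_def)
  have VV': "in_path_algebra (edge_sum T i (Inl (i, h)) (Inl x))" for i h x
    using VV by (cases x) simp
  have ab': "in_path_algebra (0 :: 'h bpath_alg)" by (simp add: in_path_algebra_def)
  let ?Ey = "\<lambda>\<beta>. {e. e < R \<and> label_block (ys ! \<tau> e) = \<beta>}" and ?Ez = "\<lambda>\<beta>. {e. e < R \<and> label_block (zs ! e) = \<beta>}"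
  have toz: "z \<in> (\<lambda>e. label_block (zs ! e)) ` ?Ey y" and toy: "y \<in> (\<lambda>e. label_block (ys ! \<tau> e)) ` ?Ez z"
    if "edge_sum T i y z \<noteq> 0" for i y z
    using edge_sum_nonzero[OF that] by (auto simp: blocks_edges_def)
  have 4: "card {(j, k) \<in> Z. edge_sum T i (Inl (i, h)) (Inl (j, k)) \<noteq> 0} +
        card {l \<in> Lb. edge_sum T i (Inl (i, h)) (Inr l) \<noteq> 0} \<le> v i" for i h Z Lb
  proof -
    have "card {(j, k) \<in> Z. edge_sum T i (Inl (i, h)) (Inl (j, k)) \<noteq> 0} +
        card {l \<in> Lb. edge_sum T i (Inl (i, h)) (Inr l) \<noteq> 0} \<le> card (?Ey (Inl (i, h)))"
      by (rule card_sum_type_le[of _ _ "\<lambda>e. label_block (zs ! e)"]) (auto dest!: toz)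
    then show ?thesis using card_edges_at_block(1)[of "Inl (i, h)"] by simp
  qed
  have 5: "card {(i, h) \<in> Y. edge_sum T i (Inl (i, h)) (Inl (j, k)) \<noteq> 0} +
        card {l \<in> La. edge_sum T (fst (la ! l)) (Inr l) (Inl (j, k)) \<noteq> 0} \<le> v j" for j k Y La
  proof -
    have "card {(i, h) \<in> Y. edge_sum T i (Inl (i, h)) (Inl (j, k)) \<noteq> 0} +
        card {l \<in> La. edge_sum T (fst (la ! l)) (Inr l) (Inl (j, k)) \<noteq> 0} \<le> card (?Ez (Inl (j, k)))"
      by (rule card_sum_type_le[of _ _ "\<lambda>e. label_block (ys ! \<tau> e)"]) (auto dest!: toy)
    then show ?thesis using card_edges_at_block(2)[of "Inl (j, k)"] by simp
  qed
  have 6: "card {(i, h) \<in> Y. edge_sum T i (Inl (i, h)) (Inr l) \<noteq> 0} \<le> 1" for l Y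
  proof -
    have "card {(i, h) \<in> Y. edge_sum T i (Inl (i, h)) (Inr l) \<noteq> 0} + card ({} :: nat set) \<le> card (?Ez (Inr l))"
      by (rule card_sum_type_le[of _ _ "\<lambda>e. label_block (ys ! \<tau> e)"]) (auto dest!: toy)
    then show ?thesis using card_edges_at_block(2)[of "Inr l"] by simp
  qed
  have 7: "card {(j, k) \<in> Z. edge_sum T (fst (la ! l)) (Inr l) (Inl (j, k)) \<noteq> 0} \<le> 1" for l Z
  proof -
    have "card {(j, k) \<in> Z. edge_sum T (fst (la ! l)) (Inr l) (Inl (j, k)) \<noteq> 0} + card ({} :: nat set) \<le> card (?Ey (Inr l))"
      by (rule card_sum_type_le[of _ _ "\<lambda>e. label_block (zs ! e)"]) (auto dest!: toz)
    then show ?thesis using card_edges_at_block(1)[of "Inr l"] by simp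
  qed
  show ?thesis
    unfolding chi_good_def Let_def graph_data_simps ab
    by (intro conjI ballI; (simp only: split_paired_all prod.case)?; (rule VV Vb aV ab' 4 5 6 7 refl | simp add: abs_if VV' Vb))
qed

text \<open>The determinant for the edge set \<open>T\<close> is that of the sum over \<open>T\<close> of the matrices of the single edges,
so \<open>mixed_discriminant\<close> writes the value of the bracket graph as an alternating sum of determinants of
good data.\<close>

lemma bracket_graph_generated:
  "generated m (\<lambda>s. \<Sum>\<rho>\<in>block_permutations zs. \<Sum>\<sigma>\<in>block_permutations ys. signof \<rho> * signof \<sigma> *
     (\<Prod>e<R. edge s (label_end la (ys ! \<tau> e)) (hs e) (label_end lb (zs ! e)) (label_pos (zs ! \<rho> e)) (label_pos (ys ! \<sigma> (\<tau> e)))))"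
proof -
  have "generated m (\<lambda>s. signof \<tau> * (\<Sum>T\<in>Pow {..<R}. (- 1) ^ (R - card T) * det (Psi G v (graph_data T) s)))"
    by (intro generated_scale generated_sum generated_good graph_data_chi_data graph_data_good)
  then show ?thesis
  proof (rule generated_cong[THEN iffD1, rotated])
    fix s assume s: "s \<in> rep_space G d v"
    define M where "M = (\<lambda>e i j. edge s (label_end la (ys ! \<tau> e)) (hs e) (label_end lb (zs ! e)) (label_pos (zs ! i)) (label_pos (ys ! j)))"
    let ?bz = "\<lambda>r. label_block (zs ! r)" and ?by = "\<lambda>r. label_block (ys ! r)"
    have Psi: "Psi G v (graph_data T) s = mat R R (\<lambda>(i, j). \<Sum>e\<in>T. if ?bz i = ?bz e \<and> ?by j = ?by (\<tau> e) then M e i j else 0)"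
      if T: "T \<in> Pow {..<R}" for T
    proof -
      have "Psi_entry G v (graph_data T) s (zs ! i) (ys ! j) = (\<Sum>e\<in>T. if ?bz i = ?bz e \<and> ?by j = ?by (\<tau> e) then M e i j else 0)"
        if ij: "i < R" "j < R" for i j
      proof -
        have fin: "finite T" using T finite_subset by blast
        have "Psi_entry G v (graph_data T) s (zs ! i) (ys ! j) = (\<Sum>e\<in>blocks_edges T (?by j) (?bz i).
            edge s (label_end la (ys ! j)) (hs e) (label_end lb (zs ! i)) (label_pos (zs ! i)) (label_pos (ys ! j)))"
          using ij R by (intro Psi_entry_graph_data[OF _ _ s]) auto
        also have "\<dots> = (\<Sum>e\<in>{e \<in> T. ?bz i = ?bz e \<and> ?by j = ?by (\<tau> e)}. M e i j)"
        proof (rule sum.cong)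
          show "blocks_edges T (?by j) (?bz i) = {e \<in> T. ?bz i = ?bz e \<and> ?by j = ?by (\<tau> e)}"
            using T by (auto simp: blocks_edges_def)
          fix e assume "e \<in> {e \<in> T. ?bz i = ?bz e \<and> ?by j = ?by (\<tau> e)}"
          then show "edge s (label_end la (ys ! j)) (hs e) (label_end lb (zs ! i)) (label_pos (zs ! i)) (label_pos (ys ! j)) = M e i j"
            using label_end_cong[of "ys ! j" "ys ! \<tau> e" la] label_end_cong[of "zs ! i" "zs ! e" lb] by (simp add: M_def)
        qed
        also have "\<dots> = (\<Sum>e\<in>T. if ?bz i = ?bz e \<and> ?by j = ?by (\<tau> e) then M e i j else 0)"
          by (rule sum.inter_filter[OF fin])
        finally show ?thesis .
      qed
      then show ?thesis
        using R unfolding Psi_def Let_def graph_data_simps length_map ys_def[symmetric] zs_def[symmetric]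
        by (intro eq_matI) auto
    qed
    have "signof \<tau> * (\<Sum>T\<in>Pow {..<R}. (- 1) ^ (R - card T) * det (Psi G v (graph_data T) s))
      = signof \<tau> * (signof \<tau> * (\<Sum>\<rho>\<in>color_permutations ?bz {..<R}. \<Sum>\<sigma>\<in>color_permutations ?by {..<R}.
        signof \<rho> * signof \<sigma> * (\<Prod>e<R. M e (\<rho> e) (\<sigma> (\<tau> e)))))"
      unfolding mixed_discriminant[OF \<tau>, symmetric] by (simp add: Psi)
    also have "\<dots> = (\<Sum>\<rho>\<in>color_permutations ?bz {..<R}. \<Sum>\<sigma>\<in>color_permutations ?by {..<R}.
        signof \<rho> * signof \<sigma> * (\<Prod>e<R. M e (\<rho> e) (\<sigma> (\<tau> e))))"
      unfolding mult.assoc[symmetric] by (simp add: sign_def)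
    finally show "signof \<tau> * (\<Sum>T\<in>Pow {..<R}. (- 1) ^ (R - card T) * det (Psi G v (graph_data T) s))
      = (\<Sum>\<rho>\<in>block_permutations zs. \<Sum>\<sigma>\<in>block_permutations ys. signof \<rho> * signof \<sigma> *
     (\<Prod>e<R. edge s (label_end la (ys ! \<tau> e)) (hs e) (label_end lb (zs ! e)) (label_pos (zs ! \<rho> e)) (label_pos (ys ! \<sigma> (\<tau> e)))))"
      unfolding R M_def .
  qed
qed

end

end

section \<open>Matchings of slots as wirings\<close>

fun is_frm :: "endpoint \<Rightarrow> bool" where
  "is_frm (Vtx i) = False" | "is_frm (Frm i r) = True"

fun frm_pair :: "endpoint \<Rightarrow> nat \<times> nat" where
  "frm_pair (Vtx i) = (i, 0)" | "frm_pair (Frm i r) = (i, r)"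

lemma is_frm_pair: "is_frm x \<Longrightarrow> Frm (fst (frm_pair x)) (snd (frm_pair x)) = x"
  by (cases x) auto

context framed_quiver
begin

lemma edge_frm_indep: "is_frm x \<Longrightarrow> is_frm y \<Longrightarrow> edge s x hs y p q = edge s x hs y 0 0"
  by (cases x; cases y) auto

text \<open>A generator is itself an edge, with a framed end in the case of a column of \<open>\<gamma>\<^sub>i\<close> or a row of \<open>\<delta>\<^sub>i\<close>.\<close>

fun gsrc :: "'h generator \<Rightarrow> endpoint" where
  "gsrc (Arr h) = Vtx (tail G h)" | "gsrc (Gam i r) = Frm i r" | "gsrc (Del i r) = Vtx i"

fun gtgt :: "'h generator \<Rightarrow> endpoint" where
  "gtgt (Arr h) = Vtx (head G h)" | "gtgt (Gam i r) = Vtx i" | "gtgt (Del i r) = Frm i r"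

fun garrows :: "'h generator \<Rightarrow> 'h list" where
  "garrows (Arr h) = [h]" | "garrows (Gam i r) = []" | "garrows (Del i r) = []"

lemma generator_edge:
  assumes "g \<in> gens"
  shows "epath (gsrc g) (garrows g) (gtgt g)"
  using assms by (cases g) (auto simp: gens_def epath_def)

lemma edge_generator:
  assumes s: "s \<in> rep_space G d v" and x: "(g, p, q) \<in> coords"
  shows "edge s (gsrc g) (garrows g) (gtgt g) p q = coord s (g, p, q)"
proof -
  obtain B \<gamma> \<delta> where seq: "s = (B, \<gamma>, \<delta>)" by (cases s)
  show ?thesis
  proof (cases g)
    case (Arr h)
    then have "h \<in> arcs G" using x by (simp add: mem_coords)
    then have "1\<^sub>m (v (head G h)) * fst s h = fst s h" using rep_space_carrier(1)[OF s] by (metis left_mult_one_mat)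
    then show ?thesis by (simp add: Arr W_Cons seq)
  next
    case (Gam i r)
    then have "i \<in> verts G" using x by (simp add: mem_coords)
    then have "1\<^sub>m (v i) * fst (snd s) i = fst (snd s) i" using rep_space_carrier(2)[OF s] by (metis left_mult_one_mat)
    then show ?thesis by (simp add: Gam seq)
  next
    case (Del i r)
    then have "i \<in> verts G" using x by (simp add: mem_coords)
    then have "snd (snd s) i * 1\<^sub>m (v i) = snd (snd s) i" using rep_space_carrier(3)[OF s] by (metis right_mult_one_mat)
    then show ?thesis by (simp add: Del seq)
  qed
qed

lemma generator_ends:
  assumes "g \<in> gens"
  shows "cv g \<noteq> 0 \<Longrightarrow> gsrc g = Vtx (cv g)" "cv g = 0 \<Longrightarrow> is_frm (gsrc g)"
    "rv g \<noteq> 0 \<Longrightarrow> gtgt g = Vtx (rv g)" "rv g = 0 \<Longrightarrow> is_frm (gtgt g)"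
    "edim (gsrc g) = w (cv g)" "edim (gtgt g) = w (rv g)"
    "cv g \<in> insert 0 (verts G)" "rv g \<in> insert 0 (verts G)"
proof -
  have *: "tail G h \<noteq> 0" "head G h \<noteq> 0" if "h \<in> arcs G" for h
    using that zero_notin_verts tail_in_verts head_in_verts by metis+
  have **: "i \<noteq> 0" if "i \<in> verts G" for i using that zero_notin_verts by metis
  show "cv g \<noteq> 0 \<Longrightarrow> gsrc g = Vtx (cv g)" "cv g = 0 \<Longrightarrow> is_frm (gsrc g)"
    "rv g \<noteq> 0 \<Longrightarrow> gtgt g = Vtx (rv g)" "rv g = 0 \<Longrightarrow> is_frm (gtgt g)"
    "edim (gsrc g) = w (cv g)" "edim (gtgt g) = w (rv g)"
    "cv g \<in> insert 0 (verts G)" "rv g \<in> insert 0 (verts G)"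
    using assms * ** by (cases g; auto simp: gens_def)+
qed

context
  fixes m :: "nat \<Rightarrow> int"
begin

text \<open>The slots of the determinant tensors: a vertex with \<open>m\<^sub>i < 0\<close> contributes \<open>- m\<^sub>i\<close> of them with upper
indices, a vertex with \<open>m\<^sub>i > 0\<close> contributes \<open>m\<^sub>i\<close> of them with lower indices.\<close>

definition ysB where "ysB = basis_labels G v (\<lambda>i. nat (- m i)) 0"
definition zsB where "zsB = basis_labels G v (\<lambda>i. nat (m i)) 0"

lemma ysB_nth: "r < length ysB \<Longrightarrow> \<exists>i h p. ysB ! r = Block i h p \<and> i \<in> verts G \<and> m i < 0 \<and> p < v i"
  using basis_labels_blocks[OF finite_verts, of r v "\<lambda>i. nat (- m i)"] unfolding ysB_def by fastforce

lemma zsB_nth: "r < length zsB \<Longrightarrow> \<exists>i h p. zsB ! r = Block i h p \<and> i \<in> verts G \<and> 0 < m i \<and> p < v i"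
  using basis_labels_blocks[OF finite_verts, of r v "\<lambda>i. nat (m i)"] unfolding zsB_def by fastforce

lemma full_B: "full_blocks w ysB" "full_blocks w zsB"
  unfolding ysB_def zsB_def using zero_notin_verts by (auto intro: full_blocks_basis_labels)

lemma block_perm_label:
  assumes "full_blocks w xs" "\<rho> \<in> block_permutations xs" "r < length xs"
  shows "label_pos (xs ! \<rho> r) < w (label_vertex (xs ! r))"
proof -
  have "label_block (xs ! \<rho> r) = label_block (xs ! r)" using assms(2,3) by (simp add: color_permutations_def)
  then show ?thesis
    using full_blocks_pos[OF assms(1) block_permutation_lt[OF assms(2,3)]] label_vertex_cong[of "xs ! \<rho> r" "xs ! r"] by simp
qed

text \<open>The slots of a product of \<open>N\<close> generators and of the determinant tensors: \<open>Inl k\<close> is the row index (upper)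
or the column index (lower) of generator \<open>k\<close>, and \<open>Inr r\<close> is a slot of a determinant tensor.  Framing
indices are not slots.\<close>

definition upper_slots :: "nat \<Rightarrow> (nat \<Rightarrow> 'h generator) \<Rightarrow> (nat + nat) set" where
  "upper_slots N e = Inl ` {k. k < N \<and> rv (e k) \<noteq> 0} \<union> Inr ` {..<length ysB}"

definition lower_slots :: "nat \<Rightarrow> (nat \<Rightarrow> 'h generator) \<Rightarrow> (nat + nat) set" where
  "lower_slots N e = Inl ` {k. k < N \<and> cv (e k) \<noteq> 0} \<union> Inr ` {..<length zsB}"

definition upper_color :: "(nat \<Rightarrow> 'h generator) \<Rightarrow> nat + nat \<Rightarrow> nat" where
  "upper_color e = case_sum (\<lambda>k. rv (e k)) (\<lambda>r. label_vertex (ysB ! r))"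

definition lower_color :: "(nat \<Rightarrow> 'h generator) \<Rightarrow> nat + nat \<Rightarrow> nat" where
  "lower_color e = case_sum (\<lambda>k. cv (e k)) (\<lambda>r. label_vertex (zsB ! r))"

definition upper_index :: "(nat \<Rightarrow> nat) \<Rightarrow> (nat \<Rightarrow> nat) \<Rightarrow> nat + nat \<Rightarrow> nat" where
  "upper_index p \<sigma> = case_sum p (\<lambda>r. label_pos (ysB ! \<sigma> r))"

definition lower_index :: "(nat \<Rightarrow> nat) \<Rightarrow> (nat \<Rightarrow> nat) \<Rightarrow> nat + nat \<Rightarrow> nat" where
  "lower_index q \<rho> = case_sum q (\<lambda>r. label_pos (zsB ! \<rho> r))"

text \<open>A matching \<open>\<pi>\<close> of the upper with the lower slots joins the generators into wires.  Generator \<open>k\<close> is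
a wire from its column index to its row index; the joints are the lower slots \<open>n\<close>, which absorb the
upper slots matched with them, and in addition \<open>Inl k\<close> and \<open>Inl (N + k)\<close> serve as joints for the framed
start and the framed end of generator \<open>k\<close>.  The inner joints lie between two generators.\<close>

context
  fixes N :: nat and e :: "nat \<Rightarrow> 'h generator" and \<pi> :: "nat + nat \<Rightarrow> nat + nat"
  assumes e: "e \<in> {..<N} \<rightarrow>\<^sub>E gens"
    and bij: "bij_betw \<pi> (upper_slots N e) (lower_slots N e)"
    and col\<pi>: "\<And>u. u \<in> upper_slots N e \<Longrightarrow> lower_color e (\<pi> u) = upper_color e u"
begin

definition wires :: "(nat + nat) set" where "wires = Inl ` {..<N}"

definition wire_out :: "nat + nat \<Rightarrow> nat + nat" where
  "wire_out n = (case n of Inl k \<Rightarrow> if rv (e k) = 0 then Inl (N + k) else \<pi> (Inl k) | Inr r \<Rightarrow> n)"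

definition wire_end :: "nat + nat \<Rightarrow> endpoint" where
  "wire_end n = (case n of Inl k \<Rightarrow> if k < N then gsrc (e k) else gtgt (e (k - N)) | Inr r \<Rightarrow> Vtx (label_vertex (zsB ! r)))"

definition wire_arrows :: "nat + nat \<Rightarrow> 'h list" where
  "wire_arrows n = (case n of Inl k \<Rightarrow> garrows (e k) | Inr r \<Rightarrow> [])"

definition inner_wires :: "(nat + nat) set" where "inner_wires = wires \<inter> wire_out ` wires"

text \<open>The index at an outer joint: it is prescribed by the determinant tensor that the joint is attached to,
and 0 at framed ends.\<close>

definition wire_value :: "(nat \<Rightarrow> nat) \<Rightarrow> (nat \<Rightarrow> nat) \<Rightarrow> nat + nat \<Rightarrow> nat" where
  "wire_value \<rho> \<sigma> n = (if n \<in> \<pi> ` Inr ` {..<length ysB} then label_pos (ysB ! \<sigma> (projr (inv_into (upper_slots N e) \<pi> n)))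
     else case n of Inl k \<Rightarrow> 0 | Inr r \<Rightarrow> label_pos (zsB ! \<rho> r))"

lemma e_gens: "k < N \<Longrightarrow> e k \<in> gens"
  using e by auto

lemma \<pi>_inj: "u \<in> upper_slots N e \<Longrightarrow> u' \<in> upper_slots N e \<Longrightarrow> \<pi> u = \<pi> u' \<Longrightarrow> u = u'"
  using bij by (auto simp: bij_betw_def inj_on_def)

lemma \<pi>_mem: "u \<in> upper_slots N e \<Longrightarrow> \<pi> u \<in> lower_slots N e"
  using bij by (auto simp: bij_betw_def)

lemma \<pi>_surj: "n \<in> lower_slots N e \<Longrightarrow> \<exists>u\<in>upper_slots N e. n = \<pi> u"
  using bij by (auto simp: bij_betw_def)

lemma upper_Inl: "k < N \<Longrightarrow> rv (e k) \<noteq> 0 \<Longrightarrow> Inl k \<in> upper_slots N e"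
  and upper_Inr: "r < length ysB \<Longrightarrow> Inr r \<in> upper_slots N e"
  and lower_Inl: "k < N \<Longrightarrow> cv (e k) \<noteq> 0 \<Longrightarrow> Inl k \<in> lower_slots N e"
  and lower_Inr: "r < length zsB \<Longrightarrow> Inr r \<in> lower_slots N e"
  by (auto simp: upper_slots_def lower_slots_def)

lemma lower_slots_cases:
  assumes "n \<in> lower_slots N e"
  obtains k where "n = Inl k" "k < N" "cv (e k) \<noteq> 0" | r where "n = Inr r" "r < length zsB"
  using assms by (auto simp: lower_slots_def)

lemma wire_end_lower: "n \<in> lower_slots N e \<Longrightarrow> wire_end n = Vtx (lower_color e n)"
  by (erule lower_slots_cases) (auto simp: wire_end_def lower_color_def generator_ends(1)[OF e_gens])

lemma wire_end_\<pi>: "u \<in> upper_slots N e \<Longrightarrow> wire_end (\<pi> u) = Vtx (upper_color e u)"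
  using wire_end_lower[OF \<pi>_mem] col\<pi> by simp

lemma edim_lower: "n \<in> lower_slots N e \<Longrightarrow> edim (wire_end n) = w (lower_color e n)"
proof (erule lower_slots_cases)
  fix k assume "n = Inl k" "k < N" "cv (e k) \<noteq> 0"
  then show ?thesis using generator_ends(5)[OF e_gens[of k]] by (simp add: wire_end_def lower_color_def)
next
  fix r assume "n = Inr r" "r < length zsB"
  then show ?thesis using zsB_nth[of r] by (auto simp: wire_end_def lower_color_def)
qed

text \<open>Two determinant tensors are never joined directly, because at a given vertex the sign of \<open>m\<^sub>i\<close>
allows only one of the two kinds.\<close>

lemma \<pi>_bracket:
  assumes r: "r < length ysB"
  obtains k where "\<pi> (Inr r) = Inl k" "k < N" "cv (e k) \<noteq> 0"
proof -
  have neg: "m (upper_color e (Inr r)) < 0" using ysB_nth[OF r] by (auto simp: upper_color_def)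
  from \<pi>_mem[OF upper_Inr[OF r]] show thesis
  proof (rule lower_slots_cases)
    fix r' assume r': "\<pi> (Inr r) = Inr r'" "r' < length zsB"
    have "0 < m (lower_color e (Inr r'))" using zsB_nth[OF r'(2)] by (auto simp: lower_color_def)
    then show thesis using neg col\<pi>[OF upper_Inr[OF r]] r'(1) by simp
  qed (rule that)
qed

lemma wire_value_bracket: "r < length ysB \<Longrightarrow> wire_value \<rho> \<sigma> (\<pi> (Inr r)) = label_pos (ysB ! \<sigma> r)"
proof -
  assume r: "r < length ysB"
  have "inv_into (upper_slots N e) \<pi> (\<pi> (Inr r)) = Inr r"
    using bij upper_Inr[OF r] by (simp add: bij_betw_def)
  then show ?thesis using r by (auto simp: wire_value_def)
qed

lemma wire_value_Inr: "wire_value \<rho> \<sigma> (Inr r) = label_pos (zsB ! \<rho> r)"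
proof -
  have "Inr r \<notin> \<pi> ` Inr ` {..<length ysB}"
  proof
    assume "Inr r \<in> \<pi> ` Inr ` {..<length ysB}"
    then obtain r' where "r' < length ysB" "Inr r = \<pi> (Inr r')" by auto
    then show False using \<pi>_bracket[of r'] by (metis sum.distinct(1))
  qed
  then show ?thesis by (simp add: wire_value_def)
qed

lemma wire_value_Inl: "Inl k \<notin> \<pi> ` Inr ` {..<length ysB} \<Longrightarrow> wire_value \<rho> \<sigma> (Inl k) = 0"
  by (simp add: wire_value_def)

lemma wire_value_frm: "is_frm (wire_end n) \<Longrightarrow> wire_value \<rho> \<sigma> n = 0"
proof -
  assume n: "is_frm (wire_end n)"
  have "n \<notin> \<pi> ` Inr ` {..<length ysB}"
  proof
    assume "n \<in> \<pi> ` Inr ` {..<length ysB}"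
    then obtain r where "r < length ysB" "n = \<pi> (Inr r)" by auto
    then show False using n wire_end_\<pi>[OF upper_Inr] by simp
  qed
  then show ?thesis using n by (cases n) (auto simp: wire_value_def wire_end_def)
qed

lemma wire_out_cases:
  assumes "k < N"
  shows "rv (e k) = 0 \<Longrightarrow> wire_out (Inl k) = Inl (N + k)" "rv (e k) \<noteq> 0 \<Longrightarrow> wire_out (Inl k) = \<pi> (Inl k)"
  by (simp_all add: wire_out_def)

lemma wire_end_out: "k < N \<Longrightarrow> wire_end (wire_out (Inl k)) = gtgt (e k)"
proof (cases "rv (e k) = 0")
  case False
  assume k: "k < N"
  show ?thesis using wire_end_\<pi>[OF upper_Inl[OF k False]] generator_ends(3)[OF e_gens[OF k] False]
    by (simp add: wire_out_cases(2)[OF k False] upper_color_def)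
qed (simp add: wire_out_cases wire_end_def)

lemma wire_end_in: "k < N \<Longrightarrow> wire_end (Inl k) = gsrc (e k)"
  by (simp add: wire_end_def)

lemma inj_wire_out: "inj_on wire_out wires"
proof (rule inj_onI)
  fix x y assume "x \<in> wires" "y \<in> wires" and eq: "wire_out x = wire_out y"
  then obtain k l where kl: "x = Inl k" "k < N" "y = Inl l" "l < N" by (auto simp: wires_def)
  have no: "\<pi> (Inl k') \<noteq> Inl (N + l')" if "k' < N" "rv (e k') \<noteq> 0" for k' l'
    using \<pi>_mem[OF upper_Inl[OF that]] by (auto simp: lower_slots_def)
  show "x = y"
  proof (cases "rv (e k) = 0"; cases "rv (e l) = 0")
    assume rvs: "rv (e k) \<noteq> 0" "rv (e l) \<noteq> 0"
    then have "\<pi> (Inl k) = \<pi> (Inl l)" using eq kl by (simp add: wire_out_cases)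
    then have "Inl k = (Inl l :: nat + nat)" by (rule \<pi>_inj[OF upper_Inl[OF kl(2) rvs(1)] upper_Inl[OF kl(4) rvs(2)]])
    then show ?thesis using kl by simp
  next
    assume "rv (e k) = 0" "rv (e l) \<noteq> 0"
    then show ?thesis using eq kl no[of l k] by (simp add: wire_out_cases)
  next
    assume "rv (e k) \<noteq> 0" "rv (e l) = 0"
    then show ?thesis using eq kl no[of k l] by (simp add: wire_out_cases)
  next
    assume "rv (e k) = 0" "rv (e l) = 0"
    then show ?thesis using eq kl by (simp add: wire_out_cases)
  qed
qed

lemma wire_epath: "n \<in> wires \<Longrightarrow> epath (wire_end n) (wire_arrows n) (wire_end (wire_out n))"
  using generator_edge[OF e_gens] wire_end_out wire_end_in by (auto simp: wires_def wire_arrows_def)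

lemma inner_wires_eq: "Inl k \<in> inner_wires \<longleftrightarrow> k < N \<and> (\<exists>l<N. rv (e l) \<noteq> 0 \<and> Inl k = \<pi> (Inl l))"
proof
  assume "Inl k \<in> inner_wires"
  then obtain l where l: "k < N" "l < N" "Inl k = wire_out (Inl l)" by (auto simp: inner_wires_def wires_def)
  then have "rv (e l) \<noteq> 0" by (auto simp: wire_out_def split: if_splits)
  then show "k < N \<and> (\<exists>l<N. rv (e l) \<noteq> 0 \<and> Inl k = \<pi> (Inl l))" using l by (auto simp: wire_out_cases)
next
  assume "k < N \<and> (\<exists>l<N. rv (e l) \<noteq> 0 \<and> Inl k = \<pi> (Inl l))"
  then obtain l where l: "k < N" "l < N" "rv (e l) \<noteq> 0" "Inl k = \<pi> (Inl l)" by blast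
  then have "Inl k = wire_out (Inl l)" by (simp add: wire_out_cases)
  then show "Inl k \<in> inner_wires" using l unfolding inner_wires_def wires_def by blast
qed

lemma inner_wires_Inl: "n \<in> inner_wires \<Longrightarrow> \<exists>k<N. n = Inl k \<and> cv (e k) \<noteq> 0"
proof -
  assume n: "n \<in> inner_wires"
  then obtain k where k: "n = Inl k" by (auto simp: inner_wires_def wires_def)
  then obtain l where l: "k < N" "l < N" "rv (e l) \<noteq> 0" "Inl k = \<pi> (Inl l)" using n inner_wires_eq by blast
  have "Inl k \<in> lower_slots N e" unfolding l(4) by (rule \<pi>_mem[OF upper_Inl[OF l(2,3)]])
  then show ?thesis using k l by (auto simp: lower_slots_def)
qed

lemma inner_not_bracket: "n \<in> inner_wires \<Longrightarrow> n \<notin> \<pi> ` Inr ` {..<length ysB}"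
proof
  assume n: "n \<in> inner_wires" "n \<in> \<pi> ` Inr ` {..<length ysB}"
  then obtain r where r: "r < length ysB" "n = \<pi> (Inr r)" by auto
  obtain k where "n = Inl k" using inner_wires_Inl[OF n(1)] by blast
  then obtain l where l: "l < N" "rv (e l) \<noteq> 0" "n = \<pi> (Inl l)" using n(1) inner_wires_eq by blast
  have "\<pi> (Inl l) = \<pi> (Inr r)" using l r by simp
  then have "Inl l = (Inr r :: nat + nat)" by (rule \<pi>_inj[OF upper_Inl[OF l(1,2)] upper_Inr[OF r(1)]])
  then show False by simp
qed

lemma outer_wire_cases:
  assumes "k < N" "Inl k \<notin> inner_wires"
  obtains "cv (e k) = 0" "Inl k \<notin> \<pi> ` Inr ` {..<length ysB}"
    | r where "cv (e k) \<noteq> 0" "r < length ysB" "Inl k = \<pi> (Inr r)"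
proof (cases "cv (e k) = 0")
  case True
  have "Inl k \<notin> \<pi> ` Inr ` {..<length ysB}"
  proof
    assume "Inl k \<in> \<pi> ` Inr ` {..<length ysB}"
    then obtain r where "r < length ysB" "Inl k = \<pi> (Inr r)" by auto
    then have "Inl k \<in> lower_slots N e" using \<pi>_mem[OF upper_Inr] by simp
    then show False using True by (auto simp: lower_slots_def)
  qed
  then show thesis using True that by blast
next
  case False
  obtain u where u: "u \<in> upper_slots N e" "Inl k = \<pi> u" using \<pi>_surj[OF lower_Inl[OF assms(1) False]] by blast
  show thesis
  proof (cases u)
    case (Inl l)
    then have "l < N" "rv (e l) \<noteq> 0" using u by (auto simp: upper_slots_def)
    then have "Inl k \<in> inner_wires" using u Inl assms(1) inner_wires_eq by blast
    then show thesis using assms(2) by simp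
  next
    case (Inr r)
    then show thesis using that(2)[of r] u False by (auto simp: upper_slots_def)
  qed
qed

lemma wire_value_bound:
  assumes \<rho>: "\<rho> \<in> block_permutations zsB" and \<sigma>: "\<sigma> \<in> block_permutations ysB"
    and n: "n \<in> wires \<union> wire_out ` wires - inner_wires"
  shows "wire_value \<rho> \<sigma> n < edim (wire_end n)"
proof (cases "is_frm (wire_end n)")
  case True
  then show ?thesis using wire_value_frm[OF True] by (cases "wire_end n") auto
next
  case False
  have bracket: "wire_value \<rho> \<sigma> n < edim (wire_end n)" if "r < length ysB" "n = \<pi> (Inr r)" for r
    using edim_lower[OF \<pi>_mem[OF upper_Inr[OF that(1)]]] col\<pi>[OF upper_Inr[OF that(1)]] block_perm_label[OF full_B(1) \<sigma> that(1)]
    unfolding that(2) wire_value_bracket[OF that(1)] by (simp add: upper_color_def)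
  from n consider "n \<in> wires" | "n \<in> wire_out ` wires" by blast
  then show ?thesis
  proof cases
    case 1
    then obtain k where k: "n = Inl k" "k < N" by (auto simp: wires_def)
    have "Inl k \<notin> inner_wires" using n k by simp
    from k(2) this show ?thesis
    proof (rule outer_wire_cases)
      assume "cv (e k) = 0"
      then show ?thesis using False k generator_ends(2)[OF e_gens[OF k(2)]] by (simp add: wire_end_in)
    next
      fix r assume "r < length ysB" "Inl k = \<pi> (Inr r)"
      then show ?thesis using bracket k by simp
    qed
  next
    case 2
    then obtain k where k: "n = wire_out (Inl k)" "k < N" by (auto simp: wires_def)
    have rv: "rv (e k) \<noteq> 0"
    proof
      assume "rv (e k) = 0"
      then show False using False k generator_ends(4)[OF e_gens[OF k(2)]] by (simp add: wire_end_out)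
    qed
    then have n\<pi>: "n = \<pi> (Inl k)" using k by (simp add: wire_out_cases)
    have "n \<in> lower_slots N e" unfolding n\<pi> by (rule \<pi>_mem[OF upper_Inl[OF k(2) rv]])
    then show ?thesis
    proof (rule lower_slots_cases)
      fix k' assume "n = Inl k'" "k' < N"
      then have "n \<in> inner_wires" using inner_wires_eq k rv n\<pi> by blast
      then show ?thesis using n by blast
    next
      fix r assume r: "n = Inr r" "r < length zsB"
      then show ?thesis
        using edim_lower[OF lower_Inr[OF r(2)]] block_perm_label[OF full_B(2) \<rho> r(2)]
        by (simp add: wire_value_Inr lower_color_def)
    qed
  qed
qed

text \<open>The matching determines the row indices from the column indices, and the column indices at outer joints
are determined by the determinant tensors, so that only the indices at inner joints remain free.\<close>

lemma contraction_as_wire_sum: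
  assumes s: "s \<in> rep_space G d v" and \<rho>: "\<rho> \<in> block_permutations zsB" and \<sigma>: "\<sigma> \<in> block_permutations ysB"
  shows "(\<Sum>p\<in>assignments w (rv \<circ> e) {..<N}. \<Sum>q\<in>assignments w (cv \<circ> e) {..<N}.
      of_bool (\<forall>u\<in>upper_slots N e. upper_index p \<sigma> u = lower_index q \<rho> (\<pi> u)) * (\<Prod>k<N. coord s (e k, p k, q k)))
    = (\<Sum>x\<in>Pi\<^sub>E inner_wires (\<lambda>n. {..<edim (wire_end n)}). \<Prod>n\<in>wires. edge s (wire_end n) (wire_arrows n) (wire_end (wire_out n))
        (override inner_wires (wire_value \<rho> \<sigma>) x (wire_out n)) (override inner_wires (wire_value \<rho> \<sigma>) x n))"
proof -
  let ?P = "assignments w (rv \<circ> e) {..<N}" and ?Q = "assignments w (cv \<circ> e) {..<N}"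
  let ?X = "Pi\<^sub>E inner_wires (\<lambda>n. {..<edim (wire_end n)})"
  define pq where "pq = (\<lambda>q. \<lambda>k\<in>{..<N}. if rv (e k) = 0 then 0 else lower_index q \<rho> (\<pi> (Inl k)))"
  define cond where "cond = (\<lambda>q. \<forall>r<length ysB. label_pos (ysB ! \<sigma> r) = lower_index q \<rho> (\<pi> (Inr r)))"
  define ov where "ov = (\<lambda>x. override inner_wires (wire_value \<rho> \<sigma>) x)"
  have lower_bound: "lower_index q \<rho> n < w (lower_color e n)" if q: "q \<in> ?Q" and n: "n \<in> lower_slots N e" for q n
    using n
  proof (rule lower_slots_cases)
    fix k assume "n = Inl k" "k < N"
    then show ?thesis using q by (auto simp: lower_index_def lower_color_def assignments_def PiE_iff)
  next
    fix r assume "n = Inr r" "r < length zsB"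
    then show ?thesis using block_perm_label[OF full_B(2) \<rho>, of r] by (simp add: lower_index_def lower_color_def)
  qed
  have pq: "pq q \<in> ?P" if q: "q \<in> ?Q" for q
  proof -
    have "lower_index q \<rho> (\<pi> (Inl k)) < w (rv (e k))" if "k < N" "rv (e k) \<noteq> 0" for k
      using lower_bound[OF q \<pi>_mem[OF upper_Inl[OF that]]] col\<pi>[OF upper_Inl[OF that]] by (simp add: upper_color_def)
    then show ?thesis by (auto simp: pq_def assignments_def)
  qed
  have cond_iff: "(\<forall>u\<in>upper_slots N e. upper_index p \<sigma> u = lower_index q \<rho> (\<pi> u)) \<longleftrightarrow> p = pq q \<and> cond q"
    if p: "p \<in> ?P" and q: "q \<in> ?Q" for p q
  proof -
    have "(\<forall>u\<in>upper_slots N e. upper_index p \<sigma> u = lower_index q \<rho> (\<pi> u))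
      \<longleftrightarrow> (\<forall>k<N. rv (e k) \<noteq> 0 \<longrightarrow> p k = lower_index q \<rho> (\<pi> (Inl k))) \<and> cond q"
      unfolding upper_slots_def ball_Un ball_simps by (simp add: upper_index_def cond_def Ball_def imp_conjL)
    also have "(\<forall>k<N. rv (e k) \<noteq> 0 \<longrightarrow> p k = lower_index q \<rho> (\<pi> (Inl k))) \<longleftrightarrow> p = pq q"
    proof -
      have "p k = 0" if "k < N" "rv (e k) = 0" for k
        using PiE_mem[OF p[unfolded assignments_def], of k] that by simp
      then have "(\<forall>k<N. rv (e k) \<noteq> 0 \<longrightarrow> p k = lower_index q \<rho> (\<pi> (Inl k))) \<longleftrightarrow> (\<forall>k\<in>{..<N}. p k = pq q k)"
        by (auto simp: pq_def)
      then show ?thesis using assignments_eq_iff[OF p pq[OF q]] by simp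
    qed
    finally show ?thesis .
  qed
  have "(\<Sum>p\<in>?P. \<Sum>q\<in>?Q. of_bool (\<forall>u\<in>upper_slots N e. upper_index p \<sigma> u = lower_index q \<rho> (\<pi> u)) * (\<Prod>k<N. coord s (e k, p k, q k)))
      = (\<Sum>q\<in>?Q. \<Sum>p\<in>?P. if p = pq q then if cond q then \<Prod>k<N. coord s (e k, pq q k, q k) else 0 else 0)"
    by (subst sum.swap, rule sum.cong[OF refl], rule sum.cong[OF refl]) (simp add: cond_iff)
  also have "\<dots> = (\<Sum>q\<in>?Q. if cond q then \<Prod>k<N. coord s (e k, pq q k, q k) else 0)"
    using pq by (intro sum.cong refl) simp
  also have "\<dots> = (\<Sum>q\<in>{q \<in> ?Q. cond q}. \<Prod>k<N. coord s (e k, pq q k, q k))"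
    by (rule sum.inter_filter[symmetric]) simp
  also have "\<dots> = (\<Sum>x\<in>?X. \<Prod>n\<in>wires. edge s (wire_end n) (wire_arrows n) (wire_end (wire_out n)) (ov x (wire_out n)) (ov x n))"
  proof (rule sum.reindex_bij_witness[of _ "\<lambda>x. \<lambda>k\<in>{..<N}. ov x (Inl k)" "\<lambda>q. \<lambda>n\<in>inner_wires. q (projl n)"])
    fix q assume "q \<in> {q \<in> ?Q. cond q}"
    then have q: "q \<in> ?Q" and cq: "cond q" by auto
    let ?x = "\<lambda>n\<in>inner_wires. q (projl n)"
    have q_lt: "q k < w (cv (e k))" if "k < N" for k using q that by (auto simp: assignments_def PiE_iff)
    show "?x \<in> ?X"
    proof (rule PiE_I)
      fix n assume n: "n \<in> inner_wires"
      then obtain k where "k < N" "n = Inl k" using inner_wires_Inl by blast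
      then show "?x n \<in> {..<edim (wire_end n)}"
        using n q_lt[of k] generator_ends(5)[OF e_gens, of k] by (simp add: wire_end_in)
    qed simp
    have ov_eq: "ov ?x (Inl k) = q k" if k: "k < N" for k
    proof (cases "Inl k \<in> inner_wires")
      case False
      from k False show ?thesis
      proof (rule outer_wire_cases)
        assume "cv (e k) = 0" "Inl k \<notin> \<pi> ` Inr ` {..<length ysB}"
        then show ?thesis using q_lt[OF k] False by (simp add: ov_def override_def wire_value_Inl)
      next
        fix r assume r: "r < length ysB" "Inl k = \<pi> (Inr r)"
        then have "label_pos (ysB ! \<sigma> r) = q k" using cq r(2)[symmetric] by (auto simp: cond_def lower_index_def)
        then show ?thesis using False wire_value_bracket[OF r(1)] r(2) by (simp add: ov_def override_def)
      qed
    qed (simp add: ov_def override_def)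
    show *: "(\<lambda>k\<in>{..<N}. ov ?x (Inl k)) = q"
      using PiE_restrict[OF q[unfolded assignments_def]] ov_eq by (metis (no_types, lifting) lessThan_iff restrict_ext)
    show "(\<Prod>n\<in>wires. edge s (wire_end n) (wire_arrows n) (wire_end (wire_out n)) (ov ?x (wire_out n)) (ov ?x n))
        = (\<Prod>k<N. coord s (e k, pq q k, q k))"
      unfolding wires_def
    proof (subst prod.reindex, simp, rule prod.cong[OF refl])
      fix k assume "k \<in> {..<N}"
      then have k: "k < N" by simp
      have out: "ov ?x (wire_out (Inl k)) = pq q k"
      proof (cases "rv (e k) = 0")
        case True
        have "Inl (N + k) \<notin> inner_wires" by (auto simp: inner_wires_def wires_def)
        moreover have "is_frm (wire_end (Inl (N + k)))"
          using generator_ends(4)[OF e_gens[OF k] True] by (simp add: wire_end_def)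
        ultimately show ?thesis using True k by (simp add: wire_out_cases ov_def override_def wire_value_frm pq_def)
      next
        case False
        from \<pi>_mem[OF upper_Inl[OF k False]] have "ov ?x (\<pi> (Inl k)) = lower_index q \<rho> (\<pi> (Inl k))"
        proof (rule lower_slots_cases)
          fix k' assume "\<pi> (Inl k) = Inl k'" "k' < N"
          then show ?thesis using ov_eq by (simp add: lower_index_def)
        next
          fix r assume r: "\<pi> (Inl k) = Inr r"
          have "Inr r \<notin> inner_wires" by (auto simp: inner_wires_def wires_def)
          then show ?thesis unfolding r by (simp add: ov_def override_def wire_value_Inr lower_index_def)
        qed
        then show ?thesis using False k by (simp add: wire_out_cases pq_def)
      qed
      have mem: "(e k, pq q k, q k) \<in> coords"
        using e_gens[OF k] q_lt[OF k] PiE_mem[OF pq[OF q, unfolded assignments_def], of k] k by (simp add: coords_def)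
      show "((\<lambda>n. edge s (wire_end n) (wire_arrows n) (wire_end (wire_out n)) (ov ?x (wire_out n)) (ov ?x n)) \<circ> Inl) k = coord s (e k, pq q k, q k)"
        using edge_generator[OF s mem] k by (simp add: wire_end_in wire_end_out wire_arrows_def ov_eq[OF k] out)
    qed
  next
    fix x assume x: "x \<in> ?X"
    let ?q = "\<lambda>k\<in>{..<N}. ov x (Inl k)"
    have bound: "ov x (Inl k) < w (cv (e k))" if k: "k < N" for k
    proof -
      have dim: "edim (wire_end (Inl k)) = w (cv (e k))" using generator_ends(5)[OF e_gens[OF k]] k by (simp add: wire_end_in)
      show ?thesis
      proof (cases "Inl k \<in> inner_wires")
        case True
        then show ?thesis using PiE_mem[OF x True] dim by (simp add: ov_def override_def)
      next
        case False
        then have "wire_value \<rho> \<sigma> (Inl k) < edim (wire_end (Inl k))"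
          using k by (intro wire_value_bound[OF \<rho> \<sigma>]) (auto simp: wires_def)
        then show ?thesis using False dim by (simp add: ov_def override_def)
      qed
    qed
    have "?q \<in> ?Q" using bound by (auto simp: assignments_def)
    moreover have "cond ?q"
      unfolding cond_def
    proof (intro allI impI)
      fix r assume r: "r < length ysB"
      obtain k where k: "\<pi> (Inr r) = Inl k" "k < N" by (rule \<pi>_bracket[OF r])
      have "Inl k \<notin> inner_wires"
        using inner_not_bracket[of "Inl k"] k(1) r by (metis image_eqI lessThan_iff)
      then have "ov x (Inl k) = label_pos (ysB ! \<sigma> r)"
        using wire_value_bracket[OF r] k(1) by (simp add: ov_def override_def)
      then show "label_pos (ysB ! \<sigma> r) = lower_index ?q \<rho> (\<pi> (Inr r))"
        using k by (simp add: lower_index_def)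
    qed
    ultimately show "?q \<in> {q \<in> ?Q. cond q}" by simp
    show "(\<lambda>n\<in>inner_wires. ?q (projl n)) = x"
    proof -
      have "(\<lambda>n\<in>inner_wires. ?q (projl n)) = restrict x inner_wires"
      proof (rule restrict_ext)
        fix n assume n: "n \<in> inner_wires"
        then obtain k where "k < N" "n = Inl k" using inner_wires_Inl by blast
        then show "?q (projl n) = x n" using n by (simp add: ov_def override_def)
      qed
      then show ?thesis using PiE_restrict[OF x] by simp
    qed
  qed
  finally show ?thesis by (simp add: ov_def)
qed

text \<open>After the elimination of the inner joints there remain open paths.  Those with two framed ends are
invariant functions and join the invariant factor from the closed paths.  The others form a bracket
graph: every slot of a determinant tensor is an end of exactly one of them, and their framed ends are
numbered to become the one-dimensional summands.\<close>

lemma contraction_generated: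
  "generated m (\<lambda>s. \<Sum>\<rho>\<in>block_permutations zsB. \<Sum>\<sigma>\<in>block_permutations ysB. signof \<rho> * signof \<sigma> *
     (\<Sum>p\<in>assignments w (rv \<circ> e) {..<N}. \<Sum>q\<in>assignments w (cv \<circ> e) {..<N}.
      of_bool (\<forall>u\<in>upper_slots N e. upper_index p \<sigma> u = lower_index q \<rho> (\<pi> u)) * (\<Prod>k<N. coord s (e k, p k, q k))))"
proof -
  have fin: "finite wires" "finite inner_wires" by (auto simp: wires_def inner_wires_def)
  have vtx: "\<exists>i. wire_end a = Vtx i" if a: "a \<in> inner_wires" for a
  proof -
    obtain k where "k < N" "a = Inl k" "cv (e k) \<noteq> 0" using inner_wires_Inl[OF a] by blast
    then show ?thesis using generator_ends(1)[OF e_gens[of k]] by (auto simp: wire_end_in)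
  qed
  obtain J hs' out' where J: "invariant J" and inj': "inj_on out' (wires - inner_wires)"
    and out': "out' ` (wires - inner_wires) = wire_out ` wires - inner_wires"
    and ep': "\<forall>k\<in>wires - inner_wires. epath (wire_end k) (hs' k) (wire_end (out' k))"
    and sum': "\<forall>s\<in>rep_space G d v. \<forall>\<beta>. (\<forall>n\<in>wires \<union> wire_out ` wires - inner_wires. \<beta> n < edim (wire_end n)) \<longrightarrow>
      (\<Sum>x\<in>Pi\<^sub>E inner_wires (\<lambda>n. {..<edim (wire_end n)}). \<Prod>k\<in>wires. edge s (wire_end k) (wire_arrows k) (wire_end (wire_out k))
         (override inner_wires \<beta> x (wire_out k)) (override inner_wires \<beta> x k))
      = J s * (\<Prod>k\<in>wires - inner_wires. edge s (wire_end k) (hs' k) (wire_end (out' k)) (\<beta> (out' k)) (\<beta> k))"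
    by (rule exE[OF eliminate_wires[where S = inner_wires and K = wires and out = wire_out and hs = wire_arrows and col = wire_end,
        OF fin(2,1) inj_wire_out wire_epath _ vtx]];
      (assumption | (simp add: inner_wires_def; fail) | (elim exE conjE, rule that; assumption)))
  define Q where "Q = wires - inner_wires"
  \<comment> \<open>\<open>D\<close> collects the paths with two framed ends and \<open>P\<close> the edges of the bracket graph.\<close>
  define D where "D = {n \<in> Q. is_frm (wire_end n) \<and> is_frm (wire_end (out' n))}"
  define P where "P = Q - D"
  have finQ: "finite Q" "finite D" "finite P" using fin by (auto simp: Q_def D_def P_def)
  let ?E = "\<lambda>s \<rho> \<sigma> n. edge s (wire_end n) (hs' n) (wire_end (out' n)) (wire_value \<rho> \<sigma> (out' n)) (wire_value \<rho> \<sigma> n)"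
  define J' where "J' = (\<lambda>s. J s * (\<Prod>n\<in>D. edge s (wire_end n) (hs' n) (wire_end (out' n)) 0 0))"
  have J': "invariant J'"
    unfolding J'_def
  proof (intro invariant_mult J invariant_prod)
    fix n assume n: "n \<in> D"
    then obtain i r j r' where ends: "wire_end n = Frm i r" "wire_end (out' n) = Frm j r'"
      unfolding D_def by (cases "wire_end n"; cases "wire_end (out' n)") auto
    have "epath (wire_end n) (hs' n) (wire_end (out' n))" using ep' n by (simp add: D_def Q_def)
    then show "invariant (\<lambda>s. edge s (wire_end n) (hs' n) (wire_end (out' n)) 0 0)"
      unfolding ends by (rule invariant_framed_edge)
  qed
  have reduce: "(\<Sum>p\<in>assignments w (rv \<circ> e) {..<N}. \<Sum>q\<in>assignments w (cv \<circ> e) {..<N}.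
      of_bool (\<forall>u\<in>upper_slots N e. upper_index p \<sigma> u = lower_index q \<rho> (\<pi> u)) * (\<Prod>k<N. coord s (e k, p k, q k)))
      = J' s * (\<Prod>n\<in>P. ?E s \<rho> \<sigma> n)"
    if s: "s \<in> rep_space G d v" and \<rho>: "\<rho> \<in> block_permutations zsB" and \<sigma>: "\<sigma> \<in> block_permutations ysB" for s \<rho> \<sigma>
  proof -
    have bound: "\<forall>n\<in>wires \<union> wire_out ` wires - inner_wires. wire_value \<rho> \<sigma> n < edim (wire_end n)"
      using wire_value_bound[OF \<rho> \<sigma>] by blast
    have "(\<Prod>n\<in>Q. ?E s \<rho> \<sigma> n) = (\<Prod>n\<in>P. ?E s \<rho> \<sigma> n) * (\<Prod>n\<in>D. ?E s \<rho> \<sigma> n)"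
      unfolding P_def using finQ by (intro prod.subset_diff) (auto simp: D_def)
    also have "(\<Prod>n\<in>D. ?E s \<rho> \<sigma> n) = (\<Prod>n\<in>D. edge s (wire_end n) (hs' n) (wire_end (out' n)) 0 0)"
      by (intro prod.cong refl edge_frm_indep) (auto simp: D_def)
    finally have split: "(\<Prod>n\<in>Q. ?E s \<rho> \<sigma> n) = (\<Prod>n\<in>P. ?E s \<rho> \<sigma> n) * \<dots>" .
    have "(\<Sum>x\<in>Pi\<^sub>E inner_wires (\<lambda>n. {..<edim (wire_end n)}). \<Prod>k\<in>wires. edge s (wire_end k) (wire_arrows k) (wire_end (wire_out k))
        (override inner_wires (wire_value \<rho> \<sigma>) x (wire_out k)) (override inner_wires (wire_value \<rho> \<sigma>) x k)) = J s * (\<Prod>n\<in>Q. ?E s \<rho> \<sigma> n)"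
      unfolding Q_def by (rule sum'[rule_format, OF s]) (rule bound[rule_format])
    then show ?thesis
      unfolding contraction_as_wire_sum[OF s \<rho> \<sigma>] split J'_def by simp
  qed
  \<comment> \<open>The ends of the open paths in \<open>P\<close> are slots of determinant tensors or framed.\<close>
  have out_P: "out' n \<in> wire_out ` wires - inner_wires" if "n \<in> Q" for n
    using out' that unfolding Q_def[symmetric] by blast
  have Inr_out: "Inr r \<in> out' ` P" if r: "r < length zsB" for r
  proof -
    obtain u where u: "u \<in> upper_slots N e" "Inr r = \<pi> u" using \<pi>_surj[OF lower_Inr[OF r]] by blast
    have "\<exists>k. u = Inl k"
    proof (cases u)
      case (Inr r')
      then have "r' < length ysB" using u by (auto simp: upper_slots_def)
      then show ?thesis using \<pi>_bracket[of r'] u Inr by (metis sum.distinct(1))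
    qed auto
    then obtain k where k: "u = Inl k" "k < N" "rv (e k) \<noteq> 0" using u by (auto simp: upper_slots_def)
    then have "Inr r = wire_out (Inl k)" using u by (simp add: wire_out_cases)
    moreover have "Inr r \<notin> inner_wires" by (auto simp: inner_wires_def wires_def)
    ultimately have "Inr r \<in> out' ` Q" using k unfolding Q_def out' by (auto simp: wires_def)
    then obtain n where n: "n \<in> Q" "Inr r = out' n" by blast
    have "wire_end (out' n) = Vtx (label_vertex (zsB ! r))" unfolding n(2)[symmetric] by (simp add: wire_end_def)
    then have "n \<notin> D" by (simp add: D_def)
    then show ?thesis using n by (auto simp: P_def)
  qed
  have out_cases: "(\<exists>r<length zsB. n = Inr r) \<or> is_frm (wire_end n)" if "n \<in> out' ` P" for n
  proof -
    have "n \<in> wire_out ` wires - inner_wires" using that out_P by (auto simp: P_def)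
    then obtain k where k: "n = wire_out (Inl k)" "k < N" "n \<notin> inner_wires" by (auto simp: wires_def)
    show ?thesis
    proof (cases "rv (e k) = 0")
      case True
      then show ?thesis using k generator_ends(4)[OF e_gens[OF k(2)]] by (simp add: wire_end_out)
    next
      case False
      then have n\<pi>: "n = \<pi> (Inl k)" using k by (simp add: wire_out_cases)
      have "n \<in> lower_slots N e" unfolding n\<pi> by (rule \<pi>_mem[OF upper_Inl[OF k(2) False]])
      then show ?thesis
      proof (rule lower_slots_cases)
        fix k' assume "n = Inl k'" "k' < N"
        then have "n \<in> inner_wires" using inner_wires_eq k False n\<pi> by blast
        then show ?thesis using k by blast
      qed auto
    qed
  qed
  have bracket_in: "\<pi> (Inr r) \<in> P" if r: "r < length ysB" for r
  proof -
    obtain k where k: "\<pi> (Inr r) = Inl k" "k < N" by (rule \<pi>_bracket[OF r])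
    have "\<pi> (Inr r) \<notin> inner_wires" using inner_not_bracket[of "\<pi> (Inr r)"] r by blast
    then show ?thesis using k wire_end_\<pi>[OF upper_Inr[OF r]] by (auto simp: P_def Q_def D_def wires_def)
  qed
  have in_cases: "(\<exists>r<length ysB. n = \<pi> (Inr r)) \<or> is_frm (wire_end n)" if nP: "n \<in> P" for n
  proof -
    obtain k where k: "n = Inl k" "k < N" "Inl k \<notin> inner_wires" using nP by (auto simp: P_def Q_def wires_def)
    from k(2,3) show ?thesis
    proof (rule outer_wire_cases)
      assume "cv (e k) = 0"
      then show ?thesis using k generator_ends(2)[OF e_gens[OF k(2)]] by (simp add: wire_end_in)
    next
      fix r assume "r < length ysB" "Inl k = \<pi> (Inr r)"
      then show ?thesis using k by blast
    qed
  qed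
  obtain NA where NA: "set NA = {n \<in> P. is_frm (wire_end n)}" "distinct NA"
    using finite_distinct_list[of "{n \<in> P. is_frm (wire_end n)}"] finQ by auto
  obtain NB where NB: "set NB = {n \<in> out' ` P. is_frm (wire_end n)}" "distinct NB"
    using finite_distinct_list[of "{n \<in> out' ` P. is_frm (wire_end n)}"] finQ by auto
  define la where "la = map (\<lambda>n. frm_pair (wire_end n)) NA"
  define lb where "lb = map (\<lambda>n. frm_pair (wire_end n)) NB"
  define ys where "ys = basis_labels G v (\<lambda>i. nat (- m i)) (length la)"
  define zs where "zs = basis_labels G v (\<lambda>i. nat (m i)) (length lb)"
  define incoming where "incoming = (\<lambda>j. if j < length ysB then \<pi> (Inr j) else NA ! (j - length ysB))"
  define outgoing where "outgoing = (\<lambda>j. if j < length zsB then Inr j else NB ! (j - length zsB))"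
  have len: "length ys = length ysB + length NA" "length zs = length zsB + length NB"
    unfolding ys_def zs_def ysB_def zsB_def la_def lb_def
    by (subst basis_labels_nth(3), simp)+
  have bij_in: "bij_betw incoming {..<length ys} P"
    unfolding bij_betw_def
  proof
    show "inj_on incoming {..<length ys}"
    proof (rule inj_onI)
      fix i j assume ij: "i \<in> {..<length ys}" "j \<in> {..<length ys}" "incoming i = incoming j"
      have frm: "is_frm (wire_end (NA ! l))" if "l < length NA" for l using NA(1) nth_mem[OF that] by auto
      have mixed: False if "i < length ysB" "\<not> j < length ysB" "j < length ys" "incoming i = incoming j" for i j
      proof -
        have "j - length ysB < length NA" using that(2,3) len by linarith
        then show False using that frm[of "j - length ysB"] wire_end_\<pi>[OF upper_Inr[of i]] by (simp add: incoming_def)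
      qed
      show "i = j"
      proof (cases "i < length ysB"; cases "j < length ysB")
        assume lt: "i < length ysB" "j < length ysB"
        then have "\<pi> (Inr i) = \<pi> (Inr j)" using ij by (simp add: incoming_def)
        then have "Inr i = (Inr j :: nat + nat)" by (rule \<pi>_inj[OF upper_Inr[OF lt(1)] upper_Inr[OF lt(2)]])
        then show ?thesis by simp
      next
        assume "\<not> i < length ysB" "\<not> j < length ysB"
        then have "i - length ysB = j - length ysB"
          using ij NA(2) by (simp add: incoming_def len nth_eq_iff_index_eq)
        then show ?thesis using \<open>\<not> i < length ysB\<close> \<open>\<not> j < length ysB\<close> by simp
      qed (use mixed[of i j] mixed[of j i] ij in auto)
    qed
    show "incoming ` {..<length ys} = P"
    proof (intro subset_antisym subsetI)
      fix n assume "n \<in> incoming ` {..<length ys}"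
      then obtain j where j: "j < length ys" "n = incoming j" by auto
      show "n \<in> P"
      proof (cases "j < length ysB")
        case False
        then have "n \<in> set NA" using j by (simp add: incoming_def len)
        then show ?thesis using NA(1) by simp
      qed (use j bracket_in in \<open>simp add: incoming_def\<close>)
    next
      fix n assume n: "n \<in> P"
      from in_cases[OF n] show "n \<in> incoming ` {..<length ys}"
      proof
        assume "\<exists>r<length ysB. n = \<pi> (Inr r)"
        then obtain r where "r < length ysB" "n = \<pi> (Inr r)" by blast
        then show ?thesis by (intro image_eqI[of _ _ r]) (simp_all add: incoming_def len)
      next
        assume "is_frm (wire_end n)"
        then have "n \<in> set NA" using n NA(1) by simp
        then obtain l where "l < length NA" "n = NA ! l" unfolding in_set_conv_nth by blast
        then show ?thesis by (intro image_eqI[of _ _ "length ysB + l"]) (simp_all add: incoming_def len)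
      qed
    qed
  qed
  have bij_out: "bij_betw outgoing {..<length zs} (out' ` P)"
    unfolding bij_betw_def
  proof
    show "inj_on outgoing {..<length zs}"
    proof (rule inj_onI)
      fix i j assume ij: "i \<in> {..<length zs}" "j \<in> {..<length zs}" "outgoing i = outgoing j"
      have frm: "is_frm (wire_end (NB ! l))" if "l < length NB" for l using NB(1) nth_mem[OF that] by auto
      have mixed: False if "i < length zsB" "\<not> j < length zsB" "j < length zs" "outgoing i = outgoing j" for i j
      proof -
        have "wire_end (Inr i) = wire_end (NB ! (j - length zsB))" using that by (simp add: outgoing_def)
        then have "wire_end (NB ! (j - length zsB)) = Vtx (label_vertex (zsB ! i))" by (simp add: wire_end_def)
        moreover have "j - length zsB < length NB" using that(2,3) len by linarith
        ultimately show False using frm[of "j - length zsB"] by simp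
      qed
      show "i = j"
      proof (cases "i < length zsB"; cases "j < length zsB")
        assume "\<not> i < length zsB" "\<not> j < length zsB"
        then have "i - length zsB = j - length zsB"
          using ij NB(2) by (simp add: outgoing_def len nth_eq_iff_index_eq)
        then show ?thesis using \<open>\<not> i < length zsB\<close> \<open>\<not> j < length zsB\<close> by simp
      qed (use mixed[of i j] mixed[of j i] ij in \<open>auto simp: outgoing_def\<close>)
    qed
    show "outgoing ` {..<length zs} = out' ` P"
    proof (intro subset_antisym subsetI)
      fix n assume "n \<in> outgoing ` {..<length zs}"
      then obtain j where j: "j < length zs" "n = outgoing j" by auto
      show "n \<in> out' ` P"
      proof (cases "j < length zsB")
        case False
        then have "n \<in> set NB" using j by (simp add: outgoing_def len)
        then show ?thesis using NB(1) by simp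
      qed (use j Inr_out in \<open>simp add: outgoing_def\<close>)
    next
      fix n assume n: "n \<in> out' ` P"
      from out_cases[OF n] show "n \<in> outgoing ` {..<length zs}"
      proof
        assume "\<exists>r<length zsB. n = Inr r"
        then obtain r where "r < length zsB" "n = Inr r" by blast
        then show ?thesis by (intro image_eqI[of _ _ r]) (simp_all add: outgoing_def len)
      next
        assume "is_frm (wire_end n)"
        then have "n \<in> set NB" using n NB(1) by simp
        then obtain l where "l < length NB" "n = NB ! l" unfolding in_set_conv_nth by blast
        then show ?thesis by (intro image_eqI[of _ _ "length zsB + l"]) (simp_all add: outgoing_def len)
      qed
    qed
  qed
  have injP: "inj_on out' P" using inj' by (rule inj_on_subset) (auto simp: P_def Q_def)
  then have bij_out': "bij_betw out' P (out' ` P)" by (simp add: bij_betw_def)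
  define R where "R = length zs"
  have R_ys: "length ys = R"
    using bij_betw_same_card[OF bij_in] bij_betw_same_card[OF bij_out] bij_betw_same_card[OF bij_out'] by (simp add: R_def)
  \<comment> \<open>Edges are numbered by their end in \<open>Z\<close>: edge \<open>j\<close> is the path \<open>\<theta> j\<close>, and it starts at the basis vector number \<open>\<tau> j\<close> of \<open>Y\<close>.\<close>
  define \<theta> where "\<theta> = (\<lambda>j. inv_into P out' (outgoing j))"
  have bij_\<theta>: "bij_betw \<theta> {..<R} P"
    unfolding \<theta>_def R_def using bij_betw_trans[OF bij_out bij_betw_inv_into[OF bij_out']] by (simp add: comp_def)
  have out_\<theta>: "out' (\<theta> j) = outgoing j" if "j < R" for j
  proof -
    have "outgoing j \<in> out' ` P" using bij_betwE[OF bij_out] that by (simp add: R_def)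
    then show ?thesis unfolding \<theta>_def by (rule f_inv_into_f)
  qed
  have \<theta>_P: "\<theta> j \<in> P" if "j < R" for j using bij_betwE[OF bij_\<theta>] that by simp
  define \<tau> where "\<tau> = (\<lambda>j. if j < R then inv_into {..<R} incoming (\<theta> j) else j)"
  have bij_inR: "bij_betw incoming {..<R} P" using bij_in by (simp add: R_ys)
  have in_\<tau>: "incoming (\<tau> j) = \<theta> j" if "j < R" for j
  proof -
    have "\<theta> j \<in> incoming ` {..<R}" using bij_inR \<theta>_P[OF that] by (simp add: bij_betw_def)
    then show ?thesis using that by (simp add: \<tau>_def f_inv_into_f)
  qed
  have \<tau>: "\<tau> permutes {..<R}"
  proof (rule bij_imp_permutes)
    have "bij_betw (inv_into {..<R} incoming \<circ> \<theta>) {..<R} {..<R}"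
      by (rule bij_betw_trans[OF bij_\<theta> bij_betw_inv_into[OF bij_inR]])
    then show "bij_betw \<tau> {..<R} {..<R}"
      by (rule bij_betw_cong[THEN iffD1, rotated]) (simp add: \<tau>_def)
  qed (simp add: \<tau>_def)
  have \<tau>_lt: "\<tau> j < R" if "j < R" for j using permutes_in_image[OF \<tau>, of j] that by simp
  have ys_nth: "j < length ysB \<Longrightarrow> ys ! j = ysB ! j" "l < length NA \<Longrightarrow> ys ! (length ysB + l) = Line l" for j l
    unfolding ys_def ysB_def by (rule basis_labels_nth, assumption) (rule basis_labels_nth, simp add: la_def)
  have zs_nth: "j < length zsB \<Longrightarrow> zs ! j = zsB ! j" "l < length NB \<Longrightarrow> zs ! (length zsB + l) = Line l" for j l
    unfolding zs_def zsB_def by (rule basis_labels_nth, assumption) (rule basis_labels_nth, simp add: lb_def)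
  have split_index: "\<exists>l<length NA. j = length ysB + l" if "j < R" "\<not> j < length ysB" for j
    using that R_ys len by (intro exI[of _ "j - length ysB"]) auto
  have split_index': "\<exists>l<length NB. j = length zsB + l" if "j < R" "\<not> j < length zsB" for j
    using that len by (intro exI[of _ "j - length zsB"]) (auto simp: R_def)
  have NA_frm: "is_frm (wire_end (NA ! l))" "NA ! l \<in> P" if "l < length NA" for l using NA(1) nth_mem[OF that] by auto
  have NB_frm: "is_frm (wire_end (NB ! l))" "NB ! l \<in> out' ` P" if "l < length NB" for l using NB(1) nth_mem[OF that] by auto
  have end_in: "label_end la (ys ! j) = wire_end (incoming j)" if j: "j < R" for j
  proof (cases "j < length ysB")
    case True
    then show ?thesis
      using ys_nth(1)[OF True] ysB_nth[OF True] wire_end_\<pi>[OF upper_Inr[OF True]] by (auto simp: incoming_def upper_color_def)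
  next
    case False
    then obtain l where l: "l < length NA" "j = length ysB + l" using split_index[OF j False] by blast
    show ?thesis
      using ys_nth(2)[OF l(1)] is_frm_pair[OF NA_frm(1)[OF l(1)]] l by (simp add: incoming_def la_def)
  qed
  have end_out: "label_end lb (zs ! j) = wire_end (outgoing j)" if j: "j < R" for j
  proof (cases "j < length zsB")
    case True
    then show ?thesis using zs_nth(1)[OF True] zsB_nth[OF True] by (auto simp: outgoing_def wire_end_def)
  next
    case False
    then obtain l where l: "l < length NB" "j = length zsB + l" using split_index'[OF j False] by blast
    show ?thesis
      using zs_nth(2)[OF l(1)] is_frm_pair[OF NB_frm(1)[OF l(1)]] l by (simp add: outgoing_def lb_def)
  qed
  have ep: "epath (wire_end n) (hs' n) (wire_end (out' n))" if "n \<in> P" for n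
    using ep' that by (simp add: P_def Q_def)
  have la: "i \<in> verts G \<and> r < d i" if ir: "(i, r) \<in> set la" for i r
  proof -
    obtain n where n: "n \<in> P" "is_frm (wire_end n)" "(i, r) = frm_pair (wire_end n)" using ir NA(1) by (auto simp: la_def)
    then have "wire_end n = Frm i r" using is_frm_pair[OF n(2)] by (metis fst_conv snd_conv)
    then show ?thesis using ep[OF n(1)] path_verts by (auto simp: epath_def)
  qed
  have lb: "i \<in> verts G \<and> r < d i" if ir: "(i, r) \<in> set lb" for i r
  proof -
    obtain n where n: "n \<in> P" "is_frm (wire_end (out' n))" "(i, r) = frm_pair (wire_end (out' n))" using ir NB(1) by (auto simp: lb_def)
    then have "wire_end (out' n) = Frm i r" using is_frm_pair[OF n(2)] by (metis fst_conv snd_conv)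
    then show ?thesis using ep[OF n(1)] path_verts by (auto simp: epath_def)
  qed
  have value_in: "wire_value \<rho> \<sigma> (incoming j) = label_pos (ys ! \<sigma> j)" if \<sigma>: "\<sigma> \<in> block_permutations ysB" and j: "j < R" for \<rho> \<sigma> j
  proof (cases "j < length ysB")
    case True
    then show ?thesis
      using wire_value_bracket[OF True] block_permutation_lt[OF \<sigma> True] by (simp add: incoming_def ys_nth)
  next
    case False
    then obtain l where l: "l < length NA" "j = length ysB + l" using split_index j by blast
    have "\<sigma> j = j" using \<sigma> False unfolding color_permutations_def permutes_def by simp
    then show ?thesis using wire_value_frm[OF NA_frm(1)[OF l(1)]] ys_nth(2)[OF l(1)] l by (simp add: incoming_def)
  qed
  have value_out: "wire_value \<rho> \<sigma> (outgoing j) = label_pos (zs ! \<rho> j)" if \<rho>: "\<rho> \<in> block_permutations zsB" and j: "j < R" for \<rho> \<sigma> j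
  proof (cases "j < length zsB")
    case True
    then show ?thesis
      using block_permutation_lt[OF \<rho> True] by (simp add: outgoing_def zs_nth wire_value_Inr)
  next
    case False
    then obtain l where l: "l < length NB" "j = length zsB + l" using split_index' j by blast
    have "\<rho> j = j" using \<rho> False unfolding color_permutations_def permutes_def by simp
    then show ?thesis using wire_value_frm[OF NB_frm(1)[OF l(1)]] zs_nth(2)[OF l(1)] l by (simp add: outgoing_def)
  qed
  have perms: "block_permutations ys = block_permutations ysB" "block_permutations zs = block_permutations zsB"
    unfolding ys_def zs_def ysB_def zsB_def by (rule block_permutations_lines)+
  have path_edges: "epath (label_end la (ys ! \<tau> j)) (hs' (\<theta> j)) (label_end lb (zs ! j))" if j: "j < R" for j
    using ep[OF \<theta>_P[OF j]] by (simp add: end_in[OF \<tau>_lt[OF j]] end_out[OF j] in_\<tau>[OF j] out_\<theta>[OF j])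
  have no_lines: "zs ! j \<noteq> Line l'" if j: "j < R" and l: "ys ! \<tau> j = Line l" for j l l'
  proof
    assume l': "zs ! j = Line l'"
    have "wire_end (out' (\<theta> j)) = label_end lb (Line l')" using end_out[OF j] unfolding out_\<theta>[OF j] l' by (rule sym)
    moreover have "wire_end (\<theta> j) = label_end la (Line l)" using end_in[OF \<tau>_lt[OF j]] unfolding in_\<tau>[OF j] l by (rule sym)
    ultimately show False using \<theta>_P[OF j] by (simp add: P_def D_def)
  qed
  note bracket_graph = bracket_graph_generated[where m = m and la = la and lb = lb and \<tau> = \<tau> and hs = "\<lambda>j. hs' (\<theta> j)" and R = R,
      folded ys_def zs_def]
  have "generated m (\<lambda>s. \<Sum>\<rho>\<in>block_permutations zs. \<Sum>\<sigma>\<in>block_permutations ys. signof \<rho> * signof \<sigma> *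
     (\<Prod>j<R. edge s (label_end la (ys ! \<tau> j)) (hs' (\<theta> j)) (label_end lb (zs ! j)) (label_pos (zs ! \<rho> j)) (label_pos (ys ! \<sigma> (\<tau> j)))))"
    by (rule bracket_graph[OF R_ys R_def[symmetric] \<tau>]; (erule path_edges | (rule no_lines; assumption) | erule la | erule lb))
  then have "generated m (\<lambda>s. J' s * (\<Sum>\<rho>\<in>block_permutations zs. \<Sum>\<sigma>\<in>block_permutations ys. signof \<rho> * signof \<sigma> *
     (\<Prod>j<R. edge s (label_end la (ys ! \<tau> j)) (hs' (\<theta> j)) (label_end lb (zs ! j)) (label_pos (zs ! \<rho> j)) (label_pos (ys ! \<sigma> (\<tau> j))))))"
    by (rule generated_mult[OF J'])
  then show ?thesis
  proof (rule generated_cong[THEN iffD1, rotated])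
    fix s assume s: "s \<in> rep_space G d v"
    show "J' s * (\<Sum>\<rho>\<in>block_permutations zs. \<Sum>\<sigma>\<in>block_permutations ys. signof \<rho> * signof \<sigma> *
     (\<Prod>j<R. edge s (label_end la (ys ! \<tau> j)) (hs' (\<theta> j)) (label_end lb (zs ! j)) (label_pos (zs ! \<rho> j)) (label_pos (ys ! \<sigma> (\<tau> j)))))
     = (\<Sum>\<rho>\<in>block_permutations zsB. \<Sum>\<sigma>\<in>block_permutations ysB. signof \<rho> * signof \<sigma> *
     (\<Sum>p\<in>assignments w (rv \<circ> e) {..<N}. \<Sum>q\<in>assignments w (cv \<circ> e) {..<N}.
      of_bool (\<forall>u\<in>upper_slots N e. upper_index p \<sigma> u = lower_index q \<rho> (\<pi> u)) * (\<Prod>k<N. coord s (e k, p k, q k))))"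
      unfolding perms sum_distrib_left[of "J' s"]
    proof (rule sum.cong[OF refl], rule sum.cong[OF refl])
      fix \<rho> \<sigma> assume \<rho>: "\<rho> \<in> block_permutations zsB" and \<sigma>: "\<sigma> \<in> block_permutations ysB"
      have "(\<Prod>n\<in>P. ?E s \<rho> \<sigma> n) = (\<Prod>j<R. ?E s \<rho> \<sigma> (\<theta> j))"
        by (rule prod.reindex_bij_betw[OF bij_\<theta>, symmetric])
      also have "\<dots> = (\<Prod>j<R. edge s (label_end la (ys ! \<tau> j)) (hs' (\<theta> j)) (label_end lb (zs ! j)) (label_pos (zs ! \<rho> j)) (label_pos (ys ! \<sigma> (\<tau> j))))"
      proof (rule prod.cong[OF refl])
        fix j assume "j \<in> {..<R}"
        then have j: "j < R" by simp
        show "?E s \<rho> \<sigma> (\<theta> j) = edge s (label_end la (ys ! \<tau> j)) (hs' (\<theta> j)) (label_end lb (zs ! j)) (label_pos (zs ! \<rho> j)) (label_pos (ys ! \<sigma> (\<tau> j)))"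
          unfolding end_in[OF \<tau>_lt[OF j]] end_out[OF j] in_\<tau>[OF j] out_\<theta>[OF j] value_out[OF \<rho> j]
            value_in[OF \<sigma> \<tau>_lt[OF j], unfolded in_\<tau>[OF j]] ..
      qed
      finally show "J' s * (signof \<rho> * signof \<sigma> *
        (\<Prod>j<R. edge s (label_end la (ys ! \<tau> j)) (hs' (\<theta> j)) (label_end lb (zs ! j)) (label_pos (zs ! \<rho> j)) (label_pos (ys ! \<sigma> (\<tau> j)))))
        = signof \<rho> * signof \<sigma> * (\<Sum>p\<in>assignments w (rv \<circ> e) {..<N}. \<Sum>q\<in>assignments w (cv \<circ> e) {..<N}.
          of_bool (\<forall>u\<in>upper_slots N e. upper_index p \<sigma> u = lower_index q \<rho> (\<pi> u)) * (\<Prod>k<N. coord s (e k, p k, q k)))"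
        unfolding reduce[OF s \<rho> \<sigma>] by simp
    qed
  qed
qed

end

end

end

section \<open>Coefficient tensors are generated by bracket graphs\<close>

text \<open>A multi-index on all slots is the same as a pair of multi-indices, one for the generators and one for
the determinant tensors.  Framing indices have colour 0 and are not slots; \<open>left_part\<close> restores them with
their only possible value 0.\<close>

definition colored_slots :: "(nat \<Rightarrow> nat) \<Rightarrow> nat \<Rightarrow> nat \<Rightarrow> (nat + nat) set" where
  "colored_slots c N K = Inl ` {k. k < N \<and> c k \<noteq> 0} \<union> Inr ` {..<K}"

definition left_part :: "(nat \<Rightarrow> nat) \<Rightarrow> nat \<Rightarrow> (nat + nat \<Rightarrow> nat) \<Rightarrow> nat \<Rightarrow> nat" where
  "left_part c N a = (\<lambda>k\<in>{..<N}. if c k = 0 then 0 else a (Inl k))"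

definition right_part :: "nat \<Rightarrow> (nat + nat \<Rightarrow> nat) \<Rightarrow> nat \<Rightarrow> nat" where
  "right_part K a = (\<lambda>r\<in>{..<K}. a (Inr r))"

lemma finite_colored_slots [simp]: "finite (colored_slots c N K)"
  by (simp add: colored_slots_def)

lemma parts_mem:
  assumes "(w :: nat \<Rightarrow> nat) 0 = 1" and a: "a \<in> assignments w (case_sum c1 c2) (colored_slots c1 N K)"
  shows "left_part c1 N a \<in> assignments w c1 {..<N}" "right_part K a \<in> assignments w c2 {..<K}"
proof -
  have *: "a (Inl k) < w (c1 k)" if "k < N" "c1 k \<noteq> 0" for k
    using PiE_mem[OF a[unfolded assignments_def], of "Inl k"] that by (simp add: colored_slots_def)
  have **: "a (Inr r) < w (c2 r)" if "r < K" for r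
    using PiE_mem[OF a[unfolded assignments_def], of "Inr r"] that by (simp add: colored_slots_def)
  show "left_part c1 N a \<in> assignments w c1 {..<N}"
    unfolding left_part_def assignments_def by (rule PiE_I) (use * assms(1) in auto)
  show "right_part K a \<in> assignments w c2 {..<K}"
    unfolding right_part_def assignments_def by (rule PiE_I) (use ** in auto)
qed

lemma sum_over_parts:
  fixes g :: "(nat \<Rightarrow> nat) \<Rightarrow> (nat \<Rightarrow> nat) \<Rightarrow> complex"
  assumes w: "(w :: nat \<Rightarrow> nat) 0 = 1"
  shows "(\<Sum>a\<in>assignments w (case_sum c1 c2) (colored_slots c1 N K). g (left_part c1 N a) (right_part K a))
    = (\<Sum>p\<in>assignments w c1 {..<N}. \<Sum>x\<in>assignments w c2 {..<K}. g p x)"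
proof -
  let ?U = "colored_slots c1 N K"
  define join where "join = (\<lambda>(p :: nat \<Rightarrow> nat, x :: nat \<Rightarrow> nat). \<lambda>u\<in>?U. case_sum p x u)"
  have "(\<Sum>a\<in>assignments w (case_sum c1 c2) ?U. g (left_part c1 N a) (right_part K a))
    = (\<Sum>px\<in>assignments w c1 {..<N} \<times> assignments w c2 {..<K}. g (fst px) (snd px))"
  proof (rule sum.reindex_bij_witness[of _ join "\<lambda>a. (left_part c1 N a, right_part K a)"])
    fix a assume a: "a \<in> assignments w (case_sum c1 c2) ?U"
    show "(left_part c1 N a, right_part K a) \<in> assignments w c1 {..<N} \<times> assignments w c2 {..<K}"
      using parts_mem[OF w a] by simp
    have "join (left_part c1 N a, right_part K a) = restrict a ?U"
      unfolding join_def by (auto intro!: restrict_ext simp: colored_slots_def left_part_def right_part_def)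
    then show "join (left_part c1 N a, right_part K a) = a"
      using PiE_restrict[OF a[unfolded assignments_def]] by simp
  next
    fix px assume "px \<in> assignments w c1 {..<N} \<times> assignments w c2 {..<K}"
    then obtain p x where px: "px = (p, x)" "p \<in> assignments w c1 {..<N}" "x \<in> assignments w c2 {..<K}" by auto
    have p: "p k < w (c1 k)" if "k < N" for k using PiE_mem[OF px(2)[unfolded assignments_def]] that by simp
    have x: "x r < w (c2 r)" if "r < K" for r using PiE_mem[OF px(3)[unfolded assignments_def]] that by simp
    show mem: "join px \<in> assignments w (case_sum c1 c2) ?U"
      unfolding join_def px assignments_def prod.case by (rule PiE_I) (auto simp: colored_slots_def p x)
    have "left_part c1 N (join px) = p"
    proof (rule assignments_eq_iff[OF parts_mem(1)[OF w mem] px(2), THEN iffD2], rule ballI)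
      fix k assume "k \<in> {..<N}"
      then show "left_part c1 N (join px) k = p k"
        using p[of k] w by (cases "c1 k = 0") (auto simp: left_part_def join_def px colored_slots_def)
    qed
    moreover have "right_part K (join px) = x"
    proof (rule assignments_eq_iff[OF parts_mem(2)[OF w mem] px(3), THEN iffD2], rule ballI)
      fix r assume "r \<in> {..<K}"
      then show "right_part K (join px) r = x r" by (auto simp: right_part_def join_def px colored_slots_def)
    qed
    ultimately show "(left_part c1 N (join px), right_part K (join px)) = px" by (simp add: px)
  qed simp
  also have "\<dots> = (\<Sum>p\<in>assignments w c1 {..<N}. \<Sum>x\<in>assignments w c2 {..<K}. g p x)"
    by (simp add: sum.cartesian_product split_def)
  finally show ?thesis .
qed

lemma tensor_power_parts:
  assumes M: "M 0 = 1\<^sub>m 1"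
  shows "tensor_power (case_sum c1 c2) (colored_slots c1 N K) M a b
    = tensor_power c1 {..<N} M (left_part c1 N a) (left_part c1 N b) * tensor_power c2 {..<K} M (right_part K a) (right_part K b)"
proof -
  have "tensor_power (case_sum c1 c2) (colored_slots c1 N K) M a b
    = (\<Prod>u\<in>Inl ` {k. k < N \<and> c1 k \<noteq> 0}. M (case_sum c1 c2 u) $$ (a u, b u)) * (\<Prod>u\<in>Inr ` {..<K}. M (case_sum c1 c2 u) $$ (a u, b u))"
    unfolding tensor_power_def colored_slots_def by (rule prod.union_disjoint) auto
  also have "(\<Prod>u\<in>Inr ` {..<K}. M (case_sum c1 c2 u) $$ (a u, b u)) = tensor_power c2 {..<K} M (right_part K a) (right_part K b)"
    by (simp add: prod.reindex tensor_power_def right_part_def)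
  also have "(\<Prod>u\<in>Inl ` {k. k < N \<and> c1 k \<noteq> 0}. M (case_sum c1 c2 u) $$ (a u, b u))
      = (\<Prod>k\<in>{k. k < N \<and> c1 k \<noteq> 0}. M (c1 k) $$ (left_part c1 N a k, left_part c1 N b k))"
    by (subst prod.reindex) (auto simp: left_part_def intro!: prod.cong)
  also have "\<dots> = tensor_power c1 {..<N} M (left_part c1 N a) (left_part c1 N b)"
    unfolding tensor_power_def
    by (rule prod.mono_neutral_left) (auto simp: left_part_def M)
  finally show ?thesis .
qed

lemma tensor_power_cong_color:
  "(\<And>u. u \<in> U \<Longrightarrow> A (c u) = B (c u)) \<Longrightarrow> tensor_power c U A x y = tensor_power c U B x y"
  unfolding tensor_power_def by (rule prod.cong) auto

lemma sum_reorder: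
  "(\<Sum>i\<in>I. \<Sum>r\<in>R. \<Sum>s\<in>S. \<Sum>p\<in>P. \<Sum>q\<in>Q. t p q i r s) = (\<Sum>p\<in>P. \<Sum>q\<in>Q. \<Sum>r\<in>R. \<Sum>s\<in>S. \<Sum>i\<in>I. t p q i r s)"
proof -
  have "(\<Sum>i\<in>I. \<Sum>r\<in>R. \<Sum>s\<in>S. \<Sum>p\<in>P. \<Sum>q\<in>Q. t p q i r s) = (\<Sum>r\<in>R. \<Sum>i\<in>I. \<Sum>s\<in>S. \<Sum>p\<in>P. \<Sum>q\<in>Q. t p q i r s)" by (rule sum.swap)
  also have "\<dots> = (\<Sum>r\<in>R. \<Sum>s\<in>S. \<Sum>i\<in>I. \<Sum>p\<in>P. \<Sum>q\<in>Q. t p q i r s)" by (rule sum.cong[OF refl], rule sum.swap)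
  also have "\<dots> = (\<Sum>r\<in>R. \<Sum>s\<in>S. \<Sum>p\<in>P. \<Sum>i\<in>I. \<Sum>q\<in>Q. t p q i r s)" by (rule sum.cong[OF refl], rule sum.cong[OF refl], rule sum.swap)
  also have "\<dots> = (\<Sum>r\<in>R. \<Sum>s\<in>S. \<Sum>p\<in>P. \<Sum>q\<in>Q. \<Sum>i\<in>I. t p q i r s)" by (rule sum.cong[OF refl], rule sum.cong[OF refl], rule sum.cong[OF refl], rule sum.swap)
  also have "\<dots> = (\<Sum>r\<in>R. \<Sum>p\<in>P. \<Sum>s\<in>S. \<Sum>q\<in>Q. \<Sum>i\<in>I. t p q i r s)" by (rule sum.cong[OF refl], rule sum.swap)
  also have "\<dots> = (\<Sum>p\<in>P. \<Sum>r\<in>R. \<Sum>s\<in>S. \<Sum>q\<in>Q. \<Sum>i\<in>I. t p q i r s)" by (rule sum.swap)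
  also have "\<dots> = (\<Sum>p\<in>P. \<Sum>r\<in>R. \<Sum>q\<in>Q. \<Sum>s\<in>S. \<Sum>i\<in>I. t p q i r s)" by (rule sum.cong[OF refl], rule sum.cong[OF refl], rule sum.swap)
  also have "\<dots> = (\<Sum>p\<in>P. \<Sum>q\<in>Q. \<Sum>r\<in>R. \<Sum>s\<in>S. \<Sum>i\<in>I. t p q i r s)" by (rule sum.cong[OF refl], rule sum.swap)
  finally show ?thesis .
qed

context framed_quiver
begin

lemma upper_slots_colored: "upper_slots m N e = colored_slots (\<lambda>k. rv (e k)) N (length (ysB m))"
  by (simp add: upper_slots_def colored_slots_def)

lemma lower_slots_colored: "lower_slots m N e = colored_slots (\<lambda>k. cv (e k)) N (length (zsB m))"
  by (simp add: lower_slots_def colored_slots_def)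

lemma upper_color_nonzero: "u \<in> upper_slots m N e \<Longrightarrow> upper_color m e u \<noteq> 0"
proof -
  assume "u \<in> upper_slots m N e"
  then consider k where "u = Inl k" "rv (e k) \<noteq> 0" | r where "u = Inr r" "r < length (ysB m)" by (auto simp: upper_slots_def)
  then show ?thesis
  proof cases
    case (2 r)
    obtain i h p where "ysB m ! r = Block i h p" "i \<in> verts G" using ysB_nth[OF 2(2)] by blast
    then show ?thesis using 2 zero_notin_verts by (cases "i = 0") (auto simp: upper_color_def)
  qed (simp add: upper_color_def)
qed

lemma lower_color_nonzero: "u \<in> lower_slots m N e \<Longrightarrow> lower_color m e u \<noteq> 0"
proof -
  assume "u \<in> lower_slots m N e"
  then consider k where "u = Inl k" "cv (e k) \<noteq> 0" | r where "u = Inr r" "r < length (zsB m)" by (auto simp: lower_slots_def)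
  then show ?thesis
  proof cases
    case (2 r)
    obtain i h p where "zsB m ! r = Block i h p" "i \<in> verts G" using zsB_nth[OF 2(2)] by blast
    then show ?thesis using 2 zero_notin_verts by (cases "i = 0") (auto simp: lower_color_def)
  qed (simp add: lower_color_def)
qed

text \<open>A vertex with \<open>m\<^sub>i > 0\<close> has \<open>m\<^sub>i\<close> determinant tensors with lower indices, which transform by the
inverse of the determinant, and a vertex with \<open>m\<^sub>i < 0\<close> has \<open>- m\<^sub>i\<close> with upper indices, which transform
by the determinant itself.\<close>

lemma character_cancels:
  assumes A: "(A, A') \<in> inverse_families w" and A0: "A 0 = 1\<^sub>m 1" "A' 0 = 1\<^sub>m 1"
  shows "(\<Prod>i\<in>verts G. det (A i) powi m i) * det (block_matrix (ysB m) A) * det (block_matrix (zsB m) A') = 1"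
proof -
  have carr: "A i \<in> carrier_mat (v i) (v i)" "A' i \<in> carrier_mat (v i) (v i)" "A i * A' i = 1\<^sub>m (v i)" if "i \<in> verts G" for i
    using A w_verts[OF that] unfolding inverse_families_def by (simp_all; metis)+
  have one: "det (A i) * det (A' i) = 1" if i: "i \<in> verts G" for i
    using det_mult[OF carr(1,2)[OF i]] carr(3)[OF i] by simp
  have dy: "det (block_matrix (ysB m) A) = (\<Prod>i\<in>verts G. det (A i) ^ nat (- m i))"
    unfolding ysB_def by (rule det_block_matrix) (use carr A0 in auto)
  have dz: "det (block_matrix (zsB m) A') = (\<Prod>i\<in>verts G. det (A' i) ^ nat (m i))"
    unfolding zsB_def by (rule det_block_matrix) (use carr A0 in auto)
  have cancel: "det (A i) powi m i * det (A i) ^ nat (- m i) * det (A' i) ^ nat (m i) = 1" if i: "i \<in> verts G" for i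
  proof (cases "0 \<le> m i")
    case True
    then have "det (A i) powi m i = det (A i) ^ nat (m i)" by (simp add: power_int_def)
    then show ?thesis using True one[OF i] by (simp add: power_mult_distrib[symmetric])
  next
    case False
    have "det (A i) \<noteq> 0" using one[OF i] by auto
    then show ?thesis using False by (simp add: power_int_def power_mult_distrib[symmetric])
  qed
  show ?thesis unfolding dy dz prod.distrib[symmetric] by (rule prod.neutral, rule ballI, rule cancel)
qed

text \<open>Multiplied by the determinant tensors, the coefficient tensor \<open>c\<close> becomes invariant, hence a combination
of matchings \<open>\<pi> i\<close>.  Contracting the determinant tensors with themselves recovers a positive multiple
\<open>\<kappa>\<close> of \<open>c\<close>, where \<open>\<kappa>\<close> counts pairs of block permutations.  The same contraction applied to a
single matching gives the functions of \<open>contraction_generated\<close>.\<close>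

lemma tensor_slice_generated:
  fixes N :: nat and c :: "(nat \<Rightarrow> nat) \<Rightarrow> (nat \<Rightarrow> nat) \<Rightarrow> complex"
  assumes e: "e \<in> {..<N} \<rightarrow>\<^sub>E gens"
    and law: "\<And>A A' p q. (A, A') \<in> inverse_families w \<Longrightarrow> A 0 = 1\<^sub>m 1 \<Longrightarrow> A' 0 = 1\<^sub>m 1 \<Longrightarrow>
      p \<in> assignments w (rv \<circ> e) {..<N} \<Longrightarrow> q \<in> assignments w (cv \<circ> e) {..<N} \<Longrightarrow>
      (\<Sum>p'\<in>assignments w (rv \<circ> e) {..<N}. \<Sum>q'\<in>assignments w (cv \<circ> e) {..<N}.
        c p' q' * tensor_power (rv \<circ> e) {..<N} A p' p * tensor_power (cv \<circ> e) {..<N} A' q q')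
      = (\<Prod>i\<in>verts G. det (A i) powi m i) * c p q"
  shows "generated m (\<lambda>s. \<Sum>p\<in>assignments w (rv \<circ> e) {..<N}. \<Sum>q\<in>assignments w (cv \<circ> e) {..<N}.
    c p q * (\<Prod>k<N. coord s (e k, p k, q k)))"
proof -
  let ?P = "assignments w (rv \<circ> e) {..<N}" and ?Q = "assignments w (cv \<circ> e) {..<N}"
  let ?U = "upper_slots m N e" and ?L = "lower_slots m N e" and ?cu = "upper_color m e" and ?cl = "lower_color m e"
  let ?y = "\<lambda>r. label_vertex (ysB m ! r)" and ?z = "\<lambda>r. label_vertex (zsB m ! r)"
  let ?K = "length (ysB m)" and ?K' = "length (zsB m)"
  let ?X = "assignments w ?y {..<?K}" and ?Z = "assignments w ?z {..<?K'}"
  let ?BY = "block_permutations (ysB m)" and ?BZ = "block_permutations (zsB m)"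
  have w0: "w 0 = 1" by simp
  define lu where "lu = left_part (rv \<circ> e) N"
  define ru where "ru = right_part ?K"
  define ll where "ll = left_part (cv \<circ> e) N"
  define rl where "rl = right_part ?K'"
  define F where "F = (\<lambda>a b. c (lu a) (ll b) * block_sign (ysB m) (ru a) * block_sign (zsB m) (rl b))"
  have U: "?U = colored_slots (rv \<circ> e) N ?K" "?cu = case_sum (rv \<circ> e) ?y"
    by (simp_all add: upper_slots_colored upper_color_def comp_def)
  have L: "?L = colored_slots (cv \<circ> e) N ?K'" "?cl = case_sum (cv \<circ> e) ?z"
    by (simp_all add: lower_slots_colored lower_color_def comp_def)
  have parts_u: "lu a \<in> ?P" "ru a \<in> ?X" if "a \<in> assignments w ?cu ?U" for a
    using parts_mem[OF w0 that[unfolded U]] by (simp_all add: lu_def ru_def)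
  have parts_l: "ll b \<in> ?Q" "rl b \<in> ?Z" if "b \<in> assignments w ?cl ?L" for b
    using parts_mem[OF w0 that[unfolded L]] by (simp_all add: ll_def rl_def)
  have sum_u: "(\<Sum>a\<in>assignments w ?cu ?U. g (lu a) (ru a)) = (\<Sum>p\<in>?P. \<Sum>x\<in>?X. g p x)"
    for g :: "(nat \<Rightarrow> nat) \<Rightarrow> (nat \<Rightarrow> nat) \<Rightarrow> complex"
    unfolding U lu_def ru_def by (rule sum_over_parts[where w = w and g = g, OF w0])
  have sum_l: "(\<Sum>b\<in>assignments w ?cl ?L. g (ll b) (rl b)) = (\<Sum>q\<in>?Q. \<Sum>z\<in>?Z. g q z)"
    for g :: "(nat \<Rightarrow> nat) \<Rightarrow> (nat \<Rightarrow> nat) \<Rightarrow> complex"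
    unfolding L ll_def rl_def by (rule sum_over_parts[where w = w and g = g, OF w0])
  have invariance: "(\<Sum>a'\<in>assignments w ?cu ?U. \<Sum>b'\<in>assignments w ?cl ?L.
      F a' b' * tensor_power ?cu ?U A a' a * tensor_power ?cl ?L A' b b') = F a b"
    if AA: "(A, A') \<in> inverse_families w" and a: "a \<in> assignments w ?cu ?U" and b: "b \<in> assignments w ?cl ?L" for A A' a b
  proof -
    \<comment> \<open>No slot has colour 0, so the matrices of that colour may be replaced by the identity.\<close>
    define B where "B = A(0 := 1\<^sub>m 1)"
    define B' where "B' = A'(0 := 1\<^sub>m 1)"
    have BB: "(B, B') \<in> inverse_families w" using AA by (auto simp: inverse_families_def B_def B'_def)
    have B0: "B 0 = 1\<^sub>m 1" "B' 0 = 1\<^sub>m 1" by (simp_all add: B_def B'_def)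
    have Bc: "B i \<in> carrier_mat (w i) (w i)" "B' i \<in> carrier_mat (w i) (w i)" for i
      using BB by (auto simp: inverse_families_def)
    have TU: "tensor_power ?cu ?U A a' a = tensor_power (rv \<circ> e) {..<N} B (lu a') (lu a) * tensor_power ?y {..<?K} B (ru a') (ru a)" for a'
    proof -
      have "tensor_power ?cu ?U A a' a = tensor_power ?cu ?U B a' a"
        by (rule tensor_power_cong_color) (simp add: B_def fun_upd_other[OF upper_color_nonzero] del: fun_upd_apply)
      then show ?thesis unfolding U lu_def ru_def tensor_power_parts[where M = B, OF B0(1)] .
    qed
    have TL: "tensor_power ?cl ?L A' b b' = tensor_power (cv \<circ> e) {..<N} B' (ll b) (ll b') * tensor_power ?z {..<?K'} B' (rl b) (rl b')" for b'
    proof -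
      have "tensor_power ?cl ?L A' b b' = tensor_power ?cl ?L B' b b'"
        by (rule tensor_power_cong_color) (simp add: B'_def fun_upd_other[OF lower_color_nonzero] del: fun_upd_apply)
      then show ?thesis unfolding L ll_def rl_def tensor_power_parts[where M = B', OF B0(2)] .
    qed
    let ?T1 = "\<lambda>p'. tensor_power (rv \<circ> e) {..<N} B p' (lu a)" and ?T2 = "\<lambda>x'. tensor_power ?y {..<?K} B x' (ru a)"
    let ?T3 = "\<lambda>q'. tensor_power (cv \<circ> e) {..<N} B' (ll b) q'" and ?T4 = "\<lambda>z'. tensor_power ?z {..<?K'} B' (rl b) z'"
    have "(\<Sum>a'\<in>assignments w ?cu ?U. \<Sum>b'\<in>assignments w ?cl ?L. F a' b' * tensor_power ?cu ?U A a' a * tensor_power ?cl ?L A' b b')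
      = (\<Sum>p'\<in>?P. \<Sum>x'\<in>?X. \<Sum>q'\<in>?Q. \<Sum>z'\<in>?Z.
          c p' q' * block_sign (ysB m) x' * block_sign (zsB m) z' * (?T1 p' * ?T2 x') * (?T3 q' * ?T4 z'))"
      (is "?lhs = _")
    proof -
      let ?g = "\<lambda>p' x' q' z'. c p' q' * block_sign (ysB m) x' * block_sign (zsB m) z' * (?T1 p' * ?T2 x') * (?T3 q' * ?T4 z')"
      have "?lhs = (\<Sum>a'\<in>assignments w ?cu ?U. \<Sum>q'\<in>?Q. \<Sum>z'\<in>?Z. ?g (lu a') (ru a') q' z')"
      proof (rule sum.cong[OF refl])
        fix a'
        show "(\<Sum>b'\<in>assignments w ?cl ?L. F a' b' * tensor_power ?cu ?U A a' a * tensor_power ?cl ?L A' b b')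
          = (\<Sum>q'\<in>?Q. \<Sum>z'\<in>?Z. ?g (lu a') (ru a') q' z')"
          unfolding TU TL F_def by (rule sum_l[of "?g (lu a') (ru a')"])
      qed
      also have "\<dots> = (\<Sum>p'\<in>?P. \<Sum>x'\<in>?X. \<Sum>q'\<in>?Q. \<Sum>z'\<in>?Z. ?g p' x' q' z')"
        by (rule sum_u[of "\<lambda>p' x'. \<Sum>q'\<in>?Q. \<Sum>z'\<in>?Z. ?g p' x' q' z'"])
      finally show ?thesis .
    qed
    also have "\<dots> = (\<Sum>p'\<in>?P. \<Sum>q'\<in>?Q. c p' q' * ?T1 p' * ?T3 q') * (\<Sum>x'\<in>?X. block_sign (ysB m) x' * ?T2 x')
        * (\<Sum>z'\<in>?Z. block_sign (zsB m) z' * ?T4 z')"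
    proof -
      have "(\<Sum>p'\<in>?P. \<Sum>x'\<in>?X. \<Sum>q'\<in>?Q. \<Sum>z'\<in>?Z.
          c p' q' * block_sign (ysB m) x' * block_sign (zsB m) z' * (?T1 p' * ?T2 x') * (?T3 q' * ?T4 z'))
        = (\<Sum>p'\<in>?P. \<Sum>x'\<in>?X. \<Sum>q'\<in>?Q. (c p' q' * ?T1 p' * ?T3 q') * ((block_sign (ysB m) x' * ?T2 x') * (\<Sum>z'\<in>?Z. block_sign (zsB m) z' * ?T4 z')))"
        unfolding sum_distrib_left by (rule sum.cong[OF refl])+ (simp only: mult.assoc mult.commute mult.left_commute)
      also have "\<dots> = (\<Sum>p'\<in>?P. \<Sum>x'\<in>?X. (\<Sum>q'\<in>?Q. c p' q' * ?T1 p' * ?T3 q') * ((block_sign (ysB m) x' * ?T2 x') * (\<Sum>z'\<in>?Z. block_sign (zsB m) z' * ?T4 z')))"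
        by (simp only: sum_distrib_right)
      also have "\<dots> = (\<Sum>p'\<in>?P. \<Sum>q'\<in>?Q. c p' q' * ?T1 p' * ?T3 q') * (\<Sum>x'\<in>?X. (block_sign (ysB m) x' * ?T2 x') * (\<Sum>z'\<in>?Z. block_sign (zsB m) z' * ?T4 z'))"
        unfolding sum_distrib_right[of _ ?P] by (simp only: sum_distrib_left)
      finally show ?thesis by (simp only: sum_distrib_right mult.assoc)
    qed
    also have "(\<Sum>p'\<in>?P. \<Sum>q'\<in>?Q. c p' q' * ?T1 p' * ?T3 q') = (\<Prod>i\<in>verts G. det (B i) powi m i) * c (lu a) (ll b)"
      by (rule law[OF BB B0 parts_u(1)[OF a] parts_l(1)[OF b]])
    also have "(\<Sum>x'\<in>?X. block_sign (ysB m) x' * ?T2 x') = det (block_matrix (ysB m) B) * block_sign (ysB m) (ru a)"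
      by (rule block_sign_transform_transposed[OF full_B(1) Bc(1) parts_u(2)[OF a]])
    also have "(\<Sum>z'\<in>?Z. block_sign (zsB m) z' * ?T4 z') = det (block_matrix (zsB m) B') * block_sign (zsB m) (rl b)"
      by (rule block_sign_transform[OF full_B(2) Bc(2) parts_l(2)[OF b]])
    also have "(\<Prod>i\<in>verts G. det (B i) powi m i) * c (lu a) (ll b) * (det (block_matrix (ysB m) B) * block_sign (ysB m) (ru a)) *
        (det (block_matrix (zsB m) B') * block_sign (zsB m) (rl b))
      = ((\<Prod>i\<in>verts G. det (B i) powi m i) * det (block_matrix (ysB m) B) * det (block_matrix (zsB m) B')) * F a b"
      by (simp add: F_def)
    also have "\<dots> = F a b" unfolding character_cancels[OF BB B0] by simp
    finally show ?thesis .
  qed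
  have finUL: "finite ?U" "finite ?L" by (simp_all add: U L)
  obtain I :: "(nat + nat \<Rightarrow> nat + nat) set" and coef \<pi> where I: "finite I"
    and \<pi>: "\<forall>i\<in>I. bij_betw (\<pi> i) ?U ?L \<and> (\<forall>u\<in>?U. ?cl (\<pi> i u) = ?cu u)"
    and expand: "\<forall>a\<in>assignments w ?cu ?U. \<forall>b\<in>assignments w ?cl ?L. F a b = (\<Sum>i\<in>I. coef i * of_bool (\<forall>u\<in>?U. a u = b (\<pi> i u)))"
    by (rule exE[OF first_fundamental_theorem[where F = F and v = w and cu = ?cu and cl = ?cl, OF finUL]];
      ((rule invariance; assumption) | (elim exE conjE, rule that; assumption)))
  have bracketed: "c p q * (signof \<sigma> * signof \<rho>) = (\<Sum>i\<in>I. coef i * of_bool (\<forall>u\<in>?U. upper_index m p \<sigma> u = lower_index m q \<rho> (\<pi> i u)))"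
    if p: "p \<in> ?P" and q: "q \<in> ?Q" and \<sigma>: "\<sigma> \<in> ?BY" and \<rho>: "\<rho> \<in> ?BZ" for p q \<sigma> \<rho>
  proof -
    let ?a = "\<lambda>u\<in>?U. upper_index m p \<sigma> u" and ?b = "\<lambda>u\<in>?L. lower_index m q \<rho> u"
    have p_lt: "p k < w (rv (e k))" and q_lt: "q k < w (cv (e k))" if "k < N" for k
      using PiE_mem[OF p[unfolded assignments_def], of k] PiE_mem[OF q[unfolded assignments_def], of k] that by simp_all
    have a: "?a \<in> assignments w ?cu ?U"
      unfolding assignments_def
      by (rule PiE_I) (auto simp: upper_slots_def upper_index_def upper_color_def p_lt block_perm_label[OF full_B(1) \<sigma>])
    have b: "?b \<in> assignments w ?cl ?L"
      unfolding assignments_def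
      by (rule PiE_I) (auto simp: lower_slots_def lower_index_def lower_color_def q_lt block_perm_label[OF full_B(2) \<rho>])
    have "lu ?a = p"
    proof (rule assignments_eq_iff[OF parts_u(1)[OF a] p, THEN iffD2], rule ballI)
      fix k assume "k \<in> {..<N}"
      then show "lu ?a k = p k"
        using p_lt[of k] by (cases "rv (e k) = 0") (auto simp: lu_def left_part_def upper_slots_def upper_index_def)
    qed
    moreover have "ll ?b = q"
    proof (rule assignments_eq_iff[OF parts_l(1)[OF b] q, THEN iffD2], rule ballI)
      fix k assume "k \<in> {..<N}"
      then show "ll ?b k = q k"
        using q_lt[of k] by (cases "cv (e k) = 0") (auto simp: ll_def left_part_def lower_slots_def lower_index_def)
    qed
    moreover have "block_sign (ysB m) (ru ?a) = signof \<sigma>"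
      using full_B(1)[of m] \<sigma>
      by (intro block_sign_of_block_permutation) (auto simp: full_blocks_def ru_def right_part_def upper_slots_def upper_index_def)
    moreover have "block_sign (zsB m) (rl ?b) = signof \<rho>"
      using full_B(2)[of m] \<rho>
      by (intro block_sign_of_block_permutation) (auto simp: full_blocks_def rl_def right_part_def lower_slots_def lower_index_def)
    ultimately have "c p q * (signof \<sigma> * signof \<rho>) = F ?a ?b" by (simp add: F_def)
    also have "\<dots> = (\<Sum>i\<in>I. coef i * of_bool (\<forall>u\<in>?U. ?a u = ?b (\<pi> i u)))" using expand a b by blast
    also have "\<dots> = (\<Sum>i\<in>I. coef i * of_bool (\<forall>u\<in>?U. upper_index m p \<sigma> u = lower_index m q \<rho> (\<pi> i u)))"
    proof (rule sum.cong[OF refl])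
      fix i assume i: "i \<in> I"
      have "?b (\<pi> i u) = lower_index m q \<rho> (\<pi> i u)" if "u \<in> ?U" for u
        using bij_betw_apply[OF conjunct1[OF bspec[OF \<pi> i]] that] by simp
      then show "coef i * of_bool (\<forall>u\<in>?U. ?a u = ?b (\<pi> i u)) = coef i * of_bool (\<forall>u\<in>?U. upper_index m p \<sigma> u = lower_index m q \<rho> (\<pi> i u))"
        by (simp cong: ball_cong)
    qed
    finally show ?thesis .
  qed
  define \<kappa> where "\<kappa> = (of_nat (card ?BZ) * of_nat (card ?BY) :: complex)"
  have \<kappa>: "\<kappa> \<noteq> 0"
    using color_permutations_id by (fastforce simp: \<kappa>_def card_eq_0_iff)
  have coefficient: "\<kappa> * c p q = (\<Sum>\<rho>\<in>?BZ. \<Sum>\<sigma>\<in>?BY. signof \<rho> * signof \<sigma> *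
      (\<Sum>i\<in>I. coef i * of_bool (\<forall>u\<in>?U. upper_index m p \<sigma> u = lower_index m q \<rho> (\<pi> i u))))"
    if p: "p \<in> ?P" and q: "q \<in> ?Q" for p q
  proof -
    have sq: "signof \<rho> * signof \<sigma> * (c p q * (signof \<sigma> * signof \<rho>)) = c p q" for \<rho> \<sigma> :: "nat \<Rightarrow> nat"
      by (simp add: sign_def)
    have "\<kappa> * c p q = (\<Sum>\<rho>\<in>?BZ. \<Sum>\<sigma>\<in>?BY. signof \<rho> * signof \<sigma> * (c p q * (signof \<sigma> * signof \<rho>)))"
      unfolding sq by (simp add: \<kappa>_def)
    also have "\<dots> = (\<Sum>\<rho>\<in>?BZ. \<Sum>\<sigma>\<in>?BY. signof \<rho> * signof \<sigma> *
      (\<Sum>i\<in>I. coef i * of_bool (\<forall>u\<in>?U. upper_index m p \<sigma> u = lower_index m q \<rho> (\<pi> i u))))"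
      by (rule sum.cong[OF refl], rule sum.cong[OF refl], subst bracketed[OF p q]) (assumption | rule refl)+
    finally show ?thesis .
  qed
  let ?mono = "\<lambda>s p q. \<Prod>k<N. coord s (e k, p k, q k)"
  let ?contr = "\<lambda>s i \<rho> \<sigma>. \<Sum>p\<in>?P. \<Sum>q\<in>?Q. of_bool (\<forall>u\<in>?U. upper_index m p \<sigma> u = lower_index m q \<rho> (\<pi> i u)) * ?mono s p q"
  have gen: "generated m (\<lambda>s. (1 / \<kappa>) * (\<Sum>i\<in>I. coef i * (\<Sum>\<rho>\<in>?BZ. \<Sum>\<sigma>\<in>?BY. signof \<rho> * signof \<sigma> * ?contr s i \<rho> \<sigma>)))"
  proof (rule generated_scale, rule generated_sum, rule generated_scale)
    fix i assume i: "i \<in> I"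
    show "generated m (\<lambda>s. \<Sum>\<rho>\<in>?BZ. \<Sum>\<sigma>\<in>?BY. signof \<rho> * signof \<sigma> * ?contr s i \<rho> \<sigma>)"
      by (rule contraction_generated[OF e]) (use bspec[OF \<pi> i] in blast)+
  qed
  have eq: "(\<Sum>i\<in>I. coef i * (\<Sum>\<rho>\<in>?BZ. \<Sum>\<sigma>\<in>?BY. signof \<rho> * signof \<sigma> * ?contr s i \<rho> \<sigma>))
      = \<kappa> * (\<Sum>p\<in>?P. \<Sum>q\<in>?Q. c p q * ?mono s p q)" for s
  proof -
    let ?b = "\<lambda>p q i \<rho> \<sigma>. of_bool (\<forall>u\<in>?U. upper_index m p \<sigma> u = lower_index m q \<rho> (\<pi> i u)) :: complex"
    let ?t = "\<lambda>p q i \<rho> \<sigma>. signof \<rho> * signof \<sigma> * (coef i * ?b p q i \<rho> \<sigma>) * ?mono s p q"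
    have "(\<Sum>i\<in>I. coef i * (\<Sum>\<rho>\<in>?BZ. \<Sum>\<sigma>\<in>?BY. signof \<rho> * signof \<sigma> * ?contr s i \<rho> \<sigma>))
        = (\<Sum>i\<in>I. \<Sum>\<rho>\<in>?BZ. \<Sum>\<sigma>\<in>?BY. \<Sum>p\<in>?P. \<Sum>q\<in>?Q. ?t p q i \<rho> \<sigma>)"
      unfolding sum_distrib_left by (rule sum.cong[OF refl])+ (simp only: mult.assoc mult.commute mult.left_commute)
    also have "\<dots> = (\<Sum>p\<in>?P. \<Sum>q\<in>?Q. \<Sum>\<rho>\<in>?BZ. \<Sum>\<sigma>\<in>?BY. \<Sum>i\<in>I. ?t p q i \<rho> \<sigma>)"
      by (rule sum_reorder)
    also have "\<dots> = (\<Sum>p\<in>?P. \<Sum>q\<in>?Q. (\<kappa> * c p q) * ?mono s p q)"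
      by (rule sum.cong[OF refl], rule sum.cong[OF refl]) (simp only: coefficient sum_distrib_left sum_distrib_right)
    finally show ?thesis by (simp only: sum_distrib_left mult.assoc)
  qed
  show ?thesis using gen unfolding eq using \<kappa> by simp
qed

theorem semi_invariant_generated:
  assumes f: "f \<in> carrier (semi_invariant_module G d v m)"
  shows "generated m f"
proof -
  obtain M :: nat and C where expansion: "\<forall>s\<in>rep_space G d v. f s = (\<Sum>N\<le>M. \<Sum>e\<in>{..<N} \<rightarrow>\<^sub>E gens. \<Sum>p\<in>assignments w (rv \<circ> e) {..<N}.
       \<Sum>q\<in>assignments w (cv \<circ> e) {..<N}. C N e p q * (\<Prod>k<N. coord s (e k, p k, q k)))"
    and law: "\<forall>N :: nat. \<forall>e\<in>{..<N} \<rightarrow>\<^sub>E gens. \<forall>(A, A')\<in>inverse_families w. A 0 = 1\<^sub>m 1 \<longrightarrow> A' 0 = 1\<^sub>m 1 \<longrightarrow>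
       (\<forall>p\<in>assignments w (rv \<circ> e) {..<N}. \<forall>q\<in>assignments w (cv \<circ> e) {..<N}.
       (\<Sum>p'\<in>assignments w (rv \<circ> e) {..<N}. \<Sum>q'\<in>assignments w (cv \<circ> e) {..<N}.
          C N e p' q' * tensor_power (rv \<circ> e) {..<N} A p' p * tensor_power (cv \<circ> e) {..<N} A' q q')
       = (\<Prod>i\<in>verts G. det (A i) powi m i) * C N e p q)"
    using semi_invariant_tensor_expansion[OF f] by (elim exE conjE) (rule that)
  have slice: "generated m (\<lambda>s. \<Sum>p\<in>assignments w (rv \<circ> e) {..<N}.
       \<Sum>q\<in>assignments w (cv \<circ> e) {..<N}. C N e p q * (\<Prod>k<N. coord s (e k, p k, q k)))" if e: "e \<in> {..<N} \<rightarrow>\<^sub>E gens" for N e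
  proof (rule tensor_slice_generated[OF e])
    fix A A' p q
    assume "(A, A') \<in> inverse_families w" "A 0 = 1\<^sub>m 1" "A' 0 = 1\<^sub>m 1"
      "p \<in> assignments w (rv \<circ> e) {..<N}" "q \<in> assignments w (cv \<circ> e) {..<N}"
    then show "(\<Sum>p'\<in>assignments w (rv \<circ> e) {..<N}. \<Sum>q'\<in>assignments w (cv \<circ> e) {..<N}.
          C N e p' q' * tensor_power (rv \<circ> e) {..<N} A p' p * tensor_power (cv \<circ> e) {..<N} A' q q')
       = (\<Prod>i\<in>verts G. det (A i) powi m i) * C N e p q"
      using bspec[OF bspec[OF spec[OF law, of N] e], of "(A, A')"] by simp
  qed
  have "generated m (\<lambda>s. \<Sum>N\<le>M. \<Sum>e\<in>{..<N} \<rightarrow>\<^sub>E gens. \<Sum>p\<in>assignments w (rv \<circ> e) {..<N}.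
       \<Sum>q\<in>assignments w (cv \<circ> e) {..<N}. C N e p q * (\<Prod>k<N. coord s (e k, p k, q k)))"
    by (rule generated_sum, rule generated_sum, rule slice)
  then show ?thesis by (rule generated_cong[THEN iffD1, rotated]) (use expansion in simp)
qed

theorem good_functions_generate:
  "LinearCombinations.module.gen_set (invariant_ring G d v) (semi_invariant_module G d v m) (good_functions m)"
proof
  show "LinearCombinations.module.span (invariant_ring G d v) (semi_invariant_module G d v m) (good_functions m)
      \<subseteq> carrier (semi_invariant_module G d v m)"
    using span_submodule[of m] by (simp add: LinearCombinations.submodule_def)
  show "carrier (semi_invariant_module G d v m)
      \<subseteq> LinearCombinations.module.span (invariant_ring G d v) (semi_invariant_module G d v m) (good_functions m)"
  proof
    fix f assume f: "f \<in> carrier (semi_invariant_module G d v m)"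
    then have "restrict f (rep_space G d v) = f"
      by (intro extensional_restrict regular_extensional) (simp add: semi_invariant_module_carrier)
    then show "f \<in> LinearCombinations.module.span (invariant_ring G d v) (semi_invariant_module G d v m) (good_functions m)"
      using semi_invariant_generated[OF f] by (simp add: generated_def)
  qed
qed

end

theorem proposition20:
  fixes G :: "(nat, 'h) pre_digraph" and n :: nat and bar :: "'h \<Rightarrow> 'h" and eps :: "'h \<Rightarrow> int"
    and d v :: "nat \<Rightarrow> nat" and m :: "nat \<Rightarrow> int"
  assumes "double_quiver G n bar eps"
  shows "{f_Delta G d v \<Delta> | \<Delta>. is_chi_data G d v m \<Delta> \<and> chi_good G v m \<Delta>}
           \<subseteq> carrier (semi_invariant_module G d v m) \<and>
         LinearCombinations.module.gen_set (invariant_ring G d v) (semi_invariant_module G d v m)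
           {f_Delta G d v \<Delta> | \<Delta>. is_chi_data G d v m \<Delta> \<and> chi_good G v m \<Delta>}"
proof -
  interpret double_quiver G n bar eps by (rule assms)
  interpret framed_quiver G d v by unfold_locales (simp add: verts_eq)
  show ?thesis
    using good_functions_semi_invariant[of m] good_functions_generate[of m] unfolding good_functions_def by simp
qed

end
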